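(* Let $n\in\mathbb{N}$, $1\le p<\infty$, let $s>0$ be a real number that is not an integer, and let $r\in\mathbb{R}$. If $u\in H^{r,p}(\mathbb{R}^n)$ satisfies $(-\Delta)^s u=u=0$ in a nonempty open set $V\subset\mathbb{R}^n$, then $u\equiv 0$ in $\mathbb{R}^n$.
   Context: The Fourier transform is $\hat u(\xi)=\int_{\mathbb{R}^n}u(x)e^{-ix\cdot\xi}\,dx$ on Schwartz functions, extended by duality to tempered distributions $\mathscr{S}'(\mathbb{R}^n)$. For $r\in\mathbb{R}$ and $1\le p<\infty$, the Bessel potential space is $H^{r,p}(\mathbb{R}^n)=\{u\in\mathscr{S}'(\mathbb{R}^n): \mathcal{F}^{-1}(\langle\xi\rangle^r\hat u)\in L^p(\mathbb{R}^n)\}$ with $\langle\xi\rangle=(1+|\xi|^2)^{1/2}$ and norm $\|u\|_{H^{r,p}(\mathbb{R}^n)}=\|\mathcal{F}^{-1}(\langle\xi\rangle^r\hat u)\|_{L^p(\mathbb{R}^n)}$. The fractional Laplacian of order $s\ge 0$ is the Fourier multiplier $(-\Delta)^s u=\mathcal{F}^{-1}(|\xi|^{2s}\hat u)$, which is a bounded linear operator $H^{r,p}(\mathbb{R}^n)\to H^{r-2s,p}(\mathbb{R}^n)$ (the continuous extension from Schwartz functions). Vanishing in the open set $V$ is meant in the sense of distributions. *)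

theory Defs
  imports "HOL-Analysis.Analysis"
begin

text \<open>
  All function spaces consist of complex-valued functions on a Euclidean space. A functional on
  Schwartz functions is a total function of type \<open>('a \<Rightarrow> complex) \<Rightarrow> complex\<close> that takes the
  value 0 on every argument that is not a Schwartz function; with this convention, equality of
  tempered distributions is equality in HOL.
\<close>

section \<open>Schwartz functions\<close>

fun partial_deriv :: "'a::euclidean_space list \<Rightarrow> ('a \<Rightarrow> complex) \<Rightarrow> 'a \<Rightarrow> complex" where
  "partial_deriv [] f = f"
| "partial_deriv (b # bs) f = (\<lambda>x. frechet_derivative (partial_deriv bs f) (at x) b)"

text \<open>
  The lists \<open>bs\<close> over the standard basis play the role of multi-indices. Differentiability of all
  iterated partial derivatives is the usual infinite differentiability; it also guarantees that
  \<^const>\<open>frechet_derivative\<close> is meaningful wherever it is used.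
\<close>

definition smooth_function :: "('a::euclidean_space \<Rightarrow> complex) \<Rightarrow> bool" where
  "smooth_function f \<longleftrightarrow>
     (\<forall>bs x. set bs \<subseteq> Basis \<longrightarrow> partial_deriv bs f differentiable (at x))"

definition schwartz :: "('a::euclidean_space \<Rightarrow> complex) \<Rightarrow> bool" where
  "schwartz f \<longleftrightarrow> smooth_function f \<and>
     (\<forall>k bs. set bs \<subseteq> Basis \<longrightarrow>
        bounded (range (\<lambda>x. (1 + norm x) ^ k *\<^sub>R partial_deriv bs f x)))"

definition schwartz_seminorm :: "nat \<Rightarrow> 'a::euclidean_space list \<Rightarrow> ('a \<Rightarrow> complex) \<Rightarrow> real" where
  "schwartz_seminorm k bs f = (SUP x. (1 + norm x) ^ k * norm (partial_deriv bs f x))"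

definition test_function :: "'a::euclidean_space set \<Rightarrow> ('a \<Rightarrow> complex) \<Rightarrow> bool" where
  "test_function V \<phi> \<longleftrightarrow> smooth_function \<phi> \<and>
     compact (closure {x. \<phi> x \<noteq> 0}) \<and> closure {x. \<phi> x \<noteq> 0} \<subseteq> V"

section \<open>Tempered distributions\<close>

type_synonym 'a functional = "('a \<Rightarrow> complex) \<Rightarrow> complex"

definition on_schwartz :: "'a::euclidean_space functional \<Rightarrow> 'a functional" where
  "on_schwartz T = (\<lambda>\<phi>. if schwartz \<phi> then T \<phi> else 0)"

text \<open>
  Continuity for the locally convex topology generated by the seminorms is stated as domination
  by finitely many of them.
\<close>

definition tempered_distribution :: "'a::euclidean_space functional \<Rightarrow> bool" where
  "tempered_distribution u \<longleftrightarrow>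
     (\<forall>\<phi> \<psi>. schwartz \<phi> \<longrightarrow> schwartz \<psi> \<longrightarrow> u (\<lambda>x. \<phi> x + \<psi> x) = u \<phi> + u \<psi>) \<and>
     (\<forall>c \<phi>. schwartz \<phi> \<longrightarrow> u (\<lambda>x. c * \<phi> x) = c * u \<phi>) \<and>
     (\<exists>C N. \<forall>\<phi>. schwartz \<phi> \<longrightarrow>
        norm (u \<phi>) \<le> C * (\<Sum>bs \<in> {bs. set bs \<subseteq> Basis \<and> length bs \<le> N}.
                            schwartz_seminorm N bs \<phi>)) \<and>
     (\<forall>\<phi>. \<not> schwartz \<phi> \<longrightarrow> u \<phi> = 0)"

definition distribution_of :: "('a::euclidean_space \<Rightarrow> complex) \<Rightarrow> 'a functional" where
  "distribution_of f = on_schwartz (\<lambda>\<phi>. LINT x|lborel. f x * \<phi> x)"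

definition vanishes_in :: "'a::euclidean_space set \<Rightarrow> 'a functional \<Rightarrow> bool" where
  "vanishes_in V u \<longleftrightarrow> (\<forall>\<phi>. test_function V \<phi> \<longrightarrow> u \<phi> = 0)"

section \<open>Fourier transform\<close>

definition fourier :: "('a::euclidean_space \<Rightarrow> complex) \<Rightarrow> 'a \<Rightarrow> complex" where
  "fourier f \<xi> = (LINT x|lborel. f x * exp (- \<i> * complex_of_real (x \<bullet> \<xi>)))"

definition inverse_fourier :: "('a::euclidean_space \<Rightarrow> complex) \<Rightarrow> 'a \<Rightarrow> complex" where
  "inverse_fourier f x =
     (LINT \<xi>|lborel. f \<xi> * exp (\<i> * complex_of_real (x \<bullet> \<xi>))) / (2 * complex_of_real pi) ^ DIM('a)"

definition fourier_dist :: "'a::euclidean_space functional \<Rightarrow> 'a functional" where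
  "fourier_dist u = on_schwartz (\<lambda>\<phi>. u (fourier \<phi>))"

definition inverse_fourier_dist :: "'a::euclidean_space functional \<Rightarrow> 'a functional" where
  "inverse_fourier_dist u = on_schwartz (\<lambda>\<phi>. u (inverse_fourier \<phi>))"

text \<open>
  Meant for smooth multipliers \<open>m\<close> all of whose derivatives grow at most polynomially, so that
  multiplication by \<open>m\<close> preserves Schwartz functions.
\<close>

definition mult_dist :: "('a::euclidean_space \<Rightarrow> complex) \<Rightarrow> 'a functional \<Rightarrow> 'a functional" where
  "mult_dist m u = on_schwartz (\<lambda>\<phi>. u (\<lambda>\<xi>. m \<xi> * \<phi> \<xi>))"

section \<open>Bessel potential spaces\<close>

definition japanese_bracket :: "'a::euclidean_space \<Rightarrow> real" where
  "japanese_bracket \<xi> = sqrt (1 + (norm \<xi>)\<^sup>2)"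

definition bessel_potential :: "real \<Rightarrow> 'a::euclidean_space functional \<Rightarrow> 'a functional" where
  "bessel_potential r u =
     inverse_fourier_dist
       (mult_dist (\<lambda>\<xi>. complex_of_real (japanese_bracket \<xi> powr r)) (fourier_dist u))"

definition Lp_space :: "real \<Rightarrow> ('a::euclidean_space \<Rightarrow> complex) set" where
  "Lp_space p =
     {f. f \<in> borel_measurable lborel \<and> integrable lborel (\<lambda>x. norm (f x) powr p)}"

definition Lp_norm :: "real \<Rightarrow> ('a::euclidean_space \<Rightarrow> complex) \<Rightarrow> real" where
  "Lp_norm p f = (LINT x|lborel. norm (f x) powr p) powr (1 / p)"

definition bessel_space :: "real \<Rightarrow> real \<Rightarrow> 'a::euclidean_space functional set" where
  "bessel_space r p =
     {u. tempered_distribution u \<and> (\<exists>f \<in> Lp_space p. bessel_potential r u = distribution_of f)}"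

text \<open>
  The representing function \<open>f\<close> is determined almost everywhere, so the choice is immaterial.
\<close>

definition bessel_norm :: "real \<Rightarrow> real \<Rightarrow> 'a::euclidean_space functional \<Rightarrow> real" where
  "bessel_norm r p u =
     Lp_norm p (SOME f. f \<in> Lp_space p \<and> bessel_potential r u = distribution_of f)"

section \<open>The fractional Laplacian\<close>

text \<open>
  For Schwartz \<open>\<phi>\<close> the product of \<open>|\<xi>|\<^sup>2\<^sup>s\<close> with the transform of \<open>\<phi>\<close> is an integrable function,
  although in general not a Schwartz function; its inverse transform is taken in the sense of
  tempered distributions.
\<close>

definition frac_laplacian_schwartz ::
  "real \<Rightarrow> ('a::euclidean_space \<Rightarrow> complex) \<Rightarrow> 'a functional" where
  "frac_laplacian_schwartz s \<phi> =
     inverse_fourier_dist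
       (distribution_of (\<lambda>\<xi>. complex_of_real (norm \<xi> powr (2 * s)) * fourier \<phi> \<xi>))"

text \<open>
  For \<open>|\<xi>|\<^sup>2\<^sup>s\<close> not smooth at the origin, multiplication is not defined on all tempered
  distributions. The operator on \<open>H\<^sup>r\<^sup>,\<^sup>p\<close> is therefore the continuous extension of the
  multiplier from Schwartz functions: its value at \<open>u\<close> is the limit, in the target norm, of its
  values along Schwartz sequences converging to \<open>u\<close> in \<open>H\<^sup>r\<^sup>,\<^sup>p\<close>. This is well defined for
  \<open>1 \<le> p < \<infinity>\<close>, as Schwartz functions are dense and the multiplier is bounded
  into \<open>bessel_space (r - 2 * s) p\<close>.
\<close>

definition frac_laplacian ::
  "real \<Rightarrow> real \<Rightarrow> real \<Rightarrow> 'a::euclidean_space functional \<Rightarrow> 'a functional" where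
  "frac_laplacian s r p u =
     (THE v. v \<in> bessel_space (r - 2 * s) p \<and>
        (\<forall>\<Phi> :: nat \<Rightarrow> 'a \<Rightarrow> complex.
           (\<forall>k. schwartz (\<Phi> k)) \<longrightarrow>
           (\<lambda>k. bessel_norm r p (\<lambda>\<psi>. distribution_of (\<Phi> k) \<psi> - u \<psi>)) \<longlonglongrightarrow> 0 \<longrightarrow>
           (\<lambda>k. bessel_norm (r - 2 * s) p
                  (\<lambda>\<psi>. frac_laplacian_schwartz s (\<Phi> k) \<psi> - v \<psi>)) \<longlonglongrightarrow> 0))"

end

theory Submission
  imports Defs "HOL-Probability.Probability"
begin

text \<open>
  Mollifying \<open>u\<close> by a bump of small support reduces the claim to a bounded continuous function \<open>w\<close>
  such that \<open>w\<close> and \<open>(-\<Delta>)\<^sup>s w\<close> vanish near a point \<open>x\<^sub>0\<close>. As \<open>(-\<Delta>)\<^sup>s\<close> commutes with the Laplacian,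
  \<open>(-\<Delta>)\<^sup>a w\<close> vanishes near \<open>x\<^sub>0\<close> for every \<open>a = s + j\<close>. Let \<open>\<psi>\<close> be a test function supported near \<open>x\<^sub>0\<close>,
  where \<open>w = 0\<close>. Off the support of \<open>\<psi>\<close> the heat semigroup represents \<open>(-\<Delta>)\<^sup>a \<psi>\<close> by a nonzero multiple
  (here \<open>s\<close> must not be an integer) of the kernel of homogeneity \<open>-n - 2a\<close>, so the integral of
  \<open>\<psi>(x) w(y)\<close> against the power \<open>-n - 2a\<close> of \<open>|x - y|\<close> is 0 for all these \<open>a\<close>. These integrals are all the moments of the
  bounded quantity \<open>|x - y|\<^sup>-\<^sup>2\<close> with respect to one finite complex measure, and by Weierstrass'
  theorem the kernel may be replaced by a Gaussian in \<open>x - y\<close>. Small translations of \<open>\<psi>\<close> are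
  allowed, and the resulting identity is analytic in the translation, hence holds for all of them:
  every Gaussian mean of \<open>w\<close> is 0, so \<open>w = 0\<close>.

  The operator itself is accessible on \<open>L\<^sup>p\<close> because \<open>(-\<Delta>)\<^sup>s (1 - \<Delta>)\<^sup>-\<^sup>s\<close> is the identity plus
  convolution with an integrable function, also for \<open>p = 1\<close>.
\<close>

text \<open>The symbol |xi|^(2s) is not smooth at 0, so it cannot be moved onto Schwartz test
  functions, and the operator is given only as the description of a limit. That description has to
  be eliminated in favour of a pairing of the density \<open>f\<close> of \<open>u\<close> with a
  function that is explicit on the Fourier side; afterwards only this pairing counts.

  Two obstacles shape the moment argument. A merely bounded \<open>w\<close> is not integrable
  against slowly decaying kernels, so the moments start at an exponent large enough for decay at
  infinity. The kernels are singular on the diagonal, but \<open>w\<close> vanishes on a full ball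
  while the test functions live in a smaller one, which keeps |x - y| bounded below.

  The Gaussian is the right replacement for two reasons. Divided by the kernel of the lowest moment
  it is still a continuous function of |x - y|^(-2), including the value 0. And by completing the
  square its dependence on a translation is essentially the exponential of a linear function, so the
  continuation concerns a power series in one real variable.\<close>

declare partial_deriv.simps(2) [simp del]

section \<open>Smooth, temperate and Schwartz functions\<close>

lemma partial_deriv_append: "partial_deriv (bs @ cs) f = partial_deriv bs (partial_deriv cs f)"
  by (induction bs) (auto simp: partial_deriv.simps(2))

lemma partial_deriv_Cons: "partial_deriv (b # bs) f = partial_deriv [b] (partial_deriv bs f)"
  using partial_deriv_append[of "[b]" bs f] by simp

lemma partial_deriv_single: "partial_deriv [b] f = (\<lambda>x. frechet_derivative f (at x) b)"
  by (simp add: partial_deriv.simps(2))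

lemma partial_deriv_eq:
  assumes "\<And>x. (f has_derivative D x) (at x)"
  shows "partial_deriv [b] f = (\<lambda>x. D x b)"
  using frechet_derivative_at[OF assms] by (simp add: partial_deriv_single fun_eq_iff)

text \<open>Iterated derivatives are lists from which one basis vector is peeled off at a time, so
  it suffices to exhibit a class of differentiable functions closed under single partial
  derivatives. The analogues for Schwartz functions, temperate functions and operators add only a
  growth bound on the members of the class.\<close>

lemma smooth_coinduct:
  assumes "X f" and diff: "\<And>f x. X f \<Longrightarrow> f differentiable (at x)"
    and pd: "\<And>f b. X f \<Longrightarrow> b \<in> Basis \<Longrightarrow> X (partial_deriv [b] f)"
  shows "smooth_function f"
proof -
  have "X (partial_deriv bs f)" if "set bs \<subseteq> Basis" for bs
    using that
  proof (induction bs)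
    case (Cons b bs)
    then show ?case using pd by (subst partial_deriv_Cons) auto
  qed (use \<open>X f\<close> in auto)
  with diff show ?thesis by (auto simp: smooth_function_def)
qed

lemma schwartz_coinduct:
  assumes "X f" and diff: "\<And>f x. X f \<Longrightarrow> f differentiable (at x)"
    and pd: "\<And>f b. X f \<Longrightarrow> b \<in> Basis \<Longrightarrow> X (partial_deriv [b] f)"
    and bd: "\<And>f k. X f \<Longrightarrow> \<exists>C. \<forall>x. (1 + norm x) ^ k * norm (f x) \<le> C"
  shows "schwartz f"
proof -
  have X: "X (partial_deriv bs f)" if "set bs \<subseteq> Basis" for bs
    using that
  proof (induction bs)
    case (Cons b bs)
    then show ?case using pd by (subst partial_deriv_Cons) auto
  qed (use \<open>X f\<close> in auto)
  have "bounded (range (\<lambda>x. (1 + norm x) ^ k *\<^sub>R partial_deriv bs f x))"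
    if "set bs \<subseteq> Basis" for k bs
    using bd[OF X[OF that], of k] by (auto simp: bounded_iff)
  moreover have "smooth_function f"
    using assms(1-3) by (rule smooth_coinduct)
  ultimately show ?thesis
    by (auto simp: schwartz_def)
qed

text \<open>The multipliers of the Schwartz space, usually called O_M: the order of polynomial
  growth may depend on the derivative. The symbol |xi|^(2s) with non-integer s is not of this kind,
  being not smooth at the origin.\<close>

definition temperate :: "('a::euclidean_space \<Rightarrow> complex) \<Rightarrow> bool" where
  "temperate m \<longleftrightarrow> (\<forall>bs. set bs \<subseteq> Basis \<longrightarrow> (\<forall>x. partial_deriv bs m differentiable (at x)) \<and>
     (\<exists>C k. \<forall>x. norm (partial_deriv bs m x) \<le> C * (1 + norm x) ^ k))"

lemma temperate_coinduct:
  assumes "X f" and diff: "\<And>f x. X f \<Longrightarrow> f differentiable (at x)"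
    and pd: "\<And>f b. X f \<Longrightarrow> b \<in> Basis \<Longrightarrow> X (partial_deriv [b] f)"
    and bd: "\<And>f. X f \<Longrightarrow> \<exists>C k. \<forall>x. norm (f x) \<le> C * (1 + norm x) ^ k"
  shows "temperate f"
proof -
  have X: "X (partial_deriv bs f)" if "set bs \<subseteq> Basis" for bs
    using that
  proof (induction bs)
    case (Cons b bs)
    then show ?case using pd by (subst partial_deriv_Cons) auto
  qed (use \<open>X f\<close> in auto)
  with diff bd show ?thesis unfolding temperate_def by meson
qed

lemma smooth_differentiable: "smooth_function f \<Longrightarrow> f differentiable (at x)"
  unfolding smooth_function_def by (metis empty_subsetI list.set(1) partial_deriv.simps(1))

lemma smooth_partial_deriv:
  "smooth_function f \<Longrightarrow> set bs \<subseteq> Basis \<Longrightarrow> smooth_function (partial_deriv bs f)"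
  unfolding smooth_function_def by (metis partial_deriv_append set_append Un_subset_iff)

lemma schwartz_smooth: "schwartz f \<Longrightarrow> smooth_function f"
  by (simp add: schwartz_def)

lemma schwartz_partial_deriv:
  "schwartz f \<Longrightarrow> set bs \<subseteq> Basis \<Longrightarrow> schwartz (partial_deriv bs f)"
  unfolding schwartz_def using smooth_partial_deriv
  by (metis partial_deriv_append set_append Un_subset_iff)

lemma schwartz_differentiable: "schwartz f \<Longrightarrow> f differentiable (at x)"
  by (simp add: schwartz_smooth smooth_differentiable)

lemma temperate_partial_deriv:
  "temperate f \<Longrightarrow> set bs \<subseteq> Basis \<Longrightarrow> temperate (partial_deriv bs f)"
  unfolding temperate_def by (metis partial_deriv_append set_append Un_subset_iff)

lemma temperate_differentiable: "temperate f \<Longrightarrow> f differentiable (at x)"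
  unfolding temperate_def by (metis empty_subsetI list.set(1) partial_deriv.simps(1))

lemma temperate_bound: "temperate f \<Longrightarrow> \<exists>C k. \<forall>x. norm (f x) \<le> C * (1 + norm x) ^ k"
  unfolding temperate_def by (metis empty_subsetI list.set(1) partial_deriv.simps(1))

lemma schwartz_bound:
  assumes "schwartz f"
  shows "\<exists>C. \<forall>x. (1 + norm x) ^ k * norm (f x) \<le> C"
proof -
  have "bounded (range (\<lambda>x. (1 + norm x) ^ k *\<^sub>R partial_deriv [] f x))"
    using assms unfolding schwartz_def by (metis empty_subsetI list.set(1))
  then show ?thesis by (auto simp: bounded_iff)
qed

section \<open>Product rule and algebras closed under differentiation\<close>

lemma partial_deriv_add:
  assumes "\<And>x. f differentiable (at x)" "\<And>x. g differentiable (at x)"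
  shows "partial_deriv [b] (\<lambda>x. f x + g x) = (\<lambda>x. partial_deriv [b] f x + partial_deriv [b] g x)"
  unfolding partial_deriv_single[of b f] partial_deriv_single[of b g]
  by (rule partial_deriv_eq) (use assms in \<open>auto intro!: derivative_eq_intros simp: frechet_derivative_works[symmetric]\<close>)

lemma partial_deriv_mult:
  assumes "\<And>x. f differentiable (at x)" "\<And>x. g differentiable (at x)"
  shows "partial_deriv [b] (\<lambda>x. f x * g x) =
    (\<lambda>x. partial_deriv [b] f x * g x + f x * partial_deriv [b] g x)"
  unfolding partial_deriv_single[of b f] partial_deriv_single[of b g]
  using partial_deriv_eq[OF has_derivative_mult[OF assms(1)[unfolded frechet_derivative_works] assms(2)[unfolded frechet_derivative_works]], of b]
  by (simp add: add.commute)

lemma partial_deriv_const [simp]: "partial_deriv [b] (\<lambda>x. c) = (\<lambda>x. 0)"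
  by (subst partial_deriv_eq[where D="\<lambda>x h. 0"]) auto

text \<open>The unital algebra generated by \<open>S\<close> under pointwise operations. If the
  partial derivatives of the generators lie in the algebra, the product rule makes the whole algebra
  closed under differentiation. Smoothness of a concrete function is thereby reduced to one
  derivative computation per generator.\<close>

inductive_set alg :: "('a \<Rightarrow> complex) set \<Rightarrow> ('a \<Rightarrow> complex) set" for S where
  base: "f \<in> S \<Longrightarrow> f \<in> alg S"
| const: "(\<lambda>x. c) \<in> alg S"
| add: "f \<in> alg S \<Longrightarrow> g \<in> alg S \<Longrightarrow> (\<lambda>x. f x + g x) \<in> alg S"
| mult: "f \<in> alg S \<Longrightarrow> g \<in> alg S \<Longrightarrow> (\<lambda>x. f x * g x) \<in> alg S"

lemma alg_derivative:
  assumes S: "\<And>f x. f \<in> S \<Longrightarrow> f differentiable (at x)"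
    and S': "\<And>f. f \<in> S \<Longrightarrow> partial_deriv [b] f \<in> alg S"
  shows "f \<in> alg S \<Longrightarrow> (\<forall>x. f differentiable (at x)) \<and> partial_deriv [b] f \<in> alg S"
proof (induction rule: alg.induct)
  case (add f g)
  then show ?case by (auto simp: partial_deriv_add intro: alg.add)
next
  case (mult f g)
  then show ?case by (auto simp: partial_deriv_mult intro!: alg.add alg.mult)
qed (use S S' in \<open>auto intro: alg.const\<close>)

lemma alg_smooth:
  assumes S: "\<And>f x. f \<in> S \<Longrightarrow> f differentiable (at x)"
    and S': "\<And>f b. f \<in> S \<Longrightarrow> b \<in> Basis \<Longrightarrow> partial_deriv [b] f \<in> alg S"
    and f: "f \<in> alg S"
  shows "smooth_function f"
  by (rule smooth_coinduct[where X="\<lambda>f. f \<in> alg S"])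
     (use alg_derivative[of S] assms SOME_Basis in blast)+

lemma poly_growth_add:
  fixes f g :: "'a::real_normed_vector \<Rightarrow> 'b::real_normed_vector"
  assumes "\<forall>x. norm (f x) \<le> C * (1 + norm x) ^ k" "\<forall>x. norm (g x) \<le> D * (1 + norm x) ^ l"
  shows "norm (f x + g x) \<le> (\<bar>C\<bar> + \<bar>D\<bar>) * (1 + norm x) ^ (k + l)"
proof -
  have "norm (f x + g x) \<le> C * (1 + norm x) ^ k + D * (1 + norm x) ^ l"
    using assms norm_triangle_le add_mono by metis
  also have "\<dots> \<le> \<bar>C\<bar> * (1 + norm x) ^ (k+l) + \<bar>D\<bar> * (1 + norm x) ^ (k+l)"
    by (intro add_mono mult_mono power_increasing) auto
  finally show ?thesis by (simp add: algebra_simps)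
qed

lemma poly_growth_mult:
  fixes f g :: "'a::real_normed_vector \<Rightarrow> complex"
  assumes "\<forall>x. norm (f x) \<le> C * (1 + norm x) ^ k" "\<forall>x. norm (g x) \<le> D * (1 + norm x) ^ l"
  shows "norm (f x * g x) \<le> (C * D) * (1 + norm x) ^ (k + l)"
proof -
  have "norm (f x) * norm (g x) \<le> (C * (1 + norm x) ^ k) * (D * (1 + norm x) ^ l)"
    using assms by (intro mult_mono) (auto intro: order_trans[OF norm_ge_zero])
  then show ?thesis by (simp add: norm_mult power_add mult_ac)
qed

lemma alg_temperate:
  assumes S: "\<And>f x. f \<in> S \<Longrightarrow> f differentiable (at x)"
    and S': "\<And>f b. f \<in> S \<Longrightarrow> b \<in> Basis \<Longrightarrow> partial_deriv [b] f \<in> alg S"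
    and Sb: "\<And>f. f \<in> S \<Longrightarrow> \<exists>C k. \<forall>x. norm (f x) \<le> C * (1 + norm x) ^ k"
    and f: "f \<in> alg S"
  shows "temperate f"
proof -
  have bd: "\<exists>C k. \<forall>x. norm (g x) \<le> C * (1 + norm x) ^ k" if "g \<in> alg S" for g
    using that
  proof (induction rule: alg.induct)
    case (const c)
    show ?case by (rule exI[of _ "norm c"], rule exI[of _ 0]) auto
  next
    case (add f g)
    then show ?case using poly_growth_add by metis
  next
    case (mult f g)
    then show ?case using poly_growth_mult by metis
  qed (use Sb in auto)
  show ?thesis
    by (rule temperate_coinduct[where X="\<lambda>f. f \<in> alg S"])
       (use alg_derivative[of S] assms SOME_Basis bd in blast)+
qed

lemma temperate_alg_closed:
  assumes "\<And>f. f \<in> S \<Longrightarrow> temperate f" "f \<in> alg S"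
  shows "temperate f"
proof (rule alg_temperate[where S="Collect temperate"])
  show "f \<in> alg (Collect temperate)"
    using assms(2) by (induction rule: alg.induct) (auto intro: alg.intros assms(1))
  show "partial_deriv [b] f \<in> alg (Collect temperate)" if "f \<in> Collect temperate" "b \<in> Basis" for f b
    using that temperate_partial_deriv[of f "[b]"] by (auto intro: alg.base)
qed (auto simp: temperate_differentiable temperate_bound)

lemma temperate_const [simp]: "temperate (\<lambda>x. c)"
  by (rule temperate_alg_closed[where S="{}"]) (auto intro: alg.intros)

lemma temperate_add: "temperate f \<Longrightarrow> temperate g \<Longrightarrow> temperate (\<lambda>x. f x + g x)"
  by (rule temperate_alg_closed[where S="{f,g}"]) (auto intro: alg.intros)

lemma temperate_mult: "temperate f \<Longrightarrow> temperate g \<Longrightarrow> temperate (\<lambda>x. f x * g x)"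
  by (rule temperate_alg_closed[where S="{f,g}"]) (auto intro: alg.intros)

lemma temperate_minus: "temperate f \<Longrightarrow> temperate (\<lambda>x. - f x)"
  using temperate_mult[of "\<lambda>x. -1" f] by simp

lemma temperate_sum: "(\<And>i. i \<in> I \<Longrightarrow> temperate (f i)) \<Longrightarrow> temperate (\<lambda>x. \<Sum>i\<in>I. f i x)"
  by (induction I rule: infinite_finite_induct) (auto intro!: temperate_add)

lemma temperate_bounded_linear:
  assumes "bounded_linear (l :: 'a::euclidean_space \<Rightarrow> real)"
  shows "temperate (\<lambda>x. complex_of_real (l x))"
proof (rule alg_temperate[where S="{\<lambda>x. complex_of_real (l x)}"])
  have der: "((\<lambda>x. complex_of_real (l x)) has_derivative (\<lambda>h. complex_of_real (l h))) (at x)" for x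
    using has_derivative_of_real[OF bounded_linear_imp_has_derivative[OF assms]] .
  obtain K where K: "norm (l x) \<le> norm x * K" for x
    using assms bounded_linear.bounded by blast
  have K': "norm (l x) \<le> \<bar>K\<bar> * (1 + norm x) ^ 1" for x
  proof -
    have "norm x * K \<le> norm x * \<bar>K\<bar>" by (intro mult_left_mono) auto
    then show ?thesis using K[of x] by (simp add: algebra_simps)
  qed
  fix f assume f: "f \<in> {\<lambda>x. complex_of_real (l x)}"
  show "f differentiable (at x)" for x
    using der f by (auto simp: differentiable_def)
  show "partial_deriv [b] f \<in> alg {\<lambda>x. complex_of_real (l x)}" for b
    using f partial_deriv_eq[OF der, of b] by (auto intro: alg.const)
  show "\<exists>C k. \<forall>x. norm (f x) \<le> C * (1 + norm x) ^ k"
    using f K' by (intro exI[of _ "\<bar>K\<bar>"] exI[of _ 1]) auto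
qed (auto intro: alg.base)

lemma temperate_inner: "temperate (\<lambda>x. complex_of_real (x \<bullet> a))"
  by (rule temperate_bounded_linear) (rule bounded_linear_inner_left)

lemma one_le_japanese_bracket: "1 \<le> japanese_bracket x"
  by (simp add: japanese_bracket_def)

lemma japanese_bracket_le: "japanese_bracket x \<le> 1 + norm x"
  unfolding japanese_bracket_def by (rule real_le_lsqrt) (auto simp: power2_eq_square algebra_simps)

lemma japanese_bracket_powr: "japanese_bracket x powr q = (1 + x \<bullet> x) powr (q / 2)"
  by (simp add: japanese_bracket_def powr_half_sqrt[symmetric] powr_powr power2_norm_eq_inner)

text \<open>The derivative of the power q in direction b is q times the power q - 2 times the
  coordinate \<open>x \<bullet> b\<close>. Differentiation lowers the exponent indefinitely, so the
  generating set has to contain the powers with all real exponents, together with the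
  coordinates.\<close>

lemma temperate_japanese_bracket:
  "temperate (\<lambda>x::'a::euclidean_space. complex_of_real (japanese_bracket x powr q))"
proof -
  define J where "J q = (\<lambda>x::'a. complex_of_real (japanese_bracket x powr q))" for q
  define S where "S = range J \<union> range (\<lambda>b x. complex_of_real (x \<bullet> b))"
  have der: "(J q has_derivative (\<lambda>h. complex_of_real (q * (japanese_bracket x powr (q - 2)) * (x \<bullet> h)))) (at x)" for q x
  proof -
    have pos: "0 < 1 + x \<bullet> x" by (simp add: add_pos_nonneg)
    have 1: "japanese_bracket x powr (q - 2) = (1 + x \<bullet> x) powr (q / 2 - 1)"
      by (simp add: japanese_bracket_powr diff_divide_distrib)
    have "((\<lambda>x::'a. (1 + x \<bullet> x) powr (q / 2)) has_derivative
       (\<lambda>h. q * (1 + x \<bullet> x) powr (q / 2 - 1) * (x \<bullet> h))) (at x)"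
      by (rule has_derivative_eq_rhs[OF has_derivative_compose[where f="\<lambda>x. 1 + x \<bullet> x",
              OF _ has_real_derivative_powr[OF pos, unfolded has_field_derivative_def]]])
         (auto intro!: derivative_eq_intros simp: fun_eq_iff inner_commute)
    then show ?thesis unfolding J_def 1 japanese_bracket_powr[of _ q]
      by (rule has_derivative_of_real)
  qed
  have der2: "((\<lambda>x. complex_of_real (x \<bullet> b)) has_derivative (\<lambda>h. complex_of_real (h \<bullet> b))) (at x)" for b x :: 'a
    by (auto intro!: derivative_eq_intros)
  have Jpos: "japanese_bracket x powr q \<le> (1 + norm x) ^ nat \<lceil>\<bar>q\<bar>\<rceil>" for x :: 'a and q
  proof -
    have "japanese_bracket x powr q \<le> japanese_bracket x powr \<bar>q\<bar>"
      using one_le_japanese_bracket[of x] by (intro powr_mono) auto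
    also have "\<dots> \<le> (1 + norm x) powr \<bar>q\<bar>"
      using one_le_japanese_bracket[of x] japanese_bracket_le[of x] by (intro powr_mono2) auto
    also have "\<dots> \<le> (1 + norm x) powr real (nat \<lceil>\<bar>q\<bar>\<rceil>)"
      by (intro powr_mono) (auto simp: real_nat_ceiling_ge)
    also have "\<dots> = (1 + norm x) ^ nat \<lceil>\<bar>q\<bar>\<rceil>"
      by (subst powr_realpow) (auto simp: add_pos_nonneg)
    finally show ?thesis .
  qed
  have "temperate (J q)"
  proof (rule alg_temperate[where S=S])
    fix f assume f: "f \<in> S"
    then show "f differentiable (at x)" for x
      using der der2 unfolding S_def differentiable_def by blast
    show "partial_deriv [b] f \<in> alg S" for b
    proof -
      from f consider q where "f = J q" | c where "f = (\<lambda>x. complex_of_real (x \<bullet> c))"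
        unfolding S_def by auto
      then show ?thesis
      proof cases
        case 1
        have "partial_deriv [b] f = (\<lambda>x. (\<lambda>x. complex_of_real q) x * (\<lambda>x. J (q-2) x * complex_of_real (x \<bullet> b)) x)"
          unfolding 1 by (subst partial_deriv_eq[OF der]) (auto simp: J_def)
        also have "\<dots> \<in> alg S"
          by (intro alg.mult alg.const alg.base) (auto simp: S_def)
        finally show ?thesis .
      next
        case 2
        then show ?thesis using partial_deriv_eq[OF der2, of b c] by (auto intro: alg.const)
      qed
    qed
    from f consider q where "f = J q" | c where "f = (\<lambda>x. complex_of_real (x \<bullet> c))"
        unfolding S_def by auto
    then show "\<exists>C k. \<forall>x. norm (f x) \<le> C * (1 + norm x) ^ k"
    proof cases
      case 1
      show ?thesis by (rule exI[of _ 1], rule exI[of _ "nat \<lceil>\<bar>q\<bar>\<rceil>"]) (use 1 Jpos in \<open>auto simp: J_def\<close>)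
    next
      case 2
      then show ?thesis using temperate_bound[OF temperate_inner] by auto
    qed
  qed (auto simp: S_def intro: alg.base)
  then show ?thesis by (simp add: J_def)
qed

lemma temperate_exp_inner:
  "temperate (\<lambda>x::'a::euclidean_space. exp (\<i> * complex_of_real (x \<bullet> a)))"
proof (rule alg_temperate)
  let ?e = "\<lambda>x::'a. exp (\<i> * complex_of_real (x \<bullet> a))"
  have der: "(?e has_derivative (\<lambda>h. (\<i> * complex_of_real (h \<bullet> a)) * ?e x)) (at x)" for x
    by (rule has_derivative_eq_rhs[OF has_derivative_compose[where f="\<lambda>x. \<i> * complex_of_real (x \<bullet> a)",
              OF _ DERIV_exp[unfolded has_field_derivative_def]]])
       (auto intro!: derivative_eq_intros simp: fun_eq_iff)
  show "f \<in> {?e} \<Longrightarrow> f differentiable (at x)" for f x using der by (auto simp: differentiable_def)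
  show "f \<in> {?e} \<Longrightarrow> partial_deriv [b] f \<in> alg {?e}" for f b
    using partial_deriv_eq[OF der, of b] by (auto intro!: alg.mult[OF alg.const alg.base])
  show "f \<in> {?e} \<Longrightarrow> \<exists>C k. \<forall>x. norm (f x) \<le> C * (1 + norm x) ^ k" for f
    by (intro exI[of _ 1] exI[of _ 0]) auto
qed (auto intro: alg.base)

section \<open>Continuous operators on Schwartz functions\<close>

text \<open>The dominating sum in \<open>tempered_distribution\<close>. It increases with
  \<open>N\<close>, so finitely many bounds of this shape can be merged into one.\<close>

definition pnorm :: "nat \<Rightarrow> ('a::euclidean_space \<Rightarrow> complex) \<Rightarrow> real" where
  "pnorm N \<phi> = (\<Sum>bs \<in> {bs. set bs \<subseteq> Basis \<and> length bs \<le> N}. schwartz_seminorm N bs \<phi>)"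

lemma finite_multiindices: "finite {bs. set bs \<subseteq> (Basis::'a::euclidean_space set) \<and> length bs \<le> N}"
  by (rule finite_lists_length_le) simp

lemma seminorm_upper:
  assumes "schwartz \<phi>" "set bs \<subseteq> Basis"
  shows "(1 + norm x) ^ k * norm (partial_deriv bs \<phi> x) \<le> schwartz_seminorm k bs \<phi>"
  unfolding schwartz_seminorm_def
proof (rule cSUP_upper)
  obtain C where "\<forall>x. (1 + norm x) ^ k * norm (partial_deriv bs \<phi> x) \<le> C"
    using schwartz_bound[OF schwartz_partial_deriv[OF assms]] by blast
  then show "bdd_above (range (\<lambda>x. (1 + norm x) ^ k * norm (partial_deriv bs \<phi> x)))"
    by (auto simp: bdd_above_def)
qed simp

lemma seminorm_nonneg:
  assumes "schwartz \<phi>" "set bs \<subseteq> Basis"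
  shows "0 \<le> schwartz_seminorm k bs \<phi>"
  by (rule order_trans[OF _ seminorm_upper[OF assms, where x=0]]) auto

lemma pnorm_upper:
  assumes "schwartz \<phi>" "set bs \<subseteq> Basis" "k \<le> N" "length bs \<le> N"
  shows "(1 + norm x) ^ k * norm (partial_deriv bs \<phi> x) \<le> pnorm N \<phi>"
proof -
  have "(1 + norm x) ^ k * norm (partial_deriv bs \<phi> x) \<le> (1 + norm x) ^ N * norm (partial_deriv bs \<phi> x)"
    using assms by (intro mult_right_mono power_increasing) auto
  also have "\<dots> \<le> schwartz_seminorm N bs \<phi>"
    using assms by (intro seminorm_upper)
  also have "\<dots> \<le> pnorm N \<phi>"
    unfolding pnorm_def using assms finite_multiindices seminorm_nonneg
    by (intro member_le_sum) auto
  finally show ?thesis .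
qed

lemma pnorm_nonneg: "schwartz \<phi> \<Longrightarrow> 0 \<le> pnorm N \<phi>"
  unfolding pnorm_def by (intro sum_nonneg) (auto intro: seminorm_nonneg)

lemma pnorm_mono:
  assumes "schwartz \<phi>" "N \<le> M"
  shows "pnorm N \<phi> \<le> pnorm M \<phi>"
proof -
  have "schwartz_seminorm N bs \<phi> \<le> schwartz_seminorm M bs \<phi>" if "set bs \<subseteq> Basis" for bs
    unfolding schwartz_seminorm_def[of N]
  proof (rule cSUP_least)
    fix x :: 'a
    have "(1 + norm x) ^ N * norm (partial_deriv bs \<phi> x) \<le> (1 + norm x) ^ M * norm (partial_deriv bs \<phi> x)"
      using assms by (intro mult_right_mono power_increasing) auto
    also have "\<dots> \<le> schwartz_seminorm M bs \<phi>"
      using assms that by (intro seminorm_upper)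
    finally show "(1 + norm x) ^ N * norm (partial_deriv bs \<phi> x) \<le> schwartz_seminorm M bs \<phi>" .
  qed simp
  then have "pnorm N \<phi> \<le> (\<Sum>bs \<in> {bs. set bs \<subseteq> Basis \<and> length bs \<le> N}. schwartz_seminorm M bs \<phi>)"
    unfolding pnorm_def by (intro sum_mono) auto
  also have "\<dots> \<le> pnorm M \<phi>"
    unfolding pnorm_def using assms finite_multiindices seminorm_nonneg
    by (intro sum_mono2) auto
  finally show ?thesis .
qed

text \<open>Continuity of an operator on the Schwartz space as bounds that are uniform in the
  argument. Differentiability of the values is built in, so that the values are Schwartz functions
  by definition, and the bounds later yield the temperedness of functionals composed with the
  operator.\<close>

definition scont :: "(('a::euclidean_space \<Rightarrow> complex) \<Rightarrow> 'a \<Rightarrow> complex) \<Rightarrow> bool" where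
  "scont T \<longleftrightarrow> (\<forall>bs k. set bs \<subseteq> Basis \<longrightarrow> (\<exists>C N. \<forall>\<phi>. schwartz \<phi> \<longrightarrow>
     (\<forall>x. partial_deriv bs (T \<phi>) differentiable (at x) \<and>
       (1 + norm x) ^ k * norm (partial_deriv bs (T \<phi>) x) \<le> C * pnorm N \<phi>)))"

lemma scont_coinduct:
  assumes "X T" and diff: "\<And>T \<phi> x. X T \<Longrightarrow> schwartz \<phi> \<Longrightarrow> T \<phi> differentiable (at x)"
    and pd: "\<And>T b. X T \<Longrightarrow> b \<in> Basis \<Longrightarrow> X (\<lambda>\<phi>. partial_deriv [b] (T \<phi>))"
    and bd: "\<And>T k. X T \<Longrightarrow> \<exists>C N. \<forall>\<phi>. schwartz \<phi> \<longrightarrow> (\<forall>x. (1 + norm x) ^ k * norm (T \<phi> x) \<le> C * pnorm N \<phi>)"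
  shows "scont T"
proof -
  have X: "X (\<lambda>\<phi>. partial_deriv bs (T \<phi>))" if "set bs \<subseteq> Basis" for bs
    using that
  proof (induction bs)
    case (Cons b bs)
    then have "X (\<lambda>\<phi>. partial_deriv [b] (partial_deriv bs (T \<phi>)))" by (intro pd) auto
    then show ?case by (subst partial_deriv_Cons)
  qed (use \<open>X T\<close> in auto)
  show ?thesis unfolding scont_def
  proof (intro allI impI)
    fix bs :: "'a list" and k assume bs: "set bs \<subseteq> Basis"
    from bd[OF X[OF bs], of k] diff[OF X[OF bs]] show "\<exists>C N. \<forall>\<phi>. schwartz \<phi> \<longrightarrow>
     (\<forall>x. partial_deriv bs (T \<phi>) differentiable (at x) \<and>
       (1 + norm x) ^ k * norm (partial_deriv bs (T \<phi>) x) \<le> C * pnorm N \<phi>)" by blast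
  qed
qed

lemma scont_bound:
  assumes "scont T"
  shows "\<exists>C N. C \<ge> 0 \<and> (\<forall>\<phi>. schwartz \<phi> \<longrightarrow> (\<forall>x. (1 + norm x) ^ k * norm (T \<phi> x) \<le> C * pnorm N \<phi>))"
proof -
  obtain C N where CN: "\<And>\<phi> x. schwartz \<phi> \<Longrightarrow> (1 + norm x) ^ k * norm (partial_deriv [] (T \<phi>) x) \<le> C * pnorm N \<phi>"
    using assms unfolding scont_def by (metis empty_subsetI list.set(1))
  have C: "C * pnorm N \<phi> \<le> \<bar>C\<bar> * pnorm N \<phi>" if "schwartz \<phi>" for \<phi>
    using pnorm_nonneg[OF that] by (intro mult_right_mono) auto
  have "(1 + norm x) ^ k * norm (T \<phi> x) \<le> \<bar>C\<bar> * pnorm N \<phi>" if "schwartz \<phi>" for \<phi> x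
    using order_trans[OF CN[OF that] C[OF that]] by simp
  then show ?thesis
    by (intro exI[of _ "\<bar>C\<bar>"] exI[of _ N]) auto
qed

lemma scont_schwartz:
  assumes "scont T" "schwartz \<phi>"
  shows "schwartz (T \<phi>)"
  unfolding schwartz_def smooth_function_def
proof (intro conjI allI impI)
  fix bs :: "'a list" and x k assume bs: "set bs \<subseteq> Basis"
  then show "partial_deriv bs (T \<phi>) differentiable at x"
    using assms unfolding scont_def by blast
  obtain C N where "\<And>x. (1 + norm x) ^ k * norm (partial_deriv bs (T \<phi>) x) \<le> C * pnorm N \<phi>"
    using assms bs unfolding scont_def by meson
  then show "bounded (range (\<lambda>x. (1 + norm x) ^ k *\<^sub>R partial_deriv bs (T \<phi>) x))"
    unfolding bounded_iff by (intro exI[of _ "C * pnorm N \<phi>"]) auto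
qed

lemma scont_partial_deriv_comp:
  assumes "scont T" "set cs \<subseteq> Basis"
  shows "scont (\<lambda>\<phi>. partial_deriv cs (T \<phi>))"
  unfolding scont_def
proof (intro allI impI)
  fix bs :: "'a list" and k assume "set bs \<subseteq> Basis"
  then have "set (bs @ cs) \<subseteq> Basis" using assms by auto
  with assms(1) show "\<exists>C N. \<forall>\<phi>. schwartz \<phi> \<longrightarrow>
     (\<forall>x. partial_deriv bs (partial_deriv cs (T \<phi>)) differentiable (at x) \<and>
       (1 + norm x) ^ k * norm (partial_deriv bs (partial_deriv cs (T \<phi>)) x) \<le> C * pnorm N \<phi>)"
    unfolding scont_def partial_deriv_append[symmetric] by meson
qed

lemma scont_id: "scont (\<lambda>\<phi>. \<phi>)"
  unfolding scont_def
proof (intro allI impI)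
  fix bs :: "'a list" and k assume bs: "set bs \<subseteq> Basis"
  show "\<exists>C N. \<forall>\<phi>. schwartz \<phi> \<longrightarrow>
     (\<forall>x. partial_deriv bs \<phi> differentiable (at x) \<and>
       (1 + norm x) ^ k * norm (partial_deriv bs \<phi> x) \<le> C * pnorm N \<phi>)"
    using pnorm_upper[OF _ bs, of _ k "max k (length bs)"] schwartz_differentiable[OF schwartz_partial_deriv[OF _ bs]]
    by (intro exI[of _ 1] exI[of _ "max k (length bs)"]) auto
qed

text \<open>
  By the product rule the derivatives of \<open>m \<cdot> A\<close> are sums of two
  operators of the same shape.
\<close>

inductive_set opsums :: "(('a::euclidean_space \<Rightarrow> complex) \<Rightarrow> 'a \<Rightarrow> complex) set" where
  "temperate m \<Longrightarrow> scont A \<Longrightarrow> (\<And>\<phi>. schwartz \<phi> \<Longrightarrow> T \<phi> = (\<lambda>x. m x * A \<phi> x)) \<Longrightarrow> T \<in> opsums"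
| "S \<in> opsums \<Longrightarrow> S' \<in> opsums \<Longrightarrow> (\<And>\<phi>. schwartz \<phi> \<Longrightarrow> T \<phi> = (\<lambda>x. S \<phi> x + S' \<phi> x)) \<Longrightarrow> T \<in> opsums"

text \<open>The three conjuncts are what \<open>scont_coinduct\<close> asks for. They are proved in
  one induction because the derivative of a sum can be split only once differentiability of the
  summands is known.\<close>

lemma opsums_derivative:
  assumes "T \<in> opsums"
  shows "(\<forall>\<phi> x. schwartz \<phi> \<longrightarrow> T \<phi> differentiable (at x)) \<and>
    (\<forall>b\<in>Basis. (\<lambda>\<phi>. partial_deriv [b] (T \<phi>)) \<in> opsums) \<and>
    (\<forall>k. \<exists>C N. C \<ge> 0 \<and> (\<forall>\<phi>. schwartz \<phi> \<longrightarrow> (\<forall>x. (1 + norm x) ^ k * norm (T \<phi> x) \<le> C * pnorm N \<phi>)))"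
  using assms
proof (induction rule: opsums.induct)
  case (1 m A T)
  have d: "A \<phi> differentiable (at x)" "m differentiable (at x)" if "schwartz \<phi>" for \<phi> x
    using schwartz_differentiable[OF scont_schwartz[OF 1(2) that]] temperate_differentiable[OF 1(1)] by auto
  have "T \<phi> differentiable (at x)" if "schwartz \<phi>" for \<phi> x
    using that d 1(3) by simp
  moreover have "(\<lambda>\<phi>. partial_deriv [b] (T \<phi>)) \<in> opsums" if b: "b \<in> Basis" for b
  proof (rule opsums.intros(2))
    show "(\<lambda>\<phi> x. partial_deriv [b] m x * A \<phi> x) \<in> opsums"
      using 1 b by (intro opsums.intros(1)[where m="partial_deriv [b] m" and A=A] temperate_partial_deriv) auto
    show "(\<lambda>\<phi> x. m x * partial_deriv [b] (A \<phi>) x) \<in> opsums"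
      using 1 b by (intro opsums.intros(1)[where m=m and A="\<lambda>\<phi>. partial_deriv [b] (A \<phi>)"] scont_partial_deriv_comp) auto
    show "partial_deriv [b] (T \<phi>) = (\<lambda>x. partial_deriv [b] m x * A \<phi> x + m x * partial_deriv [b] (A \<phi>) x)" if "schwartz \<phi>" for \<phi>
      using that d by (simp add: 1(3) partial_deriv_mult)
  qed
  moreover have "\<exists>C N. C \<ge> 0 \<and> (\<forall>\<phi>. schwartz \<phi> \<longrightarrow> (\<forall>x. (1 + norm x) ^ k * norm (T \<phi> x) \<le> C * pnorm N \<phi>))" for k
  proof -
    obtain C l where Cl: "\<And>x. norm (m x) \<le> C * (1 + norm x) ^ l"
      using temperate_bound[OF 1(1)] by blast
    have C: "C \<ge> 0" using order_trans[OF norm_ge_zero Cl[of 0]] by simp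
    obtain D N where D: "D \<ge> 0" and DN: "\<And>\<phi> x. schwartz \<phi> \<Longrightarrow> (1 + norm x) ^ (k + l) * norm (A \<phi> x) \<le> D * pnorm N \<phi>"
      using scont_bound[OF 1(2)] by metis
    have "(1 + norm x) ^ k * norm (T \<phi> x) \<le> (C * D) * pnorm N \<phi>" if \<phi>: "schwartz \<phi>" for \<phi> x
    proof -
      have "(1 + norm x) ^ k * norm (T \<phi> x) \<le> (1 + norm x) ^ k * (C * (1 + norm x) ^ l * norm (A \<phi> x))"
        unfolding 1(3)[OF \<phi>] norm_mult using Cl by (intro mult_left_mono mult_right_mono) auto
      also have "\<dots> = C * ((1 + norm x) ^ (k + l) * norm (A \<phi> x))"
        by (simp add: power_add mult_ac)
      also have "\<dots> \<le> C * (D * pnorm N \<phi>)"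
        using C DN[OF \<phi>] by (intro mult_left_mono) auto
      finally show ?thesis by (simp add: mult_ac)
    qed
    then show ?thesis using C D by (intro exI[of _ "C * D"] exI[of _ N]) auto
  qed
  ultimately show ?case by blast
next
  case (2 S S' T)
  then have d: "S \<phi> differentiable (at x)" "S' \<phi> differentiable (at x)" if "schwartz \<phi>" for \<phi> x
    using that by auto
  have "T \<phi> differentiable (at x)" if "schwartz \<phi>" for \<phi> x
    using that d 2(3) by simp
  moreover have "(\<lambda>\<phi>. partial_deriv [b] (T \<phi>)) \<in> opsums" if b: "b \<in> Basis" for b
    by (rule opsums.intros(2)[where S="\<lambda>\<phi>. partial_deriv [b] (S \<phi>)" and S'="\<lambda>\<phi>. partial_deriv [b] (S' \<phi>)"])
       (use 2 b d in \<open>auto simp: partial_deriv_add\<close>)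
  moreover have "\<exists>C N. C \<ge> 0 \<and> (\<forall>\<phi>. schwartz \<phi> \<longrightarrow> (\<forall>x. (1 + norm x) ^ k * norm (T \<phi> x) \<le> C * pnorm N \<phi>))" for k
  proof -
    obtain C N where C: "C \<ge> 0" and CN: "\<And>\<phi> x. schwartz \<phi> \<Longrightarrow> (1 + norm x) ^ k * norm (S \<phi> x) \<le> C * pnorm N \<phi>"
      using 2 by metis
    obtain D M where D: "D \<ge> 0" and DM: "\<And>\<phi> x. schwartz \<phi> \<Longrightarrow> (1 + norm x) ^ k * norm (S' \<phi> x) \<le> D * pnorm M \<phi>"
      using 2 by metis
    have "(1 + norm x) ^ k * norm (T \<phi> x) \<le> (C + D) * pnorm (N + M) \<phi>" if \<phi>: "schwartz \<phi>" for \<phi> x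
    proof -
      have "(1 + norm x) ^ k * norm (T \<phi> x) \<le> (1 + norm x) ^ k * (norm (S \<phi> x) + norm (S' \<phi> x))"
        unfolding 2(3)[OF \<phi>] by (intro mult_left_mono norm_triangle_ineq) auto
      also have "\<dots> \<le> C * pnorm N \<phi> + D * pnorm M \<phi>"
        using CN[OF \<phi>, of x] DM[OF \<phi>, of x] by (simp add: distrib_left)
      also have "\<dots> \<le> C * pnorm (N + M) \<phi> + D * pnorm (N + M) \<phi>"
        using C D pnorm_mono[OF \<phi>] by (intro add_mono mult_left_mono) auto
      finally show ?thesis by (simp add: distrib_right)
    qed
    then show ?thesis using C D by (intro exI[of _ "C + D"] exI[of _ "N + M"]) auto
  qed
  ultimately show ?case by blast
qed

lemma opsums_scont: "T \<in> opsums \<Longrightarrow> scont T"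
  by (rule scont_coinduct[where X="\<lambda>T. T \<in> opsums"]) (use opsums_derivative in blast)+

lemma scont_mult: "temperate m \<Longrightarrow> scont A \<Longrightarrow> scont (\<lambda>\<phi> x. m x * A \<phi> x)"
  by (rule opsums_scont, rule opsums.intros(1)) auto

lemma scont_add: "scont A \<Longrightarrow> scont B \<Longrightarrow> scont (\<lambda>\<phi> x. A \<phi> x + B \<phi> x)"
  by (rule opsums_scont, rule opsums.intros(2)[where S=A and S'=B])
     (use opsums.intros(1)[of "\<lambda>x. 1"] in auto)

lemma scont_diff: "scont A \<Longrightarrow> scont B \<Longrightarrow> scont (\<lambda>\<phi> x. A \<phi> x - B \<phi> x)"
  using scont_add[of A "\<lambda>\<phi> x. -1 * B \<phi> x"] scont_mult[of "\<lambda>x. -1" B] by simp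

lemma scont_sum: "finite I \<Longrightarrow> I \<noteq> {} \<Longrightarrow> (\<And>i. i \<in> I \<Longrightarrow> scont (A i)) \<Longrightarrow> scont (\<lambda>\<phi> x. \<Sum>i\<in>I. A i \<phi> x)"
  by (induction I rule: finite_ne_induct) (auto intro!: scont_add)

lemma schwartz_mult: "temperate m \<Longrightarrow> schwartz \<phi> \<Longrightarrow> schwartz (\<lambda>x. m x * \<phi> x)"
  using scont_schwartz[OF scont_mult[OF _ scont_id]] .

lemma schwartz_cmult: "schwartz \<phi> \<Longrightarrow> schwartz (\<lambda>x. c * \<phi> x)"
  using schwartz_mult[of "\<lambda>x. c"] by simp

lemma schwartz_add:
  assumes "schwartz f" "schwartz g" shows "schwartz (\<lambda>x. f x + g x)"
proof -
  define X where "X h \<longleftrightarrow> (\<exists>f g. schwartz f \<and> schwartz g \<and> h = (\<lambda>x. f x + g x))" for h :: "'a \<Rightarrow> complex"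
  show ?thesis
  proof (rule schwartz_coinduct[where X=X])
    show "X (\<lambda>x. f x + g x)" using assms X_def by auto
    show "h differentiable (at x)" if "X h" for h x
      using that schwartz_differentiable unfolding X_def by (auto intro!: differentiable_add)
    show "X (partial_deriv [b] h)" if "X h" "b \<in> Basis" for h b
    proof -
      obtain f g where fg: "schwartz f" "schwartz g" "h = (\<lambda>x. f x + g x)" using \<open>X h\<close> X_def by auto
      then show ?thesis using schwartz_partial_deriv[of f "[b]"] schwartz_partial_deriv[of g "[b]"] that
        unfolding X_def by (intro exI[of _ "partial_deriv [b] f"] exI[of _ "partial_deriv [b] g"])
          (auto simp: partial_deriv_add schwartz_differentiable)
    qed
    show "\<exists>C. \<forall>x. (1 + norm x) ^ k * norm (h x) \<le> C" if "X h" for h k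
    proof -
      obtain f g where fg: "schwartz f" "schwartz g" "h = (\<lambda>x. f x + g x)" using \<open>X h\<close> X_def by auto
      obtain C where C: "\<And>x. (1 + norm x) ^ k * norm (f x) \<le> C" using schwartz_bound[OF fg(1)] by blast
      obtain D where D: "\<And>x. (1 + norm x) ^ k * norm (g x) \<le> D" using schwartz_bound[OF fg(2)] by blast
      have "(1 + norm x) ^ k * norm (h x) \<le> C + D" for x
      proof -
        have "(1 + norm x) ^ k * norm (h x) \<le> (1 + norm x) ^ k * (norm (f x) + norm (g x))"
          unfolding fg by (intro mult_left_mono norm_triangle_ineq) auto
        then show ?thesis using C[of x] D[of x] by (simp add: distrib_left)
      qed
      then show ?thesis by blast
    qed
  qed
qed

lemma schwartz_temperate:
  assumes "schwartz f" shows "temperate f"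
proof (rule temperate_coinduct[where X=schwartz])
  show "\<exists>C k. \<forall>x. norm (f x) \<le> C * (1 + norm x) ^ k" if f: "schwartz f" for f :: "'a \<Rightarrow> complex"
    using schwartz_bound[OF f, of 0] by (metis mult_1 power_0 mult.right_neutral)
qed (use assms in \<open>auto simp: schwartz_differentiable schwartz_partial_deriv\<close>)

lemma partial_deriv_affine:
  assumes f: "\<And>x. f differentiable (at x)"
  shows "partial_deriv [b] (\<lambda>x. f (c *\<^sub>R x + a)) = (\<lambda>x. of_real c * partial_deriv [b] f (c *\<^sub>R x + a))"
    and "(\<lambda>x. f (c *\<^sub>R x + a)) differentiable (at x)"
proof -
  have lin: "linear (frechet_derivative f (at y))" for y
    using f linear_frechet_derivative by blast
  have der: "((\<lambda>x. f (c *\<^sub>R x + a)) has_derivative (\<lambda>h. frechet_derivative f (at (c *\<^sub>R x + a)) (c *\<^sub>R h))) (at x)" for x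
    by (rule has_derivative_compose[where g=f and f="\<lambda>x. c *\<^sub>R x + a"])
       (use f in \<open>auto intro!: derivative_eq_intros simp: frechet_derivative_works[symmetric]\<close>)
  show "partial_deriv [b] (\<lambda>x. f (c *\<^sub>R x + a)) = (\<lambda>x. of_real c * partial_deriv [b] f (c *\<^sub>R x + a))"
    by (subst partial_deriv_eq[OF der]) (simp add: partial_deriv_single linear_scale[OF lin] scaleR_conv_of_real)
  show "(\<lambda>x. f (c *\<^sub>R x + a)) differentiable (at x)"
    using der differentiable_def by blast
qed

lemma affine_weight_le:
  fixes x :: "'a::real_normed_vector"
  assumes "c \<noteq> 0"
  shows "1 + norm x \<le> (1 + (1 + norm a) / \<bar>c\<bar>) * (1 + norm (c *\<^sub>R x + a))"
proof -
  have "\<bar>c\<bar> * norm x \<le> norm (c *\<^sub>R x + a) + norm a"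
    by (metis add.commute add_diff_cancel_right' norm_scaleR norm_triangle_ineq4)
  then have "norm x \<le> (norm (c *\<^sub>R x + a) + norm a) / \<bar>c\<bar>"
    using assms by (simp add: field_simps)
  also have "\<dots> \<le> (1 + norm a) / \<bar>c\<bar> * (1 + norm (c *\<^sub>R x + a))"
    using assms by (auto simp: field_simps mult_nonneg_nonneg)
  finally have "norm x \<le> (1 + norm a) / \<bar>c\<bar> * (1 + norm (c *\<^sub>R x + a))" .
  moreover have "(1 + (1 + norm a) / \<bar>c\<bar>) * (1 + norm (c *\<^sub>R x + a)) =
     1 + norm (c *\<^sub>R x + a) + (1 + norm a) / \<bar>c\<bar> * (1 + norm (c *\<^sub>R x + a))"
    by (simp add: algebra_simps)
  moreover have "0 \<le> norm (c *\<^sub>R x + a)" by simp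
  ultimately show ?thesis by linarith
qed

lemma scont_affine:
  assumes A: "scont A" and c: "c \<noteq> 0"
  shows "scont (\<lambda>\<phi> x. A \<phi> (c *\<^sub>R x + a))"
proof (rule scont_coinduct[where X="\<lambda>T. \<exists>A. scont A \<and> (\<forall>\<phi>. schwartz \<phi> \<longrightarrow> T \<phi> = (\<lambda>x. A \<phi> (c *\<^sub>R x + a)))"])
  fix T :: "('a \<Rightarrow> complex) \<Rightarrow> 'a \<Rightarrow> complex"
  assume "\<exists>A. scont A \<and> (\<forall>\<phi>. schwartz \<phi> \<longrightarrow> T \<phi> = (\<lambda>x. A \<phi> (c *\<^sub>R x + a)))"
  then obtain A where A: "scont A" and T: "\<And>\<phi>. schwartz \<phi> \<Longrightarrow> T \<phi> = (\<lambda>x. A \<phi> (c *\<^sub>R x + a))" by auto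
  have d: "A \<phi> differentiable (at x)" if "schwartz \<phi>" for \<phi> x
    using schwartz_differentiable[OF scont_schwartz[OF A that]] .
  show "T \<phi> differentiable (at x)" if "schwartz \<phi>" for \<phi> x
    unfolding T[OF that] by (rule partial_deriv_affine(2)) (rule d[OF that])
  show "\<exists>A. scont A \<and> (\<forall>\<phi>. schwartz \<phi> \<longrightarrow> partial_deriv [b] (T \<phi>) = (\<lambda>x. A \<phi> (c *\<^sub>R x + a)))" if "b \<in> Basis" for b
    by (rule exI[of _ "\<lambda>\<phi> x. of_real c * partial_deriv [b] (A \<phi>) x"])
       (use that A in \<open>auto intro!: scont_mult scont_partial_deriv_comp simp: T partial_deriv_affine(1)[OF d]\<close>)
  show "\<exists>C N. \<forall>\<phi>. schwartz \<phi> \<longrightarrow> (\<forall>x. (1 + norm x) ^ k * norm (T \<phi> x) \<le> C * pnorm N \<phi>)" for k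
  proof -
    obtain C N where C: "C \<ge> 0" and CN: "\<And>\<phi> x. schwartz \<phi> \<Longrightarrow> (1 + norm x) ^ k * norm (A \<phi> x) \<le> C * pnorm N \<phi>"
      using scont_bound[OF A] by metis
    define L where "L = 1 + (1 + norm a) / \<bar>c\<bar>"
    have L: "L \<ge> 0" unfolding L_def by auto
    have "(1 + norm x) ^ k * norm (T \<phi> x) \<le> (L ^ k * C) * pnorm N \<phi>" if \<phi>: "schwartz \<phi>" for \<phi> x
    proof -
      have "(1 + norm x) ^ k * norm (T \<phi> x) \<le> (L * (1 + norm (c *\<^sub>R x + a))) ^ k * norm (A \<phi> (c *\<^sub>R x + a))"
        unfolding T[OF \<phi>] L_def using affine_weight_le[OF c, of x a] by (intro mult_right_mono power_mono) auto
      also have "\<dots> = L ^ k * ((1 + norm (c *\<^sub>R x + a)) ^ k * norm (A \<phi> (c *\<^sub>R x + a)))"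
        by (simp add: power_mult_distrib)
      also have "\<dots> \<le> L ^ k * (C * pnorm N \<phi>)"
        using L by (intro mult_left_mono CN[OF \<phi>]) auto
      finally show ?thesis by (simp add: mult_ac)
    qed
    then show ?thesis by blast
  qed
qed (use A in auto)

lemma schwartz_affine:
  "schwartz \<phi> \<Longrightarrow> c \<noteq> 0 \<Longrightarrow> schwartz (\<lambda>x. \<phi> (c *\<^sub>R x + a))"
  using scont_schwartz[OF scont_affine[OF scont_id]] .

lemma schwartz_continuous: "schwartz f \<Longrightarrow> continuous_on UNIV f"
  by (meson continuous_at_imp_continuous_on differentiable_imp_continuous_within schwartz_differentiable)

lemma schwartz_measurable: "schwartz f \<Longrightarrow> f \<in> borel_measurable borel"
  by (simp add: borel_measurable_continuous_onI schwartz_continuous)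

section \<open>Integration on Euclidean space\<close>

lemma nn_integral_affine:
  fixes a :: "'a::euclidean_space"
  assumes [measurable]: "f \<in> borel_measurable borel" and c: "c \<noteq> 0"
  shows "(\<integral>\<^sup>+x. f x \<partial>lborel) = ennreal (\<bar>c\<bar> ^ DIM('a)) * (\<integral>\<^sup>+x. f (a + c *\<^sub>R x) \<partial>lborel)"
  by (subst lborel_affine[OF c, of a])
     (simp add: nn_integral_density nn_integral_distr nn_integral_cmult ennreal_power)

lemma integrable_affine:
  fixes f :: "'a::euclidean_space \<Rightarrow> 'b::{banach, second_countable_topology}"
  assumes f: "integrable lborel f" and c: "c \<noteq> 0"
  shows "integrable lborel (\<lambda>x. f (a + c *\<^sub>R x))"
proof -
  note [measurable] = f[THEN borel_measurable_integrable, simplified]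
  have [measurable]: "f \<in> borel_measurable borel" using f by auto
  have "(\<integral>\<^sup>+x. norm (f x) \<partial>lborel) = ennreal (\<bar>c\<bar> ^ DIM('a)) * (\<integral>\<^sup>+x. norm (f (a + c *\<^sub>R x)) \<partial>lborel)"
    by (rule nn_integral_affine[OF _ c, of "\<lambda>x. ennreal (norm (f x))"]) measurable
  moreover have "(\<integral>\<^sup>+x. norm (f x) \<partial>lborel) < \<infinity>"
    using f by (simp add: integrable_iff_bounded)
  ultimately have "(\<integral>\<^sup>+x. norm (f (a + c *\<^sub>R x)) \<partial>lborel) < \<infinity>"
    using c by (auto simp: ennreal_mult_less_top)
  then show ?thesis by (simp add: integrable_iff_bounded)
qed

lemma integral_affine:
  fixes f :: "'a::euclidean_space \<Rightarrow> 'b::{banach, second_countable_topology}"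
  assumes c: "c \<noteq> 0"
  shows "(LINT x|lborel. f x) = \<bar>c\<bar> ^ DIM('a) *\<^sub>R (LINT x|lborel. f (a + c *\<^sub>R x))"
proof (cases "integrable lborel f")
  case True
  then have [measurable]: "f \<in> borel_measurable borel" by auto
  show ?thesis using c True
    by (subst lborel_affine[OF c, of a]) (simp add: integral_density integral_distr integrable_affine)
next
  case False
  \<comment> \<open>Both integrals are then the default value 0: integrability of the transformed
    function would be carried back by the inverse affine map.\<close>
  have "\<not> integrable lborel (\<lambda>x. f (a + c *\<^sub>R x))"
  proof
    assume "integrable lborel (\<lambda>x. f (a + c *\<^sub>R x))"
    then have "integrable lborel (\<lambda>y. f (a + c *\<^sub>R ((- (1/c) *\<^sub>R a) + (1/c) *\<^sub>R y)))"
      using c by (intro integrable_affine[where f="\<lambda>x. f (a + c *\<^sub>R x)"]) auto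
    then show False using False c by (simp add: scaleR_add_right scaleR_diff_right)
  qed
  with False show ?thesis by (simp add: not_integrable_integral_eq)
qed

lemma integral_translate:
  fixes f :: "'a::euclidean_space \<Rightarrow> 'b::{banach, second_countable_topology}"
  shows "(LINT x|lborel. f (x + a)) = (LINT x|lborel. f x)"
  using integral_affine[of 1 f a] by (simp add: add.commute)

lemma integrable_translate:
  fixes f :: "'a::euclidean_space \<Rightarrow> 'b::{banach, second_countable_topology}"
  shows "integrable lborel f \<Longrightarrow> integrable lborel (\<lambda>x. f (x + a))"
  using integrable_affine[of f 1 a] by (simp add: add.commute)

lemma integral_reflect:
  fixes f :: "'a::euclidean_space \<Rightarrow> 'b::{banach, second_countable_topology}"
  shows "(LINT x|lborel. f (a - x)) = (LINT x|lborel. f x)"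
  using integral_affine[of "-1" f a] by simp

lemma integrable_reflect:
  fixes f :: "'a::euclidean_space \<Rightarrow> 'b::{banach, second_countable_topology}"
  shows "integrable lborel f \<Longrightarrow> integrable lborel (\<lambda>x. f (a - x))"
  using integrable_affine[of f "-1" a] by simp

lemma integrable_one_div_one_plus_square: "integrable lborel (\<lambda>x::real. 1 / (1 + x\<^sup>2))"
proof -
  let ?f = "\<lambda>x::real. indicator {0<..} x *\<^sub>R (1 / (1 + x\<^sup>2))"
  have 1: "integrable lborel ?f"
    using integrable_I0i_1_div_plus_square
    by (simp add: interval_lebesgue_integrable_def set_integrable_def einterval_def zero_ereal_def greaterThan_def)
  have 2: "integrable lborel (\<lambda>x. ?f (0 + (-1) * x))"
    by (rule lborel_integrable_real_affine[OF 1]) simp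
  have "integrable lborel (\<lambda>x. ?f x + ?f (0 + (-1) * x))"
    by (rule Bochner_Integration.integrable_add[OF 1 2])
  then show ?thesis
    by (rule integrable_cong_AE_imp) (auto intro!: AE_I[of _ _ "{0}"] simp: indicator_def split: if_splits)
qed

lemma weight_pos [simp]: "0 < (1 + norm x) ^ k"
  by (intro zero_less_power add_pos_nonneg) auto

text \<open>With the exponent \<open>2 * DIM('a)\<close> the weight is dominated by the product over
  the coordinates of 1 / (1 + t^2), hence integrable. Domination by a multiple of \<open>wt\<close>
  is the form in which Schwartz decay enters all convergence arguments.\<close>

definition wt :: "'a::euclidean_space \<Rightarrow> real" where
  "wt x = 1 / (1 + norm x) ^ (2 * DIM('a))"

lemma wt_pos: "0 < wt x" and wt_nonneg: "0 \<le> wt x"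
proof -
  have "0 < 1 + norm x" by (simp add: add_pos_nonneg)
  then show "0 < wt x" unfolding wt_def by (intro divide_pos_pos zero_less_power zero_less_one)
  then show "0 \<le> wt x" by simp
qed

lemma wt_measurable [measurable]: "wt \<in> borel_measurable borel"
  unfolding wt_def[abs_def] by measurable

lemma wt_le_1: "wt x \<le> 1"
proof -
  have "1 \<le> (1 + norm x) ^ (2 * DIM('a))" by (rule one_le_power) simp
  then show ?thesis by (simp add: wt_def divide_le_eq_1 del: norm_ge_zero)
qed

lemma norm_le_wtI:
  fixes x :: "'a::euclidean_space"
  assumes "(1 + norm x) ^ (2 * DIM('a)) * norm y \<le> C"
  shows "norm y \<le> C * wt x"
proof -
  have "0 < (1 + norm x) ^ (2 * DIM('a))" by (simp add: add_pos_nonneg)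
  then show ?thesis using assms by (simp add: wt_def field_simps)
qed

lemma wt_integrable: "integrable lborel (wt :: 'a::euclidean_space \<Rightarrow> real)"
proof -
  let ?P = "\<lambda>x::'a. \<Prod>b\<in>Basis. 1 / (1 + (x \<bullet> b)\<^sup>2)"
  have le: "wt x \<le> ?P x" for x :: 'a
  proof -
    have "(\<Prod>b\<in>Basis. 1 + (x \<bullet> b)\<^sup>2) \<le> (\<Prod>b\<in>(Basis::'a set). (1 + norm x)\<^sup>2)"
    proof (intro prod_mono conjI)
      fix b :: 'a assume "b \<in> Basis"
      then have "\<bar>x \<bullet> b\<bar> \<le> norm x" by (rule Basis_le_norm)
      then have "(x \<bullet> b)\<^sup>2 \<le> (norm x)\<^sup>2" by (metis abs_norm_cancel power2_le_iff_abs_le abs_le_square_iff)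
      then show "1 + (x \<bullet> b)\<^sup>2 \<le> (1 + norm x)\<^sup>2"
        using norm_ge_zero[of x] by (simp only: power2_sum power_one mult_1_right)
    qed (auto intro: add_nonneg_nonneg)
    also have "\<dots> = (1 + norm x) ^ (2 * DIM('a))" by (simp add: power_mult)
    finally show ?thesis
      unfolding wt_def prod_dividef prod_constant power_one
      by (intro divide_left_mono mult_pos_pos prod_pos zero_less_power) (auto intro: add_pos_nonneg)
  qed
  have "(\<integral>\<^sup>+x. ennreal (?P x) \<partial>lborel) = (\<integral>\<^sup>+x. (\<Prod>b\<in>Basis. ennreal (1 / (1 + (x \<bullet> b)\<^sup>2))) \<partial>(lborel::'a measure))"
    by (intro nn_integral_cong) (simp add: prod_ennreal)
  also have "\<dots> = (\<Prod>b\<in>(Basis::'a set). \<integral>\<^sup>+t. ennreal (1 / (1 + t\<^sup>2)) \<partial>lborel)"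
    by (rule nn_integral_lborel_prod) auto
  also have "\<dots> < \<infinity>"
    using integrable_one_div_one_plus_square by (simp add: integrable_iff_bounded power_less_top_ennreal)
  finally have "(\<integral>\<^sup>+x. ennreal (?P x) \<partial>lborel) < \<infinity>" .
  then have P: "integrable lborel ?P"
    by (subst integrable_iff_bounded) (auto simp: prod_nonneg abs_prod)
  show ?thesis
    by (rule Bochner_Integration.integrable_bound[OF P]) (use le in \<open>auto intro!: AE_I2 simp: prod_nonneg abs_prod abs_of_nonneg[OF wt_nonneg]\<close>)
qed

lemma schwartz_wt_bound:
  assumes "schwartz f"
  shows "\<exists>C\<ge>0. \<forall>x. norm (f x) \<le> C * wt x"
proof -
  obtain C where C: "\<And>x. (1 + norm x) ^ (2 * DIM('a)) * norm (f x) \<le> C"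
    using schwartz_bound[OF assms] by blast
  then have "C \<ge> 0" using order_trans[OF norm_ge_zero] by (metis mult_nonneg_nonneg norm_ge_zero order_trans zero_le_power add_nonneg_nonneg zero_le_one)
  with C show ?thesis by (intro exI[of _ C]) (auto intro: norm_le_wtI)
qed

lemma integrable_wt_bound:
  fixes f :: "'a::euclidean_space \<Rightarrow> 'b::{banach, second_countable_topology}"
  assumes "f \<in> borel_measurable borel" "\<And>x. norm (f x) \<le> C * wt x"
  shows "integrable lborel f"
proof (rule Bochner_Integration.integrable_bound[of _ "\<lambda>x. C * wt x"])
  show "integrable lborel (\<lambda>x::'a. C * wt x)" by (intro integrable_mult_right wt_integrable)
  show "AE x in lborel. norm (f x) \<le> norm (C * wt x)"
    using assms(2) by (intro AE_I2) (metis abs_ge_self order_trans real_norm_def)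
qed (use assms in simp)

lemma schwartz_integrable: "schwartz f \<Longrightarrow> integrable lborel f"
  using schwartz_wt_bound schwartz_measurable integrable_wt_bound by metis

lemma schwartz_bounded: "schwartz f \<Longrightarrow> \<exists>C\<ge>0. \<forall>x. norm (f x) \<le> C"
  by (metis schwartz_wt_bound wt_le_1 mult_left_mono mult.right_neutral order_trans)

text \<open>Supplies one dominating function for all translates by vectors of norm at most 1, as
  needed for difference quotients and for mollification at small scales.\<close>

lemma wt_shift:
  fixes x :: "'a::euclidean_space"
  assumes "norm y \<le> 1"
  shows "wt (x + y) \<le> 2 ^ (2 * DIM('a)) * wt x"
proof -
  have "norm x \<le> norm (x + y) + norm y" by (metis add_diff_cancel_right' norm_triangle_ineq4)
  with assms have "1 + norm x \<le> 2 * (1 + norm (x + y))" using norm_ge_zero[of "x + y"] unfolding distrib_left by linarith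
  then have "(1 + norm x) ^ (2 * DIM('a)) \<le> (2 * (1 + norm (x + y))) ^ (2 * DIM('a))"
    by (intro power_mono) auto
  then show ?thesis unfolding wt_def power_mult_distrib
    by (simp add: field_simps add_pos_nonneg)
qed

lemma integrable_prod_mult:
  fixes f :: "'a::euclidean_space \<Rightarrow> real" and g :: "'b::euclidean_space \<Rightarrow> real"
  assumes f: "integrable lborel f" and g: "integrable lborel g"
  shows "integrable (lborel \<Otimes>\<^sub>M lborel) (\<lambda>(x, y). f x * g y)"
proof (rule lborel_pair.Fubini_integrable)
  have [measurable]: "f \<in> borel_measurable borel" "g \<in> borel_measurable borel" using f g by auto
  show "(\<lambda>(x, y). f x * g y) \<in> borel_measurable (lborel \<Otimes>\<^sub>M lborel)" by measurable
  show "integrable lborel (\<lambda>x. LINT y|lborel. norm (case (x, y) of (x, y) \<Rightarrow> f x * g y))"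
    using f g by (simp add: abs_mult)
  show "AE x in lborel. integrable lborel (\<lambda>y. case (x, y) of (x, y) \<Rightarrow> f x * g y)"
    using g by simp
qed

lemma Fubini_bound:
  fixes F :: "'a::euclidean_space \<Rightarrow> 'b::euclidean_space \<Rightarrow> complex"
  assumes "integrable lborel f" and "integrable lborel g"
    and [measurable]: "(\<lambda>(x, y). F x y) \<in> borel_measurable (borel \<Otimes>\<^sub>M borel)"
    and "\<And>x y. norm (F x y) \<le> f x * g y"
  shows "(LINT y|lborel. LINT x|lborel. F x y) = (LINT x|lborel. LINT y|lborel. F x y)"
proof (rule lborel_pair.Fubini_integral)
  show "integrable (lborel \<Otimes>\<^sub>M lborel) (\<lambda>(x, y). F x y)"
    by (rule Bochner_Integration.integrable_bound[OF integrable_prod_mult[OF assms(1,2)]])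
       (use assms(4) in \<open>auto intro!: AE_I2 order_trans[OF _ abs_ge_self] simp del: borel_prod split: prod.splits\<close>)
qed

section \<open>The Fourier transform on Schwartz functions\<close>

text \<open>The difference quotients \<open>D n\<close> have integral 0 by translation invariance.
  The mean value inequality along the segment and \<open>wt_shift\<close> dominate them by a
  multiple of \<open>wt\<close>, so the derivative inherits the value 0. This is the source of
  integration by parts on the whole space.\<close>

lemma integral_partial_deriv_zero:
  assumes g: "schwartz g" and b: "b \<in> Basis"
  shows "(LINT x|lborel. partial_deriv [b] g x) = 0"
proof -
  have sb: "schwartz (partial_deriv [b] g)" using schwartz_partial_deriv[OF g, of "[b]"] b by simp
  obtain C where C: "C \<ge> 0" "\<And>x. norm (partial_deriv [b] g x) \<le> C * wt x"
    using schwartz_wt_bound[OF sb] by blast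
  define h where "h n = inverse (real (Suc n))" for n
  have h: "0 < h n" "h n \<le> 1" for n by (auto simp: h_def field_simps)
  have hlim: "h \<longlonglongrightarrow> 0" unfolding h_def by (rule LIMSEQ_inverse_real_of_nat)
  define D where "D n x = (1 / h n) *\<^sub>R (g (x + h n *\<^sub>R b) - g x)" for n x
  have vd: "((\<lambda>t. g (x + t *\<^sub>R b)) has_vector_derivative partial_deriv [b] g (x + t *\<^sub>R b)) (at t)" for x t
  proof -
    have "((\<lambda>t. g (x + t *\<^sub>R b)) has_derivative (\<lambda>s. frechet_derivative g (at (x + t *\<^sub>R b)) (s *\<^sub>R b))) (at t)"
      by (rule has_derivative_compose[where g=g and f="\<lambda>t. x + t *\<^sub>R b"])
         (use schwartz_differentiable[OF g] in \<open>auto intro!: derivative_eq_intros simp: frechet_derivative_works[symmetric]\<close>)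
    moreover have "linear (frechet_derivative g (at (x + t *\<^sub>R b)))"
      using schwartz_differentiable[OF g] linear_frechet_derivative by blast
    ultimately show ?thesis
      by (simp add: has_vector_derivative_def partial_deriv_single linear_scale)
  qed
  have "(\<lambda>n. LINT x|lborel. D n x) \<longlonglongrightarrow> (LINT x|lborel. partial_deriv [b] g x)"
  proof (rule integral_dominated_convergence)
    show "partial_deriv [b] g \<in> borel_measurable lborel" using schwartz_measurable[OF sb] by simp
    have [measurable]: "g \<in> borel_measurable borel" by (rule schwartz_measurable[OF g])
    show "D n \<in> borel_measurable lborel" for n unfolding D_def by measurable
    show "integrable lborel (\<lambda>x. (C * 2 ^ (2 * DIM('a))) * wt x)" by (intro integrable_mult_right wt_integrable)
    show "AE x in lborel. (\<lambda>n. D n x) \<longlonglongrightarrow> partial_deriv [b] g x"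
    proof (rule AE_I2)
      fix x
      have "((\<lambda>t. (1 / t) *\<^sub>R (g (x + t *\<^sub>R b) - g x)) \<longlongrightarrow> partial_deriv [b] g x) (at 0)"
      proof (rule LIM_zero_cancel, rule tendsto_norm_zero_cancel)
        have "((\<lambda>t. norm (g (x + t *\<^sub>R b) - g x - t *\<^sub>R partial_deriv [b] g x) / norm t) \<longlongrightarrow> 0) (at 0)"
          using vd[of x 0] by (simp add: has_vector_derivative_def has_derivative_at)
        moreover have "\<forall>\<^sub>F t in at 0. norm (g (x + t *\<^sub>R b) - g x - t *\<^sub>R partial_deriv [b] g x) / norm t =
            norm ((1 / t) *\<^sub>R (g (x + t *\<^sub>R b) - g x) - partial_deriv [b] g x)"
        proof (rule eventually_at_filter[THEN iffD2], rule always_eventually, intro allI impI)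
          fix t :: real assume t: "t \<noteq> 0"
          have "(1 / t) *\<^sub>R (g (x + t *\<^sub>R b) - g x) - partial_deriv [b] g x =
             (1 / t) *\<^sub>R (g (x + t *\<^sub>R b) - g x - t *\<^sub>R partial_deriv [b] g x)"
            using t by (simp add: scaleR_diff_right)
          then show "norm (g (x + t *\<^sub>R b) - g x - t *\<^sub>R partial_deriv [b] g x) / norm t =
            norm ((1 / t) *\<^sub>R (g (x + t *\<^sub>R b) - g x) - partial_deriv [b] g x)"
            by (simp only: norm_scaleR) simp
        qed
        ultimately show "((\<lambda>t. norm ((1 / t) *\<^sub>R (g (x + t *\<^sub>R b) - g x) - partial_deriv [b] g x)) \<longlongrightarrow> 0) (at 0)"
          by (rule Lim_transform_eventually)
      qed
      then show "(\<lambda>n. D n x) \<longlonglongrightarrow> partial_deriv [b] g x"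
        unfolding D_def using hlim h by (auto elim!: filterlim_compose intro!: filterlim_atI simp: less_imp_neq[symmetric])
    qed
    show "AE x in lborel. norm (D n x) \<le> (C * 2 ^ (2 * DIM('a))) * wt x" for n
    proof (rule AE_I2)
      fix x
      have "norm (g (x + h n *\<^sub>R b) - g (x + 0 *\<^sub>R b)) \<le> (C * 2 ^ (2 * DIM('a)) * wt x) * norm (h n - 0)"
      proof (rule differentiable_bound[where S="{0..h n}" and f="\<lambda>t. g (x + t *\<^sub>R b)"])
        fix t assume t: "t \<in> {0..h n}"
        show "((\<lambda>t. g (x + t *\<^sub>R b)) has_derivative (\<lambda>s. s *\<^sub>R partial_deriv [b] g (x + t *\<^sub>R b))) (at t within {0..h n})"
          using vd[of x t] has_derivative_at_withinI unfolding has_vector_derivative_def by blast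
        have "norm (t *\<^sub>R b) \<le> 1" using t h[of n] b by auto
        then have "C * wt (x + t *\<^sub>R b) \<le> C * (2 ^ (2 * DIM('a)) * wt x)"
          using C by (intro mult_left_mono wt_shift) auto
        with C(2)[of "x + t *\<^sub>R b"] have "norm (partial_deriv [b] g (x + t *\<^sub>R b)) \<le> C * 2 ^ (2 * DIM('a)) * wt x"
          by simp
        then show "onorm (\<lambda>s. s *\<^sub>R partial_deriv [b] g (x + t *\<^sub>R b)) \<le> C * 2 ^ (2 * DIM('a)) * wt x"
          by (intro onorm_le) (simp add: mult.commute mult_left_mono)
      qed (use h[of n] in auto)
      then show "norm (D n x) \<le> (C * 2 ^ (2 * DIM('a))) * wt x"
        using h[of n] unfolding D_def norm_scaleR by (simp add: divide_le_eq mult_ac)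
    qed
  qed
  moreover have "(LINT x|lborel. D n x) = 0" for n
    unfolding D_def using schwartz_integrable[OF g] integrable_translate[OF schwartz_integrable[OF g]]
    by (simp add: integral_translate)
  ultimately have "(\<lambda>n. 0) \<longlonglongrightarrow> (LINT x|lborel. partial_deriv [b] g x)" by simp
  then show ?thesis using LIMSEQ_unique tendsto_const by blast
qed

lemma norm_fourier_le: "norm (fourier f \<xi>) \<le> (LINT x|lborel. norm (f x))"
proof -
  have "norm (fourier f \<xi>) \<le> (LINT x|lborel. norm (f x * exp (- \<i> * complex_of_real (x \<bullet> \<xi>))))"
    unfolding fourier_def by (rule integral_norm_bound)
  then show ?thesis by (simp add: norm_mult)
qed

lemma integrable_fourier_kernel:
  assumes "integrable lborel f"
  shows "integrable lborel (\<lambda>x. f x * exp (- \<i> * complex_of_real (x \<bullet> \<xi>)))"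
    "integrable lborel (\<lambda>x. f x * exp (\<i> * complex_of_real (x \<bullet> \<xi>)))"
proof -
  have [measurable]: "f \<in> borel_measurable borel" using assms by auto
  show "integrable lborel (\<lambda>x. f x * exp (- \<i> * complex_of_real (x \<bullet> \<xi>)))"
    "integrable lborel (\<lambda>x. f x * exp (\<i> * complex_of_real (x \<bullet> \<xi>)))"
    by (rule Bochner_Integration.integrable_bound[OF assms]; (measurable; simp add: norm_mult))+
qed

lemma fourier_add:
  "integrable lborel f \<Longrightarrow> integrable lborel g \<Longrightarrow> fourier (\<lambda>x. f x + g x) = (\<lambda>\<xi>. fourier f \<xi> + fourier g \<xi>)"
  unfolding fourier_def using integrable_fourier_kernel(1)[of f] integrable_fourier_kernel(1)[of g]
  by (simp add: distrib_right)

lemma fourier_diff: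
  "integrable lborel f \<Longrightarrow> integrable lborel g \<Longrightarrow> fourier (\<lambda>x. f x - g x) = (\<lambda>\<xi>. fourier f \<xi> - fourier g \<xi>)"
  unfolding fourier_def using integrable_fourier_kernel(1)[of f] integrable_fourier_kernel(1)[of g]
  by (simp add: left_diff_distrib)

lemma fourier_cmult: "fourier (\<lambda>x. c * f x) = (\<lambda>\<xi>. c * fourier f \<xi>)"
  unfolding fourier_def by (simp add: mult.assoc)

lemma fourier_sum:
  assumes "\<And>i. i \<in> I \<Longrightarrow> integrable lborel (f i)"
  shows "fourier (\<lambda>x. \<Sum>i\<in>I. f i x) = (\<lambda>\<xi>. \<Sum>i\<in>I. fourier (f i) \<xi>)"
  unfolding fourier_def sum_distrib_right using integrable_fourier_kernel(1)[OF assms]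
  by (subst Bochner_Integration.integral_sum) auto

lemma inverse_fourier_eq: "inverse_fourier f x = fourier f (- x) / (2 * complex_of_real pi) ^ DIM('a)"
  for f :: "'a::euclidean_space \<Rightarrow> complex"
  by (simp add: fourier_def inverse_fourier_def inner_commute)

lemma fourier_reflect: "fourier (\<lambda>x. f (- x)) \<xi> = fourier f (- \<xi>)"
  unfolding fourier_def
  using integral_reflect[of "\<lambda>x. f x * exp (- \<i> * complex_of_real (x \<bullet> - \<xi>))" 0] by simp

lemma fourier_partial_deriv:
  assumes \<phi>: "schwartz \<phi>" and b: "b \<in> Basis"
  shows "fourier (partial_deriv [b] \<phi>) \<xi> = \<i> * complex_of_real (\<xi> \<bullet> b) * fourier \<phi> \<xi>"
proof -
  let ?e = "\<lambda>x. exp (\<i> * complex_of_real (x \<bullet> (- \<xi>)))"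
  have e: "temperate ?e" by (rule temperate_exp_inner)
  have der: "(?e has_derivative (\<lambda>h. (\<i> * complex_of_real (h \<bullet> (- \<xi>))) * ?e x)) (at x)" for x
    by (rule has_derivative_eq_rhs[OF has_derivative_compose[where f="\<lambda>x. \<i> * complex_of_real (x \<bullet> (- \<xi>))",
              OF _ DERIV_exp[unfolded has_field_derivative_def]]])
       (auto intro!: derivative_eq_intros simp: fun_eq_iff)
  have sb: "schwartz (partial_deriv [b] \<phi>)" using schwartz_partial_deriv[OF \<phi>, of "[b]"] b by simp
  have "partial_deriv [b] (\<lambda>x. ?e x * \<phi> x) = (\<lambda>x. partial_deriv [b] ?e x * \<phi> x + ?e x * partial_deriv [b] \<phi> x)"
    by (intro partial_deriv_mult temperate_differentiable[OF e] schwartz_differentiable[OF \<phi>])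
  also have "\<dots> = (\<lambda>x. partial_deriv [b] \<phi> x * ?e x - (\<i> * complex_of_real (\<xi> \<bullet> b)) * (\<phi> x * ?e x))"
    by (subst partial_deriv_eq[OF der]) (auto simp: fun_eq_iff inner_commute mult_ac)
  finally have eq: "partial_deriv [b] (\<lambda>x. ?e x * \<phi> x) = \<dots>" .
  have "0 = (LINT x|lborel. partial_deriv [b] (\<lambda>x. ?e x * \<phi> x) x)"
    by (rule integral_partial_deriv_zero[symmetric, OF schwartz_mult[OF e \<phi>] b])
  also have "\<dots> = fourier (partial_deriv [b] \<phi>) \<xi> - \<i> * complex_of_real (\<xi> \<bullet> b) * fourier \<phi> \<xi>"
    unfolding eq fourier_def
    using integrable_fourier_kernel(1)[OF schwartz_integrable[OF \<phi>], of \<xi>]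
          integrable_fourier_kernel(1)[OF schwartz_integrable[OF sb], of \<xi>]
    by (subst Bochner_Integration.integral_diff) auto
  finally show ?thesis by simp
qed

text \<open>Differentiation under the integral with an explicit remainder: with a =
  \<open>x \<bullet> h\<close>, the error of the first-order expansion of exp(-ia) is at most a^2.
  What remains is the square of the increment times the second moment of \<open>\<phi>\<close>,
  which is finite for a Schwartz function.\<close>

lemma fourier_has_derivative:
  fixes \<phi> :: "'a::euclidean_space \<Rightarrow> complex"
  assumes \<phi>: "schwartz \<phi>"
  shows "(fourier \<phi> has_derivative (\<lambda>h. fourier (\<lambda>x. - \<i> * complex_of_real (x \<bullet> h) * \<phi> x) \<xi>)) (at \<xi>)"
proof -
  let ?D = "\<lambda>h. fourier (\<lambda>x. - \<i> * complex_of_real (x \<bullet> h) * \<phi> x) \<xi>"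
  have s1: "schwartz (\<lambda>x. complex_of_real (x \<bullet> h) * \<phi> x)" for h :: 'a
    by (intro schwartz_mult temperate_inner \<phi>)
  have s: "schwartz (\<lambda>x. - \<i> * complex_of_real (x \<bullet> h) * \<phi> x)" for h :: 'a
    using schwartz_cmult[OF s1, of "-\<i>" h] by (simp add: mult.assoc)
  have int: "integrable lborel (\<lambda>x. - \<i> * complex_of_real (x \<bullet> h) * \<phi> x)" for h :: 'a
    by (rule schwartz_integrable[OF s])
  have sn: "schwartz (\<lambda>x. complex_of_real (x \<bullet> x) * \<phi> x)"
  proof (rule schwartz_mult[OF _ \<phi>])
    have "temperate (\<lambda>x::'a. \<Sum>b\<in>Basis. complex_of_real (x \<bullet> b) * complex_of_real (x \<bullet> b))"
      by (intro temperate_sum temperate_mult temperate_inner)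
    then show "temperate (\<lambda>x::'a. complex_of_real (x \<bullet> x))"
      by (subst euclidean_inner) (simp add: power2_eq_square)
  qed
  define C where "C = (LINT x|lborel. norm (complex_of_real (x \<bullet> x) * \<phi> x))"
  have Cint: "integrable lborel (\<lambda>x. norm (complex_of_real (x \<bullet> x) * \<phi> x))"
    by (rule integrable_norm[OF schwartz_integrable[OF sn]])
  show ?thesis
  proof (rule has_derivativeI_sandwich[where e=1 and H="\<lambda>y. C * norm (y - \<xi>)"])
    show "bounded_linear ?D"
    proof (rule bounded_linear_intro)
      show "?D (x + y) = ?D x + ?D y" for x y
        using fourier_add[OF int[of x] int[of y]] by (simp add: inner_add_right algebra_simps fun_eq_iff)
      show "?D (r *\<^sub>R x) = r *\<^sub>R ?D x" for r x
        using fourier_cmult[of "complex_of_real r" "\<lambda>y. - \<i> * complex_of_real (y \<bullet> x) * \<phi> y"]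
        by (simp add: scaleR_conv_of_real mult_ac fun_eq_iff)
      have sx: "integrable lborel (\<lambda>x. norm x * norm (\<phi> x))"
      proof -
        obtain D where D: "D \<ge> 0" "\<And>x. (1 + norm x) ^ (2 * DIM('a) + 1) * norm (\<phi> x) \<le> D"
          using schwartz_bound[OF \<phi>, of "2 * DIM('a) + 1"] by (metis (no_types, opaque_lifting) abs_ge_self abs_ge_zero order_trans)
        have "norm (norm x * norm (\<phi> x)) \<le> D * wt x" for x
        proof (rule norm_le_wtI)
          have "(1 + norm x) ^ (2 * DIM('a)) * norm (norm x * norm (\<phi> x)) \<le> (1 + norm x) ^ (2 * DIM('a)) * ((1 + norm x) * norm (\<phi> x))"
            by (intro mult_left_mono) (auto intro: mult_right_mono)
          also have "\<dots> \<le> D" using D(2)[of x] by (simp add: mult_ac)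
          finally show "(1 + norm x) ^ (2 * DIM('a)) * norm (norm x * norm (\<phi> x)) \<le> D" .
        qed
        moreover have [measurable]: "\<phi> \<in> borel_measurable borel" by (rule schwartz_measurable[OF \<phi>])
        ultimately show ?thesis
          by (intro integrable_wt_bound[where C=D]) auto
      qed
      show "norm (?D h) \<le> norm h * (LINT x|lborel. norm x * norm (\<phi> x))" for h
      proof -
        have "norm (?D h) \<le> (LINT x|lborel. norm (- \<i> * complex_of_real (x \<bullet> h) * \<phi> x))"
          by (rule norm_fourier_le)
        also have "\<dots> \<le> (LINT x|lborel. norm h * (norm x * norm (\<phi> x)))"
        proof (intro integral_mono integrable_mult_right sx)
          show "integrable lborel (\<lambda>x. norm (- \<i> * complex_of_real (x \<bullet> h) * \<phi> x))"
            by (rule integrable_norm[OF int])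
          show "norm (- \<i> * complex_of_real (x \<bullet> h) * \<phi> x) \<le> norm h * (norm x * norm (\<phi> x))" for x
            using mult_right_mono[OF Cauchy_Schwarz_ineq2[of x h] norm_ge_zero[of "\<phi> x"]]
            by (simp add: norm_mult mult_ac)
        qed
        finally show ?thesis by simp
      qed
    qed
    fix y :: 'a assume y: "y \<noteq> \<xi>"
    define h where "h = y - \<xi>"
    have bd: "norm (exp (- \<i> * complex_of_real a) - 1 + \<i> * complex_of_real a) \<le> a\<^sup>2" for a
    proof -
      have "norm (exp (- \<i> * complex_of_real a) - 1 + \<i> * complex_of_real a) \<le> a\<^sup>2 / 2"
        using iexp_approx1[of "-a" 1] by (simp add: power2_eq_square diff_diff_eq2 algebra_simps)
      then show ?thesis using zero_le_power2[of a] by linarith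
    qed
    let ?G = "\<lambda>x. \<phi> x * exp (- \<i> * complex_of_real (x \<bullet> \<xi>)) * (exp (- \<i> * complex_of_real (x \<bullet> h)) - 1 + \<i> * complex_of_real (x \<bullet> h))"
    have eq: "fourier \<phi> y - fourier \<phi> \<xi> - ?D h = (LINT x|lborel. ?G x)"
    proof -
      have "fourier \<phi> y - fourier \<phi> \<xi> - ?D h =
       (LINT x|lborel. \<phi> x * exp (- \<i> * complex_of_real (x \<bullet> y)) - \<phi> x * exp (- \<i> * complex_of_real (x \<bullet> \<xi>))
           - (- \<i> * complex_of_real (x \<bullet> h) * \<phi> x) * exp (- \<i> * complex_of_real (x \<bullet> \<xi>)))"
        unfolding fourier_def
        using integrable_fourier_kernel(1)[OF schwartz_integrable[OF \<phi>]] integrable_fourier_kernel(1)[OF int[of h]]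
        by (simp add: Bochner_Integration.integral_diff)
      also have "\<dots> = (LINT x|lborel. ?G x)"
        unfolding h_def by (intro Bochner_Integration.integral_cong refl) (simp add: inner_diff_right algebra_simps exp_add[symmetric] mult_exp_exp)
      finally show ?thesis .
    qed
    have "norm (fourier \<phi> y - fourier \<phi> \<xi> - ?D h) \<le> (LINT x|lborel. norm (?G x))"
      unfolding eq by (rule integral_norm_bound)
    also have "\<dots> \<le> (LINT x|lborel. (norm h)\<^sup>2 * norm (complex_of_real (x \<bullet> x) * \<phi> x))"
    proof (rule integral_mono_AE')
      show "integrable lborel (\<lambda>x. (norm h)\<^sup>2 * norm (complex_of_real (x \<bullet> x) * \<phi> x))"
        using Cint by simp
      show "AE x in lborel. norm (?G x) \<le> (norm h)\<^sup>2 * norm (complex_of_real (x \<bullet> x) * \<phi> x)"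
      proof (rule AE_I2)
        fix x
        have "norm (?G x) \<le> norm (\<phi> x) * (x \<bullet> h)\<^sup>2"
          unfolding norm_mult using bd[of "x \<bullet> h"] by (simp add: mult_left_mono)
        also have "\<dots> \<le> norm (\<phi> x) * ((x \<bullet> x) * (norm h)\<^sup>2)"
          using Cauchy_Schwarz_ineq[of x h] by (intro mult_left_mono) (simp_all add: power2_norm_eq_inner)
        finally show "norm (?G x) \<le> (norm h)\<^sup>2 * norm (complex_of_real (x \<bullet> x) * \<phi> x)"
          by (simp add: norm_mult mult_ac)
      qed
    qed auto
    also have "\<dots> = C * (norm h)\<^sup>2" by (simp add: C_def)
    finally show "norm (fourier \<phi> y - fourier \<phi> \<xi> - ?D (y - \<xi>)) / norm (y - \<xi>) \<le> C * norm (y - \<xi>)"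
      using y by (simp add: h_def divide_le_eq power2_eq_square)
  next
    show "((\<lambda>y. C * norm (y - \<xi>)) \<longlongrightarrow> 0) (at \<xi>)"
      by (auto intro!: tendsto_eq_intros)
  qed auto
qed

lemma partial_deriv_fourier:
  assumes "schwartz \<phi>"
  shows "partial_deriv [b] (fourier \<phi>) = fourier (\<lambda>x. (- \<i> * complex_of_real (x \<bullet> b)) * \<phi> x)"
  using partial_deriv_eq[OF fourier_has_derivative[OF assms], of b] by simp

lemma temperate_norm_square: "temperate (\<lambda>x::'a::euclidean_space. complex_of_real (x \<bullet> x))"
proof -
  have "temperate (\<lambda>x::'a. \<Sum>b\<in>Basis. complex_of_real (x \<bullet> b) * complex_of_real (x \<bullet> b))"
    by (intro temperate_sum temperate_mult temperate_inner)
  then show ?thesis by (subst euclidean_inner) (simp add: power2_eq_square)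
qed

definition Lap :: "('a::euclidean_space \<Rightarrow> complex) \<Rightarrow> 'a \<Rightarrow> complex" where
  "Lap \<phi> x = (\<Sum>b\<in>Basis. partial_deriv [b, b] \<phi> x)"

lemma scont_Lap: "scont A \<Longrightarrow> scont (\<lambda>\<phi>. Lap (A \<phi>))"
  unfolding Lap_def by (intro scont_sum scont_partial_deriv_comp) auto

lemma fourier_Lap:
  assumes \<phi>: "schwartz \<phi>"
  shows "fourier (Lap \<phi>) \<xi> = - complex_of_real (\<xi> \<bullet> \<xi>) * fourier \<phi> \<xi>"
proof -
  have "fourier (partial_deriv [b,b] \<phi>) \<xi> = - (complex_of_real (\<xi> \<bullet> b))\<^sup>2 * fourier \<phi> \<xi>" if "b \<in> Basis" for b
    using that fourier_partial_deriv[OF \<phi>] fourier_partial_deriv[OF schwartz_partial_deriv[OF \<phi>, of "[b]"]]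
    by (subst partial_deriv_Cons) (simp add: power2_eq_square algebra_simps)
  moreover have "fourier (Lap \<phi>) = (\<lambda>\<xi>. \<Sum>b\<in>Basis. fourier (partial_deriv [b,b] \<phi>) \<xi>)"
    unfolding Lap_def[abs_def] by (rule fourier_sum) (auto intro!: schwartz_integrable schwartz_partial_deriv \<phi>)
  ultimately show ?thesis
    by (subst euclidean_inner) (simp add: sum_distrib_right sum_negf power2_eq_square)
qed

text \<open>The operator 1 - Laplacian. Its symbol 1 + |xi|^2 controls the weight 1 + |xi| from
  above, so an L^1 bound on powers of \<open>Bop\<close> applied to a function gives polynomial
  decay of its Fourier transform.\<close>

definition Bop :: "('a::euclidean_space \<Rightarrow> complex) \<Rightarrow> 'a \<Rightarrow> complex" where
  "Bop \<phi> x = \<phi> x - Lap \<phi> x"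

lemma scont_Bop: "scont A \<Longrightarrow> scont (\<lambda>\<phi>. Bop (A \<phi>))"
  unfolding Bop_def by (intro scont_diff scont_Lap)

lemma fourier_Bop:
  assumes \<phi>: "schwartz \<phi>"
  shows "fourier (Bop \<phi>) \<xi> = complex_of_real (1 + \<xi> \<bullet> \<xi>) * fourier \<phi> \<xi>"
  unfolding Bop_def[abs_def]
  using fourier_diff[OF schwartz_integrable[OF \<phi>] schwartz_integrable[OF scont_schwartz[OF scont_Lap[OF scont_id] \<phi>]]]
  by (simp add: fourier_Lap[OF \<phi>] algebra_simps)

lemma scont_Bop_power: "scont A \<Longrightarrow> scont (\<lambda>\<phi>. (Bop ^^ k) (A \<phi>))"
  by (induction k) (auto intro: scont_Bop)

lemma fourier_Bop_power:
  assumes \<phi>: "schwartz \<phi>"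
  shows "fourier ((Bop ^^ k) \<phi>) \<xi> = complex_of_real ((1 + \<xi> \<bullet> \<xi>) ^ k) * fourier \<phi> \<xi>"
proof (induction k)
  case (Suc k)
  have "schwartz ((Bop ^^ k) \<phi>)" using scont_schwartz[OF scont_Bop_power[OF scont_id] \<phi>] .
  then show ?case using Suc fourier_Bop[of "(Bop ^^ k) \<phi>"] by (simp add: mult.assoc)
qed simp

lemma scont_integral_bound:
  fixes A :: "('a::euclidean_space \<Rightarrow> complex) \<Rightarrow> 'a \<Rightarrow> complex"
  assumes A: "scont A"
  shows "\<exists>C N. \<forall>\<phi>. schwartz \<phi> \<longrightarrow> (LINT x|lborel. norm (A \<phi> x)) \<le> C * pnorm N \<phi>"
proof -
  obtain C N where CN: "\<And>\<phi> x. schwartz \<phi> \<Longrightarrow> (1 + norm x) ^ (2 * DIM('a)) * norm (A \<phi> x) \<le> C * pnorm N \<phi>"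
    using scont_bound[OF A] by metis
  have "(LINT x|lborel. norm (A \<phi> x)) \<le> (C * (LINT x|lborel. wt (x::'a))) * pnorm N \<phi>" if \<phi>: "schwartz \<phi>" for \<phi>
  proof -
    have "(LINT x|lborel. norm (A \<phi> x)) \<le> (LINT x|lborel. (C * pnorm N \<phi>) * wt (x::'a))"
      using schwartz_integrable[OF scont_schwartz[OF A \<phi>]] wt_integrable CN[OF \<phi>]
      by (intro integral_mono integrable_norm integrable_mult_right norm_le_wtI) auto
    then show ?thesis by (simp add: mult_ac)
  qed
  then show ?thesis by blast
qed

lemma one_plus_norm_square_le: "(1 + norm x)\<^sup>2 \<le> 2 * (1 + x \<bullet> x)"
proof -
  have "0 \<le> (1 - norm x)\<^sup>2" by simp
  then show ?thesis unfolding power2_norm_eq_inner[symmetric] by (simp add: power2_eq_square algebra_simps)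
qed

text \<open>The class of operators of the form Fourier transform after a continuous operator is
  closed under derivatives, since differentiating the transform multiplies the argument by a
  coordinate. Decay of order \<open>k\<close> is bought by \<open>k\<close> applications of
  \<open>Bop\<close> before transforming.\<close>

lemma scont_fourier:
  assumes A: "scont A"
  shows "scont (\<lambda>\<phi>. fourier (A \<phi>))"
proof (rule scont_coinduct[where X="\<lambda>T. \<exists>A. scont A \<and> (\<forall>\<phi>. schwartz \<phi> \<longrightarrow> T \<phi> = fourier (A \<phi>))"])
  fix T :: "('a \<Rightarrow> complex) \<Rightarrow> 'a \<Rightarrow> complex"
  assume "\<exists>A. scont A \<and> (\<forall>\<phi>. schwartz \<phi> \<longrightarrow> T \<phi> = fourier (A \<phi>))"
  then obtain A where A: "scont A" and T: "\<And>\<phi>. schwartz \<phi> \<Longrightarrow> T \<phi> = fourier (A \<phi>)" by auto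
  show "T \<phi> differentiable at x" if "schwartz \<phi>" for \<phi> x
    unfolding T[OF that] differentiable_def
    using fourier_has_derivative[OF scont_schwartz[OF A that]] by blast
  have m: "temperate (\<lambda>x. - \<i> * complex_of_real (x \<bullet> b))" for b :: 'a
    by (intro temperate_mult temperate_inner) simp
  show "\<exists>A. scont A \<and> (\<forall>\<phi>. schwartz \<phi> \<longrightarrow> partial_deriv [b] (T \<phi>) = fourier (A \<phi>))" for b
  proof (intro exI[of _ "\<lambda>\<phi> x. (- \<i> * complex_of_real (x \<bullet> b)) * A \<phi> x"] conjI allI impI)
    show "scont (\<lambda>\<phi> x. (- \<i> * complex_of_real (x \<bullet> b)) * A \<phi> x)" by (rule scont_mult[OF m A])
  qed (simp only: T partial_deriv_fourier[OF scont_schwartz[OF A]])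
  show "\<exists>C N. \<forall>\<phi>. schwartz \<phi> \<longrightarrow> (\<forall>x. (1 + norm x) ^ k * norm (T \<phi> x) \<le> C * pnorm N \<phi>)" for k
  proof -
    obtain C N where CN: "\<And>\<phi>. schwartz \<phi> \<Longrightarrow> (LINT x|lborel. norm ((Bop ^^ k) (A \<phi>) x)) \<le> C * pnorm N \<phi>"
      using scont_integral_bound[OF scont_Bop_power[OF A]] by blast
    have "(1 + norm x) ^ k * norm (T \<phi> x) \<le> (2 ^ k * C) * pnorm N \<phi>" if \<phi>: "schwartz \<phi>" for \<phi> x
    proof -
      have "(1 + norm x) ^ k \<le> ((1 + norm x)\<^sup>2) ^ k"
        unfolding power_mult[symmetric] by (rule power_increasing) auto
      also have "\<dots> \<le> (2 * (1 + x \<bullet> x)) ^ k" by (intro power_mono one_plus_norm_square_le) auto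
      finally have "(1 + norm x) ^ k * norm (T \<phi> x) \<le> (2 * (1 + x \<bullet> x)) ^ k * norm (fourier (A \<phi>) x)"
        unfolding T[OF \<phi>] by (intro mult_right_mono) auto
      also have "\<dots> = 2 ^ k * norm (fourier ((Bop ^^ k) (A \<phi>)) x)"
        unfolding fourier_Bop_power[OF scont_schwartz[OF A \<phi>]] norm_mult norm_of_real
        by (simp add: power_mult_distrib del: distrib_left_numeral)
      also have "\<dots> \<le> 2 ^ k * (C * pnorm N \<phi>)"
        using norm_fourier_le CN[OF \<phi>] by (intro mult_left_mono) (auto intro: order_trans)
      finally show ?thesis by simp
    qed
    then show ?thesis by blast
  qed
qed (use A in auto)

lemma scont_inverse_fourier:
  assumes "scont A"
  shows "scont (\<lambda>\<phi>. inverse_fourier (A \<phi>))"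
proof -
  have "inverse_fourier (A \<phi>) = (\<lambda>x. (1 / (2 * complex_of_real pi) ^ DIM('a)) * fourier (A \<phi>) ((-1) *\<^sub>R x + 0))" for \<phi>
    by (auto simp: inverse_fourier_eq)
  then show ?thesis
    using scont_mult[OF temperate_const scont_affine[OF scont_fourier[OF assms], of "-1" 0],
        of "1 / (2 * complex_of_real pi) ^ DIM('a)"] by simp
qed

lemma schwartz_fourier: "schwartz \<phi> \<Longrightarrow> schwartz (fourier \<phi>)"
  using scont_schwartz[OF scont_fourier[OF scont_id]] .

lemma schwartz_inverse_fourier: "schwartz \<phi> \<Longrightarrow> schwartz (inverse_fourier \<phi>)"
  using scont_schwartz[OF scont_inverse_fourier[OF scont_id]] .

section \<open>Gaussians and Fourier inversion\<close>

text \<open>Comes from (1 + z/k)^k \<le> exp z. The explicit constant serves three times: for the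
  decay of Gaussians, for the flatness of \<open>eta\<close>, and for the smallness of the heat
  kernel at short times.\<close>

lemma power_le_exp:
  assumes "0 \<le> (z::real)"
  shows "z ^ k \<le> real k ^ k * exp z"
proof (cases "k = 0")
  case False
  have "(z / real k) ^ k \<le> (1 + z / real k) ^ k"
    using assms by (intro power_mono) auto
  also have "\<dots> \<le> exp z"
    using False assms by (intro exp_ge_one_plus_x_over_n_power_n) auto
  finally show ?thesis using False by (simp add: power_divide field_simps)
qed (use assms in simp)

lemma weight_gauss_bound:
  assumes "0 < t"
  shows "\<exists>D. \<forall>x::'a::euclidean_space. (1 + norm x) ^ k * exp (- t * (x \<bullet> x)) \<le> D"
proof (intro exI allI)
  fix x :: 'a
  have "(1 + norm x) ^ k \<le> ((1 + norm x)\<^sup>2) ^ k"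
    unfolding power_mult[symmetric] by (rule power_increasing) auto
  also have "\<dots> \<le> (2 * (1 + x \<bullet> x)) ^ k" by (intro power_mono one_plus_norm_square_le) auto
  also have "\<dots> = (2 / t) ^ k * (t * (1 + x \<bullet> x)) ^ k"
    using assms by (simp add: power_mult_distrib[symmetric] field_simps)
  also have "\<dots> \<le> (2 / t) ^ k * (real k ^ k * exp (t * (1 + x \<bullet> x)))"
    using assms by (intro mult_left_mono power_le_exp mult_nonneg_nonneg add_nonneg_nonneg) auto
  finally have "(1 + norm x) ^ k * exp (- t * (x \<bullet> x)) \<le>
     ((2 / t) ^ k * (real k ^ k * exp (t * (1 + x \<bullet> x)))) * exp (- t * (x \<bullet> x))"
    by (rule mult_right_mono) simp
  also have "\<dots> = (2 / t) ^ k * real k ^ k * exp t"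
    by (simp add: exp_add[symmetric] algebra_simps mult_exp_exp)
  finally show "(1 + norm x) ^ k * exp (- t * (x \<bullet> x)) \<le> (2 / t) ^ k * real k ^ k * exp t" .
qed

definition gauss :: "real \<Rightarrow> 'a::euclidean_space \<Rightarrow> complex" where
  "gauss t x = complex_of_real (exp (- t * (x \<bullet> x)))"

lemma gauss_has_derivative:
  "(gauss t has_derivative (\<lambda>h. complex_of_real (- 2 * t * (x \<bullet> h)) * gauss t x)) (at x)"
proof -
  have "((\<lambda>x. exp (- t * (x \<bullet> x))) has_derivative (\<lambda>h. (- 2 * t * (x \<bullet> h)) * exp (- t * (x \<bullet> x)))) (at x)"
    by (auto intro!: derivative_eq_intros simp: fun_eq_iff inner_commute)
  from has_derivative_of_real[OF this] show ?thesis
    by (simp add: gauss_def[abs_def])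
qed

lemma partial_deriv_gauss:
  "partial_deriv [b] (gauss t) = (\<lambda>x. complex_of_real (- 2 * t) * (complex_of_real (x \<bullet> b) * gauss t x))"
  by (subst partial_deriv_eq[OF gauss_has_derivative]) (simp add: mult.assoc)

lemma schwartz_gauss:
  assumes t: "0 < t"
  shows "schwartz (gauss t)"
proof (rule schwartz_coinduct[where X="\<lambda>f. \<exists>m. temperate m \<and> f = (\<lambda>x. m x * gauss t x)"])
  show "\<exists>m. temperate m \<and> gauss t = (\<lambda>x. m x * gauss t x)"
    by (rule exI[of _ "\<lambda>x. 1"]) auto
  fix f :: "'a \<Rightarrow> complex"
  assume "\<exists>m. temperate m \<and> f = (\<lambda>x. m x * gauss t x)"
  then obtain m where m: "temperate m" "f = (\<lambda>x. m x * gauss t x)" by auto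
  have dg: "gauss t differentiable at x" for x :: 'a
    using gauss_has_derivative differentiable_def by blast
  show "f differentiable at x" for x
    unfolding m(2) using temperate_differentiable[OF m(1)] dg by auto
  show "\<exists>n. temperate n \<and> partial_deriv [b] f = (\<lambda>x. n x * gauss t x)" if "b \<in> Basis" for b
  proof (intro exI conjI)
    show "temperate (\<lambda>x. partial_deriv [b] m x + m x * (complex_of_real (- 2 * t) * complex_of_real (x \<bullet> b)))"
      using that by (intro temperate_add temperate_mult temperate_inner temperate_const m temperate_partial_deriv) auto
    show "partial_deriv [b] f = (\<lambda>x. (partial_deriv [b] m x + m x * (complex_of_real (- 2 * t) * complex_of_real (x \<bullet> b))) * gauss t x)"
      unfolding m(2) by (subst partial_deriv_mult[OF temperate_differentiable[OF m(1)] dg])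
        (simp add: partial_deriv_gauss algebra_simps)
  qed
  show "\<exists>C. \<forall>x. (1 + norm x) ^ k * norm (f x) \<le> C" for k
  proof -
    obtain C l where Cl: "\<And>x. norm (m x) \<le> C * (1 + norm x) ^ l"
      using temperate_bound[OF m(1)] by blast
    have C: "C \<ge> 0" using order_trans[OF norm_ge_zero Cl[of 0]] by simp
    obtain D where D: "\<And>x::'a. (1 + norm x) ^ (k + l) * exp (- t * (x \<bullet> x)) \<le> D"
      using weight_gauss_bound[OF t] by metis
    have "(1 + norm x) ^ k * norm (f x) \<le> C * D" for x
    proof -
      have "(1 + norm x) ^ k * norm (f x) \<le> (1 + norm x) ^ k * ((C * (1 + norm x) ^ l) * exp (- t * (x \<bullet> x)))"
        unfolding m(2) norm_mult using Cl by (intro mult_left_mono mult_mono) (auto simp: gauss_def C)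
      also have "\<dots> = C * ((1 + norm x) ^ (k + l) * exp (- t * (x \<bullet> x)))" by (simp add: power_add mult_ac)
      also have "\<dots> \<le> C * D" by (intro mult_left_mono D C)
      finally show ?thesis .
    qed
    then show ?thesis by blast
  qed
qed

lemma nn_integral_gauss_real:
  assumes t: "0 < t"
  shows "(\<integral>\<^sup>+x. ennreal (exp (- t * x\<^sup>2)) \<partial>lborel) = ennreal (sqrt (pi / t))"
proof -
  \<comment> \<open>The standard deviation for which the Gaussian is a multiple of the normal
    density.\<close>
  define \<sigma> where "\<sigma> = sqrt (1 / (2 * t))"
  have s: "\<sigma>\<^sup>2 = 1 / (2 * t)" using t by (simp add: \<sigma>_def)
  have eq: "exp (- t * x\<^sup>2) = sqrt (pi / t) * normal_density 0 \<sigma> x" for x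
    using t unfolding normal_density_def s by (simp add: real_sqrt_divide)
  have "\<sigma> > 0" using t by (simp add: \<sigma>_def)
  then have "(\<integral>\<^sup>+x. ennreal (normal_density 0 \<sigma> x) \<partial>lborel) = 1"
    by (subst nn_integral_eq_integral) auto
  then show ?thesis
    unfolding eq using t by (simp add: ennreal_mult nn_integral_cmult)
qed

lemma nn_integral_gauss:
  assumes t: "0 < t"
  shows "(\<integral>\<^sup>+x. ennreal (exp (- t * (x \<bullet> x))) \<partial>(lborel::'a::euclidean_space measure)) = ennreal (sqrt (pi / t) ^ DIM('a))"
proof -
  have "(\<integral>\<^sup>+x. ennreal (exp (- t * (x \<bullet> x))) \<partial>(lborel::'a measure)) =
     (\<integral>\<^sup>+x. (\<Prod>b\<in>Basis. ennreal (exp (- t * (x \<bullet> b)\<^sup>2))) \<partial>(lborel::'a measure))"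
  proof (intro nn_integral_cong)
    fix x :: 'a
    have "exp (- t * (x \<bullet> x)) = (\<Prod>b\<in>Basis. exp (- t * (x \<bullet> b)\<^sup>2))"
      by (subst euclidean_inner) (simp add: exp_sum[symmetric] sum_distrib_left sum_negf power2_eq_square)
    then show "ennreal (exp (- t * (x \<bullet> x))) = (\<Prod>b\<in>Basis. ennreal (exp (- t * (x \<bullet> b)\<^sup>2)))"
      by (simp add: prod_ennreal)
  qed
  also have "\<dots> = (\<Prod>b\<in>(Basis::'a set). \<integral>\<^sup>+s. ennreal (exp (- t * s\<^sup>2)) \<partial>lborel)"
    by (rule nn_integral_lborel_prod) auto
  also have "\<dots> = ennreal (sqrt (pi / t) ^ DIM('a))"
    unfolding nn_integral_gauss_real[OF t] using t by (simp add: ennreal_power)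
  finally show ?thesis .
qed

lemma integrable_gauss_real:
  assumes "0 < t"
  shows "integrable lborel (\<lambda>x::'a::euclidean_space. exp (- t * (x \<bullet> x)))"
    "(LINT x|lborel. exp (- t * (x \<bullet> (x::'a)))) = sqrt (pi / t) ^ DIM('a)"
proof -
  show i: "integrable lborel (\<lambda>x::'a. exp (- t * (x \<bullet> x)))"
  proof (rule integrableI_nonneg)
    show "(\<integral>\<^sup>+x. ennreal (exp (- t * (x \<bullet> (x::'a)))) \<partial>lborel) < \<infinity>"
      unfolding nn_integral_gauss[OF assms] by simp
  qed auto
  show "(LINT x|lborel. exp (- t * (x \<bullet> (x::'a)))) = sqrt (pi / t) ^ DIM('a)"
    by (rule integral_eq_nn_integral[THEN trans]) (use assms in \<open>auto simp: nn_integral_gauss[OF assms, simplified]\<close>)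
qed

text \<open>Transforming the derivative of the Gaussian in two ways gives a first-order differential
  equation for the transform, which the expected Gaussian also satisfies. The two are therefore
  proportional, and the factor is the total mass, read off at 0.\<close>

lemma fourier_gauss:
  assumes t: "0 < t"
  shows "fourier (gauss t) (\<xi>::'a::euclidean_space) =
    complex_of_real (sqrt (pi / t) ^ DIM('a)) * gauss (1 / (4 * t)) \<xi>"
proof -
  let ?F = "fourier (gauss t :: 'a \<Rightarrow> complex)" and ?E = "gauss (- (1 / (4 * t))) :: 'a \<Rightarrow> complex"
  have sg: "schwartz (gauss t :: 'a \<Rightarrow> complex)" by (rule schwartz_gauss[OF t])
  let ?D = "\<lambda>\<xi> h. fourier (\<lambda>x. - \<i> * complex_of_real (x \<bullet> h) * gauss t x) \<xi>"
  have D: "?D \<xi> b = - complex_of_real (\<xi> \<bullet> b / (2 * t)) * ?F \<xi>" if b: "b \<in> Basis" for b \<xi> :: 'a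
  proof -
    have "fourier (partial_deriv [b] (gauss t)) \<xi> = complex_of_real (- 2 * t) * fourier (\<lambda>x. complex_of_real (x \<bullet> b) * gauss t x) \<xi>"
      unfolding partial_deriv_gauss fourier_cmult ..
    moreover have "?D \<xi> b = - \<i> * fourier (\<lambda>x. complex_of_real (x \<bullet> b) * gauss t x) \<xi>"
      unfolding mult.assoc fourier_cmult ..
    moreover have "fourier (\<lambda>x. complex_of_real (x \<bullet> b) * gauss t x) \<xi> = - (\<i> * complex_of_real (\<xi> \<bullet> b) * ?F \<xi>) / complex_of_real (2 * t)"
      using calculation(1) fourier_partial_deriv[OF sg b, of \<xi>] t by (simp add: field_simps)
    ultimately show ?thesis by (simp add: mult.assoc[symmetric])
  qed
  \<comment> \<open>The quotient of the transform by the expected Gaussian: \<open>?E\<close> has a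
    negative parameter and is the reciprocal of that Gaussian. It suffices that \<open>q\<close> is
    constant.\<close>
  define q where "q \<xi> = ?F \<xi> * ?E \<xi>" for \<xi>
  have "(q has_derivative (\<lambda>h. 0)) (at \<xi>)" for \<xi>
  proof -
    let ?Q = "\<lambda>h. ?F \<xi> * (complex_of_real (- 2 * (- (1 / (4 * t))) * (\<xi> \<bullet> h)) * ?E \<xi>) + ?D \<xi> h * ?E \<xi>"
    have der: "(q has_derivative ?Q) (at \<xi>)"
      unfolding q_def[abs_def] by (rule has_derivative_mult[OF fourier_has_derivative[OF sg] gauss_has_derivative])
    have "linear ?Q" using has_derivative_linear[OF der] .
    moreover have "?Q b = 0" if "b \<in> Basis" for b
      unfolding D[OF that] using t by (simp add: field_simps)
    ultimately have "?Q = (\<lambda>h. 0)"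
      by (intro linear_eq_stdbasis) (auto intro: linear_zero simp: module_hom_zero)
    with der show ?thesis by simp
  qed
  then have q: "q \<xi> = q 0" for \<xi>
    by (intro has_derivative_zero_unique[of UNIV q \<xi> 0]) (auto intro: has_derivative_at_withinI)
  have "?F 0 = complex_of_real (LINT x|lborel. exp (- t * (x \<bullet> (x::'a))))"
    unfolding fourier_def gauss_def by (subst integral_complex_of_real[symmetric]) simp
  then have "q 0 = complex_of_real (sqrt (pi / t) ^ DIM('a))"
    unfolding q_def integrable_gauss_real(2)[OF t] by (simp add: gauss_def)
  moreover have "?F \<xi> = q \<xi> * gauss (1 / (4 * t)) \<xi>"
    unfolding q_def gauss_def by (simp flip: of_real_mult exp_add add: mult.assoc mult_exp_exp)
  ultimately show ?thesis by (simp add: q[of \<xi>])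
qed

section \<open>The heat kernel as an approximate identity\<close>

definition heat :: "real \<Rightarrow> 'a::euclidean_space \<Rightarrow> real" where
  "heat t x = exp (- (x \<bullet> x) / (4 * t)) / sqrt (4 * pi * t) ^ DIM('a)"

lemma heat_nonneg [simp]: "0 < t \<Longrightarrow> 0 \<le> heat t x"
  by (simp add: heat_def)

lemma heat_measurable [measurable]: "heat t \<in> borel_measurable borel"
  unfolding heat_def[abs_def] by measurable

lemma heat_minus: "heat t (- x) = heat t x"
  by (simp add: heat_def)

lemma heat_commute: "heat t (x - y) = heat t (y - x)"
  using heat_minus[of t "x - y"] by simp

lemma heat_integrable:
  assumes t: "0 < t"
  shows "integrable lborel (heat t :: 'a::euclidean_space \<Rightarrow> real)" "(LINT x|lborel. heat t (x::'a)) = 1"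
proof -
  have eq: "heat t = (\<lambda>x::'a. exp (- (1 / (4 * t)) * (x \<bullet> x)) / sqrt (4 * pi * t) ^ DIM('a))"
    by (simp add: heat_def[abs_def])
  have pos: "0 < 1 / (4 * t)" using t by simp
  show "integrable lborel (heat t :: 'a \<Rightarrow> real)"
    unfolding eq by (intro integrable_divide integrable_gauss_real(1) pos)
  have "(LINT x|lborel. heat t (x::'a)) = sqrt (pi / (1 / (4 * t))) ^ DIM('a) / sqrt (4 * pi * t) ^ DIM('a)"
    unfolding eq using integrable_gauss_real[OF pos, where 'a='a] by simp
  also have "\<dots> = 1" using t by (simp add: mult_ac)
  finally show "(LINT x|lborel. heat t (x::'a)) = 1" .
qed

lemma gauss_kernel:
  assumes t: "0 < t"
  shows "(LINT \<xi>|lborel. gauss t \<xi> * exp (\<i> * complex_of_real (x \<bullet> \<xi>))) =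
    (2 * complex_of_real pi) ^ DIM('a) * complex_of_real (heat t (x::'a::euclidean_space))"
proof -
  have "(LINT \<xi>|lborel. gauss t \<xi> * exp (\<i> * complex_of_real (x \<bullet> \<xi>))) = fourier (gauss t) (- x)"
    by (simp add: fourier_def inner_commute)
  also have "\<dots> = complex_of_real (sqrt (pi / t) ^ DIM('a) * exp (- (x \<bullet> x) / (4 * t)))"
    unfolding fourier_gauss[OF t] by (simp add: gauss_def)
  also have "sqrt (pi / t) = 2 * pi / sqrt (4 * pi * t)"
    using t by (simp add: real_sqrt_mult real_sqrt_divide field_simps)
  also have "complex_of_real ((2 * pi / sqrt (4 * pi * t)) ^ DIM('a) * exp (- (x \<bullet> x) / (4 * t))) =
    (2 * complex_of_real pi) ^ DIM('a) * complex_of_real (heat t x)"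
    by (simp add: heat_def power_divide)
  finally show ?thesis .
qed

text \<open>The substitution y = x - sqrt(t) z moves the time from the kernel to the function, so
  that limits t \<rightarrow> 0 become dominated convergence against the fixed density
  \<open>heat 1\<close>.\<close>

lemma heat_rescale:
  fixes f :: "'a::euclidean_space \<Rightarrow> complex"
  assumes t: "0 < t"
  shows "(LINT y|lborel. f y * heat t (x - y)) = (LINT z|lborel. f (x - sqrt t *\<^sub>R z) * heat 1 z)"
proof -
  have h: "heat t (sqrt t *\<^sub>R z) = heat 1 z / sqrt t ^ DIM('a)" for z :: 'a
    using t by (simp add: heat_def real_sqrt_mult power_mult_distrib field_simps)
  have "(LINT y|lborel. f y * heat t (x - y)) =
    sqrt t ^ DIM('a) *\<^sub>R (LINT z|lborel. f (x + (- sqrt t) *\<^sub>R z) * heat t (x - (x + (- sqrt t) *\<^sub>R z)))"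
    using t by (subst integral_affine[where c="- sqrt t" and a=x]) auto
  also have "\<dots> = sqrt t ^ DIM('a) *\<^sub>R (LINT z|lborel. (f (x - sqrt t *\<^sub>R z) * heat 1 z) / sqrt t ^ DIM('a))"
    by (simp add: h)
  also have "\<dots> = (LINT z|lborel. f (x - sqrt t *\<^sub>R z) * heat 1 z)"
    using t by (subst integral_divide_zero) (simp add: scaleR_conv_of_real)
  finally show ?thesis .
qed

lemma heat_approx:
  fixes f :: "'a::euclidean_space \<Rightarrow> complex"
  assumes [measurable]: "f \<in> borel_measurable borel" and M: "\<And>y. norm (f y) \<le> M" and cont: "isCont f x"
    and \<tau>: "\<And>n. 0 < \<tau> n" "\<tau> \<longlonglongrightarrow> 0"
  shows "(\<lambda>n. LINT y|lborel. f y * heat (\<tau> n) (x - y)) \<longlonglongrightarrow> f x"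
proof -
  have M0: "M \<ge> 0" using M[of 0] norm_ge_zero order_trans by blast
  have "(\<lambda>n. LINT z|lborel. f (x - sqrt (\<tau> n) *\<^sub>R z) * heat 1 z) \<longlonglongrightarrow> (LINT z|lborel. f x * heat 1 (z::'a))"
  proof (rule integral_dominated_convergence)
    show "integrable lborel (\<lambda>z::'a. M * heat 1 z)" by (intro integrable_mult_right heat_integrable) simp
    show "AE z in lborel. norm (f (x - sqrt (\<tau> n) *\<^sub>R z) * complex_of_real (heat 1 z)) \<le> M * heat 1 z" for n
      using M by (intro AE_I2) (simp add: norm_mult mult_right_mono)
    show "AE z in lborel. (\<lambda>n. f (x - sqrt (\<tau> n) *\<^sub>R z) * complex_of_real (heat 1 z)) \<longlonglongrightarrow> f x * complex_of_real (heat 1 z)"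
    proof (intro AE_I2 tendsto_mult tendsto_const)
      fix z :: 'a
      have "(\<lambda>n. x - sqrt (\<tau> n) *\<^sub>R z) \<longlonglongrightarrow> x - sqrt 0 *\<^sub>R z"
        by (intro tendsto_intros \<tau>)
      then show "(\<lambda>n. f (x - sqrt (\<tau> n) *\<^sub>R z)) \<longlonglongrightarrow> f x"
        using isCont_tendsto_compose[OF cont] by simp
    qed
  qed measurable
  moreover have "(LINT z|lborel. f x * complex_of_real (heat 1 (z::'a))) = f x"
    by (simp add: heat_integrable(2))
  ultimately show ?thesis unfolding heat_rescale[OF \<tau>(1)] by (simp only:)
qed

lemma gauss_measurable [measurable]: "gauss t \<in> borel_measurable borel"
  unfolding gauss_def[abs_def] by measurable

lemma norm_gauss [simp]: "norm (gauss t x) = exp (- t * (x \<bullet> x))"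
  by (simp add: gauss_def)

text \<open>The Gaussian factor makes the double integral absolutely convergent for any integrable
  \<open>f\<close>. The identity is used twice: for Fourier inversion as the time tends to 0, and to
  pass between the heat flow and the symbol exp(-t |xi|^2).\<close>

lemma heat_fourier:
  fixes f :: "'a::euclidean_space \<Rightarrow> complex"
  assumes f: "integrable lborel f" and t: "0 < t"
  shows "(LINT \<xi>|lborel. fourier f \<xi> * gauss t \<xi> * exp (\<i> * complex_of_real (x \<bullet> \<xi>))) =
    (2 * complex_of_real pi) ^ DIM('a) * (LINT y|lborel. f y * heat t (x - y))"
proof -
  let ?G = "\<lambda>y \<xi>. f y * exp (- \<i> * complex_of_real (y \<bullet> \<xi>)) * (gauss t \<xi> * exp (\<i> * complex_of_real (x \<bullet> \<xi>)))"
  have [measurable]: "f \<in> borel_measurable borel" using f by auto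
  have "(LINT \<xi>|lborel. fourier f \<xi> * gauss t \<xi> * exp (\<i> * complex_of_real (x \<bullet> \<xi>))) =
     (LINT \<xi>|lborel. LINT y|lborel. ?G y \<xi>)"
    unfolding fourier_def mult.assoc[of "LINT x|lborel. f x * exp (- \<i> * complex_of_real (x \<bullet> _))"] integral_mult_left_zero ..
  also have "\<dots> = (LINT y|lborel. LINT \<xi>|lborel. ?G y \<xi>)"
  proof (rule Fubini_bound[where f="\<lambda>y. norm (f y)" and g="\<lambda>\<xi>. exp (- t * (\<xi> \<bullet> \<xi>))"])
    show "integrable lborel (\<lambda>y. norm (f y))" using f by simp
    show "integrable lborel (\<lambda>\<xi>::'a. exp (- t * (\<xi> \<bullet> \<xi>)))" by (rule integrable_gauss_real(1)[OF t])
    show "(\<lambda>(y, \<xi>). ?G y \<xi>) \<in> borel_measurable (borel \<Otimes>\<^sub>M borel)" by measurable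
  qed (simp add: norm_mult)
  also have "\<dots> = (LINT y|lborel. (2 * complex_of_real pi) ^ DIM('a) * (f y * heat t (x - y)))"
  proof (intro Bochner_Integration.integral_cong refl)
    fix y :: 'a
    have "(LINT \<xi>|lborel. ?G y \<xi>) = (LINT \<xi>|lborel. f y * (gauss t \<xi> * exp (\<i> * complex_of_real ((x - y) \<bullet> \<xi>))))"
      by (intro Bochner_Integration.integral_cong refl) (simp add: inner_diff_left algebra_simps exp_diff exp_minus divide_inverse)
    also have "\<dots> = f y * ((2 * complex_of_real pi) ^ DIM('a) * heat t (x - y))"
      by (simp add: gauss_kernel[OF t])
    finally show "(LINT \<xi>|lborel. ?G y \<xi>) = (2 * complex_of_real pi) ^ DIM('a) * (f y * heat t (x - y))"
      by (simp add: mult_ac)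
  qed
  finally show ?thesis by simp
qed

text \<open>In \<open>heat_fourier\<close> the time tends to 0: the frequency side converges by
  domination with the transform itself, the space side because heat kernels form an approximate
  identity. The generality beyond Schwartz functions is required for |xi|^(2s) times a Schwartz
  function.\<close>

lemma inverse_fourier_fourier_integrable:
  fixes f :: "'a::euclidean_space \<Rightarrow> complex"
  assumes f: "integrable lborel f" "continuous_on UNIV f" "\<And>y. norm (f y) \<le> M" and Ff: "integrable lborel (fourier f)"
  shows "inverse_fourier (fourier f) x = f x"
proof -
  define \<tau> where "\<tau> n = inverse (real (Suc n))" for n
  have \<tau>: "\<And>n. 0 < \<tau> n" "\<tau> \<longlonglongrightarrow> 0"
    unfolding \<tau>_def using LIMSEQ_inverse_real_of_nat by auto
  have [measurable]: "f \<in> borel_measurable borel" "fourier f \<in> borel_measurable borel" using f Ff by auto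
  have "(\<lambda>n. LINT \<xi>|lborel. fourier f \<xi> * gauss (\<tau> n) \<xi> * exp (\<i> * complex_of_real (x \<bullet> \<xi>)))
     \<longlonglongrightarrow> (LINT \<xi>|lborel. fourier f \<xi> * exp (\<i> * complex_of_real (x \<bullet> \<xi>)))"
  proof (rule integral_dominated_convergence)
    show "integrable lborel (\<lambda>\<xi>. norm (fourier f \<xi>))" using Ff by simp
    show "AE \<xi> in lborel. (\<lambda>n. fourier f \<xi> * gauss (\<tau> n) \<xi> * exp (\<i> * complex_of_real (x \<bullet> \<xi>)))
       \<longlonglongrightarrow> fourier f \<xi> * exp (\<i> * complex_of_real (x \<bullet> \<xi>))"
    proof (intro AE_I2 tendsto_mult tendsto_const)
      fix \<xi>
      have "(\<lambda>n. fourier f \<xi> * gauss (\<tau> n) \<xi>) \<longlonglongrightarrow> fourier f \<xi> * complex_of_real (exp (- 0 * (\<xi> \<bullet> \<xi>)))"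
        unfolding gauss_def by (intro tendsto_intros \<tau>)
      then show "(\<lambda>n. fourier f \<xi> * gauss (\<tau> n) \<xi>) \<longlonglongrightarrow> fourier f \<xi>" by simp
    qed
    show "AE \<xi> in lborel. norm (fourier f \<xi> * gauss (\<tau> n) \<xi> * exp (\<i> * complex_of_real (x \<bullet> \<xi>))) \<le> norm (fourier f \<xi>)" for n
      using \<tau>(1)[of n] by (intro AE_I2) (simp add: norm_mult mult_left_le)
  qed measurable
  moreover have "(\<lambda>n. (2 * complex_of_real pi) ^ DIM('a) * (LINT y|lborel. f y * heat (\<tau> n) (x - y)))
     \<longlonglongrightarrow> (2 * complex_of_real pi) ^ DIM('a) * f x"
    using f(2) by (intro tendsto_mult tendsto_const heat_approx[where M=M] f(3) \<tau>) (auto simp: continuous_on_eq_continuous_at)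
  ultimately have "(LINT \<xi>|lborel. fourier f \<xi> * exp (\<i> * complex_of_real (x \<bullet> \<xi>))) = (2 * complex_of_real pi) ^ DIM('a) * f x"
    unfolding heat_fourier[OF f(1) \<tau>(1)] by (rule LIMSEQ_unique)
  then show ?thesis by (simp add: inverse_fourier_def)
qed

lemma fourier_inverse_fourier_commute: "fourier (inverse_fourier f) x = inverse_fourier (fourier f) x"
proof -
  have "fourier (inverse_fourier f) x = fourier (\<lambda>x. (1 / (2 * complex_of_real pi) ^ DIM('a)) * fourier f (- x)) x"
    by (simp add: inverse_fourier_eq[abs_def])
  also have "\<dots> = (1 / (2 * complex_of_real pi) ^ DIM('a)) * fourier (fourier f) (- x)"
    unfolding fourier_cmult fourier_reflect ..
  finally show ?thesis by (simp add: inverse_fourier_eq)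
qed

lemma integrable_inverse_fourier_iff:
  "integrable lborel (inverse_fourier f) \<longleftrightarrow> integrable lborel (fourier f)"
proof -
  have 1: "inverse_fourier f = (\<lambda>x. fourier f (0 - x) / (2 * complex_of_real pi) ^ DIM('a))"
    by (simp add: inverse_fourier_eq[abs_def])
  have 2: "fourier f = (\<lambda>x. (2 * complex_of_real pi) ^ DIM('a) * inverse_fourier f (0 - x))"
    by (simp add: inverse_fourier_eq[abs_def])
  show ?thesis
  proof
    assume "integrable lborel (inverse_fourier f)"
    then show "integrable lborel (fourier f)"
      by (subst 2) (intro integrable_mult_right integrable_reflect)
  next
    assume "integrable lborel (fourier f)"
    then show "integrable lborel (inverse_fourier f)"
      by (subst 1) (intro integrable_divide integrable_reflect)
  qed
qed

lemma fourier_inverse_fourier_integrable: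
  fixes f :: "'a::euclidean_space \<Rightarrow> complex"
  assumes "integrable lborel f" "continuous_on UNIV f" "\<And>y. norm (f y) \<le> M" "integrable lborel (inverse_fourier f)"
  shows "fourier (inverse_fourier f) x = f x"
  unfolding fourier_inverse_fourier_commute
  by (rule inverse_fourier_fourier_integrable) (use assms integrable_inverse_fourier_iff in auto)

lemma inverse_fourier_fourier:
  assumes "schwartz f" shows "inverse_fourier (fourier f) = f"
proof
  obtain M where "\<And>x. norm (f x) \<le> M" using schwartz_bounded[OF assms] by blast
  then show "inverse_fourier (fourier f) x = f x" for x
    by (intro inverse_fourier_fourier_integrable schwartz_integrable schwartz_fourier schwartz_continuous assms)
qed

lemma fourier_inverse_fourier:
  assumes "schwartz f" shows "fourier (inverse_fourier f) = f"
  using inverse_fourier_fourier[OF assms] fourier_inverse_fourier_commute[of f] by (auto simp: fun_eq_iff)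

section \<open>Duality and the convolution theorem\<close>

lemma integral_fourier_swap:
  fixes f g :: "'a::euclidean_space \<Rightarrow> complex"
  assumes f: "integrable lborel f" and g: "integrable lborel g"
  shows "(LINT \<xi>|lborel. fourier f \<xi> * g \<xi>) = (LINT x|lborel. f x * fourier g x)"
proof -
  have [measurable]: "f \<in> borel_measurable borel" "g \<in> borel_measurable borel" using f g by auto
  have "(LINT \<xi>|lborel. fourier f \<xi> * g \<xi>) = (LINT \<xi>|lborel. LINT x|lborel. f x * exp (- \<i> * complex_of_real (x \<bullet> \<xi>)) * g \<xi>)"
    unfolding fourier_def by simp
  also have "\<dots> = (LINT x|lborel. LINT \<xi>|lborel. f x * exp (- \<i> * complex_of_real (x \<bullet> \<xi>)) * g \<xi>)"
  proof (rule Fubini_bound[where f="\<lambda>y. norm (f y)" and g="\<lambda>\<xi>. norm (g \<xi>)"])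
    show "(\<lambda>(x, \<xi>). f x * exp (- \<i> * complex_of_real (x \<bullet> \<xi>)) * g \<xi>) \<in> borel_measurable (borel \<Otimes>\<^sub>M borel)"
      by measurable
  qed (use f g in \<open>simp_all add: norm_mult\<close>)
  also have "\<dots> = (LINT x|lborel. f x * fourier g x)"
    unfolding fourier_def by (simp add: mult_ac inner_commute)
  finally show ?thesis .
qed

lemma integral_inverse_fourier_swap:
  fixes f g :: "'a::euclidean_space \<Rightarrow> complex"
  assumes f: "integrable lborel f" and g: "integrable lborel g"
  shows "(LINT \<xi>|lborel. inverse_fourier f \<xi> * g \<xi>) = (LINT x|lborel. f x * inverse_fourier g x)"
proof -
  have "(LINT \<xi>|lborel. fourier f (0 - \<xi>) * g \<xi>) = (LINT \<xi>|lborel. fourier f \<xi> * g (- \<xi>))"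
    using integral_reflect[of "\<lambda>\<xi>. fourier f \<xi> * g (- \<xi>)" 0] by simp
  also have "\<dots> = (LINT x|lborel. f x * fourier (\<lambda>x. g (- x)) x)"
    using integrable_reflect[OF g, of 0] by (intro integral_fourier_swap f) simp
  finally show ?thesis by (simp add: inverse_fourier_eq fourier_reflect)
qed

text \<open>The convolution theorem in the direction that asks for integrability of the
  frequency-side factor \<open>h\<close> and of \<open>g\<close> only. It covers convolution with
  the kernel of the multiplier as well as mollification.\<close>

lemma integral_inverse_fourier_kernel:
  fixes h g :: "'a::euclidean_space \<Rightarrow> complex"
  assumes h: "integrable lborel h" and g: "integrable lborel g"
  shows "(LINT y|lborel. inverse_fourier h (x - y) * g y) = inverse_fourier (\<lambda>\<xi>. h \<xi> * fourier g \<xi>) x"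
proof -
  have [measurable]: "h \<in> borel_measurable borel" "g \<in> borel_measurable borel" using h g by auto
  let ?G = "\<lambda>\<xi> y. h \<xi> * exp (\<i> * complex_of_real ((x - y) \<bullet> \<xi>)) * g y"
  have "(LINT y|lborel. LINT \<xi>|lborel. ?G \<xi> y) = (LINT \<xi>|lborel. LINT y|lborel. ?G \<xi> y)"
  proof (rule Fubini_bound[where f="\<lambda>y. norm (h y)" and g="\<lambda>\<xi>. norm (g \<xi>)"])
    show "(\<lambda>(\<xi>, y). ?G \<xi> y) \<in> borel_measurable (borel \<Otimes>\<^sub>M borel)" by measurable
  qed (use h g in \<open>simp_all add: norm_mult\<close>)
  also have "\<dots> = (LINT \<xi>|lborel. (h \<xi> * fourier g \<xi>) * exp (\<i> * complex_of_real (x \<bullet> \<xi>)))"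
  proof (intro Bochner_Integration.integral_cong refl)
    fix \<xi> :: 'a
    have "(LINT y|lborel. ?G \<xi> y) = (LINT y|lborel. (h \<xi> * exp (\<i> * complex_of_real (x \<bullet> \<xi>))) * (g y * exp (- \<i> * complex_of_real (y \<bullet> \<xi>))))"
      by (intro Bochner_Integration.integral_cong refl) (simp add: inner_diff_left algebra_simps exp_diff exp_minus divide_inverse)
    also have "\<dots> = (h \<xi> * exp (\<i> * complex_of_real (x \<bullet> \<xi>))) * fourier g \<xi>"
      unfolding fourier_def by (rule integral_mult_right_zero)
    finally show "(LINT y|lborel. ?G \<xi> y) = (h \<xi> * fourier g \<xi>) * exp (\<i> * complex_of_real (x \<bullet> \<xi>))"
      by (simp add: mult_ac)
  qed
  finally show ?thesis unfolding inverse_fourier_def by simp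
qed

lemma fourier_translate:
  "fourier (\<lambda>x. f (x - a)) \<xi> = exp (- \<i> * complex_of_real (a \<bullet> \<xi>)) * fourier f \<xi>"
proof -
  have "fourier (\<lambda>x. f (x - a)) \<xi> = (LINT x|lborel. f (x + a - a) * exp (- \<i> * complex_of_real ((x + a) \<bullet> \<xi>)))"
    unfolding fourier_def by (rule integral_translate[symmetric])
  also have "\<dots> = (LINT x|lborel. exp (- \<i> * complex_of_real (a \<bullet> \<xi>)) * (f x * exp (- \<i> * complex_of_real (x \<bullet> \<xi>))))"
    by (intro Bochner_Integration.integral_cong refl) (simp add: inner_add_left algebra_simps exp_diff exp_minus divide_inverse)
  finally show ?thesis by (simp add: fourier_def)
qed

section \<open>Bump functions and test functions\<close>

text \<open>The functions t^(-k) exp(-1/t), flat at 0. The whole family is carried along because it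
  is closed under differentiation up to linear combinations; \<open>eta 0\<close> gives the bump,
  and the higher members return as flat factors in the moment argument.\<close>

definition eta :: "nat \<Rightarrow> real \<Rightarrow> real" where
  "eta k t = (if t > 0 then (1 / t) ^ k * exp (- (1 / t)) else 0)"

lemma eta_nonneg: "0 \<le> eta k t"
  by (auto simp: eta_def)

lemma eta_le_square: "eta k t \<le> real (k + 2) ^ (k + 2) * t\<^sup>2"
proof (cases "t > 0")
  case True
  define z where "z = 1 / t"
  have z: "0 < z" "t = 1 / z" using True by (auto simp: z_def)
  have "z ^ (k + 2) \<le> real (k + 2) ^ (k + 2) * exp z"
    using z by (intro power_le_exp) simp
  then have "z ^ k * z\<^sup>2 * exp (- z) \<le> real (k + 2) ^ (k + 2)"
    by (simp add: exp_minus field_simps power_add power2_eq_square)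
  then have "z ^ k * exp (- z) \<le> real (k + 2) ^ (k + 2) / z\<^sup>2"
    using z by (simp add: field_simps)
  then show ?thesis using True z by (simp add: eta_def power_divide)
qed (simp add: eta_def)

lemma eta_has_derivative:
  "(eta k has_real_derivative (- real k * eta (Suc k) t + eta (Suc (Suc k)) t)) (at t)"
proof -
  consider "t > 0" | "t < 0" | "t = 0" by linarith
  then show ?thesis
  proof cases
    case 1
    have "((\<lambda>t. (1 / t) ^ k * exp (- (1 / t))) has_real_derivative (- real k * eta (Suc k) t + eta (Suc (Suc k)) t)) (at t)"
      apply (cases k)
       apply (use 1 in \<open>auto intro!: derivative_eq_intros simp: eta_def power_divide field_simps power2_eq_square\<close>)
      apply (simp add: power_eq_if split: if_splits)
      done
    then show ?thesis
      by (rule has_field_derivative_transform_within_open[where S="{0<..}"]) (use 1 in \<open>auto simp: eta_def\<close>)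
  next
    case 2
    have "((\<lambda>t. 0) has_real_derivative (- real k * eta (Suc k) t + eta (Suc (Suc k)) t)) (at t)"
      using 2 by (auto simp: eta_def)
    then show ?thesis
      by (rule has_field_derivative_transform_within_open[where S="{..<0}"]) (use 2 in \<open>auto simp: eta_def\<close>)
  next
    case 3
    \<comment> \<open>At the origin the quadratic bound of \<open>eta_le_square\<close> forces the
      derivative 0.\<close>
    have "(eta k has_derivative (\<lambda>h. 0)) (at 0)"
    proof (rule has_derivativeI_sandwich[where e=1 and H="\<lambda>y. real (k + 2) ^ (k + 2) * \<bar>y\<bar>"])
      fix y :: real assume "y \<noteq> 0"
      have "\<bar>eta k y\<bar> \<le> real (k + 2) ^ (k + 2) * y\<^sup>2"
        using eta_le_square[of k y] eta_nonneg[of k y] by simp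
      then show "norm (eta k y - eta k 0 - 0) / norm (y - 0) \<le> real (k + 2) ^ (k + 2) * \<bar>y\<bar>"
        using \<open>y \<noteq> 0\<close> by (simp add: divide_le_eq eta_def[of _ 0] mult.assoc abs_mult_self_eq power2_eq_square)
    next
      show "((\<lambda>y. real (k + 2) ^ (k + 2) * \<bar>y\<bar>) \<longlongrightarrow> 0) (at 0)"
        by (auto intro!: tendsto_eq_intros)
    qed auto
    moreover have "(*) (0::real) = (\<lambda>h. 0)" by (rule ext) simp
    ultimately show ?thesis using 3 by (simp add: eta_def has_field_derivative_def)
  qed
qed

definition bump :: "'a::euclidean_space \<Rightarrow> complex" where
  "bump x = complex_of_real (eta 0 (1 - x \<bullet> x))"

lemma smooth_bump: "smooth_function (bump :: 'a::euclidean_space \<Rightarrow> complex)"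
proof -
  define E where "E k = (\<lambda>x::'a. complex_of_real (eta k (1 - x \<bullet> x)))" for k
  define S where "S = range E \<union> range (\<lambda>b x. complex_of_real (x \<bullet> b))"
  have der: "(E k has_derivative (\<lambda>h. complex_of_real (- real k * eta (Suc k) (1 - x \<bullet> x) + eta (Suc (Suc k)) (1 - x \<bullet> x)) * complex_of_real (- 2 * (x \<bullet> h)))) (at x)" for k x
  proof -
    have "((\<lambda>x::'a. eta k (1 - x \<bullet> x)) has_derivative
       (\<lambda>h. (- real k * eta (Suc k) (1 - x \<bullet> x) + eta (Suc (Suc k)) (1 - x \<bullet> x)) * (- 2 * (x \<bullet> h)))) (at x)"
      by (rule has_derivative_eq_rhs[OF has_derivative_compose[where f="\<lambda>x. 1 - x \<bullet> x",
              OF _ eta_has_derivative[unfolded has_field_derivative_def]]])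
         (auto intro!: derivative_eq_intros simp: fun_eq_iff inner_commute)
    from has_derivative_of_real[OF this] show ?thesis
      unfolding E_def by (simp only: of_real_mult)
  qed
  have der2: "((\<lambda>x. complex_of_real (x \<bullet> b)) has_derivative (\<lambda>h. complex_of_real (h \<bullet> b))) (at x)" for b x :: 'a
    by (auto intro!: derivative_eq_intros)
  have "smooth_function (E 0)"
  proof (rule alg_smooth[where S=S])
    fix f assume f: "f \<in> S"
    then show "f differentiable (at x)" for x
      using der der2 unfolding S_def differentiable_def by blast
    show "partial_deriv [b] f \<in> alg S" for b
    proof -
      from f consider k where "f = E k" | c where "f = (\<lambda>x. complex_of_real (x \<bullet> c))"
        unfolding S_def by auto
      then show ?thesis
      proof cases
        case 1
        have "partial_deriv [b] f = (\<lambda>x. ((\<lambda>x. - of_nat k * E (Suc k) x) x + E (Suc (Suc k)) x) * ((-2) * complex_of_real (x \<bullet> b)))"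
          unfolding 1 by (subst partial_deriv_eq[OF der]) (auto simp: E_def)
        also have "\<dots> \<in> alg S"
          by (intro alg.add alg.mult[OF alg.const] alg.mult alg.base) (auto simp: S_def)
        finally show ?thesis .
      next
        case 2
        then show ?thesis using partial_deriv_eq[OF der2, of b c] by (auto intro: alg.const)
      qed
    qed
  qed (auto simp: S_def intro: alg.base)
  then show ?thesis by (simp add: E_def bump_def[abs_def])
qed

lemma norm_ge_1_iff: "1 \<le> norm x \<longleftrightarrow> 1 \<le> x \<bullet> x" for x :: "'a::real_inner"
  by (metis norm_eq_sqrt_inner real_sqrt_ge_1_iff)

lemma bump_eq_0: "1 \<le> norm x \<Longrightarrow> bump x = 0"
  by (auto simp: bump_def eta_def norm_ge_1_iff)

lemma bump_pos: "norm x < 1 \<Longrightarrow> bump x \<noteq> 0"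
  using norm_ge_1_iff[of x] by (auto simp: bump_def eta_def not_le)

lemma norm_bump_le: "norm (bump x) \<le> 1"
  by (auto simp: bump_def eta_def)

lemma partial_deriv_outside:
  fixes f :: "'a::euclidean_space \<Rightarrow> complex"
  assumes "closed K" "\<And>x. x \<notin> K \<Longrightarrow> f x = 0" "x \<notin> K"
  shows "partial_deriv [b] f x = 0"
proof -
  have "((\<lambda>x. 0) has_derivative (\<lambda>h. 0)) (at x)" by simp
  then have "(f has_derivative (\<lambda>h. 0)) (at x)"
    by (rule has_derivative_transform_within_open[where s="- K"]) (use assms in auto)
  then show ?thesis by (metis frechet_derivative_at partial_deriv_single)
qed

lemma partial_derivs_outside:
  fixes f :: "'a::euclidean_space \<Rightarrow> complex"
  assumes "closed K" "\<And>x. x \<notin> K \<Longrightarrow> f x = 0"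
  shows "x \<notin> K \<Longrightarrow> partial_deriv bs f x = 0"
proof (induction bs arbitrary: x)
  case (Cons b bs)
  then show ?case by (subst partial_deriv_Cons) (rule partial_deriv_outside[OF assms(1)], auto)
qed (use assms in auto)

lemma schwartz_compact_support:
  assumes "smooth_function f" "compact K" "\<And>x. x \<notin> K \<Longrightarrow> f x = 0"
  shows "schwartz f"
proof (rule schwartz_coinduct[where X="\<lambda>f. smooth_function f \<and> (\<forall>x. x \<notin> K \<longrightarrow> f x = 0)"])
  fix f :: "'a \<Rightarrow> complex" assume f: "smooth_function f \<and> (\<forall>x. x \<notin> K \<longrightarrow> f x = 0)"
  show "f differentiable at x" for x using f smooth_differentiable by blast
  show "smooth_function (partial_deriv [b] f) \<and> (\<forall>x. x \<notin> K \<longrightarrow> partial_deriv [b] f x = 0)" if "b \<in> Basis" for b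
    using f that compact_imp_closed[OF assms(2)] by (auto intro!: smooth_partial_deriv partial_deriv_outside)
  show "\<exists>C. \<forall>x. (1 + norm x) ^ k * norm (f x) \<le> C" for k
  proof -
    have "continuous_on UNIV f"
      using f by (meson continuous_at_imp_continuous_on differentiable_imp_continuous_within smooth_differentiable)
    then have "continuous_on K (\<lambda>x. (1 + norm x) ^ k * norm (f x))"
      by (intro continuous_intros) (auto elim: continuous_on_subset)
    then have "bounded ((\<lambda>x. (1 + norm x) ^ k * norm (f x)) ` K)"
      using assms(2) compact_continuous_image compact_imp_bounded by blast
    then obtain C where C: "\<And>x. x \<in> K \<Longrightarrow> norm ((1 + norm x) ^ k * norm (f x)) \<le> C"
      by (auto simp: bounded_iff)
    have "(1 + norm x) ^ k * norm (f x) \<le> \<bar>C\<bar>" for x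
    proof (cases "x \<in> K")
      case True
      then show ?thesis using C[OF True] by (metis abs_ge_self order_trans real_norm_def)
    qed (use f in simp)
    then show ?thesis by blast
  qed
qed (use assms in auto)

lemma test_functionI:
  assumes "smooth_function \<phi>" "compact K" "K \<subseteq> V" "\<And>x. x \<notin> K \<Longrightarrow> \<phi> x = 0"
  shows "test_function V \<phi>"
proof -
  have sub: "closure {x. \<phi> x \<noteq> 0} \<subseteq> K"
    using assms(4) compact_imp_closed[OF assms(2)] by (intro closure_minimal) auto
  then have "compact (closure {x. \<phi> x \<noteq> 0})"
    using assms(2) by (metis closed_closure compact_Int_closed inf.absorb_iff2)
  with sub assms show ?thesis by (auto simp: test_function_def)
qed

lemma schwartz_bump: "schwartz bump"
  by (rule schwartz_compact_support[OF smooth_bump, of "cball 0 1"]) (auto simp: bump_eq_0)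

definition bump_at :: "'a::euclidean_space \<Rightarrow> real \<Rightarrow> 'a \<Rightarrow> complex" where
  "bump_at a e x = bump ((1 / e) *\<^sub>R (x - a))"

lemma schwartz_bump_at: "e > 0 \<Longrightarrow> schwartz (bump_at a e)"
  using schwartz_affine[OF schwartz_bump, of "1 / e" "- (1 / e) *\<^sub>R a"]
  by (simp add: bump_at_def[abs_def] algebra_simps)

lemma bump_at_eq_0: "e > 0 \<Longrightarrow> e \<le> norm (x - a) \<Longrightarrow> bump_at a e x = 0"
  unfolding bump_at_def by (rule bump_eq_0) (simp add: le_divide_eq)

text \<open>The bump is not normalised; its mass is carried through the limits as a nonzero factor.
  A nonnegative function with integral 0 vanishes almost everywhere, which positivity on the unit
  ball excludes.\<close>

lemma bump_integral_nonzero: "(LINT x|lborel. bump (x::'a::euclidean_space)) \<noteq> 0"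
proof
  let ?b = "\<lambda>x::'a. eta 0 (1 - x \<bullet> x)"
  assume "(LINT x|lborel. bump (x::'a)) = 0"
  then have 0: "(LINT x|lborel. ?b x) = 0"
    unfolding bump_def by simp
  have int: "integrable lborel ?b"
    using integrable_norm[OF schwartz_integrable[OF schwartz_bump]] by (simp add: bump_def eta_nonneg)
  then have "AE x in lborel. ?b x = 0"
    using 0 by (subst (asm) integral_nonneg_eq_0_iff_AE) (auto simp: eta_nonneg)
  then have "AE x in lborel. x \<notin> ball (0::'a) 1"
    by eventually_elim (use bump_pos in \<open>auto simp: bump_def\<close>)
  then have "emeasure lborel (ball (0::'a) 1) = 0"
    by (subst (asm) AE_iff_measurable[OF _ refl]) (auto simp: ball_def)
  moreover have "unit_ball_vol (real DIM('a)) > 0" by simp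
  ultimately show False by (simp add: emeasure_ball)
qed

section \<open>Density of Schwartz functions\<close>

lemma temperate_real_polynomial:
  "real_polynomial_function f \<Longrightarrow> temperate (\<lambda>x::'a::euclidean_space. complex_of_real (f x))"
  by (induction rule: real_polynomial_function.induct)
     (auto intro: temperate_bounded_linear temperate_add temperate_mult)

lemma temperate_polynomial:
  fixes f :: "'a::euclidean_space \<Rightarrow> complex"
  assumes "polynomial_function f"
  shows "temperate f"
proof -
  have "temperate (\<lambda>x. complex_of_real ((Re \<circ> f) x) + \<i> * complex_of_real ((Im \<circ> f) x))"
    using assms bounded_linear_Re bounded_linear_Im unfolding polynomial_function_def
    by (intro temperate_add temperate_mult temperate_const temperate_real_polynomial) (auto simp del: o_apply)
  then show ?thesis by (simp flip: complex_eq)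
qed

text \<open>Divide by a bump that is positive on a larger ball, approximate the quotient by a
  polynomial, and multiply back: a polynomial times a bump is Schwartz, and the bump is bounded by
  1, so the error does not grow. The quotient stays continuous up to the radius 3R, where the bump
  vanishes, because \<open>h\<close> is already 0 from the radius 2R on.\<close>

lemma continuous_approx_schwartz:
  fixes h :: "'a::euclidean_space \<Rightarrow> complex"
  assumes h: "continuous_on UNIV h" and h0: "\<And>x. 2 * R \<le> norm x \<Longrightarrow> h x = 0" and R: "R > 0" and e: "e > 0"
  shows "\<exists>\<phi>. schwartz \<phi> \<and> (\<forall>x. norm (\<phi> x - h x) \<le> e) \<and> (\<forall>x. 3 * R \<le> norm x \<longrightarrow> \<phi> x = 0)"
proof -
  let ?b = "bump_at (0::'a) (3 * R)"
  have sb: "schwartz ?b" using R by (intro schwartz_bump_at) simp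
  have bn: "?b x \<noteq> 0" if "norm x < 3 * R" for x
    unfolding bump_at_def using that R by (intro bump_pos) (simp add: field_simps)
  have b0: "?b x = 0" if "3 * R \<le> norm x" for x
    using that R by (intro bump_at_eq_0) auto
  have bl: "norm (?b x) \<le> 1" for x
    unfolding bump_at_def by (rule norm_bump_le)
  define q where "q x = h x / ?b x" for x
  have "continuous_on (cball 0 (2 * R) \<union> {x. 2 * R \<le> norm x}) q"
  proof (rule continuous_on_closed_Un)
    show "closed {x::'a. 2 * R \<le> norm x}" by (intro closed_Collect_le continuous_intros)
    show "continuous_on (cball 0 (2 * R)) q"
      unfolding q_def using bn R schwartz_continuous[OF sb] h
      by (intro continuous_on_divide) (auto elim: continuous_on_subset)
    have "continuous_on {x. 2 * R \<le> norm x} (\<lambda>x. 0)" by simp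
    then show "continuous_on {x. 2 * R \<le> norm x} q"
      by (rule continuous_on_eq) (simp add: q_def h0)
  qed simp
  then have "continuous_on (cball 0 (3 * R)) q"
    by (rule continuous_on_subset) auto
  then obtain P where P: "polynomial_function P" "\<And>x. x \<in> cball 0 (3 * R) \<Longrightarrow> norm (q x - P x) < e"
    using Stone_Weierstrass_polynomial_function[OF compact_cball _ e] by metis
  show ?thesis
  proof (intro exI conjI allI impI)
    show "schwartz (\<lambda>x. P x * ?b x)"
      by (intro schwartz_mult temperate_polynomial P sb)
    show "P x * ?b x = 0" if "3 * R \<le> norm x" for x using b0[OF that] by simp
    show "norm (P x * ?b x - h x) \<le> e" for x
    proof (cases "norm x < 3 * R")
      case True
      then have "P x * ?b x - h x = (P x - q x) * ?b x"
        using bn[OF True] by (simp add: q_def algebra_simps)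
      then have "norm (P x * ?b x - h x) = norm (q x - P x) * norm (?b x)"
        by (simp add: norm_mult norm_minus_commute)
      also have "\<dots> \<le> e * 1"
        using P(2)[of x] True bl[of x] e by (intro mult_mono) auto
      finally show ?thesis by simp
    next
      case False
      then show ?thesis using b0[of x] h0[of x] R e by simp
    qed
  qed
qed

text \<open>A measurable function is an almost everywhere limit of continuous ones. Truncating their
  values and cutting off their supports gives the uniform bounds that dominated convergence needs
  later, without disturbing the limit, since \<open>b\<close> obeys the bounds itself.\<close>

lemma bounded_approx_schwartz:
  fixes b :: "'a::euclidean_space \<Rightarrow> complex"
  assumes b: "b \<in> borel_measurable borel" and M: "\<And>x. norm (b x) \<le> M" "M > 0"
    and b0: "\<And>x. R < norm x \<Longrightarrow> b x = 0" and R: "R > 0"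
  shows "\<exists>\<phi>. (\<forall>n::nat. schwartz (\<phi> n)) \<and> (\<forall>n x. norm (\<phi> n x) \<le> M + 1) \<and>
    (\<forall>n x. 3 * R \<le> norm x \<longrightarrow> \<phi> n x = 0) \<and> (AE x in lborel. (\<lambda>n. \<phi> n x) \<longlonglongrightarrow> b x)"
proof -
  have "b measurable_on UNIV"
    using b by (intro lebesgue_measurable_imp_measurable_on) (auto simp: measurable_completion)
  then obtain N g where N: "negligible N" and g: "\<And>n. continuous_on UNIV (g n)"
    and lim: "\<And>x. x \<notin> N \<Longrightarrow> (\<lambda>n::nat. g n x) \<longlonglongrightarrow> b x"
    unfolding measurable_on_def by auto
  \<comment> \<open>The radial retraction of the plane onto the disc of radius
    \<open>M\<close>.\<close>
  define T where "T z = complex_of_real (M / max M (norm z)) * z" for z :: complex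
  have T_cont: "continuous_on UNIV T"
    unfolding T_def using M(2) by (intro continuous_intros) (auto simp: max_def)
  have T_id: "T z = z" if "norm z \<le> M" for z using that M(2) by (simp add: T_def max_def)
  have T_le: "norm (T z) \<le> M" for z
    using M(2) by (auto simp: T_def norm_mult norm_divide max_def)
  define c where "c x = max 0 (min 1 (2 - norm x / R))" for x :: 'a
  have c_cont: "continuous_on UNIV c" unfolding c_def using R by (intro continuous_intros) auto
  have c01: "0 \<le> c x" "c x \<le> 1" for x by (auto simp: c_def)
  have c1: "c x = 1" if "norm x \<le> R" for x
  proof -
    have "norm x / R \<le> 1" using that R by simp
    then have "1 \<le> 2 - norm x / R" by linarith
    then show ?thesis by (simp add: c_def)
  qed
  have c0: "c x = 0" if "2 * R \<le> norm x" for x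
  proof -
    have "2 \<le> norm x / R" using that R by (simp add: field_simps)
    then show ?thesis by (simp add: c_def)
  qed
  define h where "h n x = complex_of_real (c x) * T (g n x)" for n x
  have h_cont: "continuous_on UNIV (h n)" for n
    unfolding h_def
    by (intro continuous_on_mult continuous_on_of_real c_cont continuous_on_compose2[OF T_cont g]) auto
  have "\<exists>\<phi>. schwartz \<phi> \<and> (\<forall>x. norm (\<phi> x - h n x) \<le> inverse (Suc n)) \<and> (\<forall>x. 3 * R \<le> norm x \<longrightarrow> \<phi> x = 0)" for n
    by (rule continuous_approx_schwartz[OF h_cont _ R]) (auto simp: h_def c0)
  then obtain \<phi> where \<phi>: "\<And>n. schwartz (\<phi> n)" "\<And>n x. norm (\<phi> n x - h n x) \<le> inverse (Suc n)"
      "\<And>n x. 3 * R \<le> norm x \<Longrightarrow> \<phi> n x = 0" by metis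
  have h_le: "norm (h n x) \<le> M" for n x
    unfolding h_def norm_mult using c01[of x] T_le[of "g n x"] mult_mono[of "c x" 1 "norm (T (g n x))" M] by simp
  have "norm (\<phi> n x) \<le> M + 1" for n x
  proof -
    have "norm (\<phi> n x) \<le> norm (h n x) + norm (\<phi> n x - h n x)"
      by (metis add.commute diff_add_cancel norm_triangle_ineq)
    also have "\<dots> \<le> M + inverse (Suc n)" using h_le \<phi>(2) by (intro add_mono)
    also have "inverse (real (Suc n)) \<le> 1" by (simp add: field_simps)
    finally show ?thesis by simp
  qed
  moreover have "AE x in lborel. (\<lambda>n. \<phi> n x) \<longlonglongrightarrow> b x"
  proof -
    have hb: "(\<lambda>n. h n x) \<longlonglongrightarrow> b x" if "x \<notin> N" for x
    proof -
      have "isCont T (b x)" using T_cont by (simp add: continuous_on_eq_continuous_at)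
      then have "(\<lambda>n. complex_of_real (c x) * T (g n x)) \<longlonglongrightarrow> complex_of_real (c x) * T (b x)"
        by (rule tendsto_mult[OF tendsto_const isCont_tendsto_compose[OF _ lim[OF that]]])
      moreover have "complex_of_real (c x) * T (b x) = b x"
        using T_id[OF M(1)] c1[of x] b0[of x] by (cases "norm x \<le> R") (auto simp: T_def)
      ultimately show ?thesis by (simp add: h_def)
    qed
    have d0: "(\<lambda>n. \<phi> n x - h n x) \<longlonglongrightarrow> 0" for x
      by (rule Lim_null_comparison[OF _ LIMSEQ_inverse_real_of_nat]) (use \<phi>(2) in auto)
    have lim2: "(\<lambda>n. \<phi> n x) \<longlonglongrightarrow> b x" if "x \<notin> N" for x
      using tendsto_add[OF d0[of x] hb[OF that]] by simp
    have "AE x in lebesgue. x \<notin> N"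
      using N by (intro AE_not_in) (simp add: negligible_iff_null_sets)
    then have "AE x in lborel. x \<notin> N" by (simp add: AE_completion_iff)
    then show ?thesis by eventually_elim (rule lim2)
  qed
  ultimately show ?thesis using \<phi>(1,3) by blast
qed

section \<open>Elementary estimates in L^p\<close>

lemma le_one_plus_powr: "1 \<le> p \<Longrightarrow> 0 \<le> a \<Longrightarrow> a \<le> 1 + a powr (p::real)"
proof (cases "a \<le> 1")
  case False
  assume "1 \<le> p"
  with False have "a powr 1 \<le> a powr p" by (intro powr_mono) auto
  with False show ?thesis by simp
next
  case True
  moreover have "0 \<le> a powr p" by simp
  ultimately show ?thesis by linarith
qed

lemma norm_add_powr_le:
  fixes a b :: "'a::real_normed_vector"
  assumes "1 \<le> p"
  shows "norm (a + b) powr p \<le> 2 powr p * (norm a powr p + norm b powr p)"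
proof -
  have "norm (a + b) \<le> 2 * max (norm a) (norm b)"
    using norm_triangle_ineq[of a b] by (simp add: max_def)
  then have "norm (a + b) powr p \<le> (2 * max (norm a) (norm b)) powr p"
    using assms by (intro powr_mono2) auto
  also have "\<dots> = 2 powr p * (max (norm a) (norm b) powr p)"
    by (simp add: powr_mult)
  also have "max (norm a) (norm b) powr p \<le> norm a powr p + norm b powr p"
    by (cases "norm a \<le> norm b") (simp_all add: max_def)
  finally show ?thesis by simp
qed

lemma Lp_measurable: "f \<in> Lp_space p \<Longrightarrow> f \<in> borel_measurable borel"
  by (simp add: Lp_space_def)

lemma Lp_integrable: "f \<in> Lp_space p \<Longrightarrow> integrable lborel (\<lambda>x. norm (f x) powr p)"
  by (simp add: Lp_space_def)

lemma Lp_add: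
  assumes p: "1 \<le> p" and f: "f \<in> Lp_space p" and g: "g \<in> Lp_space p"
  shows "(\<lambda>x. f x + g x) \<in> Lp_space p"
proof -
  note [measurable] = Lp_measurable[OF f] Lp_measurable[OF g]
  have "integrable lborel (\<lambda>x. norm (f x + g x) powr p)"
  proof (rule Bochner_Integration.integrable_bound)
    show "integrable lborel (\<lambda>x. 2 powr p * (norm (f x) powr p + norm (g x) powr p))"
      by (intro integrable_mult_right Bochner_Integration.integrable_add Lp_integrable f g)
  qed (use norm_add_powr_le[OF p] in \<open>auto intro!: AE_I2\<close>)
  then show ?thesis by (simp add: Lp_space_def)
qed

lemma Lp_uminus: "f \<in> Lp_space p \<Longrightarrow> (\<lambda>x. - f x) \<in> Lp_space p"
  by (auto simp: Lp_space_def)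

lemma Lp_diff:
  assumes p: "1 \<le> p" and f: "f \<in> Lp_space p" and g: "g \<in> Lp_space p"
  shows "(\<lambda>x. f x - g x) \<in> Lp_space p"
  using Lp_add[OF p f Lp_uminus[OF g]] by simp

lemma schwartz_Lp:
  assumes p: "1 \<le> p" and f: "schwartz f"
  shows "f \<in> Lp_space p"
proof -
  obtain C where C: "C \<ge> 0" "\<And>x. norm (f x) \<le> C * wt x" using schwartz_wt_bound[OF f] by blast
  have "integrable lborel (\<lambda>x. norm (f x) powr p)"
  proof (rule integrable_wt_bound[where C="C powr p"])
    have [measurable]: "f \<in> borel_measurable borel" by (rule schwartz_measurable[OF f])
    show "(\<lambda>x. norm (f x) powr p) \<in> borel_measurable borel" by measurable
    show "norm (norm (f x) powr p) \<le> C powr p * wt x" for x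
    proof -
      have "norm (f x) powr p \<le> (C * wt x) powr p"
        using p C(2)[of x] by (intro powr_mono2) auto
      also have "\<dots> = C powr p * wt x powr p" using C(1) wt_nonneg by (simp add: powr_mult)
      also have "wt x powr p \<le> wt x powr 1"
        using p wt_nonneg wt_le_1 by (intro powr_mono') auto
      finally show ?thesis using wt_pos[of x] C by (simp add: mult_left_mono)
    qed
  qed
  then show ?thesis using schwartz_measurable[OF f] by (simp add: Lp_space_def)
qed

text \<open>The inequality a \<le> 1 + a^p does the work of Hoelder's inequality: against a bounded
  integrable \<open>g\<close> the product is dominated by |g| + B |f|^p. This covers all p \<ge> 1
  at once.\<close>

lemma Lp_mult_integrable:
  assumes p: "1 \<le> p" and f: "f \<in> Lp_space p" and g: "integrable lborel g" and B: "\<And>x. norm (g x) \<le> B"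
  shows "integrable lborel (\<lambda>x. f x * g x)"
proof (rule Bochner_Integration.integrable_bound)
  have [measurable]: "g \<in> borel_measurable borel" using g by auto
  note [measurable] = Lp_measurable[OF f]
  show "integrable lborel (\<lambda>x. norm (g x) + B * norm (f x) powr p)"
    by (intro Bochner_Integration.integrable_add integrable_mult_right Lp_integrable[OF f] integrable_norm g)
  show "(\<lambda>x. f x * g x) \<in> borel_measurable lborel" by measurable
  show "AE x in lborel. norm (f x * g x) \<le> norm (norm (g x) + B * norm (f x) powr p)"
  proof (rule AE_I2)
    fix x
    have B0: "0 \<le> B" using B[of x] norm_ge_zero order_trans by blast
    have "norm (f x * g x) \<le> (1 + norm (f x) powr p) * norm (g x)"
      unfolding norm_mult using p by (intro mult_right_mono le_one_plus_powr) auto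
    also have "\<dots> = norm (g x) + norm (f x) powr p * norm (g x)" by (simp add: algebra_simps)
    also have "\<dots> \<le> norm (g x) + norm (f x) powr p * B" by (intro add_left_mono mult_left_mono B) auto
    finally show "norm (f x * g x) \<le> norm (norm (g x) + B * norm (f x) powr p)"
      using B0 by (simp add: mult.commute)
  qed
qed

lemma Lp_mult_schwartz_integrable:
  "1 \<le> p \<Longrightarrow> f \<in> Lp_space p \<Longrightarrow> schwartz g \<Longrightarrow> integrable lborel (\<lambda>x. f x * g x)"
  using Lp_mult_integrable[of p f g] schwartz_integrable schwartz_bounded by metis

lemma cball_in_borel [measurable]: "cball (a::'a::euclidean_space) r \<in> sets borel"
  by (rule borel_closed[OF closed_cball])

lemma integrable_indicator_cball:
  "integrable lborel (\<lambda>x::'a::euclidean_space. indicator (cball a r) x :: real)"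
  using emeasure_lborel_cball_finite[of a r] by (intro integrable_real_indicator) auto

text \<open>On a ball, approximate the conjugate phase of \<open>h\<close> boundedly by Schwartz
  functions. In the limit the hypothesis says that the integral of |h| over the ball is 0, and
  countably many balls exhaust the space.\<close>

lemma Lp_schwartz_null:
  fixes h :: "'a::euclidean_space \<Rightarrow> complex"
  assumes p: "1 \<le> p" and h: "h \<in> Lp_space p" and z: "\<And>\<phi>. schwartz \<phi> \<Longrightarrow> (LINT x|lborel. h x * \<phi> x) = 0"
  shows "AE x in lborel. h x = 0"
proof -
  note [measurable] = Lp_measurable[OF h]
  have "AE x in lborel. norm x \<le> real (Suc n) \<longrightarrow> h x = 0" for n
  proof -
    let ?R = "real (Suc n)"
    define b where "b x = indicator (cball 0 ?R) x * cnj (sgn (h x))" for x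
    have "(\<lambda>x. cnj (sgn (h x))) \<in> borel_measurable borel"
      unfolding sgn_div_norm
      by (rule measurable_compose[OF _ borel_measurable_continuous_onI[of cnj]]) (auto intro: continuous_on_cnj)
    moreover have "(\<lambda>x::'a. indicator (cball 0 ?R) x :: complex) \<in> borel_measurable borel"
      by (rule borel_measurable_indicator[OF borel_closed[OF closed_cball]])
    ultimately have [measurable]: "b \<in> borel_measurable borel"
      unfolding b_def[abs_def] by (rule borel_measurable_times[rotated])
    have "\<exists>\<phi>. (\<forall>n::nat. schwartz (\<phi> n)) \<and> (\<forall>n x. norm (\<phi> n x) \<le> 1 + 1) \<and>
      (\<forall>n x. 3 * ?R \<le> norm x \<longrightarrow> \<phi> n x = 0) \<and> (AE x in lborel. (\<lambda>n. \<phi> n x) \<longlonglongrightarrow> b x)"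
    proof (rule bounded_approx_schwartz)
      show "b \<in> borel_measurable borel" by measurable
    qed (auto simp: b_def norm_mult norm_sgn split: split_indicator)
    then obtain \<phi> where \<phi>: "\<And>k. schwartz (\<phi> k)" "\<And>k x. norm (\<phi> k x) \<le> 2"
       "\<And>k x. 3 * ?R \<le> norm x \<Longrightarrow> \<phi> k x = 0" "AE x in lborel. (\<lambda>k::nat. \<phi> k x) \<longlonglongrightarrow> b x"
      by auto
    have cint: "integrable lborel (\<lambda>x::'a. indicator (cball 0 (3 * ?R)) x :: real)"
      by (rule integrable_indicator_cball)
    have hint: "integrable lborel (\<lambda>x. norm (h x * (2 * complex_of_real (indicator (cball 0 (3 * ?R)) x))))"
      by (intro integrable_norm Lp_mult_integrable[OF p h, where B=2] integrable_mult_right integrable_of_real cint)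
         (auto split: split_indicator)
    have "(\<lambda>k. LINT x|lborel. h x * \<phi> k x) \<longlonglongrightarrow> (LINT x|lborel. h x * b x)"
    proof (rule integral_dominated_convergence[OF _ _ hint])
      show "(\<lambda>x. h x * \<phi> k x) \<in> borel_measurable lborel" for k
        using schwartz_measurable[OF \<phi>(1)[of k]] by measurable
      show "AE x in lborel. (\<lambda>k. h x * \<phi> k x) \<longlonglongrightarrow> h x * b x"
        using \<phi>(4) by eventually_elim (intro tendsto_intros)
      show "AE x in lborel. norm (h x * \<phi> k x) \<le> norm (h x * (2 * complex_of_real (indicator (cball 0 (3 * ?R)) x)))" for k
      proof (rule AE_I2)
        fix x
        have "norm (\<phi> k x) \<le> 2 * indicator (cball 0 (3 * ?R)) x"
          using \<phi>(2)[of k x] \<phi>(3)[of x k] by (auto simp: indicator_def not_le)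
        then show "norm (h x * \<phi> k x) \<le> norm (h x * (2 * complex_of_real (indicator (cball 0 (3 * ?R)) x)))"
          unfolding norm_mult by (intro mult_left_mono) auto
      qed
    qed measurable
    then have "(LINT x|lborel. h x * b x) = 0"
      unfolding z[OF \<phi>(1)] using LIMSEQ_unique tendsto_const by blast
    also have "(\<lambda>x. h x * b x) = (\<lambda>x. complex_of_real (indicator (cball 0 ?R) x * norm (h x)))"
    proof
      fix x
      have "h x * cnj (sgn (h x)) = complex_of_real (norm (h x))"
        by (cases "h x = 0") (auto simp: sgn_div_norm scaleR_conv_of_real complex_norm_square[symmetric] power2_eq_square field_simps)
      then show "h x * b x = complex_of_real (indicator (cball 0 ?R) x * norm (h x))"
        by (auto simp: b_def split: split_indicator)
    qed
    finally have I0: "(LINT x|lborel. indicator (cball 0 ?R) x * norm (h x)) = 0"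
      by (simp only: integral_complex_of_real of_real_eq_0_iff)
    have "integrable lborel (\<lambda>x. indicator (cball 0 ?R) x * norm (h x))"
      by (rule Bochner_Integration.integrable_bound[OF hint]) (auto intro!: AE_I2 simp: norm_mult split: split_indicator)
    with I0 have "AE x in lborel. indicator (cball 0 ?R) x * norm (h x) = 0"
      by (subst (asm) integral_nonneg_eq_0_iff_AE) (auto intro!: AE_I2)
    then show ?thesis by eventually_elim (auto split: split_indicator)
  qed
  then have "AE x in lborel. \<forall>n. norm x \<le> real (Suc n) \<longrightarrow> h x = 0"
    unfolding AE_all_countable by blast
  then show ?thesis
    by eventually_elim (metis real_arch_simple less_imp_le_nat of_nat_mono order_trans lessI)
qed

text \<open>First truncate \<open>f\<close> in space and in size, then approximate the truncation by
  Schwartz functions that are uniformly bounded with supports in a common ball. Each step is an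
  instance of dominated convergence.\<close>

lemma Lp_schwartz_dense:
  fixes f :: "'a::euclidean_space \<Rightarrow> complex"
  assumes p: "1 \<le> p" and f: "f \<in> Lp_space p" and e: "e > 0"
  shows "\<exists>\<phi>. schwartz \<phi> \<and> (LINT x|lborel. norm (\<phi> x - f x) powr p) < e"
proof -
  note [measurable] = Lp_measurable[OF f]
  define F where "F n x = (if norm x \<le> real (Suc n) \<and> norm (f x) \<le> real (Suc n) then f x else 0)" for n x
  have [measurable]: "F n \<in> borel_measurable borel" for n unfolding F_def by measurable
  \<comment> \<open>The triangle inequality for p-th powers costs the factor
    \<open>2 powr p\<close>; two errors below \<open>d\<close> then add up to less than e/2.\<close>
  define d where "d = e / (2 powr p * 4)"
  have d: "d > 0" using e by (simp add: d_def)
  have "(\<lambda>n. LINT x|lborel. norm (F n x - f x) powr p) \<longlonglongrightarrow> (LINT x|(lborel::'a measure). 0)"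
  proof (rule integral_dominated_convergence[where w="\<lambda>x. norm (f x) powr p"])
    show "integrable lborel (\<lambda>x. norm (f x) powr p)" by (rule Lp_integrable[OF f])
    show "AE x in lborel. (\<lambda>n. norm (F n x - f x) powr p) \<longlonglongrightarrow> 0"
    proof (rule AE_I2)
      fix x
      obtain N where "max (norm x) (norm (f x)) \<le> real N" using real_arch_simple by blast
      then have "F n x = f x" if "n \<ge> N" for n using that by (auto simp: F_def)
      then have "\<forall>\<^sub>F n in sequentially. norm (F n x - f x) powr p = 0"
        using p by (intro eventually_sequentiallyI[of N]) simp
      then show "(\<lambda>n. norm (F n x - f x) powr p) \<longlonglongrightarrow> 0" by (rule tendsto_eventually)
    qed
    show "AE x in lborel. norm (norm (F n x - f x) powr p) \<le> norm (f x) powr p" for n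
      by (intro AE_I2) (auto simp: F_def)
  qed measurable
  then have "\<forall>\<^sub>F n in sequentially. (LINT x|lborel. norm (F n x - f x) powr p) < d"
    using d by (simp add: order_tendstoD)
  then obtain n where n: "(LINT x|lborel. norm (F n x - f x) powr p) < d"
    by (auto simp: eventually_sequentially)
  define R where "R = real (Suc n)"
  have R: "R > 0" by (simp add: R_def)
  have "\<exists>\<phi>. (\<forall>k::nat. schwartz (\<phi> k)) \<and> (\<forall>k x. norm (\<phi> k x) \<le> R + 1) \<and>
      (\<forall>k x. 3 * R \<le> norm x \<longrightarrow> \<phi> k x = 0) \<and> (AE x in lborel. (\<lambda>k. \<phi> k x) \<longlonglongrightarrow> F n x)"
    by (rule bounded_approx_schwartz) (auto simp: F_def R_def)
  then obtain \<phi> where \<phi>: "\<And>k. schwartz (\<phi> k)" "\<And>k x. norm (\<phi> k x) \<le> R + 1"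
       "\<And>k x. 3 * R \<le> norm x \<Longrightarrow> \<phi> k x = 0" "AE x in lborel. (\<lambda>k::nat. \<phi> k x) \<longlonglongrightarrow> F n x"
    by blast
  have cint: "integrable lborel (\<lambda>x::'a. indicator (cball 0 (3 * R)) x :: real)"
    by (rule integrable_indicator_cball)
  have [measurable]: "\<phi> k \<in> borel_measurable borel" for k by (rule schwartz_measurable[OF \<phi>(1)])
  have "(\<lambda>k. LINT x|lborel. norm (\<phi> k x - F n x) powr p) \<longlonglongrightarrow> (LINT x|(lborel::'a measure). 0)"
  proof (rule integral_dominated_convergence)
    show "integrable lborel (\<lambda>x::'a. (2 * R + 1) powr p * indicator (cball 0 (3 * R)) x)"
      by (intro integrable_mult_right cint)
    show "AE x in lborel. (\<lambda>k. norm (\<phi> k x - F n x) powr p) \<longlonglongrightarrow> 0"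
      using \<phi>(4)
    proof eventually_elim
      case (elim x)
      then have "(\<lambda>k. norm (\<phi> k x - F n x)) \<longlonglongrightarrow> 0" by (simp add: LIM_zero tendsto_norm_zero)
      then have "(\<lambda>k. norm (\<phi> k x - F n x) powr p) \<longlonglongrightarrow> 0 powr p"
        using p by (intro tendsto_powr2) auto
      then show ?case using p by simp
    qed
    show "AE x in lborel. norm (norm (\<phi> k x - F n x) powr p) \<le> (2 * R + 1) powr p * indicator (cball 0 (3 * R)) x" for k
    proof (rule AE_I2)
      fix x
      have F: "norm (F n x) \<le> R" by (simp add: F_def R_def)
      show "norm (norm (\<phi> k x - F n x) powr p) \<le> (2 * R + 1) powr p * indicator (cball 0 (3 * R)) x"
      proof (cases "norm x \<le> 3 * R")
        case True
        have "norm (\<phi> k x - F n x) \<le> 2 * R + 1"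
          using norm_triangle_ineq4[of "\<phi> k x" "F n x"] \<phi>(2)[of k x] F by linarith
        then show ?thesis using True p by (auto intro: powr_mono2)
      next
        case False
        then have "F n x = 0" "\<phi> k x = 0" using \<phi>(3)[of x k] R by (auto simp: F_def R_def)
        then show ?thesis using p by simp
      qed
    qed
  qed measurable
  then have "\<forall>\<^sub>F k in sequentially. (LINT x|lborel. norm (\<phi> k x - F n x) powr p) < d"
    using d by (simp add: order_tendstoD)
  then obtain k where k: "(LINT x|lborel. norm (\<phi> k x - F n x) powr p) < d"
    by (auto simp: eventually_sequentially)
  have FLp: "F n \<in> Lp_space p"
  proof -
    have "integrable lborel (\<lambda>x. norm (F n x) powr p)"
      by (rule Bochner_Integration.integrable_bound[OF Lp_integrable[OF f]]) (auto intro!: AE_I2 simp: F_def)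
    then show ?thesis by (simp add: Lp_space_def)
  qed
  have i1: "integrable lborel (\<lambda>x. norm (\<phi> k x - F n x) powr p)"
    by (rule Lp_integrable[OF Lp_diff[OF p schwartz_Lp[OF p \<phi>(1)] FLp]])
  have i2: "integrable lborel (\<lambda>x. norm (F n x - f x) powr p)"
    by (rule Lp_integrable[OF Lp_diff[OF p FLp f]])
  have i3: "integrable lborel (\<lambda>x. norm (\<phi> k x - f x) powr p)"
    by (rule Lp_integrable[OF Lp_diff[OF p schwartz_Lp[OF p \<phi>(1)] f]])
  have "(LINT x|lborel. norm (\<phi> k x - f x) powr p) \<le>
     (LINT x|lborel. 2 powr p * (norm (\<phi> k x - F n x) powr p + norm (F n x - f x) powr p))"
  proof (intro integral_mono integrable_mult_right Bochner_Integration.integrable_add i1 i2 i3)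
    show "norm (\<phi> k x - f x) powr p \<le> 2 powr p * (norm (\<phi> k x - F n x) powr p + norm (F n x - f x) powr p)" for x
      using norm_add_powr_le[OF p, of "\<phi> k x - F n x" "F n x - f x"] by simp
  qed
  also have "\<dots> = 2 powr p * ((LINT x|lborel. norm (\<phi> k x - F n x) powr p) + (LINT x|lborel. norm (F n x - f x) powr p))"
    using i1 i2 by simp
  also have "\<dots> < 2 powr p * (d + d)"
    using n k by (intro mult_strict_left_mono add_strict_mono) auto
  also have "\<dots> \<le> e" using e by (simp add: d_def field_simps)
  finally show ?thesis using \<phi>(1) by blast
qed

section \<open>The multiplier as a convolution with an integrable kernel\<close>

lemma integral_erlang:
  assumes "0 < c"
  shows "integrable lborel (\<lambda>t. indicator {0<..} t * (t ^ k / fact k * exp (- c * t)) :: real)"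
    and "(LINT t|lborel. indicator {0<..} t * (t ^ k / fact k * exp (- c * t))) = 1 / c ^ Suc k"
proof -
  interpret prob_space "density lborel (erlang_density k c)"
    by (rule prob_space_erlang_density[OF assms])
  have nn: "(\<integral>\<^sup>+t. ennreal (erlang_density k c t) \<partial>lborel) = 1"
    using emeasure_space_1 by (simp add: emeasure_density)
  have int: "integrable lborel (erlang_density k c)"
    by (rule integrableI_nonneg) (use assms nn in auto)
  have one: "(LINT t|lborel. erlang_density k c t) = 1"
    by (subst integral_eq_nn_integral) (use assms nn in auto)
  have ae: "AE t in lborel. indicator {0<..} t * (t ^ k / fact k * exp (- c * t)) = erlang_density k c t / c ^ Suc k"
    using AE_lborel_singleton[of "0::real"]
    by eventually_elim (use assms in \<open>auto simp: erlang_density_def split: split_indicator\<close>)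
  show "integrable lborel (\<lambda>t. indicator {0<..} t * (t ^ k / fact k * exp (- c * t)) :: real)"
    by (subst integrable_cong_AE[OF _ _ ae]) (auto intro!: integrable_divide int)
  show "(LINT t|lborel. indicator {0<..} t * (t ^ k / fact k * exp (- c * t))) = 1 / c ^ Suc k"
    by (subst integral_cong_AE[OF _ _ ae]) (auto simp: one)
qed

text \<open>The binomial coefficients are of order n^(-s-1), which is summable because s > 0.
  Absolute summability at the edge of the disc of convergence is what makes the kernel integrable
  over all times.\<close>

lemma summable_gbinomial:
  assumes s: "0 < (s::real)"
  shows "summable (\<lambda>n. \<bar>s gchoose n\<bar>)"
proof -
  have "Bseq (\<lambda>n. (s gchoose n) / ((-1) ^ n / exp ((s + 1) * of_real (ln (real n)))))"
    by (rule convergent_imp_Bseq) (use gbinomial_asymptotic[of s] in \<open>auto simp: convergent_def\<close>)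
  then obtain C where C: "C > 0" "\<And>n. norm ((s gchoose n) / ((-1) ^ n / exp ((s + 1) * of_real (ln (real n))))) \<le> C"
    by (auto simp: Bseq_def)
  have "\<bar>s gchoose n\<bar> \<le> C * real n powr (- (s + 1))" if "n \<ge> 1" for n
  proof -
    have "\<bar>s gchoose n\<bar> * exp ((s + 1) * ln (real n)) \<le> C"
      using C(2)[of n] by (simp add: abs_mult abs_divide power_abs)
    then have "\<bar>s gchoose n\<bar> \<le> C / exp ((s + 1) * ln (real n))"
      by (subst pos_le_divide_eq) auto
    also have "\<dots> = C * real n powr (- (s + 1))"
      using that by (simp only: powr_def exp_minus divide_inverse mult_minus_left) simp
    finally show ?thesis .
  qed
  then have ev: "\<forall>\<^sub>F n in sequentially. norm \<bar>s gchoose n\<bar> \<le> C * real n powr (- (s + 1))"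
    by (intro eventually_sequentiallyI[of 1]) simp
  have "summable (\<lambda>n. C * real n powr (- (s + 1)))"
    using s by (intro summable_mult) (simp add: summable_real_powr_iff)
  then show ?thesis by (rule summable_comparison_test_ev[OF ev])
qed

text \<open>
  Expand \<open>(1 - 1 / (1 + l))\<^sup>s\<close> binomially; the powers of \<open>1 / (1 +
  l)\<close> are Laplace transforms of Erlang densities.
\<close>

lemma kappa_exists:
  assumes s: "0 < (s::real)"
  shows "\<exists>\<kappa>. integrable lborel \<kappa> \<and> (\<forall>t\<le>0. \<kappa> t = 0) \<and>
    (\<forall>l>0. (l / (1 + l)) powr s - 1 = (LINT t|lborel. \<kappa> t * exp (- t * l)))"
proof -
  \<comment> \<open>The index is shifted by one because the constant term 1 of the binomial series
    is subtracted in the claim.\<close>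
  define a where "a k = (s gchoose Suc k) * (-1) ^ Suc k" for k
  have a_sum: "summable (\<lambda>k. \<bar>a k\<bar>)"
    using summable_gbinomial[OF s] by (subst (asm) summable_Suc_iff[symmetric]) (simp add: a_def abs_mult power_abs)
  define f where "f l k t = a k * (indicator {0<..} t * (t ^ k / fact k * exp (- (1 + l) * t)))" for l :: real and k t
  have f_int: "integrable lborel (f l k)" and f_val: "(LINT t|lborel. f l k t) = a k / (1 + l) ^ Suc k"
    and f_norm: "(LINT t|lborel. norm (f l k t)) = \<bar>a k\<bar> / (1 + l) ^ Suc k" if "0 \<le> l" for l k
  proof -
    have "0 < 1 + l" using that by simp
    note E = integral_erlang[OF this, of k]
    show "integrable lborel (f l k)" unfolding f_def by (intro integrable_mult_right E)
    show "(LINT t|lborel. f l k t) = a k / (1 + l) ^ Suc k"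
      unfolding f_def integral_mult_right_zero E(2) by simp
    have "norm (f l k t) = \<bar>a k\<bar> * (indicator {0<..} t * (t ^ k / fact k * exp (- (1 + l) * t)))" for t
      by (auto simp: f_def abs_mult split: split_indicator)
    then show "(LINT t|lborel. norm (f l k t)) = \<bar>a k\<bar> / (1 + l) ^ Suc k"
      by (simp only: integral_mult_right_zero E(2)) simp
  qed
  have summ: "summable (\<lambda>k. norm (f l k t))" if l: "0 \<le> l" for l t
  proof -
    obtain B where B: "\<And>k. \<bar>a k\<bar> \<le> B"
      using summable_imp_Bseq[OF a_sum] by (auto simp: Bseq_def)
    have "summable (\<lambda>k. B * (\<bar>t\<bar> ^ k / fact k))"
      using summable_exp[of "\<bar>t\<bar>"] by (intro summable_mult) (simp add: field_simps)
    moreover have "norm (norm (f l k t)) \<le> B * (\<bar>t\<bar> ^ k / fact k)" for k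
    proof (cases "t > 0")
      case True
      have "exp (- (1 + l) * t) \<le> 1" using True l by (simp add: mult_nonpos_nonneg)
      then have "\<bar>a k\<bar> * (t ^ k / fact k * exp (- (1 + l) * t)) \<le> B * (t ^ k / fact k * 1)"
        using True B[of k] by (intro mult_mono mult_left_mono) (auto intro: order_trans[OF abs_ge_zero])
      then show ?thesis using True by (simp add: f_def abs_mult)
    next
      case False
      have "B \<ge> 0" using B[of 0] abs_ge_zero order_trans by blast
      then show ?thesis using False by (simp add: f_def)
    qed
    ultimately show ?thesis using summable_comparison_test'[of "\<lambda>k. B * (\<bar>t\<bar> ^ k / fact k)" 0 "\<lambda>k. norm (f l k t)"] by simp
  qed
  have summI: "summable (\<lambda>k. LINT t|lborel. norm (f l k t))" if "0 \<le> l" for l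
    unfolding f_norm[OF that]
  proof (rule summable_comparison_test'[OF a_sum, where N=0])
    show "norm (\<bar>a n\<bar> / (1 + l) ^ Suc n) \<le> \<bar>a n\<bar>" for n
    proof -
      have "1 \<le> (1 + l) ^ Suc n" using that by (intro one_le_power) simp
      then have "\<bar>a n\<bar> / (1 + l) ^ Suc n \<le> \<bar>a n\<bar> / 1" by (intro divide_left_mono) auto
      then show ?thesis using that by simp
    qed
  qed
  \<comment> \<open>At l = 0 the k-th term is \<open>a k\<close> times a probability density, so the
    L^1 norms add up to the sum of \<open>\<bar>a k\<bar>\<close>. A positive l only inserts the
    factor exp(-t l).\<close>
  define \<kappa> where "\<kappa> t = (\<Sum>k. f 0 k t)" for t
  have "integrable lborel \<kappa>"
    unfolding \<kappa>_def by (rule integrable_suminf) (use f_int[of 0] summ[of 0] summI[of 0] in auto)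
  moreover have "\<kappa> t = 0" if "t \<le> 0" for t
    using that by (simp add: \<kappa>_def f_def)
  moreover have "(l / (1 + l)) powr s - 1 = (LINT t|lborel. \<kappa> t * exp (- t * l))" if l: "l > 0" for l
  proof -
    have fl: "f 0 k t * exp (- t * l) = f l k t" for k t
    proof -
      have "exp (- (1 + l) * t) = exp (- (1 + 0) * t) * exp (- t * l)"
        unfolding exp_add[symmetric] by (simp add: algebra_simps)
      then show ?thesis by (simp add: f_def)
    qed
    have "(LINT t|lborel. \<kappa> t * exp (- t * l)) = (LINT t|lborel. (\<Sum>k. f l k t))"
      unfolding \<kappa>_def fl[symmetric]
      by (intro Bochner_Integration.integral_cong refl suminf_mult2) (rule summable_norm_cancel[OF summ[OF order_refl]])
    also have "\<dots> = (\<Sum>k. a k / (1 + l) ^ Suc k)"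
      using l f_int[of l] summ[of l] summI[of l] by (subst integral_suminf) (auto simp: f_val simp del: power_Suc)
    also have "\<dots> = (l / (1 + l)) powr s - 1"
    proof -
      have "(\<lambda>n. (s gchoose n) * (- 1 / (1 + l)) ^ n) sums (1 + (- 1 / (1 + l))) powr s"
        using l by (intro gen_binomial_real) auto
      then have "(\<lambda>n. (s gchoose Suc n) * (- 1 / (1 + l)) ^ Suc n) sums ((1 + (- 1 / (1 + l))) powr s - 1)"
        by (subst sums_Suc_iff) simp
      moreover have "(s gchoose Suc n) * (- 1 / (1 + l)) ^ Suc n = a n / (1 + l) ^ Suc n" for n
        by (simp only: a_def power_divide times_divide_eq_right)
      moreover have "1 + (- 1 / (1 + l)) = l / (1 + l)" using l by (simp add: field_simps)
      ultimately show ?thesis by (simp only: sums_iff)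
    qed
    finally show ?thesis by simp
  qed
  ultimately show ?thesis by blast
qed

lemma Fubini_integrable_real:
  fixes F :: "'a::euclidean_space \<Rightarrow> 'b::euclidean_space \<Rightarrow> 'c::{banach, second_countable_topology}"
  assumes [measurable]: "(\<lambda>(x, y). F x y) \<in> borel_measurable (borel \<Otimes>\<^sub>M borel)"
    and "\<And>x. integrable lborel (F x)" and "\<And>x. (LINT y|lborel. norm (F x y)) = g x" and "integrable lborel g"
  shows "integrable (lborel \<Otimes>\<^sub>M lborel) (\<lambda>(x, y). F x y)"
proof (rule lborel_pair.Fubini_integrable)
  show "(\<lambda>(x, y). F x y) \<in> borel_measurable (lborel \<Otimes>\<^sub>M lborel)"
    by (simp del: borel_prod) measurable
qed (use assms in \<open>auto intro!: AE_I2\<close>)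

lemma integrable_conv:
  fixes f g :: "'a::euclidean_space \<Rightarrow> real"
  assumes f: "integrable lborel f" and g: "integrable lborel g"
  shows "integrable (lborel \<Otimes>\<^sub>M lborel) (\<lambda>(y, x). g y * f (x + c *\<^sub>R y))"
proof (rule Fubini_integrable_real)
  have [measurable]: "f \<in> borel_measurable borel" "g \<in> borel_measurable borel" using f g by auto
  show "(\<lambda>(y, x). g y * f (x + c *\<^sub>R y)) \<in> borel_measurable (borel \<Otimes>\<^sub>M borel)" by measurable
  show "integrable lborel (\<lambda>x. g y * f (x + c *\<^sub>R y))" for y
    by (intro integrable_mult_right integrable_translate f)
  show "(LINT x|lborel. norm (g y * f (x + c *\<^sub>R y))) = \<bar>g y\<bar> * (LINT x|lborel. \<bar>f x\<bar>)" for y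
    using integral_translate[of "\<lambda>x. \<bar>f x\<bar>" "c *\<^sub>R y"] by (simp add: abs_mult)
  show "integrable lborel (\<lambda>y. \<bar>g y\<bar> * (LINT x|lborel. \<bar>f x\<bar>))"
    by (intro integrable_mult_left integrable_abs g)
qed

lemma fourier_heat:
  assumes t: "0 < t"
  shows "fourier (\<lambda>x. complex_of_real (heat t x)) \<xi> = gauss t \<xi>"
proof -
  have pos: "0 < 1 / (4 * t)" using t by simp
  have eq: "(\<lambda>x. complex_of_real (heat t x)) = (\<lambda>x::'a. (1 / complex_of_real (sqrt (4 * pi * t) ^ DIM('a))) * gauss (1 / (4 * t)) x)"
    by (auto simp: heat_def gauss_def)
  have "fourier (\<lambda>x. complex_of_real (heat t x)) \<xi> =
     (1 / complex_of_real (sqrt (4 * pi * t) ^ DIM('a))) * (complex_of_real (sqrt (pi / (1 / (4 * t))) ^ DIM('a)) * gauss (1 / (4 * (1 / (4 * t)))) \<xi>)"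
    unfolding eq fourier_cmult fourier_gauss[OF pos] ..
  also have "sqrt (pi / (1 / (4 * t))) = sqrt (4 * pi * t)" by (simp add: mult_ac)
  also have "1 / (4 * (1 / (4 * t))) = t" using t by simp
  finally show ?thesis using t by simp
qed

definition conv :: "('a::euclidean_space \<Rightarrow> real) \<Rightarrow> ('a \<Rightarrow> complex) \<Rightarrow> 'a \<Rightarrow> complex" where
  "conv K f x = (LINT y|lborel. complex_of_real (K y) * f (x - y))"

text \<open>
  At \<open>l = |\<xi>|\<^sup>2\<close> the Laplace kernel is the Fourier transform of the
  heat kernel.
\<close>

lemma kernel_exists:
  assumes s: "0 < (s::real)"
  shows "\<exists>K::'a::euclidean_space \<Rightarrow> real. integrable lborel K \<and> (\<forall>x. K (- x) = K x) \<and>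
    (\<forall>\<xi>. \<xi> \<noteq> 0 \<longrightarrow> 1 + fourier (\<lambda>x. complex_of_real (K x)) \<xi> =
       complex_of_real (norm \<xi> powr (2 * s) * japanese_bracket \<xi> powr (- (2 * s))))"
proof -
  obtain \<kappa> where \<kappa>: "integrable lborel \<kappa>" "\<And>t. t \<le> 0 \<Longrightarrow> \<kappa> t = 0"
    and lap: "\<And>l. l > 0 \<Longrightarrow> (l / (1 + l)) powr s - 1 = (LINT t|lborel. \<kappa> t * exp (- t * l))"
    using kappa_exists[OF s] by blast
  have [measurable]: "\<kappa> \<in> borel_measurable borel" using \<kappa> by auto
  have heat_m [measurable]: "(\<lambda>(t, x::'a). heat t x) \<in> borel_measurable (borel \<Otimes>\<^sub>M borel)"
    unfolding heat_def by measurable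
  \<comment> \<open>A superposition of heat kernels. Since \<open>\<kappa>\<close> vanishes for t
    \<le> 0, only genuine kernels of mass 1 enter, so integrability over the product reduces to that
    of \<open>\<kappa>\<close>, and evenness is inherited.\<close>
  define K where "K x = (LINT t|lborel. \<kappa> t * heat t x)" for x :: 'a
  have prod: "integrable (lborel \<Otimes>\<^sub>M lborel) (\<lambda>(t, x::'a). \<kappa> t * heat t x)"
  proof (rule Fubini_integrable_real)
    show "(\<lambda>(t, x::'a). \<kappa> t * heat t x) \<in> borel_measurable (borel \<Otimes>\<^sub>M borel)" by measurable
    show "integrable lborel (\<lambda>x::'a. \<kappa> t * heat t x)" for t
      using \<kappa>(2)[of t] by (cases "t \<le> 0") (auto intro!: integrable_mult_right heat_integrable)
    show "(LINT x|lborel. norm (\<kappa> t * heat t (x::'a))) = \<bar>\<kappa> t\<bar>" for t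
      using \<kappa>(2)[of t] by (cases "t \<le> 0") (auto simp: abs_mult heat_integrable)
    show "integrable lborel (\<lambda>t. \<bar>\<kappa> t\<bar>)" using \<kappa> by simp
  qed
  have "integrable lborel K"
    unfolding K_def[abs_def] by (rule lborel_pair.integrable_snd[OF prod])
  moreover have "K (- x) = K x" for x by (simp add: K_def heat_minus)
  moreover have "1 + fourier (\<lambda>x. complex_of_real (K x)) \<xi> =
       complex_of_real (norm \<xi> powr (2 * s) * japanese_bracket \<xi> powr (- (2 * s)))" if \<xi>: "\<xi> \<noteq> 0" for \<xi> :: 'a
  proof -
    let ?G = "\<lambda>t x. complex_of_real (\<kappa> t * heat t x) * exp (- \<i> * complex_of_real (x \<bullet> \<xi>))"
    have "fourier (\<lambda>x. complex_of_real (K x)) \<xi> = (LINT x|lborel. LINT t|lborel. ?G t x)"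
      unfolding fourier_def K_def integral_mult_left_zero integral_complex_of_real ..
    also have "\<dots> = (LINT t|lborel. LINT x|lborel. ?G t x)"
    proof (rule lborel_pair.Fubini_integral)
      show "integrable (lborel \<Otimes>\<^sub>M lborel) (\<lambda>(t, x). ?G t x)"
      proof (rule Bochner_Integration.integrable_bound[OF prod])
        show "(\<lambda>(t, x). ?G t x) \<in> borel_measurable (lborel \<Otimes>\<^sub>M lborel)"
          by measurable
      qed (auto intro!: AE_I2 simp: norm_mult simp del: of_real_mult)
    qed
    also have "\<dots> = (LINT t|lborel. complex_of_real (\<kappa> t * exp (- t * (\<xi> \<bullet> \<xi>))))"
    proof (intro Bochner_Integration.integral_cong refl)
      fix t :: real
      show "(LINT x|lborel. ?G t x) = complex_of_real (\<kappa> t * exp (- t * (\<xi> \<bullet> \<xi>)))"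
      proof (cases "t \<le> 0")
        case False
        have "(LINT x|lborel. ?G t x) = \<kappa> t * fourier (\<lambda>x. complex_of_real (heat t x)) \<xi>"
          unfolding fourier_def by (simp add: mult.assoc)
        then show ?thesis using False by (simp add: fourier_heat gauss_def)
      qed (simp add: \<kappa>(2))
    qed
    also have "\<dots> = complex_of_real (((\<xi> \<bullet> \<xi>) / (1 + \<xi> \<bullet> \<xi>)) powr s - 1)"
      using lap[of "\<xi> \<bullet> \<xi>"] \<xi> by (simp add: integral_complex_of_real del: of_real_mult)
    finally have "1 + fourier (\<lambda>x. complex_of_real (K x)) \<xi> = complex_of_real (((\<xi> \<bullet> \<xi>) / (1 + \<xi> \<bullet> \<xi>)) powr s)"
      by simp
    also have "((\<xi> \<bullet> \<xi>) / (1 + \<xi> \<bullet> \<xi>)) powr s = norm \<xi> powr (2 * s) * japanese_bracket \<xi> powr (- (2 * s))"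
    proof -
      have "norm \<xi> powr (2 * s) = (\<xi> \<bullet> \<xi>) powr s"
        by (metis norm_ge_zero power2_norm_eq_inner powr_numeral powr_powr)
      moreover have "japanese_bracket \<xi> powr (- (2 * s)) = inverse ((1 + \<xi> \<bullet> \<xi>) powr s)"
        by (simp add: japanese_bracket_powr powr_minus)
      moreover have "((\<xi> \<bullet> \<xi>) / (1 + \<xi> \<bullet> \<xi>)) powr s = (\<xi> \<bullet> \<xi>) powr s / (1 + \<xi> \<bullet> \<xi>) powr s"
        by (rule powr_divide)
      ultimately show ?thesis by (simp only: divide_inverse)
    qed
    finally show ?thesis .
  qed
  ultimately show ?thesis by blast
qed

lemma conv_inverse_fourier:
  fixes h :: "'a::euclidean_space \<Rightarrow> complex"
  assumes h: "integrable lborel h" and K: "integrable lborel K"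
  shows "conv K (inverse_fourier h) x = inverse_fourier (\<lambda>\<xi>. h \<xi> * fourier (\<lambda>x. complex_of_real (K x)) \<xi>) x"
  using integral_inverse_fourier_kernel[OF h, of "\<lambda>x. complex_of_real (K x)" x] K
  by (simp add: conv_def mult.commute)

section \<open>Convolution with an integrable kernel on L^p\<close>

lemma conv_measurable:
  assumes [measurable]: "K \<in> borel_measurable borel" "f \<in> borel_measurable borel"
  shows "conv K f \<in> borel_measurable borel"
  unfolding conv_def[abs_def] by measurable

text \<open>A form of Young's inequality, with a constant that is not sharp. In place of Hoelder's
  inequality the pointwise bound a \<le> c^(1-p) a^p + c is integrated against |K|, and the
  parameter c > 0 is then chosen separately for each point x. The function \<open>G\<close>, the
  convolution of |K| with |f|^p, is integrable by Fubini, which also makes the inner integrals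
  finite almost everywhere.\<close>

lemma conv_Lp:
  fixes K :: "'a::euclidean_space \<Rightarrow> real"
  assumes p: "1 \<le> p" and K: "integrable lborel K" and f: "f \<in> Lp_space p"
  shows "conv K f \<in> Lp_space p"
    and "(LINT x|lborel. norm (conv K f x) powr p) \<le>
      ((1 + (LINT y|lborel. \<bar>K y\<bar>)) powr p * (LINT y|lborel. \<bar>K y\<bar>)) * (LINT x|lborel. norm (f x) powr p)"
proof -
  note [measurable] = Lp_measurable[OF f]
  have [measurable]: "K \<in> borel_measurable borel" using K by auto
  define N where "N = (LINT y|lborel. \<bar>K y\<bar>)"
  have N: "N \<ge> 0" unfolding N_def by simp
  have prod: "integrable (lborel \<Otimes>\<^sub>M lborel) (\<lambda>(y, x). \<bar>K y\<bar> * norm (f (x + (-1) *\<^sub>R y)) powr p)"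
    by (rule integrable_conv[OF Lp_integrable[OF f]]) (use K in simp)
  define G where "G x = (LINT y|lborel. \<bar>K y\<bar> * norm (f (x - y)) powr p)" for x
  have G_int: "integrable lborel G"
    using lborel_pair.integrable_snd[OF prod] by (simp add: G_def[abs_def])
  have G_val: "(LINT x|lborel. G x) = N * (LINT x|lborel. norm (f x) powr p)"
  proof -
    have "(LINT x|lborel. G x) = (LINT y|lborel. LINT x|lborel. \<bar>K y\<bar> * norm (f (x - y)) powr p)"
      using lborel_pair.Fubini_integral[OF prod] by (simp add: G_def)
    also have "\<dots> = (LINT y|lborel. \<bar>K y\<bar> * (LINT x|lborel. norm (f x) powr p))"
      using integral_translate[of "\<lambda>x. norm (f x) powr p" "- _"] by simp
    finally show ?thesis by (simp add: N_def)
  qed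
  have ae: "AE x in lborel. integrable lborel (\<lambda>y. \<bar>K y\<bar> * norm (f (x - y)) powr p)"
    using lborel_pair.AE_integrable_snd[OF prod] by simp
  have le: "AE x in lborel. norm (conv K f x) powr p \<le> (1 + N) powr p * G x"
    using ae
  proof eventually_elim
    case (elim x)
    have tang: "norm (conv K f x) \<le> c powr (1 - p) * G x + c * N" if c: "c > 0" for c
    proof -
      have i: "integrable lborel (\<lambda>y. c powr (1 - p) * (\<bar>K y\<bar> * norm (f (x - y)) powr p) + c * \<bar>K y\<bar>)"
        using elim K by (intro Bochner_Integration.integrable_add integrable_mult_right) auto
      have ptw: "\<bar>K y\<bar> * norm (f (x - y)) \<le> c powr (1 - p) * (\<bar>K y\<bar> * norm (f (x - y)) powr p) + c * \<bar>K y\<bar>" for y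
      proof -
        let ?a = "norm (f (x - y))"
        have "?a \<le> c powr (1 - p) * ?a powr p + c"
        proof (cases "?a \<le> c")
          case True
          then show ?thesis by (simp add: add_increasing)
        next
          case False
          then have a: "?a > 0" "?a \<ge> c" using c by auto
          have "?a = ?a powr (1 - p) * ?a powr p" using a by (simp add: powr_add[symmetric])
          also have "\<dots> \<le> c powr (1 - p) * ?a powr p"
            using p c a by (intro mult_right_mono powr_mono2') auto
          finally show ?thesis using c by linarith
        qed
        then have "\<bar>K y\<bar> * ?a \<le> \<bar>K y\<bar> * (c powr (1 - p) * ?a powr p + c)" by (intro mult_left_mono) auto
        then show ?thesis by (simp add: algebra_simps)
      qed
      have "norm (conv K f x) \<le> (LINT y|lborel. norm (complex_of_real (K y) * f (x - y)))"
        unfolding conv_def by (rule integral_norm_bound)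
      also have "\<dots> \<le> (LINT y|lborel. c powr (1 - p) * (\<bar>K y\<bar> * norm (f (x - y)) powr p) + c * \<bar>K y\<bar>)"
        by (rule integral_mono_AE'[OF i]) (use ptw c in \<open>auto intro!: AE_I2 add_nonneg_nonneg simp: norm_mult\<close>)
      also have "\<dots> = c powr (1 - p) * G x + c * N"
        using elim K by (simp add: G_def N_def)
      finally show ?thesis .
    qed
    have G0: "G x \<ge> 0" unfolding G_def by (intro Bochner_Integration.integral_nonneg) auto
    show ?case
    proof (cases "G x = 0")
      case True
      \<comment> \<open>Here the bound is c N for every c > 0, and c may tend to 0.\<close>
      have "norm (conv K f x) \<le> 0"
      proof (rule field_le_epsilon)
        fix e :: real assume e: "e > 0"
        have "norm (conv K f x) \<le> (e / (1 + N)) * N"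
          using tang[of "e / (1 + N)"] e N True by simp
        also have "\<dots> \<le> e" using e N by (simp add: field_simps)
        finally show "norm (conv K f x) \<le> 0 + e" by simp
      qed
      then show ?thesis using True p by simp
    next
      case False
      then have Gp: "G x > 0" using G0 by simp
      \<comment> \<open>This choice balances the two terms: \<open>c powr (1 - p) * G x\<close>
        becomes \<open>c\<close> itself.\<close>
      define c where "c = G x powr (1 / p)"
      have c: "c > 0" using Gp by (simp add: c_def)
      have "c powr (1 - p) * G x = c"
      proof -
        have "c powr (1 - p) = G x powr (1 / p - 1)"
          using p by (simp add: c_def powr_powr field_simps)
        moreover have "G x powr (1 / p - 1) * G x = G x powr (1 / p)"
          using Gp by (simp add: powr_diff)
        ultimately show ?thesis by (simp add: c_def)
      qed
      then have "norm (conv K f x) \<le> (1 + N) * c"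
        using tang[OF c] by (simp add: algebra_simps)
      then have "norm (conv K f x) powr p \<le> ((1 + N) * c) powr p"
        using p by (intro powr_mono2) auto
      also have "\<dots> = (1 + N) powr p * G x"
        using N c p Gp by (simp add: powr_mult c_def powr_powr)
      finally show ?thesis .
    qed
  qed
  have m: "conv K f \<in> borel_measurable borel" by (rule conv_measurable) measurable
  have int: "integrable lborel (\<lambda>x. norm (conv K f x) powr p)"
  proof (rule Bochner_Integration.integrable_bound)
    show "integrable lborel (\<lambda>x. (1 + N) powr p * G x)" by (intro integrable_mult_right G_int)
    show "AE x in lborel. norm (norm (conv K f x) powr p) \<le> norm ((1 + N) powr p * G x)"
      using le by eventually_elim (simp add: order_trans[OF _ abs_ge_self])
  qed (use m in measurable)
  show "conv K f \<in> Lp_space p" using m int by (simp add: Lp_space_def)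
  have "(LINT x|lborel. norm (conv K f x) powr p) \<le> (LINT x|lborel. (1 + N) powr p * G x)"
    by (intro integral_mono_AE int integrable_mult_right G_int le)
  then show "(LINT x|lborel. norm (conv K f x) powr p) \<le>
      ((1 + (LINT y|lborel. \<bar>K y\<bar>)) powr p * (LINT y|lborel. \<bar>K y\<bar>)) * (LINT x|lborel. norm (f x) powr p)"
    by (simp add: G_val flip: N_def)
qed

lemma integral_conv_swap:
  fixes K :: "'a::euclidean_space \<Rightarrow> real"
  assumes p: "1 \<le> p" and K: "integrable lborel K" "\<And>x. K (- x) = K x" and f: "f \<in> Lp_space p"
    and g: "integrable lborel g" "\<And>x. norm (g x) \<le> B"
  shows "(LINT x|lborel. conv K f x * g x) = (LINT x|lborel. f x * conv K g x)"
proof -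
  note [measurable] = Lp_measurable[OF f]
  have [measurable]: "K \<in> borel_measurable borel" "g \<in> borel_measurable borel" using K g by auto
  have B0: "0 \<le> B" using g(2) norm_ge_zero order_trans by blast
  have bd: "norm (f a) * norm (g b) \<le> norm (g b) + B * norm (f a) powr p" for a b
  proof -
    have "norm (f a) * norm (g b) \<le> (1 + norm (f a) powr p) * norm (g b)"
      using p by (intro mult_right_mono le_one_plus_powr) auto
    also have "\<dots> \<le> norm (g b) + norm (f a) powr p * B"
      unfolding distrib_right by (simp add: mult_left_mono g(2))
    finally show ?thesis by (simp add: mult.commute)
  qed
  have K': "integrable lborel (\<lambda>y. \<bar>K y\<bar>)" using K by simp
  have gn: "integrable lborel (\<lambda>y. norm (g y))" using g by simp
  have prod1: "integrable (lborel \<Otimes>\<^sub>M lborel) (\<lambda>(y, x). complex_of_real (K y) * f (x - y) * g x)"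
  proof (rule Bochner_Integration.integrable_bound)
    show "integrable (lborel \<Otimes>\<^sub>M lborel) (\<lambda>z. (case z of (y, x) \<Rightarrow> \<bar>K y\<bar> * norm (g (x + 0 *\<^sub>R y)))
        + B * (case z of (y, x) \<Rightarrow> \<bar>K y\<bar> * norm (f (x + (-1) *\<^sub>R y)) powr p))"
      by (intro Bochner_Integration.integrable_add integrable_mult_right integrable_conv gn K' Lp_integrable[OF f])
    show "AE z in lborel \<Otimes>\<^sub>M lborel. norm (case z of (y, x) \<Rightarrow> complex_of_real (K y) * f (x - y) * g x) \<le>
       norm ((case z of (y, x) \<Rightarrow> \<bar>K y\<bar> * norm (g (x + 0 *\<^sub>R y)))
        + B * (case z of (y, x) \<Rightarrow> \<bar>K y\<bar> * norm (f (x + (-1) *\<^sub>R y)) powr p))"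
      (is "AE z in _. ?L z \<le> ?R z")
    proof (rule AE_I2)
      fix z :: "'a \<times> 'a"
      obtain y x where z: "z = (y, x)" by fastforce
      have "\<bar>K y\<bar> * (norm (f (x - y)) * norm (g (x))) \<le> \<bar>K y\<bar> * norm (g (x)) + B * (\<bar>K y\<bar> * norm (f (x - y)) powr p)"
        using mult_left_mono[OF bd[of "x - y" "x"] abs_ge_zero[of "K y"]] by (simp add: distrib_left mult.left_commute[of B])
      then show "?L z \<le> ?R z"
        unfolding z by (simp add: norm_mult mult.assoc)
    qed
  qed measurable
  have prod2: "integrable (lborel \<Otimes>\<^sub>M lborel) (\<lambda>(y, x). complex_of_real (K y) * f x * g (x + y))"
  proof (rule Bochner_Integration.integrable_bound)
    show "integrable (lborel \<Otimes>\<^sub>M lborel) (\<lambda>z. (case z of (y, x) \<Rightarrow> \<bar>K y\<bar> * norm (g (x + 1 *\<^sub>R y)))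
        + B * (case z of (y, x) \<Rightarrow> \<bar>K y\<bar> * norm (f (x + 0 *\<^sub>R y)) powr p))"
      by (intro Bochner_Integration.integrable_add integrable_mult_right integrable_conv gn K' Lp_integrable[OF f])
    show "AE z in lborel \<Otimes>\<^sub>M lborel. norm (case z of (y, x) \<Rightarrow> complex_of_real (K y) * f x * g (x + y)) \<le>
       norm ((case z of (y, x) \<Rightarrow> \<bar>K y\<bar> * norm (g (x + 1 *\<^sub>R y)))
        + B * (case z of (y, x) \<Rightarrow> \<bar>K y\<bar> * norm (f (x + 0 *\<^sub>R y)) powr p))"
      (is "AE z in _. ?L z \<le> ?R z")
    proof (rule AE_I2)
      fix z :: "'a \<times> 'a"
      obtain y x where z: "z = (y, x)" by fastforce
      have "\<bar>K y\<bar> * (norm (f (x)) * norm (g (x + y))) \<le> \<bar>K y\<bar> * norm (g (x + y)) + B * (\<bar>K y\<bar> * norm (f (x)) powr p)"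
        using mult_left_mono[OF bd[of "x" "x + y"] abs_ge_zero[of "K y"]] by (simp add: distrib_left mult.left_commute[of B])
      then show "?L z \<le> ?R z"
        unfolding z by (simp add: norm_mult mult.assoc)
    qed
  qed measurable
  have "(LINT x|lborel. conv K f x * g x) = (LINT x|lborel. LINT y|lborel. complex_of_real (K y) * f (x - y) * g x)"
    by (simp add: conv_def)
  also have "\<dots> = (LINT y|lborel. LINT x|lborel. complex_of_real (K y) * f (x - y) * g x)"
    by (rule lborel_pair.Fubini_integral[OF prod1])
  also have "\<dots> = (LINT y|lborel. LINT x|lborel. complex_of_real (K y) * f x * g (x + y))"
    using integral_translate[of "\<lambda>x. complex_of_real (K y) * f (x - y) * g x" y for y] by simp
  also have "\<dots> = (LINT x|lborel. LINT y|lborel. complex_of_real (K y) * f x * g (x + y))"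
    by (rule lborel_pair.Fubini_integral[OF prod2, symmetric])
  also have "\<dots> = (LINT x|lborel. f x * conv K g x)"
  proof (intro Bochner_Integration.integral_cong refl)
    fix x
    have "(LINT y|lborel. complex_of_real (K y) * f x * g (x + y)) = f x * (LINT y|lborel. complex_of_real (K y) * g (x + y))"
      by (simp add: mult.assoc mult.left_commute[of _ "f x"])
    also have "(LINT y|lborel. complex_of_real (K y) * g (x + y)) = conv K g x"
      using integral_reflect[of "\<lambda>y. complex_of_real (K y) * g (x + y)" 0] by (simp add: conv_def K(2))
    finally show "(LINT y|lborel. complex_of_real (K y) * f x * g (x + y)) = f x * conv K g x" .
  qed
  finally show ?thesis .
qed

section \<open>Bessel potentials and the fractional Laplacian\<close>

definition jm :: "real \<Rightarrow> 'a::euclidean_space \<Rightarrow> complex" where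
  "jm a \<xi> = complex_of_real (japanese_bracket \<xi> powr a)"

text \<open>
  This is \<open>(1 - \<Delta>)\<close> to the power \<open>a/2\<close>, composed in the
  order in which duality unfolds \<^const>\<open>bessel_potential\<close>.
\<close>

definition Jop :: "real \<Rightarrow> ('a::euclidean_space \<Rightarrow> complex) \<Rightarrow> 'a \<Rightarrow> complex" where
  "Jop a \<theta> = fourier (\<lambda>\<xi>. jm a \<xi> * inverse_fourier \<theta> \<xi>)"

lemma temperate_jm: "temperate (jm a)"
  using temperate_japanese_bracket by (simp add: jm_def[abs_def])

lemma jm_add: "jm (a + b) \<xi> = jm a \<xi> * jm b \<xi>"
  by (simp add: jm_def powr_add)

lemma jm_0 [simp]: "jm 0 \<xi> = 1"
  using one_le_japanese_bracket[of \<xi>] by (simp add: jm_def)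

lemma jm_minus: "jm a (- \<xi>) = jm a \<xi>"
  by (simp add: jm_def japanese_bracket_def)

lemma scont_Jop: "scont (Jop a)"
  using scont_fourier[OF scont_mult[OF temperate_jm scont_inverse_fourier[OF scont_id]], of a]
  by (simp add: Jop_def[abs_def])

lemma schwartz_Jop: "schwartz \<theta> \<Longrightarrow> schwartz (Jop a \<theta>)"
  by (rule scont_schwartz[OF scont_Jop])

lemma inverse_fourier_Jop:
  "schwartz \<theta> \<Longrightarrow> inverse_fourier (Jop a \<theta>) = (\<lambda>\<xi>. jm a \<xi> * inverse_fourier \<theta> \<xi>)"
  unfolding Jop_def by (intro inverse_fourier_fourier schwartz_mult temperate_jm schwartz_inverse_fourier)

lemma fourier_eq_inverse: "fourier f \<xi> = (2 * complex_of_real pi) ^ DIM('a) * inverse_fourier f (- \<xi>)"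
  for f :: "'a::euclidean_space \<Rightarrow> complex"
  by (simp add: inverse_fourier_eq)

lemma fourier_Jop: "schwartz \<theta> \<Longrightarrow> fourier (Jop a \<theta>) = (\<lambda>\<xi>. jm a \<xi> * fourier \<theta> \<xi>)"
  by (simp add: fun_eq_iff fourier_eq_inverse inverse_fourier_Jop jm_minus)

lemma Jop_alt: "schwartz \<theta> \<Longrightarrow> Jop a \<theta> = inverse_fourier (\<lambda>\<xi>. jm a \<xi> * fourier \<theta> \<xi>)"
  using inverse_fourier_fourier[OF schwartz_Jop, of \<theta> a] by (simp only: fourier_Jop)

lemma Jop_Jop: "schwartz \<theta> \<Longrightarrow> Jop a (Jop b \<theta>) = Jop (a + b) \<theta>"
  unfolding Jop_def[of a] Jop_def[of "a + b"] by (simp add: inverse_fourier_Jop jm_add mult.assoc)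

lemma Jop_0: "schwartz \<theta> \<Longrightarrow> Jop 0 \<theta> = \<theta>"
  by (simp add: Jop_def fourier_inverse_fourier)

lemma Jop_inverse: "schwartz \<theta> \<Longrightarrow> Jop a (Jop (- a) \<theta>) = \<theta>" "schwartz \<theta> \<Longrightarrow> Jop (- a) (Jop a \<theta>) = \<theta>"
  by (simp_all add: Jop_Jop Jop_0)

lemma inverse_fourier_add:
  assumes "integrable lborel f" "integrable lborel g"
  shows "inverse_fourier (\<lambda>x. f x + g x) = (\<lambda>\<xi>. inverse_fourier f \<xi> + inverse_fourier g \<xi>)"
  by (simp add: inverse_fourier_eq[abs_def] fourier_add[OF assms] add_divide_distrib)

lemma inverse_fourier_cmult: "inverse_fourier (\<lambda>x. c * f x) = (\<lambda>\<xi>. c * inverse_fourier f \<xi>)"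
  by (simp add: inverse_fourier_eq[abs_def] fourier_cmult)

lemma Jop_add:
  assumes "schwartz f" "schwartz g"
  shows "Jop a (\<lambda>x. f x + g x) = (\<lambda>x. Jop a f x + Jop a g x)"
  using assms unfolding Jop_def
  by (simp add: inverse_fourier_add schwartz_integrable distrib_left fourier_add
      schwartz_mult[OF temperate_jm] schwartz_inverse_fourier)

lemma Jop_cmult: "Jop a (\<lambda>x. c * f x) = (\<lambda>x. c * Jop a f x)"
  unfolding Jop_def by (simp add: inverse_fourier_cmult mult.left_commute fourier_cmult)

lemma integral_Jop_swap:
  assumes "schwartz \<Phi>" "schwartz \<theta>"
  shows "(LINT x|lborel. \<Phi> x * Jop a \<theta> x) = (LINT x|lborel. Jop a \<Phi> x * \<theta> x)"
proof -
  have "(LINT x|lborel. \<Phi> x * Jop a \<theta> x) = (LINT \<xi>|lborel. fourier \<Phi> \<xi> * (jm a \<xi> * inverse_fourier \<theta> \<xi>))"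
    unfolding Jop_def using assms
    by (intro integral_fourier_swap[symmetric] schwartz_integrable schwartz_mult temperate_jm schwartz_inverse_fourier)
  also have "\<dots> = (LINT \<xi>|lborel. (jm a \<xi> * fourier \<Phi> \<xi>) * inverse_fourier \<theta> \<xi>)"
    by (simp add: mult_ac)
  also have "\<dots> = (LINT x|lborel. Jop a \<Phi> x * \<theta> x)"
    unfolding Jop_alt[OF assms(1)] using assms
    by (intro integral_inverse_fourier_swap[symmetric] schwartz_integrable schwartz_mult temperate_jm schwartz_fourier)
  finally show ?thesis .
qed

lemma bessel_potential_eval:
  "bessel_potential r u \<theta> = (if schwartz \<theta> then u (Jop r \<theta>) else 0)"
  by (simp add: bessel_potential_def inverse_fourier_dist_def mult_dist_def fourier_dist_def on_schwartz_def
      Jop_def jm_def[symmetric] schwartz_inverse_fourier schwartz_mult[OF temperate_jm])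

lemma distribution_of_eval: "schwartz \<theta> \<Longrightarrow> distribution_of f \<theta> = (LINT x|lborel. f x * \<theta> x)"
  by (simp add: distribution_of_def on_schwartz_def)

text \<open>The Bessel potential is undone on the test function, which is legitimate because
  \<open>Jop (- r)\<close> preserves Schwartz functions and inverts \<open>Jop r\<close>. It
  recovers \<open>u\<close> from its L^p density.\<close>

lemma bessel_representation:
  assumes "bessel_potential r u = distribution_of f" "schwartz \<theta>"
  shows "u \<theta> = (LINT x|lborel. f x * Jop (- r) \<theta> x)"
proof -
  have "bessel_potential r u (Jop (- r) \<theta>) = distribution_of f (Jop (- r) \<theta>)" by (simp add: assms(1))
  then show ?thesis
    using assms(2) schwartz_Jop[OF assms(2)] by (simp add: bessel_potential_eval distribution_of_eval Jop_inverse)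
qed

lemma distribution_of_unique:
  assumes p: "1 \<le> p" and f: "f \<in> Lp_space p" and g: "g \<in> Lp_space p" and eq: "distribution_of f = distribution_of g"
  shows "AE x in lborel. f x = g x"
proof -
  have "AE x in lborel. f x - g x = 0"
  proof (rule Lp_schwartz_null[OF p Lp_diff[OF p f g]])
    fix \<phi> :: "'a \<Rightarrow> complex" assume \<phi>: "schwartz \<phi>"
    have "(LINT x|lborel. (f x - g x) * \<phi> x) = (LINT x|lborel. f x * \<phi> x) - (LINT x|lborel. g x * \<phi> x)"
      unfolding left_diff_distrib
      by (rule Bochner_Integration.integral_diff) (intro Lp_mult_schwartz_integrable[OF p] f g \<phi>)+
    also have "\<dots> = 0" using fun_cong[OF eq, of \<phi>] \<phi> by (simp add: distribution_of_eval)
    finally show "(LINT x|lborel. (f x - g x) * \<phi> x) = 0" .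
  qed
  then show ?thesis by eventually_elim simp
qed

text \<open>The norm is defined through an arbitrary choice of a density. Densities are unique
  almost everywhere, so any density at hand computes it.\<close>

lemma bessel_norm_eq:
  assumes p: "1 \<le> p" and f: "f \<in> Lp_space p" and eq: "bessel_potential r u = distribution_of f"
  shows "bessel_norm r p u = (LINT x|lborel. norm (f x) powr p) powr (1 / p)"
proof -
  define g where "g = (SOME f. f \<in> Lp_space p \<and> bessel_potential r u = distribution_of f)"
  have g: "g \<in> Lp_space p \<and> bessel_potential r u = distribution_of g"
    unfolding g_def using someI_ex[of "\<lambda>f. f \<in> Lp_space p \<and> bessel_potential r u = distribution_of f"] f eq by blast
  then have "AE x in lborel. g x = f x"
    using f eq by (intro distribution_of_unique[OF p]) auto
  then have "AE x in lborel. norm (g x) powr p = norm (f x) powr p" by eventually_elim simp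
  then have "(LINT x|lborel. norm (g x) powr p) = (LINT x|lborel. norm (f x) powr p)"
    using Lp_integrable[OF f] Lp_integrable[of g p] g by (intro integral_cong_AE) auto
  then show ?thesis by (simp add: bessel_norm_def Lp_norm_def g_def[symmetric])
qed

lemma tendsto_root_zero_iff:
  fixes I :: "nat \<Rightarrow> real"
  assumes p: "1 \<le> p" and I: "\<And>k. 0 \<le> I k"
  shows "(\<lambda>k. I k powr (1 / p)) \<longlonglongrightarrow> 0 \<longleftrightarrow> I \<longlonglongrightarrow> 0"
proof
  assume "(\<lambda>k. I k powr (1 / p)) \<longlonglongrightarrow> 0"
  then have "(\<lambda>k. (I k powr (1 / p)) powr p) \<longlonglongrightarrow> 0 powr p"
    using p by (intro tendsto_powr2 tendsto_const) auto
  then show "I \<longlonglongrightarrow> 0" using p I by (simp add: powr_powr)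
next
  assume "I \<longlonglongrightarrow> 0"
  then have "(\<lambda>k. I k powr (1 / p)) \<longlonglongrightarrow> 0 powr (1 / p)"
    using p I by (intro tendsto_powr2 tendsto_const) auto
  then show "(\<lambda>k. I k powr (1 / p)) \<longlonglongrightarrow> 0" by simp
qed

lemma powr_tangent:
  assumes "1 \<le> p" "0 < c" "0 \<le> (a::real)"
  shows "a \<le> c powr (1 - p) * a powr p + c"
proof (cases "a \<le> c")
  case True
  then show ?thesis by (simp add: add_increasing)
next
  case False
  then have a: "a > 0" "a \<ge> c" using assms by auto
  have "a = a powr (1 - p) * a powr p" using a by (simp add: powr_add[symmetric])
  also have "\<dots> \<le> c powr (1 - p) * a powr p"
    using assms a by (intro mult_right_mono powr_mono2') auto
  finally show ?thesis using assms by linarith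
qed

text \<open>The same tangent inequality as for convolutions: the term with factor \<open>c\<close>
  is at most e/2 by the choice of \<open>c\<close>, uniformly in \<open>k\<close>, and for this
  fixed \<open>c\<close> the other term tends to 0.\<close>

lemma Lp_weak_limit:
  fixes h :: "nat \<Rightarrow> 'a::euclidean_space \<Rightarrow> complex"
  assumes p: "1 \<le> p" and h: "\<And>k. h k \<in> Lp_space p" and lim: "(\<lambda>k. LINT x|lborel. norm (h k x) powr p) \<longlonglongrightarrow> 0"
    and g: "integrable lborel g" and B: "\<And>x. norm (g x) \<le> B"
  shows "(\<lambda>k. LINT x|lborel. h k x * g x) \<longlonglongrightarrow> 0"
proof (rule LIMSEQ_I)
  fix e :: real assume e: "e > 0"
  define N where "N = (LINT x|lborel. norm (g x))"
  have N: "N \<ge> 0" by (simp add: N_def)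
  have B0: "B \<ge> 0" using B norm_ge_zero order_trans by blast
  define c where "c = e / (2 * (1 + N))"
  have c: "c > 0" using e N by (simp add: c_def add_pos_nonneg)
  have bd: "norm (LINT x|lborel. h k x * g x) \<le> c powr (1 - p) * B * (LINT x|lborel. norm (h k x) powr p) + c * N" for k
  proof -
    have i: "integrable lborel (\<lambda>x. (c powr (1 - p) * B) * norm (h k x) powr p + c * norm (g x))"
      by (intro Bochner_Integration.integrable_add integrable_mult_right Lp_integrable[OF h] integrable_norm g)
    have "norm (LINT x|lborel. h k x * g x) \<le> (LINT x|lborel. norm (h k x * g x))" by (rule integral_norm_bound)
    also have "\<dots> \<le> (LINT x|lborel. (c powr (1 - p) * B) * norm (h k x) powr p + c * norm (g x))"
    proof (rule integral_mono_AE'[OF i])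
      show "AE x in lborel. norm (h k x * g x) \<le> (c powr (1 - p) * B) * norm (h k x) powr p + c * norm (g x)"
      proof (rule AE_I2)
        fix x
        have "norm (h k x * g x) \<le> (c powr (1 - p) * norm (h k x) powr p + c) * norm (g x)"
          unfolding norm_mult using p c by (intro mult_right_mono powr_tangent) auto
        also have "\<dots> \<le> (c powr (1 - p) * norm (h k x) powr p) * B + c * norm (g x)"
          unfolding distrib_right by (intro add_mono mult_left_mono B mult_nonneg_nonneg) (use c in auto)
        finally show "norm (h k x * g x) \<le> (c powr (1 - p) * B) * norm (h k x) powr p + c * norm (g x)"
          by (simp add: mult_ac)
      qed
    qed (use c B0 in \<open>auto intro!: AE_I2 add_nonneg_nonneg mult_nonneg_nonneg\<close>)
    also have "\<dots> = c powr (1 - p) * B * (LINT x|lborel. norm (h k x) powr p) + c * N"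
      using Lp_integrable[OF h] g by (simp add: N_def)
    finally show ?thesis .
  qed
  have "(\<lambda>k. c powr (1 - p) * B * (LINT x|lborel. norm (h k x) powr p)) \<longlonglongrightarrow> c powr (1 - p) * B * 0"
    by (intro tendsto_mult tendsto_const lim)
  then have "\<forall>\<^sub>F k in sequentially. c powr (1 - p) * B * (LINT x|lborel. norm (h k x) powr p) < e / 2"
    using e by (intro order_tendstoD(2)) auto
  then obtain k0 where k0: "\<And>k. k \<ge> k0 \<Longrightarrow> c powr (1 - p) * B * (LINT x|lborel. norm (h k x) powr p) < e / 2"
    by (auto simp: eventually_sequentially)
  have "c * N \<le> e / 2"
  proof -
    have "c * N \<le> c * (1 + N)" using c by (intro mult_left_mono) auto
    also have "\<dots> = e / 2" using N by (simp add: c_def field_simps)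
    finally show ?thesis .
  qed
  have "norm ((LINT x|lborel. h n x * g x) - 0) < e" if "n \<ge> k0" for n
    using bd[of n] k0[OF that] \<open>c * N \<le> e / 2\<close> by simp
  then show "\<exists>no. \<forall>n\<ge>no. norm ((LINT x|lborel. h n x * g x) - 0) < e" by blast
qed

lemma conv_schwartz:
  fixes K :: "'a::euclidean_space \<Rightarrow> real"
  assumes K: "integrable lborel K" and \<theta>: "schwartz \<theta>"
  shows "integrable lborel (conv K \<theta>)" "\<exists>B. \<forall>x. norm (conv K \<theta> x) \<le> B"
proof -
  have [measurable]: "\<theta> \<in> borel_measurable borel" "K \<in> borel_measurable borel"
    using schwartz_measurable[OF \<theta>] K by auto
  have "integrable (lborel \<Otimes>\<^sub>M lborel) (\<lambda>(y, x). \<bar>K y\<bar> * norm (\<theta> (x + (-1) *\<^sub>R y)))"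
    by (rule integrable_conv[OF integrable_norm[OF schwartz_integrable[OF \<theta>]]]) (use K in simp)
  then have "integrable (lborel \<Otimes>\<^sub>M lborel) (\<lambda>(y, x). complex_of_real (K y) * \<theta> (x - y))"
    by (rule Bochner_Integration.integrable_bound) (measurable, auto intro!: AE_I2 simp: norm_mult)
  from lborel_pair.integrable_snd[OF this] show "integrable lborel (conv K \<theta>)"
    by (simp add: conv_def[abs_def])
  obtain B where B: "B \<ge> 0" "\<And>x. norm (\<theta> x) \<le> B" using schwartz_bounded[OF \<theta>] by blast
  have "norm (conv K \<theta> x) \<le> (LINT y|lborel. B * \<bar>K y\<bar>)" for x
  proof -
    have "norm (conv K \<theta> x) \<le> (LINT y|lborel. norm (complex_of_real (K y) * \<theta> (x - y)))"
      unfolding conv_def by (rule integral_norm_bound)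
    also have "\<dots> \<le> (LINT y|lborel. B * \<bar>K y\<bar>)"
    proof (rule integral_mono_AE')
      show "AE y in lborel. norm (complex_of_real (K y) * \<theta> (x - y)) \<le> B * \<bar>K y\<bar>"
      proof (rule AE_I2)
        fix y
        show "norm (complex_of_real (K y) * \<theta> (x - y)) \<le> B * \<bar>K y\<bar>"
          using mult_left_mono[OF B(2)[of "x - y"] abs_ge_zero[of "K y"]] by (simp add: norm_mult mult.commute)
      qed
    qed (use K B in auto)
    finally show ?thesis .
  qed
  then show "\<exists>B. \<forall>x. norm (conv K \<theta> x) \<le> B" by blast
qed

text \<open>Detaches the kernel from its construction. The Fourier identity excludes the origin, a
  null set, and is applied only almost everywhere under integrals.\<close>

locale frac_kernel =
  fixes p s :: real and K :: "'a::euclidean_space \<Rightarrow> real"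
  assumes p: "1 \<le> p" and s: "0 < s"
    and K: "integrable lborel K" "\<And>x. K (- x) = K x"
    and K_fourier: "\<And>\<xi>. \<xi> \<noteq> 0 \<Longrightarrow> 1 + fourier (\<lambda>x. complex_of_real (K x)) \<xi> =
       complex_of_real (norm \<xi> powr (2 * s) * japanese_bracket \<xi> powr (- (2 * s)))"
begin

text \<open>\<open>T = (-\<Delta>)\<^sup>s (1 - \<Delta>)\<^sup>-\<^sup>s\<close>.\<close>

definition T :: "('a \<Rightarrow> complex) \<Rightarrow> 'a \<Rightarrow> complex" where
  "T g x = g x + conv K g x"

lemma T_schwartz_integrable: "schwartz \<theta> \<Longrightarrow> integrable lborel (T \<theta>)"
  unfolding T_def[abs_def] by (intro Bochner_Integration.integrable_add schwartz_integrable conv_schwartz K)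

lemma T_schwartz_bounded: "schwartz \<theta> \<Longrightarrow> \<exists>B. \<forall>x. norm (T \<theta> x) \<le> B"
proof -
  assume \<theta>: "schwartz \<theta>"
  obtain B where "\<And>x. norm (\<theta> x) \<le> B" using schwartz_bounded[OF \<theta>] by blast
  moreover obtain B' where "\<And>x. norm (conv K \<theta> x) \<le> B'" using conv_schwartz(2)[OF K(1) \<theta>] by blast
  ultimately have "norm (T \<theta> x) \<le> B + B'" for x unfolding T_def by (rule norm_triangle_mono)
  then show ?thesis by blast
qed

lemma norm_multiplier_le: "norm (complex_of_real (norm \<xi> powr (2 * s)) * jm (- (2 * s)) \<xi>) \<le> 1"
proof -
  have "norm \<xi> \<le> japanese_bracket \<xi>"
    unfolding japanese_bracket_def by (rule real_le_rsqrt) simp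
  then have "norm \<xi> powr (2 * s) \<le> japanese_bracket \<xi> powr (2 * s)"
    using s by (intro powr_mono2) auto
  moreover have "japanese_bracket \<xi> powr (2 * s) > 0" using one_le_japanese_bracket[of \<xi>] by simp
  ultimately have "norm \<xi> powr (2 * s) * japanese_bracket \<xi> powr (- (2 * s)) \<le> 1"
    unfolding powr_minus by (simp add: field_simps)
  then show ?thesis by (simp add: jm_def norm_mult)
qed

lemma multiplier_measurable [measurable]:
  "(\<lambda>\<xi>::'a. complex_of_real (norm \<xi> powr a)) \<in> borel_measurable borel" "(jm a :: 'a \<Rightarrow> complex) \<in> borel_measurable borel"
  unfolding jm_def[abs_def] japanese_bracket_def by measurable

lemma multiplier_integrable:
  fixes h :: "'a \<Rightarrow> complex"
  assumes "integrable lborel h"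
  shows "integrable lborel (\<lambda>\<xi>. complex_of_real (norm \<xi> powr (2 * s)) * jm (- (2 * s)) \<xi> * h \<xi>)"
proof (rule Bochner_Integration.integrable_bound[OF assms])
  have [measurable]: "h \<in> borel_measurable borel" using assms by auto
  show "(\<lambda>\<xi>. complex_of_real (norm \<xi> powr (2 * s)) * jm (- (2 * s)) \<xi> * h \<xi>) \<in> borel_measurable lborel" by measurable
  show "AE \<xi> in lborel. norm (complex_of_real (norm \<xi> powr (2 * s)) * jm (- (2 * s)) \<xi> * h \<xi>) \<le> norm (h \<xi>)"
    unfolding norm_mult[of _ "h _"] using norm_multiplier_le by (intro AE_I2 mult_left_le_one_le) auto
qed

text \<open>Links the operator given by an integral kernel, which makes sense on L^p, to the symbol
  |xi|^(2s) (1 + |xi|^2)^(-s). The convolution contributes the symbol minus 1, and the identity part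
  of \<open>T\<close> restores the 1.\<close>

lemma T_schwartz:
  assumes \<theta>: "schwartz \<theta>"
  shows "T \<theta> = inverse_fourier (\<lambda>\<xi>. complex_of_real (norm \<xi> powr (2 * s)) * jm (- (2 * s)) \<xi> * fourier \<theta> \<xi>)"
proof
  fix x
  let ?k = "fourier (\<lambda>x. complex_of_real (K x))"
  have Fi: "integrable lborel (fourier \<theta>)" by (intro schwartz_integrable schwartz_fourier \<theta>)
  have ae: "AE \<xi> in lborel. complex_of_real (norm \<xi> powr (2 * s)) * jm (- (2 * s)) \<xi> * fourier \<theta> \<xi> - fourier \<theta> \<xi> = fourier \<theta> \<xi> * ?k \<xi>"
    using AE_lborel_singleton[of "0::'a"]
  proof eventually_elim
    case (elim \<xi>)
    then have "complex_of_real (norm \<xi> powr (2 * s)) * jm (- (2 * s)) \<xi> = 1 + ?k \<xi>"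
      using K_fourier[of \<xi>] by (simp add: jm_def)
    then show ?case by (simp only: distrib_right) simp
  qed
  have mi: "integrable lborel (\<lambda>\<xi>. complex_of_real (norm \<xi> powr (2 * s)) * jm (- (2 * s)) \<xi> * fourier \<theta> \<xi>)"
    by (rule multiplier_integrable[OF Fi])
  have km [measurable]: "?k \<in> borel_measurable borel"
  proof -
    have [measurable]: "K \<in> borel_measurable borel" using K by auto
    show ?thesis unfolding fourier_def[abs_def] by measurable
  qed
  have [measurable]: "fourier \<theta> \<in> borel_measurable borel" using Fi by auto
  have pi: "integrable lborel (\<lambda>\<xi>. fourier \<theta> \<xi> * ?k \<xi>)"
    by (rule integrable_cong_AE_imp[OF Bochner_Integration.integrable_diff[OF mi Fi]]) (measurable, use ae in eventually_elim, simp)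
  have "conv K \<theta> x = inverse_fourier (\<lambda>\<xi>. fourier \<theta> \<xi> * ?k \<xi>) x"
    using conv_inverse_fourier[OF Fi K(1), of x] by (simp add: inverse_fourier_fourier[OF \<theta>])
  then have "T \<theta> x = inverse_fourier (\<lambda>\<xi>. fourier \<theta> \<xi> + fourier \<theta> \<xi> * ?k \<xi>) x"
    unfolding T_def inverse_fourier_add[OF Fi pi] by (simp add: inverse_fourier_fourier[OF \<theta>])
  also have "\<dots> = inverse_fourier (\<lambda>\<xi>. complex_of_real (norm \<xi> powr (2 * s)) * jm (- (2 * s)) \<xi> * fourier \<theta> \<xi>) x"
    unfolding inverse_fourier_def
  proof (rule arg_cong[where f="\<lambda>z. z / _"], rule integral_cong_AE)
    show "AE \<xi> in lborel. (fourier \<theta> \<xi> + fourier \<theta> \<xi> * ?k \<xi>) * exp (\<i> * complex_of_real (x \<bullet> \<xi>)) =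
        complex_of_real (norm \<xi> powr (2 * s)) * jm (- (2 * s)) \<xi> * fourier \<theta> \<xi> * exp (\<i> * complex_of_real (x \<bullet> \<xi>))"
      using ae by eventually_elim (simp add: eq_diff_eq[symmetric] diff_eq_eq)
  qed measurable
  finally show "T \<theta> x = inverse_fourier (\<lambda>\<xi>. complex_of_real (norm \<xi> powr (2 * s)) * jm (- (2 * s)) \<xi> * fourier \<theta> \<xi>) x" .
qed

lemma T_Jop:
  assumes "schwartz \<theta>"
  shows "T (Jop a \<theta>) = inverse_fourier (\<lambda>\<xi>. complex_of_real (norm \<xi> powr (2 * s)) * jm (a - 2 * s) \<xi> * fourier \<theta> \<xi>)"
proof -
  have "jm (a - 2 * s) \<xi> = jm (- (2 * s)) \<xi> * jm a \<xi>" for \<xi> :: 'a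
    using jm_add[of "- (2 * s)" a \<xi>] by simp
  then show ?thesis
    unfolding T_schwartz[OF schwartz_Jop[OF assms]] fourier_Jop[OF assms] by (simp only: mult.assoc)
qed

lemma T_Lp: "f \<in> Lp_space p \<Longrightarrow> T f \<in> Lp_space p"
  unfolding T_def[abs_def] by (intro Lp_add p conv_Lp K)

lemma T_schwartz_Lp: "schwartz \<theta> \<Longrightarrow> T \<theta> \<in> Lp_space p"
  by (rule T_Lp[OF schwartz_Lp[OF p]])

lemma Jop_Lp: "schwartz \<theta> \<Longrightarrow> Jop a \<theta> \<in> Lp_space p"
  by (rule schwartz_Lp[OF p schwartz_Jop])

lemma T_Lp_bound:
  "\<exists>C\<ge>0. \<forall>f\<in>Lp_space p. (LINT x|lborel. norm (T f x) powr p) \<le> C * (LINT x|lborel. norm (f x) powr p)"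
proof -
  define D where "D = (1 + (LINT y|lborel. \<bar>K y\<bar>)) powr p * (LINT y|lborel. \<bar>K y\<bar>)"
  have "(LINT x|lborel. norm (T f x) powr p) \<le> (2 powr p * (1 + D)) * (LINT x|lborel. norm (f x) powr p)"
    if f: "f \<in> Lp_space p" for f
  proof -
    have "(LINT x|lborel. norm (T f x) powr p) \<le> (LINT x|lborel. 2 powr p * (norm (f x) powr p + norm (conv K f x) powr p))"
      unfolding T_def
      by (intro integral_mono integrable_mult_right Bochner_Integration.integrable_add norm_add_powr_le p
            Lp_integrable f conv_Lp K Lp_add)
    also have "\<dots> = 2 powr p * ((LINT x|lborel. norm (f x) powr p) + (LINT x|lborel. norm (conv K f x) powr p))"
      using Lp_integrable[OF f] Lp_integrable[OF conv_Lp(1)[OF p K(1) f]] by simp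
    also have "\<dots> \<le> 2 powr p * ((LINT x|lborel. norm (f x) powr p) + D * (LINT x|lborel. norm (f x) powr p))"
      unfolding D_def by (intro mult_left_mono add_left_mono conv_Lp(2)[OF p K(1) f]) simp
    finally show ?thesis by (simp add: algebra_simps)
  qed
  moreover have "0 \<le> 2 powr p * (1 + D)" by (simp add: D_def)
  ultimately show ?thesis by blast
qed

lemma T_swap:
  assumes f: "f \<in> Lp_space p" and \<theta>: "schwartz \<theta>"
  shows "(LINT x|lborel. T f x * \<theta> x) = (LINT x|lborel. f x * T \<theta> x)"
proof -
  obtain B where B: "\<And>x. norm (\<theta> x) \<le> B" using schwartz_bounded[OF \<theta>] by blast
  obtain B' where B': "\<And>x. norm (conv K \<theta> x) \<le> B'" using conv_schwartz(2)[OF K(1) \<theta>] by blast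
  have "(LINT x|lborel. T f x * \<theta> x) = (LINT x|lborel. f x * \<theta> x) + (LINT x|lborel. conv K f x * \<theta> x)"
    unfolding T_def distrib_right
    by (rule Bochner_Integration.integral_add) (intro Lp_mult_schwartz_integrable[OF p] f \<theta> conv_Lp K p)+
  also have "(LINT x|lborel. conv K f x * \<theta> x) = (LINT x|lborel. f x * conv K \<theta> x)"
    by (rule integral_conv_swap[OF p K f schwartz_integrable[OF \<theta>] B])
  also have "(LINT x|lborel. f x * \<theta> x) + (LINT x|lborel. f x * conv K \<theta> x) = (LINT x|lborel. f x * T \<theta> x)"
    unfolding T_def distrib_left
    by (rule Bochner_Integration.integral_add[symmetric])
       (intro Lp_mult_schwartz_integrable[OF p] f \<theta> Lp_mult_integrable[OF p f conv_schwartz(1)[OF K(1) \<theta>] B'])+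
  finally show ?thesis .
qed

text \<open>Splits |xi|^(2s) times the bracket to the power r - 2s into the bounded symbol of
  \<open>T\<close> and the bracket to the power r. On the level of densities the fractional
  Laplacian is therefore the one operator \<open>T\<close>, whatever the order r.\<close>

lemma frac_laplacian_schwartz_eval:
  fixes \<Phi> :: "'a \<Rightarrow> complex"
  assumes \<Phi>: "schwartz \<Phi>" and \<theta>: "schwartz \<theta>"
  shows "frac_laplacian_schwartz s \<Phi> (Jop (r - 2 * s) \<theta>) = (LINT x|lborel. T (Jop r \<Phi>) x * \<theta> x)"
proof -
  have "frac_laplacian_schwartz s \<Phi> (Jop (r - 2 * s) \<theta>) =
     (LINT \<xi>|lborel. complex_of_real (norm \<xi> powr (2 * s)) * fourier \<Phi> \<xi> * (jm (r - 2 * s) \<xi> * inverse_fourier \<theta> \<xi>))"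
    using \<theta> by (simp add: frac_laplacian_schwartz_def inverse_fourier_dist_def on_schwartz_def distribution_of_def
        schwartz_Jop schwartz_inverse_fourier inverse_fourier_Jop schwartz_mult[OF temperate_jm])
  also have "\<dots> = (LINT \<xi>|lborel. (complex_of_real (norm \<xi> powr (2 * s)) * jm (- (2 * s)) \<xi> * fourier (Jop r \<Phi>) \<xi>) * inverse_fourier \<theta> \<xi>)"
  proof -
    have "jm (r - 2 * s) \<xi> = jm (- (2 * s)) \<xi> * jm r \<xi>" for \<xi> :: 'a
      using jm_add[of "- (2 * s)" r \<xi>] by simp
    then show ?thesis by (simp only: fourier_Jop[OF \<Phi>] mult_ac)
  qed
  also have "\<dots> = (LINT x|lborel. T (Jop r \<Phi>) x * \<theta> x)"
    unfolding T_schwartz[OF schwartz_Jop[OF \<Phi>]]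
    by (intro integral_inverse_fourier_swap[symmetric] multiplier_integrable schwartz_integrable schwartz_fourier schwartz_Jop \<Phi> \<theta>)
  finally show ?thesis .
qed

lemma frac_laplacian_difference:
  fixes \<Phi> :: "'a \<Rightarrow> complex"
  assumes \<Phi>: "schwartz \<Phi>" and v: "bessel_potential (r - 2 * s) v = distribution_of g" and g: "g \<in> Lp_space p"
  shows "bessel_potential (r - 2 * s) (\<lambda>\<psi>. frac_laplacian_schwartz s \<Phi> \<psi> - v \<psi>) =
    distribution_of (\<lambda>x. T (Jop r \<Phi>) x - g x)"
proof
  fix \<theta> :: "'a \<Rightarrow> complex"
  show "bessel_potential (r - 2 * s) (\<lambda>\<psi>. frac_laplacian_schwartz s \<Phi> \<psi> - v \<psi>) \<theta> =
    distribution_of (\<lambda>x. T (Jop r \<Phi>) x - g x) \<theta>"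
  proof (cases "schwartz \<theta>")
    case True
    have "v (Jop (r - 2 * s) \<theta>) = (LINT x|lborel. g x * \<theta> x)"
      using fun_cong[OF v, of \<theta>] True by (simp add: bessel_potential_eval distribution_of_eval)
    moreover have "(LINT x|lborel. (T (Jop r \<Phi>) x - g x) * \<theta> x) = (LINT x|lborel. T (Jop r \<Phi>) x * \<theta> x) - (LINT x|lborel. g x * \<theta> x)"
      unfolding left_diff_distrib
      by (rule Bochner_Integration.integral_diff)
         (intro Lp_mult_schwartz_integrable[OF p] g True T_schwartz_Lp schwartz_Jop \<Phi>)+
    ultimately show ?thesis
      using True by (simp add: bessel_potential_eval distribution_of_eval frac_laplacian_schwartz_eval[OF \<Phi> True])
  qed (simp add: bessel_potential_eval distribution_of_def on_schwartz_def)
qed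

lemma bessel_difference:
  fixes \<Phi> :: "'a \<Rightarrow> complex"
  assumes \<Phi>: "schwartz \<Phi>" and u: "bessel_potential r u = distribution_of f" and f: "f \<in> Lp_space p"
  shows "bessel_potential r (\<lambda>\<psi>. distribution_of \<Phi> \<psi> - u \<psi>) = distribution_of (\<lambda>x. Jop r \<Phi> x - f x)"
proof
  fix \<theta> :: "'a \<Rightarrow> complex"
  show "bessel_potential r (\<lambda>\<psi>. distribution_of \<Phi> \<psi> - u \<psi>) \<theta> = distribution_of (\<lambda>x. Jop r \<Phi> x - f x) \<theta>"
  proof (cases "schwartz \<theta>")
    case True
    have "u (Jop r \<theta>) = (LINT x|lborel. f x * \<theta> x)"
      using fun_cong[OF u, of \<theta>] True by (simp add: bessel_potential_eval distribution_of_eval)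
    moreover have "(LINT x|lborel. (Jop r \<Phi> x - f x) * \<theta> x) = (LINT x|lborel. Jop r \<Phi> x * \<theta> x) - (LINT x|lborel. f x * \<theta> x)"
      unfolding left_diff_distrib
      by (rule Bochner_Integration.integral_diff)
         (intro Lp_mult_schwartz_integrable[OF p] f True Jop_Lp \<Phi>)+
    ultimately show ?thesis
      using True by (simp add: bessel_potential_eval distribution_of_eval schwartz_Jop integral_Jop_swap[OF \<Phi> True])
  qed (simp add: bessel_potential_eval distribution_of_def on_schwartz_def)
qed

text \<open>The candidate for the definite description: the distribution whose Bessel potential of
  order r - 2s has the density \<open>T f\<close>. Undoing that potential on the test function
  explains the index 2s - r.\<close>

definition frac_rep :: "real \<Rightarrow> ('a \<Rightarrow> complex) \<Rightarrow> 'a functional" where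
  "frac_rep r f = on_schwartz (\<lambda>\<theta>. LINT x|lborel. T f x * Jop (2 * s - r) \<theta> x)"

lemma frac_rep_bessel:
  assumes f: "f \<in> Lp_space p"
  shows "bessel_potential (r - 2 * s) (frac_rep r f) = distribution_of (T f)"
proof
  fix \<theta> :: "'a \<Rightarrow> complex"
  show "bessel_potential (r - 2 * s) (frac_rep r f) \<theta> = distribution_of (T f) \<theta>"
    by (simp add: bessel_potential_eval frac_rep_def on_schwartz_def distribution_of_def schwartz_Jop Jop_Jop Jop_0)
qed

lemma frac_rep_tempered:
  assumes f: "f \<in> Lp_space p"
  shows "tempered_distribution (frac_rep r f)"
proof -
  have i: "integrable lborel (\<lambda>x. T f x * Jop (2 * s - r) \<theta> x)" if "schwartz \<theta>" for \<theta>
    by (intro Lp_mult_schwartz_integrable[OF p] T_Lp f schwartz_Jop that)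
  have "\<exists>C N. \<forall>\<phi>. schwartz \<phi> \<longrightarrow> norm (frac_rep r f \<phi>) \<le> C * pnorm N \<phi>"
  proof -
    obtain C N where CN: "C \<ge> 0" "\<And>(\<phi> :: 'a \<Rightarrow> complex) x. schwartz \<phi> \<Longrightarrow> (1 + norm x) ^ (2 * DIM('a)) * norm (Jop (2 * s - r) \<phi> x) \<le> C * pnorm N \<phi>"
      using scont_bound[OF scont_Jop] by metis
    have wi: "integrable lborel (\<lambda>x. norm (T f x) * wt x)"
    proof -
      have "integrable lborel (\<lambda>x. T f x * complex_of_real (wt x))"
        by (intro Lp_mult_integrable[OF p T_Lp[OF f], where B=1])
           (auto simp: wt_le_1 wt_nonneg wt_integrable abs_of_nonneg intro!: integrable_of_real)
      from integrable_norm[OF this] show ?thesis by (simp add: norm_mult wt_nonneg)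
    qed
    have "norm (frac_rep r f \<phi>) \<le> (C * (LINT x|lborel. norm (T f x) * wt x)) * pnorm N \<phi>" if \<phi>: "schwartz \<phi>" for \<phi>
    proof -
      have "norm (frac_rep r f \<phi>) \<le> (LINT x|lborel. norm (T f x * Jop (2 * s - r) \<phi> x))"
        unfolding frac_rep_def on_schwartz_def using \<phi> by (simp add: integral_norm_bound)
      also have "\<dots> \<le> (LINT x|lborel. (C * pnorm N \<phi>) * (norm (T f x) * wt x))"
      proof (intro integral_mono integrable_mult_right wi integrable_norm i \<phi>)
        fix x
        have "norm (Jop (2 * s - r) \<phi> x) \<le> (C * pnorm N \<phi>) * wt x"
          by (rule norm_le_wtI[OF CN(2)[OF \<phi>]])
        from mult_left_mono[OF this norm_ge_zero[of "T f x"]]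
        show "norm (T f x * Jop (2 * s - r) \<phi> x) \<le> (C * pnorm N \<phi>) * (norm (T f x) * wt x)"
          by (simp add: norm_mult mult_ac)
      qed
      also have "\<dots> = (C * (LINT x|lborel. norm (T f x) * wt x)) * pnorm N \<phi>"
        unfolding integral_mult_right_zero by (simp add: mult_ac)
      finally show ?thesis .
    qed
    then show ?thesis by blast
  qed
  then show ?thesis
    unfolding tempered_distribution_def pnorm_def
    using i by (auto simp: frac_rep_def on_schwartz_def schwartz_add schwartz_cmult Jop_add Jop_cmult
        distrib_left mult.left_commute)
qed

text \<open>That the candidate satisfies the description is the boundedness of \<open>T\<close> on
  L^p, transported by the formulas for the norms. Uniqueness rests on density: some Schwartz
  sequence converges to \<open>u\<close>, so any competitor has a density to which the images under
  \<open>T\<close> converge, and limits tested against Schwartz functions agree.\<close>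

lemma frac_laplacian_eq:
  assumes u: "bessel_potential r u = distribution_of f" and f: "f \<in> Lp_space p"
  shows "frac_laplacian s r p u = frac_rep r f"
  unfolding frac_laplacian_def
proof (rule the_equality)
  obtain C where C: "C \<ge> 0" "\<And>f. f \<in> Lp_space p \<Longrightarrow> (LINT x|lborel. norm (T f x) powr p) \<le> C * (LINT x|lborel. norm (f x) powr p)"
    using T_Lp_bound by blast
  have norm1: "bessel_norm r p (\<lambda>\<psi>. distribution_of (\<Phi>) \<psi> - u \<psi>) = (LINT x|lborel. norm (Jop r \<Phi> x - f x) powr p) powr (1 / p)"
    if "schwartz \<Phi>" for \<Phi>
    by (rule bessel_norm_eq[OF p _ bessel_difference[OF that u f]]) (intro Lp_diff p f Jop_Lp that)
  have norm2: "bessel_norm (r - 2 * s) p (\<lambda>\<psi>. frac_laplacian_schwartz s \<Phi> \<psi> - v \<psi>) =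
      (LINT x|lborel. norm (T (Jop r \<Phi>) x - g x) powr p) powr (1 / p)"
    if "schwartz \<Phi>" "bessel_potential (r - 2 * s) v = distribution_of g" "g \<in> Lp_space p" for \<Phi> v g
    by (rule bessel_norm_eq[OF p _ frac_laplacian_difference[OF that]])
       (intro Lp_diff p that T_schwartz_Lp schwartz_Jop)
  \<comment> \<open>Linearity of \<open>T\<close> is claimed only between distributions: at a point
    where a convolution integral diverges, its default value 0 could spoil the pointwise
    identity.\<close>
  have Tdiff: "distribution_of (\<lambda>x. T g x - T f x) = distribution_of (T (\<lambda>x. g x - f x))" if "g \<in> Lp_space p" for g
  proof
    fix \<theta> :: "'a \<Rightarrow> complex"
    show "distribution_of (\<lambda>x. T g x - T f x) \<theta> = distribution_of (T (\<lambda>x. g x - f x)) \<theta>"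
    proof (cases "schwartz \<theta>")
      case True
      obtain B where B: "\<And>x. norm (T \<theta> x) \<le> B" using T_schwartz_bounded[OF True] by blast
      have "(LINT x|lborel. (T g x - T f x) * \<theta> x) = (LINT x|lborel. T g x * \<theta> x) - (LINT x|lborel. T f x * \<theta> x)"
        unfolding left_diff_distrib
        by (rule Bochner_Integration.integral_diff) (intro Lp_mult_schwartz_integrable[OF p] f that True T_Lp)+
      also have "\<dots> = (LINT x|lborel. g x * T \<theta> x) - (LINT x|lborel. f x * T \<theta> x)"
        by (simp only: T_swap[OF that True] T_swap[OF f True])
      also have "\<dots> = (LINT x|lborel. (g x - f x) * T \<theta> x)"
        unfolding left_diff_distrib
        by (rule Bochner_Integration.integral_diff[symmetric])
           (intro Lp_mult_integrable[OF p _ T_schwartz_integrable[OF True] B] f that)+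
      also have "\<dots> = (LINT x|lborel. T (\<lambda>x. g x - f x) x * \<theta> x)"
        by (rule T_swap[OF Lp_diff[OF p that f] True, symmetric])
      finally show ?thesis using True by (simp add: distribution_of_eval)
    qed (simp add: distribution_of_def on_schwartz_def)
  qed
  have norm3: "bessel_norm (r - 2 * s) p (\<lambda>\<psi>. frac_laplacian_schwartz s \<Phi> \<psi> - frac_rep r f \<psi>) =
      (LINT x|lborel. norm (T (\<lambda>x. Jop r \<Phi> x - f x) x) powr p) powr (1 / p)" if "schwartz \<Phi>" for \<Phi>
  proof (rule bessel_norm_eq[OF p])
    show "T (\<lambda>x. Jop r \<Phi> x - f x) \<in> Lp_space p"
      by (intro Lp_diff p that f T_Lp Jop_Lp)
    show "bessel_potential (r - 2 * s) (\<lambda>\<psi>. frac_laplacian_schwartz s \<Phi> \<psi> - frac_rep r f \<psi>) =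
        distribution_of (T (\<lambda>x. Jop r \<Phi> x - f x))"
      using frac_laplacian_difference[OF that frac_rep_bessel[OF f] T_Lp[OF f]] Tdiff[OF schwartz_Lp[OF p schwartz_Jop[OF that]]]
      by simp
  qed
  show "frac_rep r f \<in> bessel_space (r - 2 * s) p \<and>
    (\<forall>\<Phi>. (\<forall>k. schwartz (\<Phi> k)) \<longrightarrow>
      (\<lambda>k. bessel_norm r p (\<lambda>\<psi>. distribution_of (\<Phi> k) \<psi> - u \<psi>)) \<longlonglongrightarrow> 0 \<longrightarrow>
      (\<lambda>k. bessel_norm (r - 2 * s) p (\<lambda>\<psi>. frac_laplacian_schwartz s (\<Phi> k) \<psi> - frac_rep r f \<psi>)) \<longlonglongrightarrow> 0)"
  proof (intro conjI allI impI)
    show "frac_rep r f \<in> bessel_space (r - 2 * s) p"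
      unfolding bessel_space_def using frac_rep_tempered[OF f] frac_rep_bessel[OF f] T_Lp[OF f] by blast
    fix \<Phi> :: "nat \<Rightarrow> 'a \<Rightarrow> complex"
    assume S: "\<forall>k. schwartz (\<Phi> k)" and "(\<lambda>k. bessel_norm r p (\<lambda>\<psi>. distribution_of (\<Phi> k) \<psi> - u \<psi>)) \<longlonglongrightarrow> 0"
    then have lim: "(\<lambda>k. LINT x|lborel. norm (Jop r (\<Phi> k) x - f x) powr p) \<longlonglongrightarrow> 0"
      by (simp add: norm1 tendsto_root_zero_iff[OF p])
    have "(\<lambda>k. LINT x|lborel. norm (T (\<lambda>x. Jop r (\<Phi> k) x - f x) x) powr p) \<longlonglongrightarrow> 0"
    proof (rule tendsto_sandwich[OF _ _ tendsto_const])
      show "(\<lambda>k. C * (LINT x|lborel. norm (Jop r (\<Phi> k) x - f x) powr p)) \<longlonglongrightarrow> 0"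
        using tendsto_mult[OF tendsto_const lim, of C] by simp
      show "\<forall>\<^sub>F k in sequentially. (LINT x|lborel. norm (T (\<lambda>x. Jop r (\<Phi> k) x - f x) x) powr p) \<le> C * (LINT x|lborel. norm (Jop r (\<Phi> k) x - f x) powr p)"
        using S by (intro always_eventually allI C(2) Lp_diff p f Jop_Lp) auto
    qed auto
    then show "(\<lambda>k. bessel_norm (r - 2 * s) p (\<lambda>\<psi>. frac_laplacian_schwartz s (\<Phi> k) \<psi> - frac_rep r f \<psi>)) \<longlonglongrightarrow> 0"
      using S by (simp add: norm3 tendsto_root_zero_iff[OF p])
  qed
  fix v
  assume v: "v \<in> bessel_space (r - 2 * s) p \<and>
    (\<forall>\<Phi>. (\<forall>k. schwartz (\<Phi> k)) \<longrightarrow>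
      (\<lambda>k. bessel_norm r p (\<lambda>\<psi>. distribution_of (\<Phi> k) \<psi> - u \<psi>)) \<longlonglongrightarrow> 0 \<longrightarrow>
      (\<lambda>k. bessel_norm (r - 2 * s) p (\<lambda>\<psi>. frac_laplacian_schwartz s (\<Phi> k) \<psi> - v \<psi>)) \<longlonglongrightarrow> 0)"
  then obtain g where g: "g \<in> Lp_space p" "bessel_potential (r - 2 * s) v = distribution_of g"
    and vt: "tempered_distribution v"
    unfolding bessel_space_def by blast
  \<comment> \<open>The condition on \<open>v\<close> speaks only about sequences converging to
    \<open>u\<close>. One is produced by approximating the density \<open>f\<close> and applying
    \<open>Jop (- r)\<close>.\<close>
  have "\<exists>\<phi>. schwartz \<phi> \<and> (LINT x|lborel. norm (\<phi> x - f x) powr p) < inverse (Suc n)" for n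
    by (rule Lp_schwartz_dense[OF p f]) simp
  then obtain \<Theta> where \<Theta>: "\<And>n. schwartz (\<Theta> n)" "\<And>n. (LINT x|lborel. norm (\<Theta> n x - f x) powr p) < inverse (Suc n)"
    by metis
  have lim0: "(\<lambda>n. LINT x|lborel. norm (\<Theta> n x - f x) powr p) \<longlonglongrightarrow> 0"
    by (rule tendsto_sandwich[OF _ _ tendsto_const LIMSEQ_inverse_real_of_nat])
       (use \<Theta>(2) in \<open>auto intro!: always_eventually less_imp_le\<close>)
  define \<Phi> where "\<Phi> n = Jop (- r) (\<Theta> n)" for n
  have \<Phi>: "schwartz (\<Phi> n)" "Jop r (\<Phi> n) = \<Theta> n" for n
    using \<Theta>(1) by (auto simp: \<Phi>_def schwartz_Jop Jop_inverse)
  have "(\<lambda>k. bessel_norm r p (\<lambda>\<psi>. distribution_of (\<Phi> k) \<psi> - u \<psi>)) \<longlonglongrightarrow> 0"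
    using lim0 by (simp add: norm1 \<Phi> tendsto_root_zero_iff[OF p])
  then have "(\<lambda>k. bessel_norm (r - 2 * s) p (\<lambda>\<psi>. frac_laplacian_schwartz s (\<Phi> k) \<psi> - v \<psi>)) \<longlonglongrightarrow> 0"
    using v \<Phi>(1) by blast
  then have lim1: "(\<lambda>k. LINT x|lborel. norm (T (\<Theta> k) x - g x) powr p) \<longlonglongrightarrow> 0"
    by (simp add: norm2[OF \<Phi>(1) g(2,1)] \<Phi>(2) tendsto_root_zero_iff[OF p])
  \<comment> \<open>Two sequences tending to 0 are subtracted. The parts depending on k cancel by
    the symmetry of \<open>T\<close>, so their difference is constant, and the constant must be
    0.\<close>
  have key: "(LINT x|lborel. g x * \<theta> x) = (LINT x|lborel. T f x * \<theta> x)" if \<theta>: "schwartz \<theta>" for \<theta>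
  proof -
    obtain B where B: "\<And>x. norm (\<theta> x) \<le> B" using schwartz_bounded[OF \<theta>] by blast
    obtain B' where B': "\<And>x. norm (T \<theta> x) \<le> B'" using T_schwartz_bounded[OF \<theta>] by blast
    have "(\<lambda>k. LINT x|lborel. (T (\<Theta> k) x - g x) * \<theta> x) \<longlonglongrightarrow> 0"
      by (rule Lp_weak_limit[OF p _ lim1 schwartz_integrable[OF \<theta>] B]) (intro Lp_diff p g T_schwartz_Lp \<Theta>)
    moreover have "(\<lambda>k. LINT x|lborel. (\<Theta> k x - f x) * T \<theta> x) \<longlonglongrightarrow> 0"
      by (rule Lp_weak_limit[OF p _ lim0 T_schwartz_integrable[OF \<theta>] B']) (intro Lp_diff p f schwartz_Lp[OF p \<Theta>(1)])
    ultimately have "(\<lambda>k. (LINT x|lborel. (\<Theta> k x - f x) * T \<theta> x) - (LINT x|lborel. (T (\<Theta> k) x - g x) * \<theta> x)) \<longlonglongrightarrow> 0 - 0"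
      by (intro tendsto_diff)
    moreover have "(LINT x|lborel. (\<Theta> k x - f x) * T \<theta> x) - (LINT x|lborel. (T (\<Theta> k) x - g x) * \<theta> x) =
       (LINT x|lborel. g x * \<theta> x) - (LINT x|lborel. T f x * \<theta> x)" for k
    proof -
      have "(LINT x|lborel. (\<Theta> k x - f x) * T \<theta> x) = (LINT x|lborel. \<Theta> k x * T \<theta> x) - (LINT x|lborel. f x * T \<theta> x)"
        unfolding left_diff_distrib
        by (rule Bochner_Integration.integral_diff)
           (intro Lp_mult_integrable[OF p _ T_schwartz_integrable[OF \<theta>] B'] f schwartz_Lp[OF p \<Theta>(1)])+
      moreover have "(LINT x|lborel. (T (\<Theta> k) x - g x) * \<theta> x) = (LINT x|lborel. T (\<Theta> k) x * \<theta> x) - (LINT x|lborel. g x * \<theta> x)"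
        unfolding left_diff_distrib
        by (rule Bochner_Integration.integral_diff)
           (intro Lp_mult_schwartz_integrable[OF p] T_schwartz_Lp \<Theta> g \<theta>)+
      ultimately show ?thesis
        by (simp add: T_swap[OF f \<theta>] T_swap[OF schwartz_Lp[OF p \<Theta>(1)] \<theta>])
    qed
    ultimately show ?thesis by (simp add: LIMSEQ_const_iff)
  qed
  show "v = frac_rep r f"
  proof
    fix \<theta> :: "'a \<Rightarrow> complex"
    show "v \<theta> = frac_rep r f \<theta>"
    proof (cases "schwartz \<theta>")
      case True
      then show ?thesis
        using bessel_representation[OF g(2) True] key[OF schwartz_Jop[OF True]]
        by (simp add: frac_rep_def on_schwartz_def)
    next
      case False
      then show ?thesis using vt by (simp add: tempered_distribution_def frac_rep_def on_schwartz_def)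
    qed
  qed
qed

text \<open>Here the definite description disappears: all operators sit on the test function, as one
  explicit symbol, and only the density \<open>f\<close> of \<open>u\<close> remains. The later
  arguments use the operator in this form.\<close>

lemma frac_laplacian_eval:
  assumes u: "bessel_potential r u = distribution_of f" and f: "f \<in> Lp_space p" and \<theta>: "schwartz (\<theta> :: 'a \<Rightarrow> complex)"
  shows "frac_laplacian s r p u \<theta> =
    (LINT x|lborel. f x * inverse_fourier (\<lambda>\<xi>. complex_of_real (norm \<xi> powr (2 * s)) * jm (- r) \<xi> * fourier \<theta> \<xi>) x)"
proof -
  have "frac_laplacian s r p u \<theta> = (LINT x|lborel. f x * T (Jop (2 * s - r) \<theta>) x)"
    using \<theta> by (simp add: frac_laplacian_eq[OF u f] frac_rep_def on_schwartz_def T_swap[OF f schwartz_Jop])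
  then show ?thesis unfolding T_Jop[OF \<theta>] by simp
qed

end

section \<open>The fractional Laplacian off the support through the heat flow\<close>

lemma set_integrable_of_has_integral:
  fixes f :: "real \<Rightarrow> real"
  assumes [measurable]: "f \<in> borel_measurable borel" "S \<in> sets borel" and nn: "\<And>x. 0 \<le> f x" and I: "(f has_integral I) S"
  shows "set_integrable lborel S f"
proof -
  have "(\<lambda>x. if x \<in> S then f x else 0) = (\<lambda>x. indicator S x *\<^sub>R f x)" by (auto simp: indicator_def)
  then have "((\<lambda>x. indicator S x *\<^sub>R f x) has_integral I) UNIV"
    using I by (metis has_integral_restrict_UNIV)
  then have "integral\<^sup>N lborel (\<lambda>x. indicator S x *\<^sub>R f x) = I"
    by (intro nn_integral_has_integral_lborel) (auto simp: nn)
  then show ?thesis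
    unfolding set_integrable_def by (intro integrableI_nonneg) (auto simp: nn)
qed

lemma set_integrable_powr_0: "a > -1 \<Longrightarrow> set_integrable lborel {0<..1} (\<lambda>t::real. t powr a)"
  by (rule set_integrable_subset[of _ "{0..1}"])
     (auto intro!: set_integrable_of_has_integral has_integral_powr_from_0)

lemma set_integrable_powr_inf: "a < -1 \<Longrightarrow> set_integrable lborel {1..} (\<lambda>t::real. t powr a)"
  by (auto intro!: set_integrable_of_has_integral has_integral_powr_to_inf)

lemma set_integrable_powr_bound:
  fixes f :: "real \<Rightarrow> 'b::{banach, second_countable_topology}"
  assumes m: "f \<in> borel_measurable borel" and a: "a > -1" and b: "b < -1"
    and f0: "\<And>t. 0 < t \<Longrightarrow> t \<le> 1 \<Longrightarrow> norm (f t) \<le> C * t powr a"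
    and f1: "\<And>t. 1 \<le> t \<Longrightarrow> norm (f t) \<le> C * t powr b"
  shows "set_integrable lborel {0<..} f"
  unfolding set_integrable_def
proof (rule Bochner_Integration.integrable_bound)
  show "integrable lborel (\<lambda>t. C * (indicator {0<..1} t *\<^sub>R t powr a) + C * (indicator {1..} t *\<^sub>R t powr b))"
    by (intro Bochner_Integration.integrable_add integrable_mult_right
        set_integrable_powr_0[OF a, unfolded set_integrable_def] set_integrable_powr_inf[OF b, unfolded set_integrable_def])
  have C: "0 \<le> C" using order_trans[OF norm_ge_zero f1[of 1]] by simp
  show "AE t in lborel. norm (indicator {0<..} t *\<^sub>R f t) \<le>
      norm (C * (indicator {0<..1} t *\<^sub>R t powr a) + C * (indicator {1..} t *\<^sub>R t powr b))"
  proof (rule AE_I2)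
    fix t :: real
    show "norm (indicator {0<..} t *\<^sub>R f t) \<le>
      norm (C * (indicator {0<..1} t *\<^sub>R t powr a) + C * (indicator {1..} t *\<^sub>R t powr b))"
    proof (cases "0 < t")
      case True
      have nn: "0 \<le> C * t powr a" "0 \<le> C * t powr b" using C by auto
      have "norm (f t) \<le> C * (indicator {0<..1} t *\<^sub>R t powr a) + C * (indicator {1..} t *\<^sub>R t powr b)"
        using f0[of t] f1[of t] True nn by (auto simp: indicator_def)
      then show ?thesis using True by simp
    qed auto
  qed
qed (use m in measurable)

text \<open>
  The constant in the subordination formula for \<open>l\<^sup>\<sigma>\<close>, equal to
  \<open>\<Gamma>(1 - \<sigma>) / \<sigma>\<close>; only its sign matters.
\<close>

definition Acon :: "real \<Rightarrow> real" where
  "Acon \<sigma> = (LINT t|lborel. indicator {0<..} t *\<^sub>R (t powr (- \<sigma> - 1) * (1 - exp (- t))))"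

lemma Acon_integrable:
  assumes \<sigma>: "0 < \<sigma>" "\<sigma> < 1"
  shows "integrable lborel (\<lambda>t::real. indicator {0<..} t *\<^sub>R (t powr (- \<sigma> - 1) * (1 - exp (- t))))"
proof -
  have "set_integrable lborel {0<..} (\<lambda>t::real. t powr (- \<sigma> - 1) * (1 - exp (- t)))"
  proof (rule set_integrable_powr_bound[where a="- \<sigma>" and b="- \<sigma> - 1" and C=1])
    fix t :: real assume t: "0 < t" "t \<le> 1"
    have "1 - exp (- t) \<le> t" using exp_ge_add_one_self[of "- t"] by linarith
    moreover have "exp (- t) \<le> 1" using t by simp
    ultimately have "norm (t powr (- \<sigma> - 1) * (1 - exp (- t))) \<le> t powr (- \<sigma> - 1) * t"
      by (simp add: abs_mult mult_left_mono)
    also have "\<dots> = t powr (- \<sigma>)" using t by (simp add: powr_diff)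
    finally show "norm (t powr (- \<sigma> - 1) * (1 - exp (- t))) \<le> 1 * t powr (- \<sigma>)" by simp
  next
    fix t :: real assume t: "1 \<le> t"
    have "\<bar>1 - exp (- t)\<bar> \<le> 1" using t by (simp add: abs_le_iff add_increasing)
    then show "norm (t powr (- \<sigma> - 1) * (1 - exp (- t))) \<le> 1 * t powr (- \<sigma> - 1)"
      by (simp add: abs_mult mult_left_le)
  qed (use \<sigma> in auto)
  then show ?thesis by (simp add: set_integrable_def)
qed

lemma Acon_nonneg_integrand:
  fixes t :: real
  assumes "0 \<le> l"
  shows "0 \<le> indicator {0<..} t *\<^sub>R (t powr (- \<sigma> - 1) * (1 - exp (- t * l)))"
  using assms by (auto simp: indicator_def)

lemma Acon_pos:
  assumes \<sigma>: "0 < \<sigma>" "\<sigma> < 1"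
  shows "0 < Acon \<sigma>"
proof -
  have nn: "0 \<le> indicator {0<..} t *\<^sub>R (t powr (- \<sigma> - 1) * (1 - exp (- t)))" for t :: real
    using Acon_nonneg_integrand[of 1 t \<sigma>] by simp
  have "Acon \<sigma> \<noteq> 0"
  proof
    assume "Acon \<sigma> = 0"
    then have "AE t in lborel. indicator {0<..} t *\<^sub>R (t powr (- \<sigma> - 1) * (1 - exp (- t))) = (0::real)"
      unfolding Acon_def using Acon_integrable[OF \<sigma>] nn by (subst (asm) integral_nonneg_eq_0_iff_AE) auto
    then have "AE t in lborel. (t::real) \<notin> {0<..<1}"
      by eventually_elim auto
    then have "emeasure lborel {0<..<1::real} = 0"
      by (subst (asm) AE_iff_measurable[OF _ refl]) (auto simp: greaterThanLessThan_def greaterThan_def lessThan_def Int_def)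
    then show False by simp
  qed
  moreover have "0 \<le> Acon \<sigma>" unfolding Acon_def by (intro Bochner_Integration.integral_nonneg nn)
  ultimately show ?thesis by simp
qed

text \<open>Scaling the time by l extracts the factor l^\<sigma>. With l = |xi|^2 this writes
  |xi|^(2\<sigma>) as a superposition of 1 - exp(-t |xi|^2). Convergence at time 0 requires \<sigma>
  < 1, and at infinity \<sigma> > 0.\<close>

lemma Acon_scale:
  assumes \<sigma>: "0 < \<sigma>" "\<sigma> < 1" and l: "0 \<le> l"
  shows "integrable lborel (\<lambda>t::real. indicator {0<..} t *\<^sub>R (t powr (- \<sigma> - 1) * (1 - exp (- t * l))))"
    and "(LINT t|lborel. indicator {0<..} t *\<^sub>R (t powr (- \<sigma> - 1) * (1 - exp (- t * l)))) = Acon \<sigma> * l powr \<sigma>"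
proof -
  let ?f = "\<lambda>t::real. indicator {0<..} t *\<^sub>R (t powr (- \<sigma> - 1) * (1 - exp (- t)))"
  have "integrable lborel (\<lambda>t::real. indicator {0<..} t *\<^sub>R (t powr (- \<sigma> - 1) * (1 - exp (- t * l)))) \<and>
    (LINT t|lborel. indicator {0<..} t *\<^sub>R (t powr (- \<sigma> - 1) * (1 - exp (- t * l)))) = Acon \<sigma> * l powr \<sigma>"
  proof (cases "l = 0")
    case False
    then have l: "l > 0" using l by simp
    have eq: "indicator {0<..} t *\<^sub>R (t powr (- \<sigma> - 1) * (1 - exp (- t * l))) = l powr (\<sigma> + 1) * ?f (0 + l * t)" for t :: real
    proof (cases "t > 0")
      case True
      have "l powr (\<sigma> + 1) * (l * t) powr (- \<sigma> - 1) = t powr (- \<sigma> - 1)"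
        using l True by (simp add: powr_mult powr_add[symmetric] flip: mult.assoc)
      then show ?thesis using l True by (simp add: mult.commute flip: mult.assoc)
    next
      case False
      then show ?thesis using l by (simp add: zero_less_mult_iff)
    qed
    have "Acon \<sigma> = l * (LINT t|lborel. ?f (0 + l * t))"
      unfolding Acon_def by (subst lborel_integral_real_affine[of l _ 0]) (use l in auto)
    then have "(LINT t|lborel. ?f (0 + l * t)) = Acon \<sigma> / l" using l by (simp add: field_simps)
    then have "(LINT t|lborel. l powr (\<sigma> + 1) * ?f (0 + l * t)) = Acon \<sigma> * l powr \<sigma>"
      using l unfolding integral_mult_right_zero by (simp add: powr_add)
    then show ?thesis
      unfolding eq using lborel_integrable_real_affine[OF Acon_integrable[OF \<sigma>], of l 0] l
      by (intro conjI integrable_mult_right) auto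
  qed simp
  then show "integrable lborel (\<lambda>t::real. indicator {0<..} t *\<^sub>R (t powr (- \<sigma> - 1) * (1 - exp (- t * l))))"
    "(LINT t|lborel. indicator {0<..} t *\<^sub>R (t powr (- \<sigma> - 1) * (1 - exp (- t * l)))) = Acon \<sigma> * l powr \<sigma>"
    by auto
qed

lemma schwartz_powr_integrable:
  assumes \<phi>: "schwartz \<phi>" and a: "0 \<le> a"
  shows "integrable lborel (\<lambda>\<xi>::'a::euclidean_space. complex_of_real (norm \<xi> powr a) * \<phi> \<xi>)"
proof -
  define m where "m = nat \<lceil>a\<rceil>"
  obtain C where C: "\<And>x. (1 + norm x) ^ (2 * DIM('a) + m) * norm (\<phi> x) \<le> C"
    using schwartz_bound[OF \<phi>] by blast
  have [measurable]: "\<phi> \<in> borel_measurable borel" by (rule schwartz_measurable[OF \<phi>])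
  show ?thesis
  proof (rule integrable_wt_bound[where C=C])
    show "(\<lambda>\<xi>::'a. complex_of_real (norm \<xi> powr a) * \<phi> \<xi>) \<in> borel_measurable borel" by measurable
    fix x :: 'a
    have "norm x powr a \<le> (1 + norm x) powr a" using a by (intro powr_mono2) auto
    also have "\<dots> \<le> (1 + norm x) powr real m" by (intro powr_mono) (auto simp: m_def real_nat_ceiling_ge)
    also have "\<dots> = (1 + norm x) ^ m" by (subst powr_realpow) (auto simp: add_pos_nonneg)
    finally have le: "norm x powr a \<le> (1 + norm x) ^ m" .
    show "norm (complex_of_real (norm x powr a) * \<phi> x) \<le> C * wt x"
    proof (rule norm_le_wtI)
      have "(1 + norm x) ^ (2 * DIM('a)) * norm (complex_of_real (norm x powr a) * \<phi> x) \<le>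
         (1 + norm x) ^ (2 * DIM('a)) * ((1 + norm x) ^ m * norm (\<phi> x))"
        unfolding norm_mult using le by (intro mult_left_mono mult_right_mono) auto
      also have "\<dots> \<le> C" using C[of x] by (simp add: power_add mult.assoc)
      finally show "(1 + norm x) ^ (2 * DIM('a)) * norm (complex_of_real (norm x powr a) * \<phi> x) \<le> C" .
    qed
  qed
qed

definition heat_ext :: "('a::euclidean_space \<Rightarrow> complex) \<Rightarrow> real \<Rightarrow> 'a \<Rightarrow> complex" where
  "heat_ext \<phi> t y = (LINT x|lborel. \<phi> x * complex_of_real (heat t (y - x)))"

lemma heat_measurable2 [measurable]:
  "(\<lambda>x. heat (f x) (g x)) \<in> borel_measurable M" if [measurable]: "f \<in> borel_measurable M" "g \<in> borel_measurable M"
  for g :: "'b \<Rightarrow> 'a::euclidean_space"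
  unfolding heat_def by measurable

lemma heat_ext_measurable [measurable]:
  assumes [measurable]: "\<phi> \<in> borel_measurable borel"
  shows "(\<lambda>t. heat_ext \<phi> t y) \<in> borel_measurable borel"
  unfolding heat_ext_def by measurable

text \<open>Insert the subordination formula under the inverse transform and exchange the integrals.
  The term 1 contributes a multiple of \<open>\<phi> y\<close>, which is 0, so only the heat flow
  remains.\<close>

lemma frac_power_heat:
  fixes \<phi> :: "'a::euclidean_space \<Rightarrow> complex"
  assumes \<sigma>: "0 < \<sigma>" "\<sigma> < 1" and \<phi>: "schwartz \<phi>" and y: "\<phi> y = 0"
  shows "complex_of_real (Acon \<sigma>) * inverse_fourier (\<lambda>\<xi>. complex_of_real (norm \<xi> powr (2 * \<sigma>)) * fourier \<phi> \<xi>) y =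
    - (LINT t|lborel. indicator {0<..} t *\<^sub>R (complex_of_real (t powr (- \<sigma> - 1)) * heat_ext \<phi> t y))"
proof -
  let ?a = "\<lambda>\<xi> t. indicator {0<..} t *\<^sub>R (t powr (- \<sigma> - 1) * (1 - exp (- t * (\<xi> \<bullet> \<xi>)))) :: real"
  let ?e = "\<lambda>\<xi>. fourier \<phi> \<xi> * exp (\<i> * complex_of_real (y \<bullet> \<xi>))"
  let ?G = "\<lambda>\<xi>::'a. \<lambda>t. complex_of_real (?a \<xi> t) * ?e \<xi>"
  have sF: "schwartz (fourier \<phi>)" by (rule schwartz_fourier[OF \<phi>])
  have [measurable]: "fourier \<phi> \<in> borel_measurable borel" by (rule schwartz_measurable[OF sF])
  have pw: "(\<xi> \<bullet> \<xi>) powr \<sigma> = norm \<xi> powr (2 * \<sigma>)" for \<xi> :: 'a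
    by (metis norm_ge_zero power2_norm_eq_inner powr_numeral powr_powr)
  have inner1: "(LINT t|lborel. ?G \<xi> t) = complex_of_real (Acon \<sigma>) * (complex_of_real (norm \<xi> powr (2 * \<sigma>)) * fourier \<phi> \<xi> * exp (\<i> * complex_of_real (y \<bullet> \<xi>)))" for \<xi>
    using Acon_scale(2)[OF \<sigma>, of "\<xi> \<bullet> \<xi>"] unfolding integral_mult_left_zero integral_complex_of_real by (simp add: pw)
  \<comment> \<open>The integrand in t is nonnegative up to the frequency factor, so the inner norm
    integral is evaluated exactly; what is left is |xi|^(2\<sigma>) times a Schwartz
    function.\<close>
  have prod: "integrable (lborel \<Otimes>\<^sub>M lborel) (\<lambda>(\<xi>, t). ?G \<xi> t)"
  proof (rule Fubini_integrable_real)
    show "(\<lambda>(\<xi>, t). ?G \<xi> t) \<in> borel_measurable (borel \<Otimes>\<^sub>M borel)" by measurable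
    show "integrable lborel (?G \<xi>)" for \<xi>
      by (intro integrable_mult_left integrable_of_real Acon_scale \<sigma>) simp
    show "(LINT t|lborel. norm (?G \<xi> t)) = norm (complex_of_real (Acon \<sigma>) * (complex_of_real (norm \<xi> powr (2 * \<sigma>)) * fourier \<phi> \<xi>))" for \<xi>
    proof -
      have "norm (?G \<xi> t) = ?a \<xi> t * norm (fourier \<phi> \<xi>)" for t
      proof -
        have "norm (?G \<xi> t) = \<bar>?a \<xi> t\<bar> * (norm (fourier \<phi> \<xi>) * 1)"
          by (simp only: norm_mult norm_of_real norm_exp_i_times)
        then show ?thesis using Acon_nonneg_integrand[of "\<xi> \<bullet> \<xi>" t \<sigma>] by (simp only: abs_of_nonneg inner_ge_zero mult_1_right)
      qed
      then show ?thesis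
        using Acon_scale(2)[OF \<sigma>, of "\<xi> \<bullet> \<xi>"] Acon_pos[OF \<sigma>]
        by (simp only: integral_mult_left_zero) (simp add: norm_mult pw)
    qed
    show "integrable lborel (\<lambda>\<xi>::'a. norm (complex_of_real (Acon \<sigma>) * (complex_of_real (norm \<xi> powr (2 * \<sigma>)) * fourier \<phi> \<xi>)))"
      using \<sigma> by (intro integrable_norm integrable_mult_right schwartz_powr_integrable sF) simp
  qed
  have inner2: "(LINT \<xi>|lborel. ?G \<xi> t) = - ((2 * complex_of_real pi) ^ DIM('a)) * (indicator {0<..} t *\<^sub>R (complex_of_real (t powr (- \<sigma> - 1)) * heat_ext \<phi> t y))" for t
  proof (cases "t > 0")
    case True
    have i1: "integrable lborel ?e"
      by (rule integrable_fourier_kernel(2)[OF schwartz_integrable[OF sF], of y, unfolded inner_commute[of _ y]])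
    have i2: "integrable lborel (\<lambda>\<xi>. fourier \<phi> \<xi> * gauss t \<xi> * exp (\<i> * complex_of_real (y \<bullet> \<xi>)))"
      by (rule Bochner_Integration.integrable_bound[OF i1]) (measurable, use True in \<open>auto intro!: AE_I2 simp: norm_mult mult_left_le\<close>)
    have "(LINT \<xi>|lborel. ?G \<xi> t) = (LINT \<xi>|lborel. complex_of_real (t powr (- \<sigma> - 1)) *
        (?e \<xi> - fourier \<phi> \<xi> * gauss t \<xi> * exp (\<i> * complex_of_real (y \<bullet> \<xi>))))"
      using True by (intro Bochner_Integration.integral_cong refl) (simp add: gauss_def algebra_simps)
    also have "\<dots> = complex_of_real (t powr (- \<sigma> - 1)) * ((LINT \<xi>|lborel. ?e \<xi>) - (2 * complex_of_real pi) ^ DIM('a) * heat_ext \<phi> t y)"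
      unfolding integral_mult_right_zero Bochner_Integration.integral_diff[OF i1 i2]
        heat_fourier[OF schwartz_integrable[OF \<phi>] True] heat_ext_def ..
    also have "(LINT \<xi>|lborel. ?e \<xi>) = (2 * complex_of_real pi) ^ DIM('a) * inverse_fourier (fourier \<phi>) y"
      by (simp add: inverse_fourier_def)
    also have "inverse_fourier (fourier \<phi>) y = 0" by (simp add: inverse_fourier_fourier[OF \<phi>] y)
    finally show ?thesis using True by (simp add: mult_ac)
  qed simp
  have "(2 * complex_of_real pi) ^ DIM('a) * (complex_of_real (Acon \<sigma>) * inverse_fourier (\<lambda>\<xi>. complex_of_real (norm \<xi> powr (2 * \<sigma>)) * fourier \<phi> \<xi>) y)
     = (LINT \<xi>|lborel. LINT t|lborel. ?G \<xi> t)"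
    unfolding inner1 by (simp add: inverse_fourier_def)
  also have "\<dots> = (LINT t|lborel. LINT \<xi>|lborel. ?G \<xi> t)"
    by (rule lborel_pair.Fubini_integral[OF prod, symmetric])
  also have "\<dots> = (2 * complex_of_real pi) ^ DIM('a) * (- (LINT t|lborel. indicator {0<..} t *\<^sub>R (complex_of_real (t powr (- \<sigma> - 1)) * heat_ext \<phi> t y)))"
    unfolding inner2 integral_mult_right_zero by simp
  finally show ?thesis by (subst (asm) mult_left_cancel) auto
qed

text \<open>Away from the origin the kernel vanishes to every order as the time tends to 0,
  uniformly in the position, because exp(-w) is bounded by any negative power of w = |z|^2 / (4t).
  This tames arbitrarily negative powers of t in the integrals over time.\<close>

lemma heat_small:
  assumes \<delta>: "0 < \<delta>"
  shows "\<exists>C\<ge>1. \<forall>t z::'a::euclidean_space. 0 < t \<longrightarrow> \<delta> \<le> norm z \<longrightarrow>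
     (t \<le> 1 \<longrightarrow> heat t z \<le> C * t ^ N) \<and> (1 \<le> t \<longrightarrow> heat t z \<le> C)"
proof -
  \<comment> \<open>The extra \<open>DIM('a)\<close> powers absorb the normalising factor of the
    kernel, which for t \<le> 1 is bounded crudely by t to the power
    \<open>- DIM('a)\<close>.\<close>
  define k where "k = N + DIM('a)"
  define C where "C = real k ^ k * (4 / \<delta>\<^sup>2) ^ k"
  have C: "0 \<le> C" by (simp add: C_def)
  have "heat t z \<le> C * t ^ N" if t: "0 < t" "t \<le> 1" and z: "\<delta> \<le> norm z" for t and z :: 'a
  proof -
    define w where "w = (z \<bullet> z) / (4 * t)"
    have zz: "\<delta>\<^sup>2 \<le> z \<bullet> z" using z \<delta> by (simp add: power2_norm_eq_inner[symmetric] power_mono)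
    have zp: "0 < z \<bullet> z" using zz \<delta> by (smt (verit) zero_less_power)
    have w: "w > 0" using zp t by (simp add: w_def)
    have "w ^ k \<le> real k ^ k * exp w" using w by (intro power_le_exp) simp
    then have "exp (- w) \<le> real k ^ k * (1 / w) ^ k"
      using w by (simp add: exp_minus field_simps power_divide)
    also have "(1 / w) ^ k \<le> (4 * t / \<delta>\<^sup>2) ^ k"
      using zz zp t \<delta> by (intro power_mono) (auto simp: w_def intro!: divide_left_mono)
    also have "real k ^ k * (4 * t / \<delta>\<^sup>2) ^ k = C * t ^ k"
      by (simp add: C_def power_mult_distrib power_divide)
    finally have e: "exp (- w) \<le> C * t ^ k" by (simp add: mult_left_mono)
    have "t ^ DIM('a) \<le> sqrt (4 * pi * t) ^ DIM('a)"
    proof (rule power_mono)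
      have "t \<le> 4 * pi" using t pi_gt3 by linarith
      then have "t * t \<le> 4 * pi * t" using t by (intro mult_right_mono) auto
      then show "t \<le> sqrt (4 * pi * t)" by (intro real_le_rsqrt) (simp add: power2_eq_square)
    qed (use t in simp)
    then have "heat t z \<le> exp (- w) / t ^ DIM('a)"
      unfolding heat_def w_def using t by (intro frac_le) auto
    also have "\<dots> \<le> C * t ^ k / t ^ DIM('a)" using e t by (intro divide_right_mono) auto
    also have "\<dots> = C * t ^ N" using t by (simp add: k_def power_add)
    finally show ?thesis .
  qed
  moreover have "heat t z \<le> 1" if t: "1 \<le> t" for t and z :: 'a
  proof -
    have "1 \<le> 4 * pi * t" using t pi_gt3 mult_mono[of 1 "4 * pi" 1 t] by simp
    then have "1 \<le> sqrt (4 * pi * t) ^ DIM('a)" by (intro one_le_power) simp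
    moreover have "exp (- (z \<bullet> z) / (4 * t)) \<le> 1" using t by (simp add: divide_nonpos_pos)
    ultimately have "exp (- (z \<bullet> z) / (4 * t)) \<le> sqrt (4 * pi * t) ^ DIM('a)" "0 < sqrt (4 * pi * t) ^ DIM('a)"
      by linarith+
    then show ?thesis unfolding heat_def by (subst divide_le_eq_1_pos)
  qed
  ultimately have "\<forall>t z::'a. 0 < t \<longrightarrow> \<delta> \<le> norm z \<longrightarrow>
     (t \<le> 1 \<longrightarrow> heat t z \<le> (C + 1) * t ^ N) \<and> (1 \<le> t \<longrightarrow> heat t z \<le> C + 1)"
    using C by (smt (verit) mult_right_mono zero_le_power)
  then show ?thesis using C by (intro exI[of _ "C + 1"]) auto
qed

lemma heat_ext_small:
  fixes \<phi> :: "'a::euclidean_space \<Rightarrow> complex"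
  assumes \<delta>: "0 < \<delta>" and \<phi>: "integrable lborel \<phi>" and off: "\<And>x. norm (y - x) < \<delta> \<Longrightarrow> \<phi> x = 0"
  shows "\<exists>D\<ge>0. \<forall>t. 0 < t \<longrightarrow> (t \<le> 1 \<longrightarrow> norm (heat_ext \<phi> t y) \<le> D * t ^ N) \<and> (1 \<le> t \<longrightarrow> norm (heat_ext \<phi> t y) \<le> D)"
proof -
  obtain C where C: "C \<ge> 1" "\<And>t z::'a. 0 < t \<Longrightarrow> \<delta> \<le> norm z \<Longrightarrow> t \<le> 1 \<Longrightarrow> heat t z \<le> C * t ^ N"
     "\<And>t z::'a. 0 < t \<Longrightarrow> \<delta> \<le> norm z \<Longrightarrow> 1 \<le> t \<Longrightarrow> heat t z \<le> C"
    using heat_small[OF \<delta>] by metis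
  define I where "I = (LINT x|lborel. norm (\<phi> x))"
  have I: "I \<ge> 0" by (simp add: I_def)
  have gen: "norm (heat_ext \<phi> t y) \<le> B * I" if t: "0 < t" and B: "\<And>z::'a. \<delta> \<le> norm z \<Longrightarrow> heat t z \<le> B" "0 \<le> B" for t B
  proof -
    have "norm (heat_ext \<phi> t y) \<le> (LINT x|lborel. norm (\<phi> x * complex_of_real (heat t (y - x))))"
      unfolding heat_ext_def by (rule integral_norm_bound)
    also have "\<dots> \<le> (LINT x|lborel. B * norm (\<phi> x))"
    proof (rule integral_mono_AE')
      show "AE x in lborel. norm (\<phi> x * complex_of_real (heat t (y - x))) \<le> B * norm (\<phi> x)"
      proof (rule AE_I2)
        fix x
        show "norm (\<phi> x * complex_of_real (heat t (y - x))) \<le> B * norm (\<phi> x)"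
        proof (cases "norm (y - x) < \<delta>")
          case False
          then have "heat t (y - x) \<le> B" by (intro B) simp
          then have "norm (\<phi> x) * heat t (y - x) \<le> norm (\<phi> x) * B" by (intro mult_left_mono) auto
          then show ?thesis by (simp add: norm_mult mult.commute abs_of_nonneg[OF heat_nonneg[OF t]])
        qed (simp add: off)
      qed
    qed (use \<phi> B in auto)
    finally show ?thesis by (simp add: I_def)
  qed
  show ?thesis
  proof (intro exI[of _ "C * I"] conjI allI impI)
    fix t :: real assume t: "0 < t"
    show "norm (heat_ext \<phi> t y) \<le> C * I * t ^ N" if "t \<le> 1"
      using gen[OF t, of "C * t ^ N"] C that t by (simp add: mult_ac)
    show "norm (heat_ext \<phi> t y) \<le> C * I" if "1 \<le> t"
      using gen[OF t, of C] C that t by simp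
  qed (use C I in auto)
qed

lemma heat_ext_set_integrable:
  fixes \<phi> :: "'a::euclidean_space \<Rightarrow> complex"
  assumes a: "0 < a" and \<delta>: "0 < \<delta>" and \<phi>: "integrable lborel \<phi>" and off: "\<And>x. norm (y - x) < \<delta> \<Longrightarrow> \<phi> x = 0"
  shows "set_integrable lborel {0<..} (\<lambda>t. complex_of_real (t powr (- a - 1)) * heat_ext \<phi> t y)"
proof -
  \<comment> \<open>Vanishing to order a + 1 at time 0 makes the integrand bounded there.\<close>
  define N where "N = nat \<lceil>a\<rceil> + 1"
  have N: "real N \<ge> a + 1" unfolding N_def by (simp add: real_nat_ceiling_ge)
  obtain D where D: "D \<ge> 0" "\<And>t. 0 < t \<Longrightarrow> t \<le> 1 \<Longrightarrow> norm (heat_ext \<phi> t y) \<le> D * t ^ N"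
      "\<And>t. 0 < t \<Longrightarrow> 1 \<le> t \<Longrightarrow> norm (heat_ext \<phi> t y) \<le> D"
    using heat_ext_small[OF \<delta> \<phi> off, where N=N] by metis
  have [measurable]: "\<phi> \<in> borel_measurable borel" using \<phi> by auto
  show ?thesis
  proof (rule set_integrable_powr_bound[where a=0 and b="- a - 1" and C=D])
    show "(\<lambda>t. complex_of_real (t powr (- a - 1)) * heat_ext \<phi> t y) \<in> borel_measurable borel" by measurable
    fix t :: real assume t: "0 < t" "t \<le> 1"
    have "norm (complex_of_real (t powr (- a - 1)) * heat_ext \<phi> t y) \<le> t powr (- a - 1) * (D * t ^ N)"
      unfolding norm_mult using D(2)[OF t] by (simp add: mult_left_mono)
    also have "\<dots> = D * t powr (real N - a - 1)"
      using t by (simp add: powr_realpow[symmetric] powr_add[symmetric] algebra_simps)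
    also have "\<dots> \<le> D * t powr 0"
      using t N D by (intro mult_left_mono powr_mono') auto
    finally show "norm (complex_of_real (t powr (- a - 1)) * heat_ext \<phi> t y) \<le> D * t powr 0" .
  next
    fix t :: real assume t: "1 \<le> t"
    then show "norm (complex_of_real (t powr (- a - 1)) * heat_ext \<phi> t y) \<le> D * t powr (- a - 1)"
      unfolding norm_mult using mult_left_mono[OF D(3)[of t], of "t powr (- a - 1)"] by (simp add: mult.commute)
  qed (use a in auto)
qed

text \<open>A Taylor remainder whose bound is free of exponentials. This works because both
  arguments of exp are nonpositive; it makes the difference quotients of exp(-t |xi|^2) uniformly
  controlled by |xi|^4.\<close>

lemma exp_second_order:
  fixes x y :: real
  assumes "0 \<le> x" "0 \<le> y"
  shows "\<bar>exp (- x) - exp (- y) + (x - y) * exp (- y)\<bar> \<le> (x - y)\<^sup>2"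
proof (cases "y \<le> x")
  case True
  define u where "u = x - y"
  have u: "u \<ge> 0" using True by (simp add: u_def)
  have "exp u \<ge> 1 + u" by (rule exp_ge_add_one_self)
  then have "inverse (exp u) \<le> inverse (1 + u)" using u by (intro le_imp_inverse_le) auto
  then have "exp (- u) \<le> 1 / (1 + u)" by (simp add: exp_minus inverse_eq_divide)
  then have "exp (- u) - 1 + u \<le> 1 / (1 + u) - 1 + u" by simp
  also have "\<dots> = u\<^sup>2 / (1 + u)" using u by (simp add: field_simps power2_eq_square)
  also have "\<dots> \<le> u\<^sup>2" using u by (simp add: divide_le_eq mult_left_le algebra_simps)
  finally have le: "exp (- u) - 1 + u \<le> u\<^sup>2" .
  have ge: "0 \<le> exp (- u) - 1 + u" using exp_ge_add_one_self[of "- u"] by linarith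
  have e: "exp (- x) = exp (- y) * exp (- u)" by (simp add: u_def mult_exp_exp)
  have "exp (- x) - exp (- y) + (x - y) * exp (- y) = exp (- y) * (exp (- u) - 1 + u)"
    unfolding e u_def[symmetric] by (simp add: algebra_simps)
  also have "\<bar>\<dots>\<bar> \<le> 1 * u\<^sup>2"
    unfolding abs_mult using assms le ge by (intro mult_mono) auto
  finally show ?thesis by (simp add: u_def)
next
  case False
  define v where "v = y - x"
  have v: "v \<ge> 0" using False by (simp add: v_def)
  have "exp (- v) * (1 + v) \<le> exp (- v) * exp v"
    using exp_ge_add_one_self[of v] by (intro mult_left_mono) auto
  then have ge: "0 \<le> 1 - exp (- v) * (1 + v)" by (simp add: exp_minus)
  have "(1 - v) * (1 + v) \<le> exp (- v) * (1 + v)"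
    using exp_ge_add_one_self[of "- v"] v by (intro mult_right_mono) auto
  then have le: "1 - exp (- v) * (1 + v) \<le> v\<^sup>2" by (simp add: algebra_simps power2_eq_square)
  have e: "exp (- y) = exp (- x) * exp (- v)" by (simp add: v_def mult_exp_exp)
  have xy: "x - y = - v" by (simp add: v_def)
  have "exp (- x) - exp (- y) + (x - y) * exp (- y) = exp (- x) * (1 - exp (- v) * (1 + v))"
    unfolding e xy by (simp add: algebra_simps)
  also have "\<bar>\<dots>\<bar> \<le> 1 * v\<^sup>2"
    unfolding abs_mult using assms le ge by (intro mult_mono) auto
  finally show ?thesis by (simp add: v_def power2_commute)
qed

text \<open>The heat equation, verified on the Fourier side: differentiating exp(-t |xi|^2) in t
  brings down -|xi|^2, the symbol of the Laplacian. The remainder is (r - t)^2 |xi|^4 times the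
  transform of \<open>\<phi>\<close>, which is integrable.\<close>

lemma heat_ext_has_derivative:
  fixes \<phi> :: "'a::euclidean_space \<Rightarrow> complex"
  assumes \<phi>: "schwartz \<phi>" and t: "0 < t"
  shows "((\<lambda>t. heat_ext \<phi> t y) has_vector_derivative heat_ext (Lap \<phi>) t y) (at t)"
proof -
  let ?e = "\<lambda>\<xi>. exp (\<i> * complex_of_real (y \<bullet> \<xi>))"
  let ?c = "(2 * complex_of_real pi) ^ DIM('a)"
  let ?H = "\<lambda>t. LINT \<xi>|lborel. fourier \<phi> \<xi> * gauss t \<xi> * ?e \<xi>"
  let ?H' = "\<lambda>t. LINT \<xi>|lborel. - complex_of_real (\<xi> \<bullet> \<xi>) * fourier \<phi> \<xi> * gauss t \<xi> * ?e \<xi>"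
  have sL: "schwartz (Lap \<phi>)" by (rule scont_schwartz[OF scont_Lap[OF scont_id] \<phi>])
  have sF: "schwartz (fourier \<phi>)" by (rule schwartz_fourier[OF \<phi>])
  have sFL: "schwartz (\<lambda>\<xi>. - complex_of_real (\<xi> \<bullet> \<xi>) * fourier \<phi> \<xi>)"
    by (intro schwartz_mult temperate_minus temperate_norm_square sF)
  have sFLL: "schwartz (\<lambda>\<xi>. complex_of_real (\<xi> \<bullet> \<xi>) * (complex_of_real (\<xi> \<bullet> \<xi>) * fourier \<phi> \<xi>))"
    by (intro schwartz_mult temperate_norm_square sF)
  have int: "integrable lborel (\<lambda>\<xi>. h \<xi> * gauss t \<xi> * ?e \<xi>)" if "schwartz h" "0 < t" for h and t
  proof (rule Bochner_Integration.integrable_bound[OF schwartz_integrable[OF that(1)]])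
    have [measurable]: "h \<in> borel_measurable borel" by (rule schwartz_measurable[OF that(1)])
    show "(\<lambda>\<xi>. h \<xi> * gauss t \<xi> * ?e \<xi>) \<in> borel_measurable lborel" by measurable
    show "AE \<xi> in lborel. norm (h \<xi> * gauss t \<xi> * ?e \<xi>) \<le> norm (h \<xi>)"
      using that by (intro AE_I2) (simp add: norm_mult mult_left_le)
  qed
  define Q where "Q = (LINT \<xi>|lborel. norm (complex_of_real (\<xi> \<bullet> \<xi>) * (complex_of_real (\<xi> \<bullet> \<xi>) * fourier \<phi> \<xi>)))"
  have "(?H has_derivative (\<lambda>h. h *\<^sub>R ?H' t)) (at t)"
  proof (rule has_derivativeI_sandwich[where e=t and H="\<lambda>r. Q * norm (r - t)"])
    fix r assume r: "r \<noteq> t" "dist r t < t"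
    then have rp: "0 < r" by (auto simp: dist_real_def)
    let ?R = "\<lambda>\<xi>. fourier \<phi> \<xi> * gauss r \<xi> * ?e \<xi> - fourier \<phi> \<xi> * gauss t \<xi> * ?e \<xi> - (r - t) *\<^sub>R (- complex_of_real (\<xi> \<bullet> \<xi>) * fourier \<phi> \<xi> * gauss t \<xi> * ?e \<xi>)"
    have eq: "?H r - ?H t - (r - t) *\<^sub>R ?H' t = (LINT \<xi>|lborel. ?R \<xi>)"
      using int[OF sF rp] int[OF sF t] int[OF sFL t] by simp
    have "norm (?H r - ?H t - (r - t) *\<^sub>R ?H' t) \<le> (LINT \<xi>|lborel. norm (?R \<xi>))"
      unfolding eq by (rule integral_norm_bound)
    also have "\<dots> \<le> (LINT \<xi>|lborel. (r - t)\<^sup>2 * norm (complex_of_real (\<xi> \<bullet> \<xi>) * (complex_of_real (\<xi> \<bullet> \<xi>) * fourier \<phi> \<xi>)))"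
    proof (rule integral_mono_AE')
      show "integrable lborel (\<lambda>\<xi>. (r - t)\<^sup>2 * norm (complex_of_real (\<xi> \<bullet> \<xi>) * (complex_of_real (\<xi> \<bullet> \<xi>) * fourier \<phi> \<xi>)))"
        by (intro integrable_mult_right integrable_norm schwartz_integrable sFLL)
      show "AE \<xi> in lborel. norm (?R \<xi>) \<le> (r - t)\<^sup>2 * norm (complex_of_real (\<xi> \<bullet> \<xi>) * (complex_of_real (\<xi> \<bullet> \<xi>) * fourier \<phi> \<xi>))"
      proof (rule AE_I2)
        fix \<xi> :: 'a
        define q where "q = \<xi> \<bullet> \<xi>"
        have q: "q \<ge> 0" by (simp add: q_def)
        have "?R \<xi> = fourier \<phi> \<xi> * ?e \<xi> * complex_of_real (exp (- (r * q)) - exp (- (t * q)) + (r * q - t * q) * exp (- (t * q)))"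
          by (simp add: gauss_def q_def[symmetric] algebra_simps scaleR_conv_of_real)
        then have "norm (?R \<xi>) = norm (fourier \<phi> \<xi>) * \<bar>exp (- (r * q)) - exp (- (t * q)) + (r * q - t * q) * exp (- (t * q))\<bar>"
          by (simp add: norm_mult del: of_real_add of_real_diff of_real_mult)
        also have "\<dots> \<le> norm (fourier \<phi> \<xi>) * (r * q - t * q)\<^sup>2"
          using q rp t by (intro mult_left_mono exp_second_order) auto
        also have "\<dots> = (r - t)\<^sup>2 * norm (complex_of_real (\<xi> \<bullet> \<xi>) * (complex_of_real (\<xi> \<bullet> \<xi>) * fourier \<phi> \<xi>))"
          using q by (simp add: norm_mult q_def[symmetric] power2_eq_square algebra_simps)
        finally show "norm (?R \<xi>) \<le> (r - t)\<^sup>2 * norm (complex_of_real (\<xi> \<bullet> \<xi>) * (complex_of_real (\<xi> \<bullet> \<xi>) * fourier \<phi> \<xi>))" .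
      qed
    qed auto
    also have "\<dots> = Q * norm (r - t) * norm (r - t)"
      by (simp add: Q_def power2_eq_square abs_mult_self_eq mult_ac)
    finally show "norm (?H r - ?H t - (r - t) *\<^sub>R ?H' t) / norm (r - t) \<le> Q * norm (r - t)"
      using r by (simp add: divide_le_eq)
  next
    show "((\<lambda>r. Q * norm (r - t)) \<longlongrightarrow> 0) (at t)" by (auto intro!: tendsto_eq_intros)
  next
    show "bounded_linear (\<lambda>h. h *\<^sub>R ?H' t)" by (rule bounded_linear_scaleR_left)
  qed (use t in auto)
  then have "((\<lambda>t. (1 / ?c) * ?H t) has_vector_derivative (1 / ?c) * ?H' t) (at t)"
    unfolding has_vector_derivative_def[symmetric] by (rule has_vector_derivative_mult_right)
  moreover have "(1 / ?c) * ?H' t = heat_ext (Lap \<phi>) t y"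
    using heat_fourier[OF schwartz_integrable[OF sL] t, of y]
    by (simp add: fourier_Lap[OF \<phi>] heat_ext_def)
  moreover have "(1 / ?c) * ?H r = heat_ext \<phi> r y" if "r \<in> {0<..}" for r
    using heat_fourier[OF schwartz_integrable[OF \<phi>], of r y] that by (simp add: heat_ext_def)
  ultimately show ?thesis
    using has_vector_derivative_transform_within_open[of "\<lambda>t. (1 / ?c) * ?H t" _ t "{0<..}" "\<lambda>t. heat_ext \<phi> t y"] t
    by auto
qed

lemma Lap_off:
  fixes \<phi> :: "'a::euclidean_space \<Rightarrow> complex"
  assumes "\<And>x. norm (y - x) < \<delta> \<Longrightarrow> \<phi> x = 0" and "norm (y - x) < \<delta>"
  shows "Lap \<phi> x = 0"
proof -
  have cl: "closed (- ball y \<delta>)" by (rule closed_Compl[OF open_ball])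
  have "partial_deriv bs \<phi> x = 0" for bs
    by (rule partial_derivs_outside[OF cl]) (use assms in \<open>auto simp: dist_norm\<close>)
  then show ?thesis by (simp add: Lap_def)
qed

lemma schwartz_Lap: "schwartz \<phi> \<Longrightarrow> schwartz (Lap \<phi>)"
  by (rule scont_schwartz[OF scont_Lap[OF scont_id]])

text \<open>
  The Laplacian is the time derivative of the heat flow, so it can be traded for a power of
  \<open>t\<close>.
\<close>

lemma heat_ext_by_parts:
  fixes \<phi> :: "'a::euclidean_space \<Rightarrow> complex"
  assumes a: "0 < a" and \<delta>: "0 < \<delta>" and \<phi>: "schwartz \<phi>" and off: "\<And>x. norm (y - x) < \<delta> \<Longrightarrow> \<phi> x = 0"
  shows "(LBINT t:{0<..}. complex_of_real (t powr (- a - 1)) * heat_ext (Lap \<phi>) t y) =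
    complex_of_real (a + 1) * (LBINT t:{0<..}. complex_of_real (t powr (- (a + 1) - 1)) * heat_ext \<phi> t y)"
proof -
  note \<phi>i = schwartz_integrable[OF \<phi>] and Li = schwartz_integrable[OF schwartz_Lap[OF \<phi>]]
  note offL = Lap_off[of y \<delta> \<phi>, OF off]
  let ?F = "\<lambda>t. complex_of_real (t powr (- a - 1)) * heat_ext \<phi> t y"
  let ?f1 = "\<lambda>t. complex_of_real (t powr (- a - 1)) * heat_ext (Lap \<phi>) t y"
  let ?f2 = "\<lambda>t. complex_of_real (t powr (- (a + 1) - 1)) * heat_ext \<phi> t y"
  let ?f = "\<lambda>t. ?f1 t - complex_of_real (a + 1) * ?f2 t"
  have i1: "set_integrable lborel {0<..} ?f1"
    by (rule heat_ext_set_integrable[OF a \<delta> Li]) (rule offL)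
  have i2: "set_integrable lborel {0<..} ?f2"
    by (rule heat_ext_set_integrable[OF _ \<delta> \<phi>i]) (use a off in auto)
  have i3: "set_integrable lborel {0<..} (\<lambda>t. complex_of_real (a + 1) * ?f2 t)"
    using i2 by (rule set_integrable_mult_right)
  \<comment> \<open>One order more than for mere integrability: it makes the boundary term at time 0
    of size O(t).\<close>
  define N where "N = nat \<lceil>a\<rceil> + 2"
  have N: "real N \<ge> a + 2" unfolding N_def by (simp add: real_nat_ceiling_ge)
  obtain D where D: "D \<ge> 0" "\<And>t. 0 < t \<Longrightarrow> t \<le> 1 \<Longrightarrow> norm (heat_ext \<phi> t y) \<le> D * t ^ N"
      "\<And>t. 0 < t \<Longrightarrow> 1 \<le> t \<Longrightarrow> norm (heat_ext \<phi> t y) \<le> D"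
    using heat_ext_small[OF \<delta> \<phi>i off, where N=N] by metis
  have "(LBINT t=0..\<infinity>. ?f t) = 0 - 0"
  proof (rule interval_integral_FTC_integrable[where F="?F"])
    show "(?F has_vector_derivative ?f t) (at t)" if "0 < ereal t" for t
    proof -
      have t: "0 < t" using that by (simp add: zero_ereal_def)
      have "((\<lambda>t. t powr (- a - 1)) has_real_derivative (- a - 1) * t powr (- a - 1 - 1)) (at t)"
        using has_real_derivative_powr[OF t, of "- a - 1"] by simp
      then have "((\<lambda>t. complex_of_real (t powr (- a - 1))) has_vector_derivative complex_of_real ((- a - 1) * t powr (- a - 1 - 1))) (at t)"
        by (intro has_vector_derivative_of_real) (simp add: has_real_derivative_iff_has_vector_derivative)
      from has_vector_derivative_mult[OF this heat_ext_has_derivative[OF \<phi> t, of y]]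
      show ?thesis by (rule has_vector_derivative_eq_rhs) (simp add: algebra_simps)
    qed
    show "isCont ?f t" if "0 < ereal t" for t
    proof -
      have t: "0 < t" using that by (simp add: zero_ereal_def)
      have "isCont (\<lambda>t. heat_ext \<phi> t y) t" "isCont (\<lambda>t. heat_ext (Lap \<phi>) t y) t"
        using has_vector_derivative_continuous[OF heat_ext_has_derivative[OF _ t]] \<phi> schwartz_Lap[OF \<phi>] by auto
      then show ?thesis using t by (intro continuous_intros) auto
    qed
    show "set_integrable lborel (einterval 0 \<infinity>) ?f"
      using set_integral_diff(1)[OF i1 i3] by (simp add: einterval_def zero_ereal_def greaterThan_def)
    have small: "norm (?F t) \<le> D * t" if t: "0 < t" "t < 1" for t
    proof -
      have "norm (?F t) \<le> t powr (- a - 1) * (D * t ^ N)"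
        unfolding norm_mult using D(2)[of t] t by (simp add: mult_left_mono)
      also have "\<dots> = D * t powr (real N - a - 1)"
        using t by (simp add: powr_realpow[symmetric] powr_add[symmetric] algebra_simps)
      also have "\<dots> \<le> D * t powr 1" using t N D by (intro mult_left_mono powr_mono') auto
      finally show ?thesis using t by simp
    qed
    have "(?F \<longlongrightarrow> 0) (at_right 0)"
    proof (rule Lim_null_comparison)
      show "\<forall>\<^sub>F t in at_right 0. norm (?F t) \<le> D * t"
        by (rule eventually_mono[OF eventually_at_right_real[of 0 1]]) (use small in auto)
      show "((\<lambda>t. D * t) \<longlongrightarrow> 0) (at_right 0)" by (auto intro!: tendsto_eq_intros)
    qed
    then show "((?F \<circ> real_of_ereal) \<longlongrightarrow> 0) (at_right 0)"
      by (simp add: ereal_tendsto_simps zero_ereal_def)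
    have "(?F \<longlongrightarrow> 0) at_top"
    proof (rule Lim_null_comparison)
      show "\<forall>\<^sub>F t in at_top. norm (?F t) \<le> D * t powr (- a - 1)"
        using eventually_ge_at_top[of 1]
      proof eventually_elim
        case (elim t)
        then show ?case unfolding norm_mult
          using mult_left_mono[OF D(3)[of t], of "t powr (- a - 1)"] by (simp add: mult.commute)
      qed
      have "((\<lambda>t. t powr (- a - 1)) \<longlongrightarrow> 0) at_top"
        using a by (intro tendsto_neg_powr filterlim_ident) auto
      from tendsto_mult[OF tendsto_const this, of D]
      show "((\<lambda>t. D * t powr (- a - 1)) \<longlongrightarrow> 0) at_top" by simp
    qed
    then show "((?F \<circ> real_of_ereal) \<longlongrightarrow> 0) (at_left \<infinity>)"
      by (simp add: ereal_tendsto_simps)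
  qed simp
  then have "(LBINT t:{0<..}. ?f t) = 0"
    by (simp add: interval_lebesgue_integral_def einterval_def zero_ereal_def greaterThan_def)
  then have "(LBINT t:{0<..}. ?f1 t) - (LBINT t:{0<..}. complex_of_real (a + 1) * ?f2 t) = 0"
    using set_integral_diff(2)[OF i1 i3] by simp
  then show ?thesis by (simp only: set_integral_mult_right) simp
qed

text \<open>Each integration by parts removes one Laplacian, lowers the power of t by one and
  contributes the next factor of the Pochhammer symbol. The zero set around y survives the
  Laplacian, so the step can be repeated.\<close>

lemma heat_ext_Lap_power:
  fixes \<phi> :: "'a::euclidean_space \<Rightarrow> complex"
  assumes a: "0 < a" and \<delta>: "0 < \<delta>" and \<phi>: "schwartz \<phi>" and off: "\<And>x. norm (y - x) < \<delta> \<Longrightarrow> \<phi> x = 0"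
  shows "(LBINT t:{0<..}. complex_of_real (t powr (- a - 1)) * heat_ext ((Lap ^^ k) \<phi>) t y) =
    complex_of_real (pochhammer (a + 1) k) * (LBINT t:{0<..}. complex_of_real (t powr (- (a + real k) - 1)) * heat_ext \<phi> t y)"
  using \<phi> off
proof (induction k arbitrary: \<phi>)
  case (Suc k)
  have L: "schwartz (Lap \<phi>)" "\<And>x. norm (y - x) < \<delta> \<Longrightarrow> Lap \<phi> x = 0"
    using schwartz_Lap[OF Suc.prems(1)] Lap_off[of y \<delta> \<phi>, OF Suc.prems(2)] by auto
  have p: "0 < a + real k" using a by simp
  have e: "a + real (Suc k) = (a + real k) + 1" by simp
  have "pochhammer (a + 1) (Suc k) = pochhammer (a + 1) k * (a + real k + 1)"
    by (simp add: pochhammer_Suc algebra_simps)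
  moreover have "(LBINT t:{0<..}. complex_of_real (t powr (- a - 1)) * heat_ext ((Lap ^^ k) (Lap \<phi>)) t y) =
    complex_of_real (pochhammer (a + 1) k) * (LBINT t:{0<..}. complex_of_real (t powr (- (a + real k) - 1)) * heat_ext (Lap \<phi>) t y)"
    by (rule Suc.IH) (fact L)+
  moreover have "(LBINT t:{0<..}. complex_of_real (t powr (- (a + real k) - 1)) * heat_ext (Lap \<phi>) t y) =
    complex_of_real (a + real k + 1) * (LBINT t:{0<..}. complex_of_real (t powr (- (a + real k + 1) - 1)) * heat_ext \<phi> t y)"
    by (rule heat_ext_by_parts[OF p \<delta>]) (fact Suc.prems)+
  ultimately show ?case
    unfolding e funpow_Suc_right o_apply by (simp only: mult.assoc of_real_mult)
qed simp

text \<open>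
  The constant by which integrating the heat kernel over time produces the Riesz kernel;
  only its sign matters.
\<close>

definition Ccon :: "nat \<Rightarrow> real \<Rightarrow> real" where
  "Ccon d a = (LINT t|lborel. indicator {0<..} t *\<^sub>R (t powr (- a - 1) * (exp (- (1 / (4 * t))) / sqrt (4 * pi * t) ^ d)))"

lemma Ccon_integrable:
  assumes a: "0 < a"
  shows "integrable lborel (\<lambda>t::real. indicator {0<..} t *\<^sub>R (t powr (- a - 1) * (exp (- (1 / (4 * t))) / sqrt (4 * pi * t) ^ DIM('a::euclidean_space))))"
proof -
  define N where "N = nat \<lceil>a\<rceil> + 1"
  have N: "real N \<ge> a + 1" unfolding N_def by (simp add: real_nat_ceiling_ge)
  obtain b :: 'a where b: "b \<in> Basis" using nonempty_Basis by blast
  have h: "exp (- (1 / (4 * t))) / sqrt (4 * pi * t) ^ DIM('a) = heat t b" for t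
    using b by (simp add: heat_def)
  obtain C where C: "C \<ge> 1" "\<And>t z::'a. 0 < t \<Longrightarrow> 1 \<le> norm z \<Longrightarrow> t \<le> 1 \<Longrightarrow> heat t z \<le> C * t ^ N"
     "\<And>t z::'a. 0 < t \<Longrightarrow> 1 \<le> norm z \<Longrightarrow> 1 \<le> t \<Longrightarrow> heat t z \<le> C"
    using heat_small[of 1, where 'a='a and N=N] by (metis zero_less_one)
  have "set_integrable lborel {0<..} (\<lambda>t. t powr (- a - 1) * heat t b)"
  proof (rule set_integrable_powr_bound[where a=0 and b="- a - 1" and C=C])
    show "(\<lambda>t. t powr (- a - 1) * heat t b) \<in> borel_measurable borel" by measurable
    fix t :: real assume t: "0 < t" "t \<le> 1"
    have "norm (t powr (- a - 1) * heat t b) \<le> t powr (- a - 1) * (C * t ^ N)"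
      unfolding norm_mult using C(2)[OF t(1) _ t(2), of b] b t by (simp add: mult_left_mono)
    also have "\<dots> = C * t powr (real N - a - 1)"
      using t by (simp add: powr_realpow[symmetric] powr_add[symmetric] algebra_simps)
    also have "\<dots> \<le> C * t powr 0"
      using t N C by (intro mult_left_mono powr_mono') auto
    finally show "norm (t powr (- a - 1) * heat t b) \<le> C * t powr 0" .
  next
    fix t :: real assume t: "1 \<le> t"
    then show "norm (t powr (- a - 1) * heat t b) \<le> C * t powr (- a - 1)"
      unfolding norm_mult using mult_left_mono[OF C(3)[of t b], of "t powr (- a - 1)"] b by (simp add: mult.commute)
  qed (use a in auto)
  then show ?thesis by (simp add: set_integrable_def h)
qed

lemma Ccon_pos:
  assumes a: "0 < a"
  shows "0 < Ccon (DIM('a::euclidean_space)) a"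
proof -
  let ?f = "\<lambda>t::real. indicator {0<..} t *\<^sub>R (t powr (- a - 1) * (exp (- (1 / (4 * t))) / sqrt (4 * pi * t) ^ DIM('a)))"
  have nn: "0 \<le> ?f t" for t by (auto simp: indicator_def)
  have "Ccon (DIM('a)) a \<noteq> 0"
  proof
    assume "Ccon (DIM('a)) a = 0"
    then have "AE t in lborel. ?f t = 0"
      unfolding Ccon_def using Ccon_integrable[OF a, where 'a='a] nn by (subst (asm) integral_nonneg_eq_0_iff_AE) auto
    then have "AE t in lborel. (t::real) \<notin> {0<..<1}"
      by eventually_elim auto
    then have "emeasure lborel {0<..<1::real} = 0"
      by (subst (asm) AE_iff_measurable[OF _ refl]) (auto simp: greaterThanLessThan_def greaterThan_def lessThan_def Int_def)
    then show False by simp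
  qed
  moreover have "0 \<le> Ccon (DIM('a)) a" unfolding Ccon_def by (intro Bochner_Integration.integral_nonneg nn)
  ultimately show ?thesis by simp
qed

text \<open>Measuring time in units of |z|^2 turns the integrand into that of a unit vector. The
  Jacobian, the power of t and the normalisation of the heat kernel together give the homogeneity -n
  - 2a.\<close>

lemma riesz_kernel:
  fixes z :: "'a::euclidean_space"
  assumes a: "0 < a" and z: "z \<noteq> 0"
  shows "integrable lborel (\<lambda>t. indicator {0<..} t *\<^sub>R (t powr (- a - 1) * heat t z))"
    and "(LINT t|lborel. indicator {0<..} t *\<^sub>R (t powr (- a - 1) * heat t z)) =
      Ccon (DIM('a)) a * norm z powr (- (real DIM('a) + 2 * a))"
proof -
  define r where "r = z \<bullet> z"
  have r: "r > 0" using z by (simp add: r_def)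
  let ?f = "\<lambda>t::real. indicator {0<..} t *\<^sub>R (t powr (- a - 1) * (exp (- (1 / (4 * t))) / sqrt (4 * pi * t) ^ DIM('a)))"
  let ?g = "\<lambda>t. indicator {0<..} t *\<^sub>R (t powr (- a - 1) * heat t z)"
  define c where "c = r powr (- a - 1) / sqrt r ^ DIM('a)"
  have eq: "?g (0 + r * t) = c * ?f t" for t
  proof (cases "t > 0")
    case True
    have "heat (r * t) z = exp (- (1 / (4 * t))) / (sqrt r ^ DIM('a) * sqrt (4 * pi * t) ^ DIM('a))"
      using r True by (simp add: heat_def r_def[symmetric] real_sqrt_mult power_mult_distrib mult_ac)
    then show ?thesis using True r by (simp add: c_def powr_mult)
  next
    case False
    then show ?thesis using r by (simp add: zero_less_mult_iff)
  qed
  have "integrable lborel (\<lambda>t. ?g (0 + r * t))"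
    unfolding eq by (intro integrable_mult_right Ccon_integrable[OF a])
  then show "integrable lborel ?g"
    using lborel_integrable_real_affine_iff[of r ?g 0] r by simp
  have "(LINT t|lborel. ?g t) = r * (LINT t|lborel. ?g (0 + r * t))"
    by (subst lborel_integral_real_affine[of r _ 0]) (use r in auto)
  also have "\<dots> = r * c * Ccon (DIM('a)) a"
    unfolding eq integral_mult_right_zero Ccon_def by simp
  also have "r * c = norm z powr (- (real DIM('a) + 2 * a))"
  proof -
    have n: "norm z > 0" using z by simp
    have rn: "r = norm z powr 2" using n by (simp add: r_def power2_norm_eq_inner[symmetric])
    have "sqrt r ^ DIM('a) = norm z powr real DIM('a)"
      using n by (simp add: r_def norm_eq_sqrt_inner[symmetric] powr_realpow)
    moreover have "r * r powr (- a - 1) = norm z powr (- (2 * a))"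
    proof -
      have "r * r powr (- a - 1) = r powr 1 * r powr (- a - 1)" using r by simp
      also have "\<dots> = r powr (- a)" by (simp only: powr_add[symmetric]) simp
      also have "\<dots> = norm z powr (- (2 * a))" unfolding rn powr_powr by simp
      finally show ?thesis .
    qed
    ultimately have "r * c = norm z powr (- (2 * a)) / norm z powr real DIM('a)"
      by (simp add: c_def)
    moreover have "- (real DIM('a) + 2 * a) = - (2 * a) - real DIM('a)" by simp
    ultimately show ?thesis by (simp only: powr_diff)
  qed
  finally show "(LINT t|lborel. ?g t) = Ccon (DIM('a)) a * norm z powr (- (real DIM('a) + 2 * a))"
    by simp
qed

lemma heat_ext_riesz:
  fixes \<phi> :: "'a::euclidean_space \<Rightarrow> complex"
  assumes a: "0 < a" and \<delta>: "0 < \<delta>" and \<phi>: "integrable lborel \<phi>" and off: "\<And>x. norm (y - x) < \<delta> \<Longrightarrow> \<phi> x = 0"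
  shows "(LBINT t:{0<..}. complex_of_real (t powr (- a - 1)) * heat_ext \<phi> t y) =
    complex_of_real (Ccon (DIM('a)) a) * (LINT x|lborel. \<phi> x * complex_of_real (norm (y - x) powr (- (real DIM('a) + 2 * a))))"
proof -
  have [measurable]: "\<phi> \<in> borel_measurable borel" using \<phi> by auto
  let ?k = "\<lambda>x t. indicator {0<..} t *\<^sub>R (t powr (- a - 1) * heat t (y - x)) :: real"
  let ?G = "\<lambda>x t. \<phi> x * complex_of_real (?k x t)"
  let ?q = "\<lambda>x. norm (y - x) powr (- (real DIM('a) + 2 * a))"
  have C0: "Ccon (DIM('a)) a \<ge> 0" using Ccon_pos[OF a, where 'a='a] by simp
  have yx: "y - x \<noteq> 0" if "\<phi> x \<noteq> 0" for x using off[of x] that \<delta> by fastforce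
  have k_nn: "0 \<le> ?k x t" for x t by (auto simp: indicator_def)
  have prod: "integrable (lborel \<Otimes>\<^sub>M lborel) (\<lambda>(x, t). ?G x t)"
  proof (rule Fubini_integrable_real)
    show "(\<lambda>(x, t). ?G x t) \<in> borel_measurable (borel \<Otimes>\<^sub>M borel)" by measurable
    show "integrable lborel (?G x)" for x
    proof (cases "\<phi> x = 0")
      case False
      then show ?thesis by (intro integrable_mult_right integrable_of_real riesz_kernel(1)[OF a yx])
    qed simp
    show "(LINT t|lborel. norm (?G x t)) = norm (\<phi> x) * (Ccon (DIM('a)) a * ?q x)" for x
    proof (cases "\<phi> x = 0")
      case False
      have "norm (?G x t) = norm (\<phi> x) * ?k x t" for t
        by (simp only: norm_mult norm_of_real abs_of_nonneg[OF k_nn])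
      then show ?thesis using riesz_kernel(2)[OF a yx[OF False]] by (simp only: integral_mult_right_zero)
    qed simp
    show "integrable lborel (\<lambda>x. norm (\<phi> x) * (Ccon (DIM('a)) a * ?q x))"
    proof (rule Bochner_Integration.integrable_bound)
      show "integrable lborel (\<lambda>x. (Ccon (DIM('a)) a * \<delta> powr (- (real DIM('a) + 2 * a))) * norm (\<phi> x))"
        by (intro integrable_mult_right integrable_norm \<phi>)
      show "AE x in lborel. norm (norm (\<phi> x) * (Ccon (DIM('a)) a * ?q x)) \<le>
         norm ((Ccon (DIM('a)) a * \<delta> powr (- (real DIM('a) + 2 * a))) * norm (\<phi> x))"
      proof (rule AE_I2)
        fix x
        show "norm (norm (\<phi> x) * (Ccon (DIM('a)) a * ?q x)) \<le>
         norm ((Ccon (DIM('a)) a * \<delta> powr (- (real DIM('a) + 2 * a))) * norm (\<phi> x))"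
        proof (cases "norm (y - x) < \<delta>")
          case False
          then have "?q x \<le> \<delta> powr (- (real DIM('a) + 2 * a))"
            using \<delta> a by (intro powr_mono2') auto
          then have "norm (\<phi> x) * (Ccon (DIM('a)) a * ?q x) \<le> norm (\<phi> x) * (Ccon (DIM('a)) a * \<delta> powr (- (real DIM('a) + 2 * a)))"
            using C0 by (intro mult_left_mono) auto
          then show ?thesis using C0 by (simp add: abs_mult mult_ac)
        qed (simp add: off)
      qed
    qed measurable
  qed
  have "(LBINT t:{0<..}. complex_of_real (t powr (- a - 1)) * heat_ext \<phi> t y) = (LINT t|lborel. LINT x|lborel. ?G x t)"
    unfolding set_lebesgue_integral_def
  proof (intro Bochner_Integration.integral_cong refl)
    fix t :: real
    have "(LINT x|lborel. ?G x t) = (LINT x|lborel. (indicator {0<..} t * complex_of_real (t powr (- a - 1))) * (\<phi> x * complex_of_real (heat t (y - x))))"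
      by (intro Bochner_Integration.integral_cong refl) (auto simp: indicator_def)
    also have "\<dots> = (indicator {0<..} t * complex_of_real (t powr (- a - 1))) * heat_ext \<phi> t y"
      unfolding heat_ext_def by (rule integral_mult_right_zero)
    finally show "indicat_real {0<..} t *\<^sub>R (complex_of_real (t powr (- a - 1)) * heat_ext \<phi> t y) = (LINT x|lborel. ?G x t)"
      by (auto simp: indicator_def)
  qed
  also have "\<dots> = (LINT x|lborel. LINT t|lborel. ?G x t)"
    by (rule lborel_pair.Fubini_integral[OF prod])
  also have "\<dots> = (LINT x|lborel. complex_of_real (Ccon (DIM('a)) a) * (\<phi> x * complex_of_real (?q x)))"
  proof (intro Bochner_Integration.integral_cong refl)
    fix x
    show "(LINT t|lborel. ?G x t) = complex_of_real (Ccon (DIM('a)) a) * (\<phi> x * complex_of_real (?q x))"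
    proof (cases "\<phi> x = 0")
      case False
      show ?thesis unfolding integral_mult_right_zero integral_complex_of_real riesz_kernel(2)[OF a yx[OF False]]
        by simp
    qed simp
  qed
  finally show ?thesis by simp
qed

lemma schwartz_Lap_power: "schwartz \<phi> \<Longrightarrow> schwartz ((Lap ^^ k) \<phi>)"
  by (induction k) (auto intro: schwartz_Lap)

lemma Lap_power_off:
  fixes \<phi> :: "'a::euclidean_space \<Rightarrow> complex"
  assumes "\<And>x. norm (y - x) < \<delta> \<Longrightarrow> \<phi> x = 0"
  shows "norm (y - x) < \<delta> \<Longrightarrow> (Lap ^^ k) \<phi> x = 0"
proof (induction k arbitrary: x)
  case (Suc k)
  then show ?case using Lap_off[of y \<delta> "(Lap ^^ k) \<phi>" x] by simp
qed (use assms in simp)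

lemma fourier_Lap_power:
  "schwartz \<phi> \<Longrightarrow> fourier ((Lap ^^ k) \<phi>) \<xi> = (- 1) ^ k * complex_of_real ((\<xi> \<bullet> \<xi>) ^ k) * fourier \<phi> \<xi>"
  by (induction k) (auto simp: fourier_Lap schwartz_Lap_power)

lemma norm_powr_add_power: "norm \<xi> powr (2 * (\<sigma> + real k)) = norm \<xi> powr (2 * \<sigma>) * (\<xi> \<bullet> \<xi>) ^ k"
proof (cases "\<xi> = 0")
  case False
  then have n: "norm \<xi> > 0" by simp
  have "(\<xi> \<bullet> \<xi>) ^ k = norm \<xi> ^ (2 * k)"
    by (simp only: power2_norm_eq_inner[symmetric] power_mult)
  also have "\<dots> = norm \<xi> powr (2 * real k)" using powr_realpow[OF n, of "2 * k"] by simp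
  finally have "(\<xi> \<bullet> \<xi>) ^ k = norm \<xi> powr (2 * real k)" .
  then show ?thesis by (simp add: powr_add distrib_left)
qed simp

text \<open>The subordination formula reaches only exponents \<sigma> in (0, 1). The integer part k
  is written as k Laplacians on \<open>\<phi>\<close>, each of which changes the sign and is then
  traded for a power of t. The product of the constants never vanishes, which is all that is used of
  it.\<close>

lemma frac_power_off_support:
  fixes \<phi> :: "'a::euclidean_space \<Rightarrow> complex"
  assumes \<sigma>: "0 < \<sigma>" "\<sigma> < 1" and \<delta>: "0 < \<delta>" and \<phi>: "schwartz \<phi>" and off: "\<And>x. norm (y - x) < \<delta> \<Longrightarrow> \<phi> x = 0"
  shows "complex_of_real (Acon \<sigma>) * inverse_fourier (\<lambda>\<xi>. complex_of_real (norm \<xi> powr (2 * (\<sigma> + real k))) * fourier \<phi> \<xi>) y =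
    - ((-1) ^ k * complex_of_real (pochhammer (\<sigma> + 1) k * Ccon (DIM('a)) (\<sigma> + real k))) *
      (LINT x|lborel. \<phi> x * complex_of_real (norm (y - x) powr (- (real DIM('a) + 2 * (\<sigma> + real k)))))"
proof -
  let ?L = "(Lap ^^ k) \<phi>"
  have sL: "schwartz ?L" by (rule schwartz_Lap_power[OF \<phi>])
  have L0: "?L y = 0" using Lap_power_off[of y \<delta> \<phi> y k, OF off] \<delta> by simp
  have p: "0 < \<sigma> + real k" using \<sigma> by simp
  have "complex_of_real (norm \<xi> powr (2 * (\<sigma> + real k))) * fourier \<phi> \<xi> =
     (-1) ^ k * (complex_of_real (norm \<xi> powr (2 * \<sigma>)) * fourier ?L \<xi>)" for \<xi>
  proof -
    have one: "(-1) ^ k * ((-1) ^ k :: complex) = 1" by (simp flip: power_mult_distrib)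
    have "(-1) ^ k * (complex_of_real (norm \<xi> powr (2 * \<sigma>)) * fourier ?L \<xi>) =
      ((-1) ^ k * (-1) ^ k) * (complex_of_real (norm \<xi> powr (2 * \<sigma>)) * complex_of_real ((\<xi> \<bullet> \<xi>) ^ k) * fourier \<phi> \<xi>)"
      unfolding fourier_Lap_power[OF \<phi>] by (simp only: mult_ac)
    then show ?thesis by (simp only: one mult_1 norm_powr_add_power of_real_mult)
  qed
  then have "complex_of_real (Acon \<sigma>) * inverse_fourier (\<lambda>\<xi>. complex_of_real (norm \<xi> powr (2 * (\<sigma> + real k))) * fourier \<phi> \<xi>) y
    = (-1) ^ k * (complex_of_real (Acon \<sigma>) * inverse_fourier (\<lambda>\<xi>. complex_of_real (norm \<xi> powr (2 * \<sigma>)) * fourier ?L \<xi>) y)"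
    by (simp add: inverse_fourier_cmult mult_ac)
  also have "\<dots> = (-1) ^ k * (- (LBINT t:{0<..}. complex_of_real (t powr (- \<sigma> - 1)) * heat_ext ?L t y))"
    unfolding frac_power_heat[OF \<sigma> sL L0] set_lebesgue_integral_def ..
  also have "(LBINT t:{0<..}. complex_of_real (t powr (- \<sigma> - 1)) * heat_ext ?L t y) =
     complex_of_real (pochhammer (\<sigma> + 1) k) * (complex_of_real (Ccon (DIM('a)) (\<sigma> + real k)) *
       (LINT x|lborel. \<phi> x * complex_of_real (norm (y - x) powr (- (real DIM('a) + 2 * (\<sigma> + real k))))))"
  proof -
    have "(LBINT t:{0<..}. complex_of_real (t powr (- \<sigma> - 1)) * heat_ext ?L t y) =
      complex_of_real (pochhammer (\<sigma> + 1) k) * (LBINT t:{0<..}. complex_of_real (t powr (- (\<sigma> + real k) - 1)) * heat_ext \<phi> t y)"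
      by (rule heat_ext_Lap_power[OF \<sigma>(1) \<delta> \<phi>]) (fact off)
    moreover have "(LBINT t:{0<..}. complex_of_real (t powr (- (\<sigma> + real k) - 1)) * heat_ext \<phi> t y) =
      complex_of_real (Ccon (DIM('a)) (\<sigma> + real k)) *
       (LINT x|lborel. \<phi> x * complex_of_real (norm (y - x) powr (- (real DIM('a) + 2 * (\<sigma> + real k)))))"
      by (rule heat_ext_riesz[OF p \<delta> schwartz_integrable[OF \<phi>]]) (fact off)
    ultimately show ?thesis by (simp only:)
  qed
  finally show ?thesis by simp
qed

section \<open>Unique continuation for bounded continuous functions\<close>

text \<open>The complex measure with density \<open>N\<close> is viewed through \<open>t\<close>,
  which maps its support into a compact interval, so vanishing moments extend to continuous
  functions by uniform approximation. The range condition is restricted to the places where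
  \<open>N\<close> is nonzero because in the application \<open>t\<close> is unbounded near the
  diagonal.\<close>

lemma moments_zero:
  fixes N :: "'z \<Rightarrow> complex" and t :: "'z \<Rightarrow> real"
  assumes N: "integrable M N" and t [measurable]: "t \<in> borel_measurable M"
    and range: "\<And>z. N z \<noteq> 0 \<Longrightarrow> t z \<in> {0..B}"
    and mom: "\<And>j. (LINT z|M. N z * complex_of_real (t z ^ j)) = 0"
    and q: "continuous_on {0..B} q" and qm: "q \<in> borel_measurable borel"
  shows "(LINT z|M. N z * complex_of_real (q (t z))) = 0"
proof -
  note [measurable] = qm
  have [measurable]: "N \<in> borel_measurable M" using N by auto
  have bdd_int: "integrable M (\<lambda>z. N z * complex_of_real (h (t z)))"
    if [measurable]: "h \<in> borel_measurable borel" and h: "\<And>x. x \<in> {0..B} \<Longrightarrow> \<bar>h x\<bar> \<le> H" for h H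
  proof (rule Bochner_Integration.integrable_bound[OF integrable_mult_right[OF integrable_norm[OF N], of H]])
    show "AE z in M. norm (N z * complex_of_real (h (t z))) \<le> norm (H * norm (N z))"
    proof (rule AE_I2)
      fix z
      show "norm (N z * complex_of_real (h (t z))) \<le> norm (H * norm (N z))"
      proof (cases "N z = 0")
        case False
        then have "\<bar>h (t z)\<bar> \<le> \<bar>H\<bar>" using h[OF range[OF False]] by linarith
        then have "norm (N z) * \<bar>h (t z)\<bar> \<le> norm (N z) * \<bar>H\<bar>" by (intro mult_left_mono) auto
        then show ?thesis by (simp add: norm_mult abs_mult mult.commute)
      qed simp
    qed
  qed measurable
  have cont_bdd: "\<exists>H. \<forall>x\<in>{0..B}. \<bar>h x\<bar> \<le> H" if "continuous_on {0..B} h" for h :: "real \<Rightarrow> real"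
    using compact_imp_bounded[OF compact_continuous_image[OF that compact_Icc]] by (auto simp: bounded_iff)
  have poly: "(LINT z|M. N z * complex_of_real (p (t z))) = 0" if "real_polynomial_function p" for p
  proof -
    have "\<exists>a n. p = (\<lambda>x. \<Sum>i\<le>n. a i * x ^ i)"
      using that by (simp only: real_polynomial_function_iff_sum)
    then obtain a n where p: "p = (\<lambda>x. \<Sum>i\<le>n. a i * x ^ i)" by blast
    have i: "integrable M (\<lambda>z. N z * complex_of_real (t z ^ j))" for j
    proof -
      obtain H where "\<And>x. x \<in> {0..B} \<Longrightarrow> \<bar>x ^ j\<bar> \<le> H"
        using cont_bdd[OF continuous_on_power[OF continuous_on_id]] by blast
      then show ?thesis by (intro bdd_int[where H=H]) auto
    qed
    have "(LINT z|M. N z * complex_of_real (p (t z))) = (LINT z|M. (\<Sum>j\<le>n. complex_of_real (a j) * (N z * complex_of_real (t z ^ j))))"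
      by (simp add: p sum_distrib_left mult_ac)
    also have "\<dots> = (\<Sum>j\<le>n. complex_of_real (a j) * (LINT z|M. N z * complex_of_real (t z ^ j)))"
      by (subst Bochner_Integration.integral_sum) (auto intro!: integrable_mult_right i simp del: of_real_power)
    finally show ?thesis by (simp only: mom) simp
  qed
  define I where "I = (LINT z|M. norm (N z))"
  have I: "I \<ge> 0" by (simp add: I_def)
  obtain Hq where Hq: "\<And>x. x \<in> {0..B} \<Longrightarrow> \<bar>q x\<bar> \<le> Hq" using cont_bdd[OF q] by blast
  have "norm (LINT z|M. N z * complex_of_real (q (t z))) \<le> 0"
  proof (rule field_le_epsilon)
    fix e :: real assume e: "e > 0"
    define d where "d = e / (1 + I)"
    have d: "d > 0" using e I by (simp add: d_def add_pos_nonneg)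
    obtain p where p: "real_polynomial_function p" "\<And>x. x \<in> {0..B} \<Longrightarrow> \<bar>q x - p x\<bar> < d"
      using Stone_Weierstrass_real_polynomial_function[OF compact_Icc q d] by blast
    have pc: "continuous_on S p" for S
      using p(1) by (intro continuous_on_polymonial_function) (simp add: real_polynomial_function_eq)
    have [measurable]: "p \<in> borel_measurable borel" by (rule borel_measurable_continuous_onI[OF pc])
    obtain Hp where Hp: "\<And>x. x \<in> {0..B} \<Longrightarrow> \<bar>p x\<bar> \<le> Hp" using cont_bdd[OF pc] by blast
    have iq: "integrable M (\<lambda>z. N z * complex_of_real (q (t z)))" by (rule bdd_int[OF qm Hq])
    have ip: "integrable M (\<lambda>z. N z * complex_of_real (p (t z)))" by (rule bdd_int[OF _ Hp]) auto
    have "(LINT z|M. N z * complex_of_real (q (t z))) = (LINT z|M. N z * complex_of_real (q (t z)) - N z * complex_of_real (p (t z)))"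
      using iq ip by (simp add: poly[OF p(1)])
    also have "norm \<dots> \<le> (LINT z|M. norm (N z * complex_of_real (q (t z)) - N z * complex_of_real (p (t z))))"
      by (rule integral_norm_bound)
    also have "\<dots> \<le> (LINT z|M. d * norm (N z))"
    proof (rule integral_mono_AE')
      show "AE z in M. norm (N z * complex_of_real (q (t z)) - N z * complex_of_real (p (t z))) \<le> d * norm (N z)"
      proof (rule AE_I2)
        fix z
        show "norm (N z * complex_of_real (q (t z)) - N z * complex_of_real (p (t z))) \<le> d * norm (N z)"
        proof (cases "N z = 0")
          case False
          have "N z * complex_of_real (q (t z)) - N z * complex_of_real (p (t z)) = N z * complex_of_real (q (t z) - p (t z))"
            by (simp add: algebra_simps)
          then have "norm (N z * complex_of_real (q (t z)) - N z * complex_of_real (p (t z))) = norm (N z) * \<bar>q (t z) - p (t z)\<bar>"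
            by (simp only: norm_mult norm_of_real)
          also have "\<dots> \<le> norm (N z) * d"
            using p(2)[OF range[OF False]] by (intro mult_left_mono) auto
          finally show ?thesis by (simp add: mult.commute)
        qed simp
      qed
    qed (use N d in auto)
    also have "\<dots> = d * I" by (simp add: I_def)
    also have "\<dots> \<le> e" using e I by (simp add: d_def field_simps)
    finally show "norm (LINT z|M. N z * complex_of_real (q (t z))) \<le> 0 + e" by simp
  qed
  then show ?thesis by simp
qed

text \<open>Once the lower coefficients vanish, dividing by x^n leaves a power series whose limit at
  0 is the n-th coefficient.\<close>

lemma real_powser_zero:
  fixes c :: "nat \<Rightarrow> real"
  assumes r: "0 < r" and s: "\<And>x. \<bar>x\<bar> < r \<Longrightarrow> (\<lambda>n. c n * x ^ n) sums 0"
  shows "c n = 0"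
proof (induction n rule: less_induct)
  case (less n)
  have "(\<lambda>k. c (k + n) * x ^ k) sums 0" if "x \<noteq> 0" "norm x < r" for x
  proof -
    have "(\<lambda>k. c (k + n) * x ^ (k + n)) sums (0 - (\<Sum>k<n. c k * x ^ k))"
      using s[of x] that by (intro sums_split_initial_segment) auto
    moreover have "(\<Sum>k<n. c k * x ^ k) = 0" using less by (intro sum.neutral) auto
    ultimately have "(\<lambda>k. (c (k + n) * x ^ (k + n)) / x ^ n) sums (0 / x ^ n)"
      by (intro sums_divide) simp
    then show ?thesis using that by (simp add: power_add)
  qed
  from powser_limit_0_strong[OF r this] have "((\<lambda>x. 0) \<longlongrightarrow> c (0 + n)) (at (0::real))" by simp
  then show ?case by (simp add: tendsto_const_iff)
qed

lemma complex_powser_zero: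
  fixes c :: "nat \<Rightarrow> complex"
  assumes r: "0 < r" and s: "\<And>x. \<bar>x\<bar> < r \<Longrightarrow> (\<lambda>n. c n * complex_of_real (x ^ n)) sums 0"
  shows "c n = 0"
proof (rule complex_eqI)
  have "(\<lambda>n. Re (c n) * x ^ n) sums 0" if "\<bar>x\<bar> < r" for x
    using sums_Re[OF s[OF that]] by (simp del: of_real_power)
  from real_powser_zero[OF r this] show "Re (c n) = Re 0" by simp
  have "(\<lambda>n. Im (c n) * x ^ n) sums 0" if "\<bar>x\<bar> < r" for x
    using sums_Im[OF s[OF that]] by (simp del: of_real_power)
  from real_powser_zero[OF r this] show "Im (c n) = Im 0" by simp
qed

text \<open>Expanding the exponential gives a power series in s that converges for all real s; if it
  vanishes near 0, its coefficients are 0 and it vanishes everywhere. Integrability for both signs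
  of s bounds exp |s u|, which dominates all partial sums and permits termwise integration.\<close>

lemma exp_integral_zero:
  fixes N :: "'z \<Rightarrow> complex" and u :: "'z \<Rightarrow> real"
  assumes [measurable]: "N \<in> borel_measurable M" "u \<in> borel_measurable M"
    and int: "\<And>s. integrable M (\<lambda>z. N z * complex_of_real (exp (s * u z)))"
    and r: "0 < r" and zero: "\<And>s. \<bar>s\<bar> < r \<Longrightarrow> (LINT z|M. N z * complex_of_real (exp (s * u z))) = 0"
  shows "(LINT z|M. N z * complex_of_real (exp (s * u z))) = 0"
proof -
  define c where "c k = (LINT z|M. N z * complex_of_real (u z ^ k / fact k))" for k
  have intabs: "integrable M (\<lambda>z. norm (N z) * exp (\<bar>s * u z\<bar>))" for s
  proof (rule Bochner_Integration.integrable_bound)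
    show "integrable M (\<lambda>z. norm (N z * complex_of_real (exp (s * u z))) + norm (N z * complex_of_real (exp ((- s) * u z))))"
      by (intro Bochner_Integration.integrable_add integrable_norm int)
    show "AE z in M. norm (norm (N z) * exp \<bar>s * u z\<bar>) \<le>
      norm (norm (N z * complex_of_real (exp (s * u z))) + norm (N z * complex_of_real (exp ((- s) * u z))))"
    proof (rule AE_I2)
      fix z
      have "exp \<bar>s * u z\<bar> \<le> exp (s * u z) + exp (- (s * u z))"
        by (cases "0 \<le> s * u z") auto
      then have "norm (N z) * exp \<bar>s * u z\<bar> \<le> norm (N z) * (exp (s * u z) + exp (- (s * u z)))"
        by (rule mult_left_mono) simp
      then show "norm (norm (N z) * exp \<bar>s * u z\<bar>) \<le>
        norm (norm (N z * complex_of_real (exp (s * u z))) + norm (N z * complex_of_real (exp ((- s) * u z))))"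
        by (simp add: norm_mult distrib_left)
    qed
  qed measurable
  have sums: "(\<lambda>k. c k * complex_of_real (s ^ k)) sums (LINT z|M. N z * complex_of_real (exp (s * u z)))" for s
  proof -
    let ?f = "\<lambda>k z. N z * complex_of_real ((s * u z) ^ k / fact k)"
    have exps: "(\<lambda>k. (x::real) ^ k / fact k) sums exp x" for x
      using exp_converges[of x] by (simp add: field_simps)
    have nf: "norm (?f k z) = norm (N z) * (\<bar>s * u z\<bar> ^ k / fact k)" for k z
      by (simp add: norm_mult abs_mult power_abs norm_divide norm_power power_mult_distrib)
    have fb: "norm (N z) * (\<bar>s * u z\<bar> ^ k / fact k) \<le> norm (N z) * exp \<bar>s * u z\<bar>" for k z
    proof -
      have "(\<Sum>i\<in>{k}. \<bar>s * u z\<bar> ^ i / fact i) \<le> exp \<bar>s * u z\<bar>"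
        using exps[of "\<bar>s * u z\<bar>"] by (intro sum_le_suminf[THEN order_trans]) (auto simp: sums_iff)
      then show ?thesis by (intro mult_left_mono) auto
    qed
    have fi: "integrable M (?f k)" for k
      by (rule Bochner_Integration.integrable_bound[OF intabs[of s]])
         (measurable, intro AE_I2, use nf fb in auto)
    have 1: "AE z in M. summable (\<lambda>k. norm (?f k z))"
      unfolding nf using exps by (intro AE_I2 summable_mult) (auto simp: sums_iff)
    have 2: "summable (\<lambda>k. LINT z|M. norm (?f k z))"
    proof (rule summableI_nonneg_bounded)
      fix n
      have "(\<Sum>k<n. LINT z|M. norm (?f k z)) = (LINT z|M. (\<Sum>k<n. norm (?f k z)))"
        by (rule Bochner_Integration.integral_sum[symmetric]) (intro integrable_norm fi)
      also have "\<dots> \<le> (LINT z|M. norm (N z) * exp \<bar>s * u z\<bar>)"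
      proof (rule integral_mono)
        show "integrable M (\<lambda>z. \<Sum>k<n. norm (?f k z))" by (intro Bochner_Integration.integrable_sum integrable_norm fi)
        show "integrable M (\<lambda>z. norm (N z) * exp \<bar>s * u z\<bar>)" by (rule intabs)
        fix z
        have "(\<Sum>k<n. \<bar>s * u z\<bar> ^ k / fact k) \<le> exp \<bar>s * u z\<bar>"
          using exps[of "\<bar>s * u z\<bar>"] by (intro sum_le_suminf[THEN order_trans]) (auto simp: sums_iff)
        then show "(\<Sum>k<n. norm (?f k z)) \<le> norm (N z) * exp \<bar>s * u z\<bar>"
          unfolding nf sum_distrib_left[symmetric] by (intro mult_left_mono) auto
      qed
      finally show "(\<Sum>k<n. LINT z|M. norm (?f k z)) \<le> (LINT z|M. norm (N z) * exp \<bar>s * u z\<bar>)" .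
    qed simp
    have "(\<lambda>k. LINT z|M. ?f k z) sums (LINT z|M. (\<Sum>k. ?f k z))"
      by (rule sums_integral[OF fi 1 2])
    moreover have "(\<Sum>k. ?f k z) = N z * complex_of_real (exp (s * u z))" for z
    proof -
      have "(\<lambda>k. ?f k z) sums (N z * complex_of_real (exp (s * u z)))"
        by (intro sums_mult sums_of_real exps)
      then show ?thesis by (simp only: sums_iff)
    qed
    moreover have "(LINT z|M. ?f k z) = c k * complex_of_real (s ^ k)" for k
    proof -
      have "(LINT z|M. ?f k z) = (LINT z|M. (N z * complex_of_real (u z ^ k / fact k)) * complex_of_real (s ^ k))"
        by (simp add: power_mult_distrib mult_ac)
      also have "\<dots> = c k * complex_of_real (s ^ k)"
        unfolding c_def by (rule integral_mult_left_zero)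
      finally show ?thesis .
    qed
    ultimately show ?thesis by simp
  qed
  have "c k = 0" for k
    by (rule complex_powser_zero[OF r]) (use sums zero in metis)
  then have "(\<lambda>k. c k * complex_of_real (s ^ k)) sums 0" by simp
  then show ?thesis using sums[of s] sums_unique2 by blast
qed

lemma bump_scale:
  fixes g :: "'a::euclidean_space \<Rightarrow> complex"
  assumes e: "0 < e"
  shows "(LINT x|lborel. bump_at c e x * g x) = complex_of_real (e ^ DIM('a)) * (LINT z|lborel. bump z * g (c + e *\<^sub>R z))"
  using integral_affine[of e "\<lambda>x. bump_at c e x * g x" c] e by (simp add: bump_at_def scaleR_conv_of_real)

lemma continuous_eta: "continuous_on UNIV (eta k)"
  by (intro continuous_at_imp_continuous_on ballI DERIV_isCont[OF eta_has_derivative])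

text \<open>The function vanishes on the ball of radius R while the test functions live in the ball
  of radius R/2, so the two supports are at least R/2 apart. The threshold \<open>k0\<close> is
  there because the vanishing is known only for exponents \<sigma> + k that are not below the
  original s.\<close>

locale ucp_setting =
  fixes w :: "'a::euclidean_space \<Rightarrow> complex" and x0 :: 'a and R \<sigma> M :: real and k0 :: nat
  assumes w_cont: "continuous_on UNIV w" and w_bdd: "\<And>y. norm (w y) \<le> M"
    and R: "0 < R" and \<sigma>: "0 < \<sigma>" "\<sigma> < 1"
    and w_zero: "\<And>y. norm (y - x0) < R \<Longrightarrow> w y = 0"
    and w_frac: "\<And>\<psi> k. schwartz \<psi> \<Longrightarrow> (\<And>x. R / 2 \<le> norm (x - x0) \<Longrightarrow> \<psi> x = 0) \<Longrightarrow> k0 \<le> k \<Longrightarrow>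
      (LINT y|lborel. w y * inverse_fourier (\<lambda>\<xi>. complex_of_real (norm \<xi> powr (2 * (\<sigma> + real k))) * fourier \<psi> \<xi>) y) = 0"
begin

lemma w_measurable [measurable]: "w \<in> borel_measurable borel"
  by (rule borel_measurable_continuous_onI[OF w_cont])

lemma M_nonneg: "0 \<le> M"
  using w_bdd[of x0] norm_ge_zero order_trans by blast

lemma separation:
  assumes off: "\<And>x. R / 2 \<le> norm (x - x0) \<Longrightarrow> \<psi> x = 0" and "R \<le> norm (y - x0)" "norm (y - x) < R / 2"
  shows "\<psi> x = 0"
proof (rule off)
  have "norm (y - x0) \<le> norm (y - x) + norm (x - x0)"
    using norm_triangle_ineq[of "y - x" "x - x0"] by simp
  then show "R / 2 \<le> norm (x - x0)" using assms by linarith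
qed

text \<open>Where \<open>w\<close> vanishes there is nothing to compare. Every other y keeps the
  distance R/2 from the support of \<open>\<psi>\<close>, so the kernel formula applies with a
  constant that does not depend on y. Its factors are positive up to sign, hence it can be
  cancelled.\<close>

lemma moment:
  assumes \<psi>: "schwartz \<psi>" and off: "\<And>x. R / 2 \<le> norm (x - x0) \<Longrightarrow> \<psi> x = 0" and k: "k0 \<le> k"
  shows "(LINT y|lborel. w y * (LINT x|lborel. \<psi> x * complex_of_real (norm (y - x) powr (- (real DIM('a) + 2 * (\<sigma> + real k)))))) = 0"
proof -
  define c where "c = - ((-1) ^ k * complex_of_real (pochhammer (\<sigma> + 1) k * Ccon (DIM('a)) (\<sigma> + real k)))"
  have "pochhammer (\<sigma> + 1) k > 0" using \<sigma> by (intro pochhammer_pos) simp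
  moreover have "Ccon (DIM('a)) (\<sigma> + real k) > 0" using \<sigma> by (intro Ccon_pos) simp
  ultimately have c: "c \<noteq> 0" by (simp add: c_def)
  let ?I = "\<lambda>y. LINT x|lborel. \<psi> x * complex_of_real (norm (y - x) powr (- (real DIM('a) + 2 * (\<sigma> + real k))))"
  let ?F = "inverse_fourier (\<lambda>\<xi>. complex_of_real (norm \<xi> powr (2 * (\<sigma> + real k))) * fourier \<psi> \<xi>)"
  have eq: "complex_of_real (Acon \<sigma>) * (w y * ?F y) = c * (w y * ?I y)" for y
  proof (cases "norm (y - x0) < R")
    case False
    have "complex_of_real (Acon \<sigma>) * ?F y = c * ?I y"
      unfolding c_def
      by (rule frac_power_off_support[where \<delta>="R / 2", OF \<sigma> _ \<psi>]) (use separation[of \<psi> y] off False R in auto)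
    then show ?thesis by (simp add: mult.left_commute)
  qed (simp add: w_zero)
  have "c * (LINT y|lborel. w y * ?I y) = (LINT y|lborel. complex_of_real (Acon \<sigma>) * (w y * ?F y))"
    unfolding eq by simp
  also have "\<dots> = 0" using w_frac[OF \<psi> off k] by simp
  finally show ?thesis using c by simp
qed

text \<open>
  After the substitution \<open>t = |y - x|\<^sup>-\<^sup>2\<close> the Gaussian becomes a
  flat function of \<open>t\<close> at 0, to which the moment argument applies.
\<close>

lemma gauss_moment:
  assumes \<psi>: "schwartz \<psi>" and off: "\<And>x. R / 2 \<le> norm (x - x0) \<Longrightarrow> \<psi> x = 0" and l: "0 < l"
  shows "(LINT z|(lborel \<Otimes>\<^sub>M lborel). (case z of (x, y) \<Rightarrow> \<psi> x * w y * gauss l (y - x))) = 0"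
proof -
  have [measurable]: "\<psi> \<in> borel_measurable borel" by (rule schwartz_measurable[OF \<psi>])
  define \<delta> where "\<delta> = R / 2"
  have \<delta>: "\<delta> > 0" using R by (simp add: \<delta>_def)
  have sep: "\<delta> \<le> norm (y - x)" if "\<psi> x * w y \<noteq> 0" for x y
  proof (rule ccontr)
    assume "\<not> \<delta> \<le> norm (y - x)"
    then have n: "norm (y - x) < R / 2" by (simp add: \<delta>_def)
    have "w y \<noteq> 0" "\<psi> x \<noteq> 0" using that by auto
    then have "R \<le> norm (y - x0)" using w_zero[of y] by (auto simp: not_less[symmetric])
    from separation[of \<psi>, OF _ this n] off have "\<psi> x = 0" by simp
    with \<open>\<psi> x \<noteq> 0\<close> show False by simp
  qed
  \<comment> \<open>Raises the exponent \<open>E\<close> of the kernel beyond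
    \<open>2 * DIM('a)\<close>, so that off the diagonal the kernel decays at least like
    \<open>wt\<close> and is integrable against the merely bounded \<open>w\<close>.\<close>
  define k1 where "k1 = k0 + DIM('a)"
  define E where "E k = real DIM('a) + 2 * (\<sigma> + real k)" for k
  define N where "N j = (\<lambda>(x, y). \<psi> x * w y * complex_of_real (norm (y - x) powr (- E (k1 + j))))" for j
  have N_meas [measurable]: "N j \<in> borel_measurable (lborel \<Otimes>\<^sub>M lborel)" for j
    unfolding N_def by measurable
  define B where "B = 1 / \<delta>\<^sup>2"
  define C where "C j = M * ((1 + 1 / \<delta>) ^ (2 * DIM('a)) * \<delta> powr (2 * real DIM('a) - E (k1 + j)))" for j
  have N_int: "integrable (lborel \<Otimes>\<^sub>M lborel) (N j)" for j
  proof (rule Bochner_Integration.integrable_bound)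
    show "integrable (lborel \<Otimes>\<^sub>M lborel) (\<lambda>z. C j * (case z of (x, y) \<Rightarrow> norm (\<psi> x) * wt (y + (-1) *\<^sub>R x)))"
      by (intro integrable_mult_right integrable_conv wt_integrable integrable_norm schwartz_integrable \<psi>)
    show "AE z in lborel \<Otimes>\<^sub>M lborel. norm (N j z) \<le> norm (C j * (case z of (x, y) \<Rightarrow> norm (\<psi> x) * wt (y + (-1) *\<^sub>R x)))"
    proof (rule AE_I2)
      fix z :: "'a \<times> 'a"
      obtain x y where z: "z = (x, y)" by fastforce
      have C0: "0 \<le> C j" unfolding C_def using M_nonneg \<delta> by simp
      have "norm (N j z) \<le> C j * (norm (\<psi> x) * wt (y - x))"
      proof (cases "\<psi> x * w y = 0")
        case False
        define n where "n = norm (y - x)"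
        have n: "\<delta> \<le> n" "0 < n" using sep[OF False] \<delta> by (auto simp: n_def)
        have "E (k1 + j) \<ge> 2 * real DIM('a)" using \<sigma> by (simp add: E_def k1_def)
        then have 1: "n powr (2 * real DIM('a) - E (k1 + j)) \<le> \<delta> powr (2 * real DIM('a) - E (k1 + j))"
          using n \<delta> by (intro powr_mono2') auto
        have "1 + n \<le> (1 + 1 / \<delta>) * n" using n \<delta> by (simp add: field_simps)
        then have "(1 + n) ^ (2 * DIM('a)) \<le> ((1 + 1 / \<delta>) * n) ^ (2 * DIM('a))"
          using n by (intro power_mono) auto
        then have "(1 + n) ^ (2 * DIM('a)) * n powr (- E (k1 + j)) \<le>
            (1 + 1 / \<delta>) ^ (2 * DIM('a)) * (n ^ (2 * DIM('a)) * n powr (- E (k1 + j)))"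
          by (simp add: power_mult_distrib mult_right_mono flip: mult.assoc)
        also have "n ^ (2 * DIM('a)) * n powr (- E (k1 + j)) = n powr (2 * real DIM('a) - E (k1 + j))"
          using n by (simp add: powr_realpow[symmetric] powr_add[symmetric])
        also have "(1 + 1 / \<delta>) ^ (2 * DIM('a)) * n powr (2 * real DIM('a) - E (k1 + j)) \<le>
           (1 + 1 / \<delta>) ^ (2 * DIM('a)) * \<delta> powr (2 * real DIM('a) - E (k1 + j))"
          using 1 \<delta> by (intro mult_left_mono) auto
        finally have 2: "(1 + n) ^ (2 * DIM('a)) * n powr (- E (k1 + j)) \<le>
           (1 + 1 / \<delta>) ^ (2 * DIM('a)) * \<delta> powr (2 * real DIM('a) - E (k1 + j))" .
        have "norm (n powr (- E (k1 + j))) \<le> ((1 + 1 / \<delta>) ^ (2 * DIM('a)) * \<delta> powr (2 * real DIM('a) - E (k1 + j))) * wt (y - x)"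
          by (rule norm_le_wtI) (use 2 in \<open>simp add: n_def\<close>)
        then have "norm (\<psi> x) * norm (w y) * norm (n powr (- E (k1 + j))) \<le>
           norm (\<psi> x) * M * (((1 + 1 / \<delta>) ^ (2 * DIM('a)) * \<delta> powr (2 * real DIM('a) - E (k1 + j))) * wt (y - x))"
          using w_bdd M_nonneg by (intro mult_mono mult_left_mono) auto
        then show ?thesis unfolding z N_def C_def by (simp add: norm_mult n_def mult_ac)
      qed (use C0 wt_nonneg in \<open>auto simp: z N_def intro!: mult_nonneg_nonneg\<close>)
      then show "norm (N j z) \<le> norm (C j * (case z of (x, y) \<Rightarrow> norm (\<psi> x) * wt (y + (-1) *\<^sub>R x)))"
        by (simp add: z)
    qed
  qed measurable
  have N_zero: "(LINT z|(lborel \<Otimes>\<^sub>M lborel). N j z) = 0" for j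
  proof -
    let ?n = "\<lambda>x y. \<psi> x * w y * complex_of_real (norm (y - x) powr (- E (k1 + j)))"
    have i: "integrable (lborel \<Otimes>\<^sub>M lborel) (\<lambda>(x, y). ?n x y)"
      using N_int[of j] by (simp add: N_def)
    have "(LINT z|(lborel \<Otimes>\<^sub>M lborel). N j z) = (LINT y|lborel. LINT x|lborel. ?n x y)"
      unfolding lborel_pair.integral_snd[OF i] by (simp add: N_def)
    also have "\<dots> = (LINT y|lborel. w y * (LINT x|lborel. \<psi> x * complex_of_real (norm (y - x) powr (- E (k1 + j)))))"
    proof (intro Bochner_Integration.integral_cong refl)
      fix y
      have "(LINT x|lborel. ?n x y) = (LINT x|lborel. w y * (\<psi> x * complex_of_real (norm (y - x) powr (- E (k1 + j)))))"
        by (simp add: mult_ac)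
      then show "(LINT x|lborel. ?n x y) = w y * (LINT x|lborel. \<psi> x * complex_of_real (norm (y - x) powr (- E (k1 + j))))"
        by simp
    qed
    also have "\<dots> = 0"
      unfolding E_def by (rule moment[OF \<psi> off]) (auto simp: k1_def)
    finally show ?thesis .
  qed
  \<comment> \<open>Multiplication by \<open>t\<close> raises the moment index by one:
    \<open>N 0\<close> times the j-th power of \<open>t\<close> is \<open>N j\<close>.\<close>
  define t where "t = (\<lambda>(x, y). 1 / (norm (y - x :: 'a))\<^sup>2)"
  \<comment> \<open>An integer above \<open>E k1 / 2\<close>, so that the remaining exponent
    \<open>\<beta>\<close> is positive and \<open>s powr \<beta>\<close> is continuous at 0.\<close>
  define m where "m = nat \<lceil>E k1\<rceil>"
  define \<beta> where "\<beta> = real m - E k1 / 2"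
  have Ek: "E k1 > 0" using \<sigma> by (simp add: E_def add_nonneg_pos)
  have \<beta>: "\<beta> > 0"
  proof -
    have "real m \<ge> E k1" by (simp add: m_def real_nat_ceiling_ge)
    then show ?thesis using Ek by (simp add: \<beta>_def)
  qed
  \<comment> \<open>For s > 0 this is s^(-E/2) exp(-l/s) with E = \<open>E k1\<close>. At s = |x -
    y|^(-2) the power cancels the kernel contained in \<open>N 0\<close> and leaves the Gaussian.
    The form with \<open>eta\<close> exhibits the continuity at s = 0, the value approached as |x -
    y| grows.\<close>
  define q where "q s = s powr \<beta> * (eta m (s / l) / l ^ m)" for s :: real
  have "(LINT z|(lborel \<Otimes>\<^sub>M lborel). N 0 z * complex_of_real (q (t z))) = 0"
  proof (rule moments_zero[where B=B and N="N 0" and t=t and q=q])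
    show "integrable (lborel \<Otimes>\<^sub>M lborel) (N 0)" by (rule N_int)
    show "t \<in> borel_measurable (lborel \<Otimes>\<^sub>M lborel)" unfolding t_def by measurable
    show "t z \<in> {0..B}" if "N 0 z \<noteq> 0" for z
    proof -
      obtain x y where z: "z = (x, y)" by fastforce
      have "\<delta> \<le> norm (y - x)" using that by (intro sep) (auto simp: N_def z)
      then have "1 / (norm (y - x))\<^sup>2 \<le> 1 / \<delta>\<^sup>2" using \<delta> by (intro frac_le power_mono zero_less_power) auto
      then show ?thesis by (simp add: t_def z B_def)
    qed
    show "(LINT z|(lborel \<Otimes>\<^sub>M lborel). N 0 z * complex_of_real (t z ^ j)) = 0" for j
    proof -
      have "N 0 z * complex_of_real (t z ^ j) = N j z" for z
      proof -
        obtain x y where z: "z = (x, y)" by fastforce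
        show ?thesis
        proof (cases "\<psi> x * w y = 0")
          case False
          define n where "n = norm (y - x)"
          have n: "0 < n" using sep[OF False] \<delta> unfolding n_def by linarith
          have "n powr (- E k1) * (1 / n\<^sup>2) ^ j = n powr (- E (k1 + j))"
          proof -
            have "(1 / n\<^sup>2) ^ j = n powr (- (2 * real j))"
              using n powr_realpow[OF n, of "2 * j"] by (simp add: power_inverse powr_minus divide_inverse flip: power_mult)
            then show ?thesis by (simp add: powr_add[symmetric] E_def algebra_simps)
          qed
          then have "complex_of_real (n powr (- E k1)) * complex_of_real ((1 / n\<^sup>2) ^ j) = complex_of_real (n powr (- E (k1 + j)))"
            by (simp only: of_real_mult[symmetric])
          then show ?thesis unfolding N_def t_def z n_def by (simp del: of_real_power add: mult.assoc)
        qed (auto simp: N_def z)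
      qed
      then show ?thesis using N_zero by simp
    qed
    have "continuous_on {0..B} (\<lambda>s. s powr \<beta>)"
      using \<beta> by (intro continuous_on_powr' continuous_intros) auto
    moreover have "continuous_on {0..B} (\<lambda>s. eta m (s / l) / l ^ m)"
      using l by (intro continuous_intros continuous_on_compose2[OF continuous_eta]) auto
    ultimately show "continuous_on {0..B} q" unfolding q_def by (rule continuous_on_mult)
    have [measurable]: "eta m \<in> borel_measurable borel" by (rule borel_measurable_continuous_onI[OF continuous_eta])
    show "q \<in> borel_measurable borel" unfolding q_def by measurable
  qed
  moreover have "N 0 z * complex_of_real (q (t z)) = (case z of (x, y) \<Rightarrow> \<psi> x * w y * gauss l (y - x))" for z
  proof -
    obtain x y where z: "z = (x, y)" by fastforce
    show ?thesis
    proof (cases "\<psi> x * w y = 0")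
      case False
      define n where "n = norm (y - x)"
      have n: "0 < n" using sep[OF False] \<delta> unfolding n_def by linarith
      have nn: "(y - x) \<bullet> (y - x) = n\<^sup>2" by (simp add: n_def power2_norm_eq_inner)
      have "n powr (- E k1) * q (1 / n\<^sup>2) = exp (- l * n\<^sup>2)"
      proof -
        have "(1 / n\<^sup>2) powr \<beta> = n powr (- (2 * \<beta>))"
        proof -
          have "1 / n\<^sup>2 = n powr (- 2)" using n by (simp add: powr_minus divide_inverse)
          then show ?thesis by (simp add: powr_powr)
        qed
        moreover have "eta m (1 / n\<^sup>2 / l) / l ^ m = n powr (2 * real m) * exp (- l * n\<^sup>2)"
        proof -
          have "n powr (2 * real m) = (n\<^sup>2) ^ m" using powr_realpow[OF n, of "2 * m"] by (simp add: power_mult)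
          then show ?thesis using n l by (simp add: eta_def power_mult_distrib mult_ac)
        qed
        ultimately have "n powr (- E k1) * q (1 / n\<^sup>2) = (n powr (- E k1) * n powr (- (2 * \<beta>)) * n powr (2 * real m)) * exp (- l * n\<^sup>2)"
          by (simp add: q_def mult_ac)
        also have "n powr (- E k1) * n powr (- (2 * \<beta>)) * n powr (2 * real m) = 1"
          using n by (simp add: powr_add[symmetric] \<beta>_def algebra_simps)
        finally show ?thesis by simp
      qed
      then have "complex_of_real (n powr (- E k1)) * complex_of_real (q (1 / n\<^sup>2)) = complex_of_real (exp (- l * n\<^sup>2))"
        by (simp only: of_real_mult[symmetric])
      then show ?thesis unfolding N_def t_def z gauss_def nn by (simp add: n_def mult.assoc power2_norm_eq_inner)
    qed (auto simp: N_def z)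
  qed
  ultimately show ?thesis by simp
qed

section \<open>From Gaussian means to pointwise values\<close>

lemma product_gauss_integrable:
  assumes \<psi>: "schwartz \<psi>" and l: "0 < l"
  shows "integrable (lborel \<Otimes>\<^sub>M lborel) (\<lambda>(x, y). \<psi> x * w y * gauss l (y - x - a))"
proof (rule Bochner_Integration.integrable_bound)
  have [measurable]: "\<psi> \<in> borel_measurable borel" by (rule schwartz_measurable[OF \<psi>])
  have "integrable lborel (\<lambda>y. norm (gauss l (y + (- a))))"
    by (intro integrable_translate[where f="\<lambda>y. norm (gauss l y)"] integrable_norm schwartz_integrable schwartz_gauss l)
  then have g: "integrable lborel (\<lambda>y. norm (gauss l (y - a)))" by simp
  show "integrable (lborel \<Otimes>\<^sub>M lborel) (\<lambda>z. M * (case z of (x, y) \<Rightarrow> norm (\<psi> x) * norm (gauss l (y + (-1) *\<^sub>R x - a))))"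
    by (intro integrable_mult_right integrable_conv[OF g] integrable_norm schwartz_integrable \<psi>)
  show "(\<lambda>(x, y). \<psi> x * w y * gauss l (y - x - a)) \<in> borel_measurable (lborel \<Otimes>\<^sub>M lborel)" by measurable
  show "AE z in lborel \<Otimes>\<^sub>M lborel. norm (case z of (x, y) \<Rightarrow> \<psi> x * w y * gauss l (y - x - a)) \<le>
     norm (M * (case z of (x, y) \<Rightarrow> norm (\<psi> x) * norm (gauss l (y + (-1) *\<^sub>R x - a))))"
  proof (rule AE_I2)
    fix z :: "'a \<times> 'a"
    obtain x y where z: "z = (x, y)" by fastforce
    have "norm (\<psi> x) * norm (w y) * norm (gauss l (y - x - a)) \<le> norm (\<psi> x) * M * norm (gauss l (y - x - a))"
      by (intro mult_right_mono mult_left_mono w_bdd) auto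
    then show "norm (case z of (x, y) \<Rightarrow> \<psi> x * w y * gauss l (y - x - a)) \<le>
     norm (M * (case z of (x, y) \<Rightarrow> norm (\<psi> x) * norm (gauss l (y + (-1) *\<^sub>R x - a))))"
      using M_nonneg by (simp add: z norm_mult abs_mult mult_ac)
  qed
qed

text \<open>
  For small \<open>a\<close> translate \<open>\<psi>\<close>; for large \<open>a\<close>
  the dependence on the translation is an exponential integral, hence analytic along lines.
\<close>

lemma gauss_moment_shift:
  assumes \<psi>: "schwartz \<psi>" and off: "\<And>x. R / 4 \<le> norm (x - x0) \<Longrightarrow> \<psi> x = 0" and l: "0 < l"
  shows "(LINT z|(lborel \<Otimes>\<^sub>M lborel). (case z of (x, y) \<Rightarrow> \<psi> x * w y * gauss l (y - x - a))) = 0"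
proof -
  have [measurable]: "\<psi> \<in> borel_measurable borel" by (rule schwartz_measurable[OF \<psi>])
  \<comment> \<open>A translate by less than R/4 of a function supported within R/4 is still
    supported within R/2, where \<open>gauss_moment\<close> applies.\<close>
  have small: "(LINT z|(lborel \<Otimes>\<^sub>M lborel). (case z of (x, y) \<Rightarrow> \<psi> x * w y * gauss l (y - x - b))) = 0"
    if b: "norm b < R / 4" for b
  proof -
    have s: "schwartz (\<lambda>x. \<psi> (x - b))" using schwartz_affine[OF \<psi>, of 1 "- b"] by simp
    have o: "\<psi> (x - b) = 0" if "R / 2 \<le> norm (x - x0)" for x
    proof (rule off)
      have "norm (x - x0) \<le> norm (x - b - x0) + norm b"
        using norm_triangle_ineq[of "x - b - x0" b] by simp
      then show "R / 4 \<le> norm (x - b - x0)" using that b by linarith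
    qed
    have i1: "integrable (lborel \<Otimes>\<^sub>M lborel) (\<lambda>(x, y). \<psi> (x - b) * w y * gauss l (y - x))"
      using product_gauss_integrable[OF s l, of 0] by simp
    note i2 = product_gauss_integrable[OF \<psi> l, of b]
    have "(LINT z|(lborel \<Otimes>\<^sub>M lborel). (case z of (x, y) \<Rightarrow> \<psi> x * w y * gauss l (y - x - b))) =
      (LINT y|lborel. LINT x|lborel. \<psi> x * w y * gauss l (y - x - b))"
      by (rule lborel_pair.integral_snd[OF i2, symmetric])
    also have "\<dots> = (LINT y|lborel. LINT x|lborel. \<psi> (x - b) * w y * gauss l (y - x))"
      using integral_translate[of "\<lambda>x. \<psi> (x - b) * w y * gauss l (y - x)" b for y] by (simp add: diff_diff_add add.commute)
    also have "\<dots> = (LINT z|(lborel \<Otimes>\<^sub>M lborel). (case z of (x, y) \<Rightarrow> \<psi> (x - b) * w y * gauss l (y - x)))"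
      by (rule lborel_pair.integral_snd[OF i1])
    also have "\<dots> = 0" by (rule gauss_moment[OF s o l])
    finally show ?thesis .
  qed
  let ?N = "\<lambda>(x, y). \<psi> x * w y * gauss l (y - x)"
  let ?u = "\<lambda>(x, y). 2 * l * (a \<bullet> (y - x))"
  \<comment> \<open>Completing the square: the shift by s a produces a factor depending on s alone
    and the exponential of s times a linear function of y - x.\<close>
  have expand: "(case z of (x, y) \<Rightarrow> \<psi> x * w y * gauss l (y - x - s *\<^sub>R a)) =
     complex_of_real (exp (- l * (s\<^sup>2 * (a \<bullet> a)))) * (?N z * complex_of_real (exp (s * ?u z)))" for s z
  proof -
    obtain x y where z: "z = (x, y)" by fastforce
    have "- l * ((y - x - s *\<^sub>R a) \<bullet> (y - x - s *\<^sub>R a)) = - l * (s\<^sup>2 * (a \<bullet> a)) + (- l * ((y - x) \<bullet> (y - x)) + s * (2 * l * (a \<bullet> (y - x))))"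
      by (simp add: inner_diff_left inner_diff_right inner_commute power2_eq_square algebra_simps)
    then have "gauss l (y - x - s *\<^sub>R a) = complex_of_real (exp (- l * (s\<^sup>2 * (a \<bullet> a))) * (exp (- l * ((y - x) \<bullet> (y - x))) * exp (s * (2 * l * (a \<bullet> (y - x))))))"
      unfolding gauss_def by (simp only: exp_add)
    then show ?thesis by (simp add: z gauss_def mult_ac)
  qed
  have E: "(LINT z|(lborel \<Otimes>\<^sub>M lborel). (case z of (x, y) \<Rightarrow> \<psi> x * w y * gauss l (y - x - s *\<^sub>R a))) =
     complex_of_real (exp (- l * (s\<^sup>2 * (a \<bullet> a)))) * (LINT z|(lborel \<Otimes>\<^sub>M lborel). ?N z * complex_of_real (exp (s * ?u z)))" for s
    unfolding expand by (rule integral_mult_right_zero)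
  have "(LINT z|(lborel \<Otimes>\<^sub>M lborel). ?N z * complex_of_real (exp (1 * ?u z))) = 0"
  \<comment> \<open>The radius keeps the norm of s a below R/4; the summand 1 covers a = 0.\<close>
  proof (rule exp_integral_zero[where r="R / (4 * (1 + norm a))"])
    show "?N \<in> borel_measurable (lborel \<Otimes>\<^sub>M lborel)" by measurable
    show "?u \<in> borel_measurable (lborel \<Otimes>\<^sub>M lborel)" by measurable
    show "integrable (lborel \<Otimes>\<^sub>M lborel) (\<lambda>z. ?N z * complex_of_real (exp (s * ?u z)))" for s
    proof -
      have "integrable (lborel \<Otimes>\<^sub>M lborel) (\<lambda>z. complex_of_real (exp (l * (s\<^sup>2 * (a \<bullet> a)))) * (case z of (x, y) \<Rightarrow> \<psi> x * w y * gauss l (y - x - s *\<^sub>R a)))"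
        by (intro integrable_mult_right product_gauss_integrable \<psi> l)
      moreover have "complex_of_real (exp (l * (s\<^sup>2 * (a \<bullet> a)))) * (case z of (x, y) \<Rightarrow> \<psi> x * w y * gauss l (y - x - s *\<^sub>R a)) =
         ?N z * complex_of_real (exp (s * ?u z))" for z
      proof -
        have one: "complex_of_real (exp (l * (s\<^sup>2 * (a \<bullet> a)))) * complex_of_real (exp (- l * (s\<^sup>2 * (a \<bullet> a)))) = 1"
          by (simp only: of_real_mult[symmetric] exp_add[symmetric]) simp
        show ?thesis
          unfolding expand
          by (simp only: mult.assoc[symmetric, of "complex_of_real (exp (l * (s\<^sup>2 * (a \<bullet> a))))"
               "complex_of_real (exp (- l * (s\<^sup>2 * (a \<bullet> a))))"] one mult_1)
      qed
      ultimately show ?thesis by (simp only:)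
    qed
    show "0 < R / (4 * (1 + norm a))" using R by (intro divide_pos_pos) (auto simp: add_pos_nonneg)
    show "(LINT z|(lborel \<Otimes>\<^sub>M lborel). ?N z * complex_of_real (exp (s * ?u z))) = 0" if "\<bar>s\<bar> < R / (4 * (1 + norm a))" for s
    proof -
      have "\<bar>s\<bar> * norm a \<le> \<bar>s\<bar> * (1 + norm a)" by (intro mult_left_mono) auto
      also have "\<dots> < R / 4" using that by (simp add: field_simps add_pos_nonneg)
      finally have "norm (s *\<^sub>R a) < R / 4" by simp
      from small[OF this] show ?thesis unfolding E by simp
    qed
  qed
  then show ?thesis using E[of 1] by simp
qed

text \<open>The heat kernel at time \<open>\<tau> n\<close> is a multiple of the Gaussian with
  parameter 1 / (4 \<open>\<tau> n\<close>), so all heat averages of \<open>w\<close> vanish when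
  tested on the shifted bump. Letting the time tend to 0 replaces the averages by \<open>w\<close>;
  the shift a is arbitrary.\<close>

lemma bump_mean:
  assumes e: "0 < e" "e < R / 4"
  shows "(LINT x|lborel. bump_at x0 e x * w (x + a)) = 0"
proof -
  let ?\<psi> = "bump_at x0 e"
  have \<psi>: "schwartz ?\<psi>" by (rule schwartz_bump_at[OF e(1)])
  have off: "?\<psi> x = 0" if "R / 4 \<le> norm (x - x0)" for x
    using that e by (intro bump_at_eq_0) auto
  have [measurable]: "?\<psi> \<in> borel_measurable borel" by (rule schwartz_measurable[OF \<psi>])
  define \<tau> where "\<tau> n = inverse (real (Suc n))" for n
  have \<tau>: "\<And>n. 0 < \<tau> n" "\<tau> \<longlonglongrightarrow> 0"
    unfolding \<tau>_def using LIMSEQ_inverse_real_of_nat by auto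
  define W where "W n x = (LINT y|lborel. w y * complex_of_real (heat (\<tau> n) (x + a - y)))" for n x
  have W_bd: "norm (W n x) \<le> M" for n x
  proof -
    have hi: "integrable lborel (\<lambda>y. heat (\<tau> n) (x + a - y))"
      by (rule integrable_reflect[OF heat_integrable(1)[OF \<tau>(1)]])
    have "norm (W n x) \<le> (LINT y|lborel. norm (w y * complex_of_real (heat (\<tau> n) (x + a - y))))"
      unfolding W_def by (rule integral_norm_bound)
    also have "\<dots> \<le> (LINT y|lborel. M * heat (\<tau> n) (x + a - y))"
    proof (rule integral_mono_AE')
      show "AE y in lborel. norm (w y * complex_of_real (heat (\<tau> n) (x + a - y))) \<le> M * heat (\<tau> n) (x + a - y)"
        using w_bdd by (intro AE_I2) (simp add: norm_mult abs_of_nonneg[OF heat_nonneg[OF \<tau>(1)]] mult_right_mono \<tau>(1))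
    qed (use hi M_nonneg \<tau>(1) in auto)
    also have "\<dots> = M"
      using integral_reflect[of "heat (\<tau> n)" "x + a"] heat_integrable(2)[OF \<tau>(1), where 'a='a] by simp
    finally show ?thesis .
  qed
  have W_meas: "W n \<in> borel_measurable borel" for n unfolding W_def by measurable
  have zero: "(LINT x|lborel. ?\<psi> x * W n x) = 0" for n
  proof -
    define l where "l = 1 / (4 * \<tau> n)"
    have l: "l > 0" using \<tau>(1)[of n] by (simp add: l_def)
    define S where "S = complex_of_real (sqrt (4 * pi * \<tau> n) ^ DIM('a))"
    have S: "S \<noteq> 0" using \<tau>(1)[of n] by (simp add: S_def)
    have h: "complex_of_real (heat (\<tau> n) (x + a - y)) = gauss l (y - x - a) / S" for x y
    proof -
      have "heat (\<tau> n) (x + a - y) = heat (\<tau> n) (y - x - a)"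
        using heat_commute[of "\<tau> n" "x + a" y] by (simp add: diff_diff_add)
      then show ?thesis by (simp add: heat_def gauss_def l_def S_def)
    qed
    have "(LINT x|lborel. ?\<psi> x * W n x) = (LINT x|lborel. (LINT y|lborel. ?\<psi> x * w y * gauss l (y - x - a)) / S)"
    proof (intro Bochner_Integration.integral_cong refl)
      fix x
      have "?\<psi> x * W n x = (LINT y|lborel. ?\<psi> x * (w y * complex_of_real (heat (\<tau> n) (x + a - y))))"
        unfolding W_def by (rule integral_mult_right_zero[symmetric])
      also have "\<dots> = (LINT y|lborel. ?\<psi> x * w y * gauss l (y - x - a) / S)"
        by (intro Bochner_Integration.integral_cong refl) (simp add: h)
      also have "\<dots> = (LINT y|lborel. ?\<psi> x * w y * gauss l (y - x - a)) / S"
        by (rule integral_divide_zero)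
      finally show "?\<psi> x * W n x = (LINT y|lborel. ?\<psi> x * w y * gauss l (y - x - a)) / S" .
    qed
    also have "\<dots> = (LINT x|lborel. LINT y|lborel. ?\<psi> x * w y * gauss l (y - x - a)) / S"
      by (rule integral_divide_zero)
    also have "(LINT x|lborel. LINT y|lborel. ?\<psi> x * w y * gauss l (y - x - a)) =
       (LINT z|(lborel \<Otimes>\<^sub>M lborel). (case z of (x, y) \<Rightarrow> ?\<psi> x * w y * gauss l (y - x - a)))"
      by (rule lborel_pair.integral_fst[OF product_gauss_integrable[OF \<psi> l]])
    also have "\<dots> = 0" by (rule gauss_moment_shift[OF \<psi> off l])
    finally show ?thesis by simp
  qed
  have "(\<lambda>n. LINT x|lborel. ?\<psi> x * W n x) \<longlonglongrightarrow> (LINT x|lborel. ?\<psi> x * w (x + a))"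
  proof (rule integral_dominated_convergence)
    show "integrable lborel (\<lambda>x. M * norm (?\<psi> x))" by (intro integrable_mult_right integrable_norm schwartz_integrable \<psi>)
    show "(\<lambda>x. ?\<psi> x * W n x) \<in> borel_measurable lborel" for n using W_meas[of n] by measurable
    show "AE x in lborel. (\<lambda>n. ?\<psi> x * W n x) \<longlonglongrightarrow> ?\<psi> x * w (x + a)"
      unfolding W_def using w_cont
      by (intro AE_I2 tendsto_mult tendsto_const heat_approx[OF w_measurable w_bdd _ \<tau>]) (simp add: continuous_on_eq_continuous_at)
    show "AE x in lborel. norm (?\<psi> x * W n x) \<le> M * norm (?\<psi> x)" for n
      using W_bd by (intro AE_I2) (simp add: norm_mult mult.commute mult_right_mono)
  qed measurable
  then have "(\<lambda>n. 0) \<longlonglongrightarrow> (LINT x|lborel. ?\<psi> x * w (x + a))" by (simp only: zero)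
  then show ?thesis using LIMSEQ_unique tendsto_const by blast
qed

text \<open>The shift carries x0 to y. Shrinking the bump concentrates the vanishing means at y,
  where continuity gives the value of \<open>w\<close> times the mass of the bump.\<close>

lemma w_vanishes: "w y = 0"
proof -
  define a where "a = y - x0"
  define e where "e n = R / 8 * inverse (real (Suc n))" for n
  have e: "0 < e n" "e n < R / 4" for n
  proof -
    show "0 < e n" using R by (simp add: e_def)
    have "inverse (real (Suc n)) \<le> 1" by (simp add: field_simps)
    then have "e n \<le> R / 8 * 1" unfolding e_def using R by (intro mult_left_mono) auto
    then show "e n < R / 4" using R by linarith
  qed
  have "(\<lambda>n. R / 8 * inverse (real (Suc n))) \<longlonglongrightarrow> R / 8 * 0"
    by (intro tendsto_mult tendsto_const LIMSEQ_inverse_real_of_nat)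
  then have elim: "e \<longlonglongrightarrow> 0" by (simp add: e_def[abs_def])
  have zero: "(LINT z|lborel. bump z * w (x0 + e n *\<^sub>R z + a)) = 0" for n
    using bump_mean[OF e, of n a] e(1)[of n] unfolding bump_scale[OF e(1)] by simp
  have [measurable]: "(bump :: 'a \<Rightarrow> complex) \<in> borel_measurable borel" by (rule schwartz_measurable[OF schwartz_bump])
  have "(\<lambda>n. LINT z|lborel. bump z * w (x0 + e n *\<^sub>R z + a)) \<longlonglongrightarrow> (LINT z|lborel. bump (z::'a) * w y)"
  proof (rule integral_dominated_convergence)
    show "integrable lborel (\<lambda>z::'a. M * norm (bump z))" by (intro integrable_mult_right integrable_norm schwartz_integrable schwartz_bump)
    show "AE z in lborel. (\<lambda>n. bump z * w (x0 + e n *\<^sub>R z + a)) \<longlonglongrightarrow> bump z * w y"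
    proof (intro AE_I2 tendsto_mult tendsto_const)
      fix z :: 'a
      have "(\<lambda>n. x0 + e n *\<^sub>R z + a) \<longlonglongrightarrow> x0 + 0 *\<^sub>R z + a" by (intro tendsto_intros elim)
      moreover have "isCont w (x0 + 0 *\<^sub>R z + a)" using w_cont by (simp add: continuous_on_eq_continuous_at)
      ultimately have "(\<lambda>n. w (x0 + e n *\<^sub>R z + a)) \<longlonglongrightarrow> w (x0 + 0 *\<^sub>R z + a)" by (rule isCont_tendsto_compose[rotated])
      then show "(\<lambda>n. w (x0 + e n *\<^sub>R z + a)) \<longlonglongrightarrow> w y" by (simp add: a_def)
    qed
    show "AE z in lborel. norm (bump z * w (x0 + e n *\<^sub>R z + a)) \<le> M * norm (bump z)" for n
    proof (rule AE_I2)
      fix z :: 'a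
      show "norm (bump z * w (x0 + e n *\<^sub>R z + a)) \<le> M * norm (bump z)"
        using mult_left_mono[OF w_bdd[of "x0 + e n *\<^sub>R z + a"] norm_ge_zero[of "bump z"]]
        by (simp add: norm_mult mult.commute)
    qed
  qed measurable
  then have "(\<lambda>n. 0) \<longlonglongrightarrow> (LINT z|lborel. bump (z::'a)) * w y" by (simp add: zero)
  then have "(LINT z|lborel. bump (z::'a)) * w y = 0" using LIMSEQ_unique tendsto_const by blast
  then show ?thesis using bump_integral_nonzero[where 'a='a] by simp
qed

end

section \<open>Mollification and conclusion\<close>

lemma Jop_translate:
  assumes \<theta>: "schwartz \<theta>"
  shows "Jop a (\<lambda>x. \<theta> (x - y)) = (\<lambda>x. Jop a \<theta> (x - y))"
proof
  fix x
  have "schwartz (\<lambda>x. \<theta> (x - y))" using schwartz_affine[OF \<theta>, of 1 "- y"] by simp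
  then have "Jop a (\<lambda>x. \<theta> (x - y)) x = inverse_fourier (\<lambda>\<xi>. jm a \<xi> * (exp (- \<i> * complex_of_real (y \<bullet> \<xi>)) * fourier \<theta> \<xi>)) x"
    by (simp only: Jop_alt fourier_translate)
  also have "\<dots> = inverse_fourier (\<lambda>\<xi>. jm a \<xi> * fourier \<theta> \<xi>) (x - y)"
  proof -
    have e: "exp (- \<i> * complex_of_real (y \<bullet> \<xi>)) * exp (\<i> * complex_of_real (x \<bullet> \<xi>)) = exp (\<i> * complex_of_real ((x - y) \<bullet> \<xi>))" for \<xi>
      by (simp add: exp_add[symmetric] inner_diff_left algebra_simps)
    have "jm a \<xi> * (exp (- \<i> * complex_of_real (y \<bullet> \<xi>)) * fourier \<theta> \<xi>) * exp (\<i> * complex_of_real (x \<bullet> \<xi>)) =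
        jm a \<xi> * fourier \<theta> \<xi> * exp (\<i> * complex_of_real ((x - y) \<bullet> \<xi>))" for \<xi>
      unfolding e[symmetric] by (simp only: mult_ac)
    then show ?thesis unfolding inverse_fourier_def by (simp only:)
  qed
  finally show "Jop a (\<lambda>x. \<theta> (x - y)) x = Jop a \<theta> (x - y)" by (simp add: Jop_alt[OF \<theta>])
qed

lemma convolution_schwartz:
  assumes \<rho>: "schwartz \<rho>" and \<psi>: "schwartz \<psi>"
  shows "(LINT y|lborel. \<rho> (x - y) * \<psi> y) = inverse_fourier (\<lambda>\<xi>. fourier \<rho> \<xi> * fourier \<psi> \<xi>) x"
  using integral_inverse_fourier_kernel[of "fourier \<rho>" \<psi> x] \<rho> \<psi>
  by (simp add: schwartz_integrable schwartz_fourier inverse_fourier_fourier)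

lemma schwartz_convolution:
  "schwartz \<rho> \<Longrightarrow> schwartz \<psi> \<Longrightarrow> schwartz (inverse_fourier (\<lambda>\<xi>. fourier \<rho> \<xi> * fourier \<psi> \<xi>))"
  by (intro schwartz_inverse_fourier schwartz_mult schwartz_temperate schwartz_fourier)

lemma fourier_convolution:
  "schwartz \<rho> \<Longrightarrow> schwartz \<psi> \<Longrightarrow> fourier (inverse_fourier (\<lambda>\<xi>. fourier \<rho> \<xi> * fourier \<psi> \<xi>)) = (\<lambda>\<xi>. fourier \<rho> \<xi> * fourier \<psi> \<xi>)"
  by (intro fourier_inverse_fourier schwartz_mult schwartz_temperate schwartz_fourier)

section \<open>Correlation of an L^p function with a Schwartz function\<close>

lemma norm_mult_le_powr:
  fixes a b :: complex
  assumes p: "1 \<le> p" and B: "norm b \<le> B"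
  shows "norm (a * b) \<le> norm b + B * norm a powr p"
proof -
  have "norm (a * b) \<le> (1 + norm a powr p) * norm b"
    unfolding norm_mult by (intro mult_right_mono le_one_plus_powr p norm_ge_zero)
  also have "\<dots> \<le> norm b + B * norm a powr p"
    using mult_right_mono[OF B, of "norm a powr p"] by (simp add: algebra_simps)
  finally show ?thesis .
qed

context
  fixes p :: real and f Q :: "'a::euclidean_space \<Rightarrow> complex"
  assumes p: "1 \<le> p" and f: "f \<in> Lp_space p" and Q: "schwartz Q"
begin

lemma correlation_bounded: "\<exists>M. \<forall>y. norm (LINT x|lborel. f x * Q (x - y)) \<le> M"
proof -
  obtain B where B: "\<And>x. norm (Q x) \<le> B" using schwartz_bounded[OF Q] by blast
  have "norm (LINT x|lborel. f x * Q (x - y)) \<le> (LINT x|lborel. norm (Q x)) + B * (LINT x|lborel. norm (f x) powr p)" for y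
  proof -
    have iQ: "integrable lborel (\<lambda>x. norm (Q (x - y)))"
      using integrable_translate[OF integrable_norm[OF schwartz_integrable[OF Q]], of "- y"] by simp
    have "norm (LINT x|lborel. f x * Q (x - y)) \<le> (LINT x|lborel. norm (Q (x - y)) + B * norm (f x) powr p)"
    proof (rule Bochner_Integration.integral_norm_bound_integral)
      have "integrable lborel (\<lambda>x. Q (x - y))" using integrable_translate[OF schwartz_integrable[OF Q], of "- y"] by simp
      then show "integrable lborel (\<lambda>x. f x * Q (x - y))" by (rule Lp_mult_integrable[OF p f]) (rule B)
      show "integrable lborel (\<lambda>x. norm (Q (x - y)) + B * norm (f x) powr p)"
        by (intro Bochner_Integration.integrable_add iQ integrable_mult_right Lp_integrable f)
    qed (rule norm_mult_le_powr[OF p B])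
    also have "\<dots> = (LINT x|lborel. norm (Q (x - y))) + B * (LINT x|lborel. norm (f x) powr p)"
      by (simp add: iQ Lp_integrable[OF f])
    also have "(LINT x|lborel. norm (Q (x - y))) = (LINT x|lborel. norm (Q x))"
      using integral_translate[of "\<lambda>x. norm (Q x)" "- y"] by simp
    finally show ?thesis .
  qed
  then show ?thesis by blast
qed

lemma correlation_continuous: "continuous_on UNIV (\<lambda>y. LINT x|lborel. f x * Q (x - y))"
proof (intro continuous_at_imp_continuous_on ballI)
  fix y :: 'a
  have [measurable]: "f \<in> borel_measurable borel" "Q \<in> borel_measurable borel"
    using f Q by (auto intro: Lp_measurable schwartz_measurable)
  obtain C where C: "C \<ge> 0" "\<And>x. norm (Q x) \<le> C * wt x" using schwartz_wt_bound[OF Q] by blast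
  define D where "D = C * 2 ^ (2 * DIM('a))"
  have D: "D \<ge> 0" using C by (simp add: D_def)
  show "isCont (\<lambda>y. LINT x|lborel. f x * Q (x - y)) y"
  proof (unfold continuous_at_sequentially, intro allI impI)
    fix Y :: "nat \<Rightarrow> 'a" assume Y: "Y \<longlonglongrightarrow> y"
    \<comment> \<open>Only the tail of the sequence within distance 1 of the limit matters; there
      \<open>wt_shift\<close> yields one dominating function.\<close>
    then obtain N where N: "\<And>n. n \<ge> N \<Longrightarrow> dist (Y n) y < 1" using LIMSEQ_D[OF Y, of 1] by (auto simp: dist_norm)
    have "(\<lambda>n. LINT x|lborel. f x * Q (x - Y (n + N))) \<longlonglongrightarrow> (LINT x|lborel. f x * Q (x - y))"
    proof (rule integral_dominated_convergence)
      show "integrable lborel (\<lambda>x. D * wt (x - y) + D * norm (f x) powr p)"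
        using integrable_translate[OF wt_integrable, of "- y"]
        by (intro Bochner_Integration.integrable_add integrable_mult_right Lp_integrable f) simp
      show "AE x in lborel. (\<lambda>n. f x * Q (x - Y (n + N))) \<longlonglongrightarrow> f x * Q (x - y)"
      proof (intro AE_I2 tendsto_mult tendsto_const)
        fix x
        have "isCont Q (x - y)" using schwartz_continuous[OF Q] by (simp add: continuous_on_eq_continuous_at)
        moreover have "(\<lambda>n. x - Y (n + N)) \<longlonglongrightarrow> x - y" by (intro tendsto_intros LIMSEQ_ignore_initial_segment Y)
        ultimately show "(\<lambda>n. Q (x - Y (n + N))) \<longlonglongrightarrow> Q (x - y)" by (rule isCont_tendsto_compose)
      qed
      show "AE x in lborel. norm (f x * Q (x - Y (n + N))) \<le> D * wt (x - y) + D * norm (f x) powr p" for n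
      proof (rule AE_I2)
        fix x
        have n: "norm (y - Y (n + N)) \<le> 1" using N[of "n + N"] by (simp add: dist_norm norm_minus_commute)
        have "norm (Q (x - Y (n + N))) \<le> C * wt ((x - y) + (y - Y (n + N)))" using C(2)[of "x - Y (n + N)"] by simp
        also have "\<dots> \<le> C * (2 ^ (2 * DIM('a)) * wt (x - y))" by (intro mult_left_mono wt_shift n C(1))
        finally have le: "norm (Q (x - Y (n + N))) \<le> D * wt (x - y)" by (simp add: D_def mult.assoc)
        also have "D * wt (x - y) \<le> D * 1" by (intro mult_left_mono wt_le_1 D)
        finally have "norm (Q (x - Y (n + N))) \<le> D" by simp
        from norm_mult_le_powr[OF p this, of "f x"] le
        show "norm (f x * Q (x - Y (n + N))) \<le> D * wt (x - y) + D * norm (f x) powr p" by linarith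
      qed
    qed measurable
    then show "((\<lambda>y. LINT x|lborel. f x * Q (x - y)) \<circ> Y) \<longlonglongrightarrow> (LINT x|lborel. f x * Q (x - y))"
      unfolding o_def by (rule LIMSEQ_offset)
  qed
qed

lemma correlation_pairing:
  assumes g: "integrable lborel g"
  shows "(LINT y|lborel. (LINT x|lborel. f x * Q (x - y)) * g y) = (LINT x|lborel. f x * (LINT y|lborel. Q (x - y) * g y))"
proof -
  have [measurable]: "f \<in> borel_measurable borel" "Q \<in> borel_measurable borel" "g \<in> borel_measurable borel"
    using f Q g by (auto intro: Lp_measurable schwartz_measurable)
  obtain B where B: "\<And>x. norm (Q x) \<le> B" using schwartz_bounded[OF Q] by blast
  have i1: "integrable (lborel \<Otimes>\<^sub>M lborel) (\<lambda>(y, x). norm (g y) * norm (Q (x + (- 1) *\<^sub>R y)))"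
    by (intro integrable_conv[of "\<lambda>x. norm (Q x)" "\<lambda>y. norm (g y)"] integrable_norm g schwartz_integrable Q)
  have i2: "integrable (lborel \<Otimes>\<^sub>M lborel) (\<lambda>(y, x). B * norm (g y) * norm (f x) powr p)"
    by (intro integrable_prod_mult integrable_mult_right integrable_norm g Lp_integrable f)
  have i: "integrable (lborel \<Otimes>\<^sub>M lborel) (\<lambda>(y, x). f x * Q (x - y) * g y)"
  proof (rule Bochner_Integration.integrable_bound[OF Bochner_Integration.integrable_add[OF i1 i2]])
    show "AE z in lborel \<Otimes>\<^sub>M lborel. norm (case z of (y, x) \<Rightarrow> f x * Q (x - y) * g y) \<le>
      norm ((case z of (y, x) \<Rightarrow> norm (g y) * norm (Q (x + (- 1) *\<^sub>R y))) + (case z of (y, x) \<Rightarrow> B * norm (g y) * norm (f x) powr p))"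
    proof (rule AE_I2)
      fix z :: "'a \<times> 'a"
      obtain y x where z: "z = (y, x)" by fastforce
      have "norm (f x * Q (x - y)) * norm (g y) \<le> (norm (Q (x - y)) + B * norm (f x) powr p) * norm (g y)"
        by (intro mult_right_mono norm_mult_le_powr p B norm_ge_zero)
      then have "norm (f x * Q (x - y) * g y) \<le> norm (g y) * norm (Q (x + (- 1) *\<^sub>R y)) + B * norm (g y) * norm (f x) powr p"
        by (simp add: norm_mult algebra_simps)
      from order_trans[OF this abs_ge_self] show "norm (case z of (y, x) \<Rightarrow> f x * Q (x - y) * g y) \<le>
        norm ((case z of (y, x) \<Rightarrow> norm (g y) * norm (Q (x + (- 1) *\<^sub>R y))) + (case z of (y, x) \<Rightarrow> B * norm (g y) * norm (f x) powr p))"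
        by (simp add: z)
    qed
  qed measurable
  have "(LINT y|lborel. (LINT x|lborel. f x * Q (x - y)) * g y) = (LINT y|lborel. LINT x|lborel. f x * Q (x - y) * g y)"
    by simp
  also have "\<dots> = (LINT x|lborel. LINT y|lborel. f x * Q (x - y) * g y)"
    by (rule lborel_pair.Fubini_integral[symmetric, OF i])
  also have "\<dots> = (LINT x|lborel. f x * (LINT y|lborel. Q (x - y) * g y))"
    by (simp add: mult.assoc)
  finally show ?thesis .
qed

end

section \<open>Shrinking the mollifier\<close>

lemma bump_convolution:
  fixes \<theta> :: "'a::euclidean_space \<Rightarrow> complex"
  assumes "0 < e"
  shows "(LINT y|lborel. bump_at 0 e (x - y) * \<theta> y) = complex_of_real (e ^ DIM('a)) * (LINT z|lborel. bump z * \<theta> (x - e *\<^sub>R z))"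
  using integral_reflect[of "\<lambda>y. bump_at 0 e y * \<theta> (x - y)" x] bump_scale[OF assms, of 0 "\<lambda>y. \<theta> (x - y)"] by simp

text \<open>The mollifier acts on the Schwartz factor, so the pointwise limit uses the continuity of
  \<open>\<theta>\<close>, while \<open>f\<close> is only integrated. As the bump lives in the unit
  ball and e n \<le> 1, all displacements are covered by \<open>wt_shift\<close>, and the averages
  are dominated by a multiple of \<open>wt\<close>.\<close>

lemma mollify_limit:
  fixes f \<theta> :: "'a::euclidean_space \<Rightarrow> complex"
  assumes p: "1 \<le> p" and f: "f \<in> Lp_space p" and \<theta>: "schwartz \<theta>"
    and e: "\<And>n. 0 < e n" "\<And>n. e n \<le> 1" "e \<longlonglongrightarrow> 0"
  shows "(\<lambda>n. LINT x|lborel. f x * (LINT z|lborel. bump z * \<theta> (x - e n *\<^sub>R z))) \<longlonglongrightarrow>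
    (LINT x|lborel. f x * \<theta> x) * (LINT z|lborel. bump (z::'a))"
proof -
  have [measurable]: "f \<in> borel_measurable borel" "\<theta> \<in> borel_measurable borel" "(bump :: 'a \<Rightarrow> complex) \<in> borel_measurable borel"
    using f \<theta> by (auto intro: Lp_measurable schwartz_measurable schwartz_bump)
  obtain C where C: "C \<ge> 0" "\<And>x. norm (\<theta> x) \<le> C * wt x" using schwartz_wt_bound[OF \<theta>] by blast
  define D where "D = C * 2 ^ (2 * DIM('a))"
  have D: "D \<ge> 0" using C by (simp add: D_def)
  have bi: "integrable lborel (\<lambda>z::'a. norm (bump z))" by (intro integrable_norm schwartz_integrable schwartz_bump)
  have le: "norm (bump z * \<theta> (x - e n *\<^sub>R z)) \<le> norm (bump z) * (D * wt x)" for x z n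
  proof (cases "norm z < 1")
    case True
    have "norm (- (e n *\<^sub>R z)) \<le> 1" using True e(1,2)[of n] mult_mono[of "e n" 1 "norm z" 1] by simp
    then have "C * wt (x + - (e n *\<^sub>R z)) \<le> C * (2 ^ (2 * DIM('a)) * wt x)" by (intro mult_left_mono wt_shift C(1))
    with C(2)[of "x - e n *\<^sub>R z"] have "norm (\<theta> (x - e n *\<^sub>R z)) \<le> D * wt x" by (simp add: D_def mult.assoc)
    then show ?thesis unfolding norm_mult by (rule mult_left_mono) simp
  next
    case False
    then show ?thesis by (simp add: bump_eq_0)
  qed
  define I where "I n x = (LINT z|lborel. bump z * \<theta> (x - e n *\<^sub>R z))" for n x
  have [measurable]: "I n \<in> borel_measurable borel" for n unfolding I_def[abs_def] by measurable
  have I_le: "norm (I n x) \<le> (LINT z|lborel. norm (bump (z::'a))) * D * wt x" for n x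
  proof -
    have "norm (I n x) \<le> (LINT z|lborel. norm (bump (z::'a)) * (D * wt x))"
      unfolding I_def
    proof (rule Bochner_Integration.integral_norm_bound_integral)
      show i: "integrable lborel (\<lambda>z::'a. norm (bump z) * (D * wt x))" by (intro integrable_mult_left bi)
      show "integrable lborel (\<lambda>z. bump z * \<theta> (x - e n *\<^sub>R z))"
      proof (rule Bochner_Integration.integrable_bound[OF i])
        show "AE z in lborel. norm (bump z * \<theta> (x - e n *\<^sub>R z)) \<le> norm (norm (bump z) * (D * wt x))"
          using order_trans[OF le abs_ge_self] by (intro AE_I2) (metis real_norm_def)
      qed measurable
    qed (rule le)
    then show ?thesis by (simp add: mult.assoc)
  qed
  have I_lim: "(\<lambda>n. I n x) \<longlonglongrightarrow> (LINT z|lborel. bump (z::'a) * \<theta> x)" for x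
    unfolding I_def
  proof (rule integral_dominated_convergence)
    show "integrable lborel (\<lambda>z::'a. norm (bump z) * (D * wt x))" by (intro integrable_mult_left bi)
    show "AE z in lborel. (\<lambda>n. bump z * \<theta> (x - e n *\<^sub>R z)) \<longlonglongrightarrow> bump z * \<theta> x"
    proof (intro AE_I2 tendsto_mult tendsto_const)
      fix z :: 'a
      have "isCont \<theta> x" using schwartz_continuous[OF \<theta>] by (simp add: continuous_on_eq_continuous_at)
      moreover have "(\<lambda>n. x - e n *\<^sub>R z) \<longlonglongrightarrow> x - 0 *\<^sub>R z" by (intro tendsto_intros e)
      ultimately show "(\<lambda>n. \<theta> (x - e n *\<^sub>R z)) \<longlonglongrightarrow> \<theta> x" by (intro isCont_tendsto_compose[of x \<theta>]) simp_all
    qed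
  qed (use le in \<open>auto intro: AE_I2\<close>)
  have "(\<lambda>n. LINT x|lborel. f x * I n x) \<longlonglongrightarrow> (LINT x|lborel. f x * (LINT z|lborel. bump (z::'a) * \<theta> x))"
  proof (rule integral_dominated_convergence)
    define S where "S = (LINT z|lborel. norm (bump (z::'a))) * D"
    have S: "S \<ge> 0" using D by (simp add: S_def)
    show "integrable lborel (\<lambda>x. S * wt x + S * norm (f x) powr p)"
      by (intro Bochner_Integration.integrable_add integrable_mult_right wt_integrable Lp_integrable f)
    show "AE x in lborel. norm (f x * I n x) \<le> S * wt x + S * norm (f x) powr p" for n
    proof (rule AE_I2)
      fix x
      have 1: "norm (I n x) \<le> S * wt x" using I_le by (simp add: S_def)
      also have "\<dots> \<le> S * 1" by (intro mult_left_mono wt_le_1 S)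
      finally have "norm (I n x) \<le> S" by simp
      from norm_mult_le_powr[OF p this, of "f x"] 1 show "norm (f x * I n x) \<le> S * wt x + S * norm (f x) powr p" by linarith
    qed
  qed (use I_lim in \<open>auto intro!: AE_I2 tendsto_mult\<close>)
  moreover have "f x * (LINT z|lborel. bump (z::'a) * \<theta> x) = f x * \<theta> x * (LINT z|lborel. bump (z::'a))" for x
    by simp
  ultimately show ?thesis by (simp only: I_def integral_mult_left_zero)
qed

text \<open>The radius 2R is divided evenly: R for the centre of a translated bump or for the
  support of a test function, and R for the scale of the mollifier.\<close>

locale mollified = frac_kernel p s K for p s :: real and K :: "'a::euclidean_space \<Rightarrow> real" +
  fixes r :: real and f :: "'a \<Rightarrow> complex" and u :: "'a functional" and V :: "'a set" and x0 :: 'a and R :: real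
  assumes s_not_int: "s \<notin> \<int>"
    and f: "f \<in> Lp_space p" and u: "bessel_potential r u = distribution_of f"
    and R: "0 < R" and cball_V: "cball x0 (2 * R) \<subseteq> V"
    and u_zero: "vanishes_in V u" and frac_zero: "vanishes_in V (frac_laplacian s r p u)"
begin

text \<open>The distribution \<open>u\<close> tested on translates of the bump at scale e, hence its
  mollification without normalisation. Writing it as a correlation with the density \<open>f\<close>
  gives boundedness and continuity directly.\<close>

definition w :: "real \<Rightarrow> 'a \<Rightarrow> complex" where
  "w e y = (LINT x|lborel. f x * Jop (- r) (bump_at 0 e) (x - y))"

lemma test_function_cball:
  assumes "schwartz \<phi>" "\<And>x. 2 * R < norm (x - x0) \<Longrightarrow> \<phi> x = 0"
  shows "test_function V \<phi>"
  using assms cball_V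
  by (intro test_functionI[where K="cball x0 (2 * R)"] schwartz_smooth compact_cball) (auto simp: dist_norm norm_minus_commute)

lemma w_eq: "0 < e \<Longrightarrow> w e y = u (\<lambda>x. bump_at 0 e (x - y))"
  using bessel_representation[OF u] schwartz_affine[OF schwartz_bump_at[of e 0], of 1 "- y"]
  by (simp add: w_def Jop_translate schwartz_bump_at)

lemma w_off:
  assumes e: "0 < e" "e \<le> R" and y: "norm (y - x0) < R"
  shows "w e y = 0"
proof -
  have "test_function V (\<lambda>x. bump_at 0 e (x - y))"
  proof (rule test_function_cball)
    show "schwartz (\<lambda>x. bump_at 0 e (x - y))" using schwartz_affine[OF schwartz_bump_at[OF e(1), of 0], of 1 "- y"] by simp
    fix x assume "2 * R < norm (x - x0)"
    moreover have "norm (x - x0) \<le> norm (x - y) + norm (y - x0)" by (metis diff_add_cancel add_diff_eq norm_triangle_ineq)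
    ultimately have "e \<le> norm (x - y)" using e y by linarith
    then show "bump_at 0 e (x - y) = 0" using bump_at_eq_0[OF e(1), of "x - y" 0] by simp
  qed
  then show ?thesis using u_zero e by (simp add: w_eq vanishes_in_def)
qed

text \<open>The function is the convolution of the bump with \<open>\<psi>\<close>; a point at
  distance more than 2R from x0 cannot be the sum of a point of norm below e \<le> R and one within
  R of x0.\<close>

lemma convolution_test_function:
  assumes e: "0 < e" "e \<le> R" and \<psi>: "schwartz \<psi>" and off: "\<And>x. R \<le> norm (x - x0) \<Longrightarrow> \<psi> x = 0"
  shows "test_function V (inverse_fourier (\<lambda>\<xi>. fourier (bump_at 0 e) \<xi> * fourier \<psi> \<xi>))"
proof (rule test_function_cball)
  show "schwartz (inverse_fourier (\<lambda>\<xi>. fourier (bump_at 0 e) \<xi> * fourier \<psi> \<xi>))"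
    by (intro schwartz_convolution schwartz_bump_at e \<psi>)
  fix x assume x: "2 * R < norm (x - x0)"
  have "bump_at 0 e (x - y) * \<psi> y = 0" for y
  proof (cases "R \<le> norm (y - x0)")
    case False
    have "norm (x - x0) \<le> norm (x - y) + norm (y - x0)" by (metis diff_add_cancel add_diff_eq norm_triangle_ineq)
    then have "e \<le> norm (x - y)" using e x False by linarith
    then show ?thesis using bump_at_eq_0[OF e(1), of "x - y" 0] by simp
  qed (simp add: off)
  then show "inverse_fourier (\<lambda>\<xi>. fourier (bump_at 0 e) \<xi> * fourier \<psi> \<xi>) x = 0"
    unfolding convolution_schwartz[OF schwartz_bump_at[OF e(1)] \<psi>, symmetric] by (simp only: integral_zero)
qed

text \<open>Phrased with an integrable \<open>g\<close> whose transform is integrable, and not with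
  Schwartz functions, since \<open>g\<close> will be a fractional Laplacian of a test
  function.\<close>

lemma w_integral_inverse_fourier:
  assumes e: "0 < e" and h: "integrable lborel h" and g: "integrable lborel g" "fourier g = h"
  shows "(LINT y|lborel. w e y * g y) =
    (LINT x|lborel. f x * inverse_fourier (\<lambda>\<xi>. jm (- r) \<xi> * fourier (bump_at 0 e) \<xi> * h \<xi>) x)"
proof -
  have sb: "schwartz (bump_at 0 e)" by (rule schwartz_bump_at[OF e])
  have "integrable lborel (\<lambda>\<xi>. jm (- r) \<xi> * fourier (bump_at 0 e) \<xi>)"
    by (intro schwartz_integrable schwartz_mult temperate_jm schwartz_fourier sb)
  then have "(LINT y|lborel. Jop (- r) (bump_at 0 e) (x - y) * g y) =
      inverse_fourier (\<lambda>\<xi>. jm (- r) \<xi> * fourier (bump_at 0 e) \<xi> * h \<xi>) x" for x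
    unfolding Jop_alt[OF sb] g(2)[symmetric] by (rule integral_inverse_fourier_kernel[OF _ g(1)])
  then show ?thesis
    unfolding w_def correlation_pairing[OF p f schwartz_Jop[OF sb] g(1)] by simp
qed

text \<open>The symbol |xi|^(2s) commutes with convolution, so testing (-\<Delta>)^s against the
  mollified \<open>w\<close> amounts to testing the distribution against a mollified function. The
  work lies in Fourier inversion for the symbol times a Schwartz transform, which is not smooth at
  0.\<close>

lemma w_frac_laplacian:
  assumes e: "0 < e" and \<psi>: "schwartz \<psi>"
  shows "(LINT y|lborel. w e y * inverse_fourier (\<lambda>\<xi>. complex_of_real (norm \<xi> powr (2 * s)) * fourier \<psi> \<xi>) y) =
    frac_laplacian s r p u (inverse_fourier (\<lambda>\<xi>. fourier (bump_at 0 e) \<xi> * fourier \<psi> \<xi>))"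
proof -
  define h where "h = (\<lambda>\<xi>. complex_of_real (norm \<xi> powr (2 * s)) * fourier \<psi> \<xi>)"
  have sb: "schwartz (bump_at 0 e)" by (rule schwartz_bump_at[OF e])
  \<comment> \<open>The factor (1 - \<Delta>)^s is absorbed into a Schwartz function, and the
    integrable kernel of \<open>T\<close> then gives integrability in space.\<close>
  have g: "inverse_fourier h = T (Jop (2 * s) \<psi>)" by (simp add: h_def T_Jop[OF \<psi>])
  have gi: "integrable lborel (inverse_fourier h)" unfolding g by (rule T_schwartz_integrable[OF schwartz_Jop[OF \<psi>]])
  have hi: "integrable lborel h" unfolding h_def using s by (intro schwartz_powr_integrable schwartz_fourier \<psi>) simp
  have hc: "continuous_on UNIV h" unfolding h_def using s
    by (intro continuous_on_mult continuous_on_of_real continuous_on_powr' continuous_intros schwartz_continuous schwartz_fourier \<psi>) auto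
  obtain M where M: "\<And>\<xi>. norm (jm (2 * s) \<xi> * fourier \<psi> \<xi>) \<le> M"
    using schwartz_bounded[OF schwartz_mult[OF temperate_jm schwartz_fourier[OF \<psi>]]] by blast
  have "norm (h \<xi>) \<le> M" for \<xi>
  proof -
    \<comment> \<open>The bounded symbol of \<open>T\<close> times a Schwartz function.\<close>
    have "h \<xi> = (complex_of_real (norm \<xi> powr (2 * s)) * jm (- (2 * s)) \<xi>) * (jm (2 * s) \<xi> * fourier \<psi> \<xi>)"
      using jm_add[of "- (2 * s)" "2 * s" \<xi>] by (simp add: h_def mult_ac)
    then have "norm (h \<xi>) = norm (complex_of_real (norm \<xi> powr (2 * s)) * jm (- (2 * s)) \<xi>) * norm (jm (2 * s) \<xi> * fourier \<psi> \<xi>)"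
      by (simp only: norm_mult)
    then show ?thesis using mult_mono[OF norm_multiplier_le M] by (simp del: norm_mult)
  qed
  then have gF: "fourier (inverse_fourier h) = h"
    using fourier_inverse_fourier_integrable[OF hi hc _ gi] by blast
  have "(LINT y|lborel. w e y * inverse_fourier h y) =
      (LINT x|lborel. f x * inverse_fourier (\<lambda>\<xi>. jm (- r) \<xi> * fourier (bump_at 0 e) \<xi> * h \<xi>) x)"
    by (rule w_integral_inverse_fourier[OF e hi gi gF])
  then show ?thesis
    unfolding frac_laplacian_eval[OF u f schwartz_convolution[OF sb \<psi>]] fourier_convolution[OF sb \<psi>] h_def
    by (simp only: mult_ac)
qed

text \<open>The exponents frac s + k with k \<ge> floor s are s plus a natural number j. The j
  Laplacians are moved onto the test function, which returns the hypothesis on (-\<Delta>)^s itself.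
  That s is not an integer enters as 0 < frac s.\<close>

lemma w_zero:
  assumes e: "0 < e" "e \<le> R"
  shows "w e y = 0"
proof -
  have sb: "schwartz (bump_at 0 e)" by (rule schwartz_bump_at[OF e(1)])
  obtain M where M: "\<And>y. norm (w e y) \<le> M"
    using correlation_bounded[OF p f schwartz_Jop[OF sb]] unfolding w_def by blast
  define k0 where "k0 = nat \<lfloor>s\<rfloor>"
  have k0: "real k0 = of_int \<lfloor>s\<rfloor>" using s by (simp add: k0_def)
  have frac: "frac s > 0" "frac s < 1" using s_not_int by (simp_all add: frac_gt_0_iff frac_lt_1)
  interpret ucp_setting "w e" x0 R "frac s" M k0
  proof
    show "continuous_on UNIV (w e)"
      using correlation_continuous[OF p f schwartz_Jop[OF sb]] unfolding w_def[abs_def] .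
    show "norm (w e y) \<le> M" for y by (rule M)
    show "0 < R" by (rule R)
    show "0 < frac s" "frac s < 1" by (fact frac)+
    show "w e y = 0" if "norm (y - x0) < R" for y by (rule w_off[OF e that])
    fix \<psi> :: "'a \<Rightarrow> complex" and k
    assume \<psi>: "schwartz \<psi>" and off: "\<And>x. R / 2 \<le> norm (x - x0) \<Longrightarrow> \<psi> x = 0" and k: "k0 \<le> k"
    define j where "j = k - k0"
    define \<Psi> where "\<Psi> = (Lap ^^ j) \<psi>"
    have s\<Psi>: "schwartz \<Psi>" unfolding \<Psi>_def by (rule schwartz_Lap_power[OF \<psi>])
    \<comment> \<open>The zeros pass to the Laplacian only from a whole ball around x, which is why
      the support bound is relaxed from R/2 to R.\<close>
    have off': "\<Psi> x = 0" if "R \<le> norm (x - x0)" for x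
    proof -
      have near: "\<psi> z = 0" if z: "norm (x - z) < R / 2" for z
      proof (rule off)
        have "norm (x - x0) \<le> norm (x - z) + norm (z - x0)" by (metis diff_add_cancel add_diff_eq norm_triangle_ineq)
        then show "R / 2 \<le> norm (z - x0)" using \<open>R \<le> norm (x - x0)\<close> z by linarith
      qed
      show ?thesis unfolding \<Psi>_def
        by (rule Lap_power_off[where y=x and \<delta>="R / 2"]) (use near R in auto)
    qed
    have "complex_of_real (norm \<xi> powr (2 * (frac s + real k))) * fourier \<psi> \<xi> =
        (- 1) ^ j * (complex_of_real (norm \<xi> powr (2 * s)) * fourier \<Psi> \<xi>)" for \<xi>
    proof -
      have "frac s + real k = s + real j" using k k0 by (simp add: frac_def j_def)
      then show ?thesis
        by (simp only: norm_powr_add_power \<Psi>_def fourier_Lap_power[OF \<psi>]) (simp add: power_mult_distrib[symmetric])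
    qed
    then have "(LINT y|lborel. w e y * inverse_fourier (\<lambda>\<xi>. complex_of_real (norm \<xi> powr (2 * (frac s + real k))) * fourier \<psi> \<xi>) y) =
        (- 1) ^ j * (LINT y|lborel. w e y * inverse_fourier (\<lambda>\<xi>. complex_of_real (norm \<xi> powr (2 * s)) * fourier \<Psi> \<xi>) y)"
      by (simp add: inverse_fourier_cmult mult.left_commute)
    then show "(LINT y|lborel. w e y * inverse_fourier (\<lambda>\<xi>. complex_of_real (norm \<xi> powr (2 * (frac s + real k))) * fourier \<psi> \<xi>) y) = 0"
      unfolding w_frac_laplacian[OF e(1) s\<Psi>]
      using frac_zero convolution_test_function[OF e s\<Psi> off'] by (simp add: vanishes_in_def)
  qed
  show ?thesis by (rule w_vanishes)
qed

text \<open>Pairing the vanishing \<open>w\<close> with the transform of \<open>\<psi>\<close> on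
  the frequency side shows that \<open>f\<close> annihilates the mollification of
  \<open>Jop (- r) \<psi>\<close> at every small scale. In the limit the pairing of \<open>f\<close>
  with \<open>Jop (- r) \<psi>\<close>, which is \<open>u \<psi>\<close>, is 0 up to the mass of the
  bump.\<close>

lemma u_eval_zero:
  assumes \<psi>: "schwartz \<psi>"
  shows "u \<psi> = 0"
proof -
  define \<theta> where "\<theta> = Jop (- r) \<psi>"
  have s\<theta>: "schwartz \<theta>" unfolding \<theta>_def by (rule schwartz_Jop[OF \<psi>])
  have zero: "(LINT x|lborel. f x * (LINT z|lborel. bump z * \<theta> (x - e *\<^sub>R z))) = 0" if e: "0 < e" "e \<le> R" for e
  proof -
    have sb: "schwartz (bump_at 0 e)" by (rule schwartz_bump_at[OF e(1)])
    have "inverse_fourier (\<lambda>\<xi>. jm (- r) \<xi> * fourier (bump_at 0 e) \<xi> * fourier \<psi> \<xi>) x =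
        complex_of_real (e ^ DIM('a)) * (LINT z|lborel. bump z * \<theta> (x - e *\<^sub>R z))" for x
      unfolding bump_convolution[OF e(1), symmetric] convolution_schwartz[OF sb s\<theta>]
      by (simp only: \<theta>_def fourier_Jop[OF \<psi>] mult_ac)
    moreover have "(LINT x|lborel. f x * inverse_fourier (\<lambda>\<xi>. jm (- r) \<xi> * fourier (bump_at 0 e) \<xi> * fourier \<psi> \<xi>) x) = 0"
      using w_integral_inverse_fourier[OF e(1) _ _ refl, of \<psi>] \<psi> w_zero[OF e] by (simp add: schwartz_integrable schwartz_fourier)
    ultimately have "(LINT x|lborel. f x * (complex_of_real (e ^ DIM('a)) * (LINT z|lborel. bump z * \<theta> (x - e *\<^sub>R z)))) = 0"
      by simp
    then show ?thesis
      using e by (simp only: mult.left_commute[of "f _"] integral_mult_right_zero mult_eq_0_iff of_real_eq_0_iff power_eq_0_iff) auto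
  qed
  define e where "e n = min R 1 * inverse (real (Suc n))" for n
  have e: "0 < e n" "e n \<le> min R 1" for n
  proof -
    show "0 < e n" using R by (simp add: e_def)
    have "inverse (real (Suc n)) \<le> 1" by (simp add: field_simps)
    then have "e n \<le> min R 1 * 1" unfolding e_def using R by (intro mult_left_mono) auto
    then show "e n \<le> min R 1" by simp
  qed
  have "e \<longlonglongrightarrow> min R 1 * 0" unfolding e_def[abs_def] by (intro tendsto_mult tendsto_const LIMSEQ_inverse_real_of_nat)
  then have lim: "e \<longlonglongrightarrow> 0" by simp
  have eR: "e n \<le> R" "e n \<le> 1" for n using e(2)[of n] by auto
  have "(\<lambda>n. 0) \<longlonglongrightarrow> (LINT x|lborel. f x * \<theta> x) * (LINT z|lborel. bump (z::'a))"
    using mollify_limit[OF p f s\<theta> e(1) eR(2) lim] by (simp add: zero[OF e(1) eR(1)])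
  then have "(LINT x|lborel. f x * \<theta> x) * (LINT z|lborel. bump (z::'a)) = 0" using LIMSEQ_unique tendsto_const by blast
  then show ?thesis using bump_integral_nonzero[where 'a='a] by (simp add: bessel_representation[OF u \<psi>] \<theta>_def)
qed

end

theorem theorem2p2:
  fixes p s r :: real and u :: "(real ^ 'n) functional" and V :: "(real ^ 'n) set"
  assumes "1 \<le> p" and "s > 0" and "s \<notin> \<int>"
    and "u \<in> bessel_space r p"
    and "open V" and "V \<noteq> {}"
    and "vanishes_in V (frac_laplacian s r p u)" and "vanishes_in V u"
  shows "u = (\<lambda>\<phi>. 0)"
proof
  fix \<phi>
  obtain f where tempered: "tempered_distribution u" and f: "f \<in> Lp_space p" and u: "bessel_potential r u = distribution_of f"
    using assms(4) unfolding bessel_space_def by blast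
  obtain K :: "real ^ 'n \<Rightarrow> real" where K: "integrable lborel K" "\<And>x. K (- x) = K x"
    "\<And>\<xi>. \<xi> \<noteq> 0 \<Longrightarrow> 1 + fourier (\<lambda>x. complex_of_real (K x)) \<xi> =
       complex_of_real (norm \<xi> powr (2 * s) * japanese_bracket \<xi> powr (- (2 * s)))"
    using kernel_exists[OF assms(2)] by blast
  obtain x0 where "x0 \<in> V" using assms(6) by blast
  with assms(5) obtain \<epsilon> where \<epsilon>: "\<epsilon> > 0" "cball x0 \<epsilon> \<subseteq> V" using open_contains_cball by blast
  \<comment> \<open>The radius is halved because the locale asks for the ball of twice the radius
    inside \<open>V\<close>.\<close>
  interpret mollified p s K r f u V x0 "\<epsilon> / 2"
    using assms K f u \<epsilon> by unfold_locales auto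
  show "u \<phi> = 0"
  proof (cases "schwartz \<phi>")
    case True
    then show ?thesis by (rule u_eval_zero)
  next
    \<comment> \<open>Outside the Schwartz space the value 0 is the convention built into tempered
      distributions.\<close>
    case False
    then show ?thesis using tempered by (simp add: tempered_distribution_def)
  qed
qed

end
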